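(* Let $\mathcal{L}\subset\operatorname{Lip}_1(\mathbb{R})$ be a monoidal subfamily with $\mathcal{TB}\subset\mathcal{L}$. Then there exists a metric $\rho$ on the set $\Pi_{\mathcal{L}}$ of all $\mathcal{L}$-pyramids such that the map $\iota_{\mathcal{L}}:(\mathcal{D}/\mathcal{L},d_{\mathrm{conc}})\to(\Pi_{\mathcal{L}},\rho)$, $\iota_{\mathcal{L}}(X):=\{Y\in\mathcal{D}/\mathcal{L}: Y\preceq X\}$, is a $1$-Lipschitz (topological) embedding, and $(\Pi_{\mathcal{L}},\rho)$ is a compactification of $(\mathcal{D}/\mathcal{L},d_{\mathrm{conc}})$, i.e. $(\Pi_{\mathcal{L}},\rho)$ is compact and $\iota_{\mathcal{L}}(\mathcal{D}/\mathcal{L})$ is dense in it.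
   Context: Geometric data sets: a geometric data set is a triple $X=(X,F_X,\mu_X)$ where $F_X$ is a nonempty set of real-valued functions on $X$ such that $d_X(x,y):=\sup_{f\in F_X}|f(x)-f(y)|$ is a complete separable metric on $X$, and $\mu_X$ is a Borel probability measure with full support on $(X,d_X)$. $\overline{F_X}$ denotes the closure of $F_X$ under pointwise convergence. $X$ and $Y$ are isomorphic if there is a bijection $\varphi:X\to Y$ with $\varphi_*\mu_X=\mu_Y$ and $\overline{F_Y}\circ\varphi=\overline{F_X}$; $\mathcal{D}$ is the set of isomorphism classes. Domination: $Y\preceq X$ if there is a Borel measurable map $f:X\to Y$ with $f_*\mu_X=\mu_Y$ and $F_Y\circ f\subset\overline{F_X}$. Ky Fan metric: for a measure $\mu$ on $X$ and $\mu$-measurable $f,g:X\to\mathbb{R}$, $d_{\mathrm{KF}}^\mu(f,g):=\inf\{\epsilon\ge 0: \mu(\{|f-g|>\epsilon\})\le\epsilon\}$; $d_{\mathrm{KF}}^X:=d_{\mathrm{KF}}^{\mu_X}$. For a metric $d$, $U(A,\epsilon;d)$ is the open $\epsilon$-neighborhood of $A$ and $d_{\mathrm{H}}$ is the Hausdorff distance. Observable distance: $d_{\mathrm{conc}}(X,Y):=\inf (d_{\mathrm{KF}}^\lambda)_{\mathrm{H}}(F_X\circ\varphi,F_Y\circ\psi)$, where $\lambda$ is Lebesgue measure on $[0,1]$ and $\varphi:[0,1]\to X$, $\psi:[0,1]\to Y$ run over Borel maps with $\varphi_*\lambda=\mu_X$, $\psi_*\lambda=\mu_Y$. Box distance: $\Pi(\mu_X,\mu_Y)$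 is the set of couplings; $d_\infty^S(f,g):=\sup_{S}|f-g|$; $$\Box(X,Y)=\min_{\pi\in\Pi(\mu_X,\mu_Y),\ S}\max\{1-\pi(S),\,2(d_\infty^S)_{\mathrm{H}}(\overline{F_X}\circ\mathrm{pr}_1,\overline{F_Y}\circ\mathrm{pr}_2)\},$$ where $S$ runs over nonempty closed subsets of $X\times Y$. Monoidal and $\mathcal{L}$-compact: $\operatorname{Lip}_1(\mathbb{R})$ is the set of 1-Lipschitz functions $\mathbb{R}\to\mathbb{R}$. $\mathcal{L}\subset\operatorname{Lip}_1(\mathbb{R})$ is monoidal if it contains $\mathrm{id}_{\mathbb{R}}$, is closed under composition, and is closed under pointwise convergence on $\mathbb{R}$. For a family $F$ of real-valued functions, $\mathcal{L}\circ F:=\{p\circ f: p\in\mathcal{L}, f\in F\}$. For $F\subset\overline{F_X}$ and $\epsilon>0$, $\operatorname{Cov}(F,\epsilon;\mathcal{L}):=\inf\{\#\mathcal{N}: \mathcal{N}\subset F\text{ finite}, F\subset U(\mathcal{L}\circ\mathcal{N},\epsilon;d_{\mathrm{KF}}^X)\}$. $X$ is $\mathcal{L}$-compact if $\mathcal{L}\circ\overline{F_X}\subset\overline{F_X}$ and $\operatorname{Cov}(\overline{F_X},\epsilon;\mathcal{L})<\infty$ for every $\epsilon>0$. $\mathcal{D}/\mathcal{L}$ is the set of isomorphism classes of $\mathcal{L}$-compact geometric data sets. Clipping family: $\mathcal{TB}:=\{x\mapsto \max\{l,\min\{x+c,u\}\}: c\in\mathbb{R},\ l\in[-\infty,+\infty),\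 u\in(-\infty,+\infty],\ l\le u\}$. $\mathcal{L}$-pyramids: $\mathcal{P}\subset\mathcal{D}/\mathcal{L}$ is an $\mathcal{L}$-pyramid if (1) for $X\in\mathcal{D}/\mathcal{L}$ and $Y\in\mathcal{P}$, $X\preceq Y$ implies $X\in\mathcal{P}$; (2) for $X,Y\in\mathcal{P}$ there is $Z\in\mathcal{P}$ with $X\preceq Z$, $Y\preceq Z$; (3) $\mathcal{P}$ is nonempty and $\Box$-closed. *)

theory Defs
  imports "HOL-Probability.Probability"
begin

section \<open>Geometric data sets\<close>

text \<open>The underlying set is a carrier \<open>pts\<close> inside an arbitrary type. Functions on \<open>pts\<close> are
  represented by extensional functions, so that equality of functions is equality on \<open>pts\<close>; in
  particular the composite of \<open>f\<close> with a map \<open>h\<close> defined on \<open>A\<close> is \<open>compose A f h\<close>.\<close>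

record 'a gds =
  pts :: "'a set"
  feat :: "('a \<Rightarrow> real) set"
  meas :: "'a measure"

definition gds_dist :: "'a gds \<Rightarrow> 'a \<Rightarrow> 'a \<Rightarrow> real" where
  "gds_dist X x y = (if x \<in> pts X \<and> y \<in> pts X then SUP f\<in>feat X. \<bar>f x - f y\<bar> else 0)"

definition gds_topology :: "'a gds \<Rightarrow> 'a topology" where
  "gds_topology X = Metric_space.mtopology (pts X) (gds_dist X)"

definition borel_of :: "'a topology \<Rightarrow> 'a measure" where
  "borel_of T = sigma (topspace T) {U. openin T U}"

text \<open>The boundedness condition says that the supremum defining the metric is finite; without it
  the supremum in \<^typ>\<open>real\<close> would be unspecified.\<close>

definition geometric_data_set :: "'a gds \<Rightarrow> bool" where
  "geometric_data_set X \<longleftrightarrow>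
     feat X \<noteq> {} \<and> feat X \<subseteq> extensional (pts X) \<and>
     (\<forall>x\<in>pts X. \<forall>y\<in>pts X. bdd_above ((\<lambda>f. \<bar>f x - f y\<bar>) ` feat X)) \<and>
     Metric_space (pts X) (gds_dist X) \<and>
     Metric_space.mcomplete (pts X) (gds_dist X) \<and>
     separable_space (gds_topology X) \<and>
     prob_space (meas X) \<and> sets (meas X) = sets (borel_of (gds_topology X)) \<and>
     (\<forall>U. openin (gds_topology X) U \<and> U \<noteq> {} \<longrightarrow> emeasure (meas X) U > 0)"

definition feat_closure :: "'a gds \<Rightarrow> ('a \<Rightarrow> real) set" where
  "feat_closure X = product_topology (\<lambda>_. euclideanreal) (pts X) closure_of feat X"

definition pull :: "'b set \<Rightarrow> ('b \<Rightarrow> 'a) \<Rightarrow> ('a \<Rightarrow> real) set \<Rightarrow> ('b \<Rightarrow> real) set" where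
  "pull A h F = (\<lambda>f. compose A f h) ` F"

definition gds_iso :: "'a gds \<Rightarrow> 'b gds \<Rightarrow> bool" where
  "gds_iso X Y \<longleftrightarrow>
     (\<exists>h. bij_betw h (pts X) (pts Y) \<and> h \<in> measurable (meas X) (meas Y) \<and>
          distr (meas X) (meas Y) h = meas Y \<and>
          pull (pts X) h (feat_closure Y) = feat_closure X)"

definition dominated :: "'a gds \<Rightarrow> 'b gds \<Rightarrow> bool" where
  "dominated Y X \<longleftrightarrow>
     (\<exists>h. h \<in> measurable (meas X) (meas Y) \<and> distr (meas X) (meas Y) h = meas Y \<and>
          pull (pts X) h (feat Y) \<subseteq> feat_closure X)"

section \<open>Distances\<close>

text \<open>Distances are \<^typ>\<open>ennreal\<close>-valued, since suprema of differences of features, and hence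
  the corresponding Hausdorff distances, may be infinite.\<close>

definition ky_fan :: "'a measure \<Rightarrow> ('a \<Rightarrow> real) \<Rightarrow> ('a \<Rightarrow> real) \<Rightarrow> ennreal" where
  "ky_fan M f g = Inf {e. emeasure M {x \<in> space M. ennreal \<bar>f x - g x\<bar> > e} \<le> e}"

definition sup_dist :: "'a set \<Rightarrow> ('a \<Rightarrow> real) \<Rightarrow> ('a \<Rightarrow> real) \<Rightarrow> ennreal" where
  "sup_dist S f g = (SUP x\<in>S. ennreal \<bar>f x - g x\<bar>)"

definition nbhd :: "('f \<Rightarrow> 'f \<Rightarrow> ennreal) \<Rightarrow> 'f set \<Rightarrow> ennreal \<Rightarrow> 'f set" where
  "nbhd d A e = {y. \<exists>x\<in>A. d x y < e}"

definition hausdorff :: "('f \<Rightarrow> 'f \<Rightarrow> ennreal) \<Rightarrow> 'f set \<Rightarrow> 'f set \<Rightarrow> ennreal" where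
  "hausdorff d A B = Inf {e. e > 0 \<and> A \<subseteq> nbhd d B e \<and> B \<subseteq> nbhd d A e}"

definition leb01 :: "real measure" where
  "leb01 = restrict_space lborel {0..1}"

definition parameters :: "'a gds \<Rightarrow> (real \<Rightarrow> 'a) set" where
  "parameters X = {h \<in> measurable leb01 (meas X). distr leb01 (meas X) h = meas X}"

definition dconc :: "'a gds \<Rightarrow> 'b gds \<Rightarrow> ennreal" where
  "dconc X Y =
     (INF (h, k) \<in> parameters X \<times> parameters Y.
        hausdorff (ky_fan leb01) (pull {0..1} h (feat X)) (pull {0..1} k (feat Y)))"

definition couplings :: "'a measure \<Rightarrow> 'b measure \<Rightarrow> ('a \<times> 'b) measure set" where
  "couplings M N =
     {P. sets P = sets (M \<Otimes>\<^sub>M N) \<and> distr P M fst = M \<and> distr P N snd = N}"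

definition box_dist :: "'a gds \<Rightarrow> 'b gds \<Rightarrow> ennreal" where
  "box_dist X Y =
     (INF (P, S) \<in> couplings (meas X) (meas Y) \<times>
                   {S. S \<noteq> {} \<and> closedin (prod_topology (gds_topology X) (gds_topology Y)) S}.
        max (ennreal (1 - measure P S))
            (2 * hausdorff (sup_dist S) (pull (pts X \<times> pts Y) fst (feat_closure X))
                                        (pull (pts X \<times> pts Y) snd (feat_closure Y))))"

section \<open>Monoidal families and compactness relative to them\<close>

definition Lip1 :: "(real \<Rightarrow> real) set" where
  "Lip1 = {p. 1-lipschitz_on UNIV p}"

text \<open>The topology on \<^typ>\<open>real \<Rightarrow> real\<close> used by \<^const>\<open>closed\<close> is the product topology, i.e.\ the
  topology of pointwise convergence.\<close>

definition monoidal :: "(real \<Rightarrow> real) set \<Rightarrow> bool" where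
  "monoidal L \<longleftrightarrow> L \<subseteq> Lip1 \<and> id \<in> L \<and> (\<forall>p\<in>L. \<forall>q\<in>L. p \<circ> q \<in> L) \<and> closed L"

definition clippings :: "(real \<Rightarrow> real) set" where
  "clippings =
     {p. \<exists>(c::real) (l::ereal) (u::ereal). l < \<infinity> \<and> -\<infinity> < u \<and> l \<le> u \<and>
           (\<forall>x. ereal (p x) = max l (min (ereal (x + c)) u))}"

definition lcomp :: "'a set \<Rightarrow> (real \<Rightarrow> real) set \<Rightarrow> ('a \<Rightarrow> real) set \<Rightarrow> ('a \<Rightarrow> real) set" where
  "lcomp A L F = (\<lambda>(p, f). compose A p f) ` (L \<times> F)"

definition Cov :: "(real \<Rightarrow> real) set \<Rightarrow> 'a gds \<Rightarrow> ('a \<Rightarrow> real) set \<Rightarrow> real \<Rightarrow> enat" where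
  "Cov L X F e =
     Inf {enat (card N) | N. N \<subseteq> F \<and> finite N \<and>
            F \<subseteq> nbhd (ky_fan (meas X)) (lcomp (pts X) L N) (ennreal e)}"

definition l_compact :: "(real \<Rightarrow> real) set \<Rightarrow> 'a gds \<Rightarrow> bool" where
  "l_compact L X \<longleftrightarrow>
     lcomp (pts X) L (feat_closure X) \<subseteq> feat_closure X \<and>
     (\<forall>e>0. Cov L X (feat_closure X) e < \<infinity>)"

section \<open>Isomorphism classes\<close>

lemma geometric_data_set_transport:
  fixes X :: "'a gds" and h :: "'a \<Rightarrow> 'b"
  assumes X: "geometric_data_set X" and inj: "inj_on h (pts X)"
  shows "\<exists>Y::'b gds. geometric_data_set Y \<and> gds_iso X Y"
proof -
  define k where "k = inv_into (pts X) h"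
  define A where "A = h ` pts X"
  have kh: "k (h x) = x" if "x \<in> pts X" for x
    using that inj by (simp add: k_def)
  have kA: "k y \<in> pts X" "h (k y) = y" if "y \<in> A" for y
    using that kh by (auto simp: A_def)
  have hA: "h x \<in> A" if "x \<in> pts X" for x using that by (auto simp: A_def)
  define G where "G = pull A k (feat X)"
  define Y0 where "Y0 = \<lparr>pts = A, feat = G, meas = undefined\<rparr>"
  define Y where "Y = \<lparr>pts = A, feat = G, meas = distr (meas X) (borel_of (gds_topology Y0)) h\<rparr>"
  have Y_simps: "pts Y = A" "feat Y = G" "meas Y = distr (meas X) (borel_of (gds_topology Y0)) h"
    by (simp_all add: Y_def)
  have dY0: "gds_dist Y0 = gds_dist Y" by (auto simp: fun_eq_iff gds_dist_def Y0_def Y_def)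
  have T0: "gds_topology Y0 = gds_topology Y" unfolding gds_topology_def dY0 by (simp add: Y0_def Y_def)
  have mX: "Metric_space (pts X) (gds_dist X)" using X by (simp add: geometric_data_set_def)
  interpret MX: Metric_space "pts X" "gds_dist X" by (fact mX)
  have img: "(\<lambda>f. \<bar>f a - f b\<bar>) ` G = (\<lambda>f. \<bar>f (k a) - f (k b)\<bar>) ` feat X" if "a \<in> A" "b \<in> A" for a b
    using that by (simp add: G_def pull_def image_image compose_def)
  have dY: "gds_dist Y a b = (if a \<in> A \<and> b \<in> A then gds_dist X (k a) (k b) else 0)" for a b
    using img[of a b] kA by (simp add: gds_dist_def Y_simps)
  interpret MY: Metric_space A "gds_dist Y"
  proof
    show "gds_dist Y a b = 0 \<longleftrightarrow> a = b" if "a \<in> A" "b \<in> A" for a b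
      using that kA[of a] kA[of b] by (metis MX.zero dY)
    show "gds_dist Y a c \<le> gds_dist Y a b + gds_dist Y b c" if "a \<in> A" "b \<in> A" "c \<in> A" for a b c
      using that kA by (auto simp: dY intro: MX.triangle)
  qed (auto simp: dY MX.commute)
  interpret M12: Metric_space12 "pts X" "gds_dist X" A "gds_dist Y" ..
  have iso: "gds_dist Y (h x) (h y) = gds_dist X x y" if "x \<in> pts X" "y \<in> pts X" for x y
    using that by (simp add: dY hA kh)
  have TX: "gds_topology X = MX.mtopology" and TY: "gds_topology Y = MY.mtopology"
    by (simp_all add: gds_topology_def Y_simps)
  have hom: "homeomorphic_map (gds_topology X) (gds_topology Y) h"
    unfolding TX TY by (rule M12.isometry_imp_homeomorphic_map) (auto simp: A_def iso)
  have compl: "MY.mcomplete"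
    unfolding MY.mcomplete_def
  proof (intro allI impI)
    fix s assume s: "MY.MCauchy s"
    have sA: "s n \<in> A" for n using s by (auto simp: MY.MCauchy_def)
    have "MX.MCauchy (k \<circ> s)"
      using s kA sA by (fastforce simp: MY.MCauchy_def MX.MCauchy_def dY)
    moreover have MX.mcomplete using X by (simp add: geometric_data_set_def)
    ultimately obtain x where x: "limitin MX.mtopology (k \<circ> s) x sequentially"
      by (meson MX.mcomplete_def)
    then have "limitin MY.mtopology s (h x) sequentially"
      by (auto simp: MX.limit_metric_sequentially MY.limit_metric_sequentially hA sA dY kh kA)
    then show "\<exists>x. limitin MY.mtopology s x sequentially" ..
  qed
  have sep: "separable_space (gds_topology Y)"
    using X hom by (meson geometric_data_set_def homeomorphic_imp_continuous_map
        homeomorphic_imp_surjective_map homeomorphic_separable_space homeomorphic_map_imp_homeomorphic_space)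
  have spX: "space (meas X) = pts X"
    using X sets_eq_imp_space_eq[of "meas X" "borel_of (gds_topology X)"]
    by (auto simp: geometric_data_set_def borel_of_def TX space_measure_of_conv)
  have meas_h: "h \<in> measurable (meas X) (borel_of (gds_topology Y))"
    unfolding borel_of_def
  proof (rule measurable_measure_of)
    show "{U. openin (gds_topology Y) U} \<subseteq> Pow (topspace (gds_topology Y))"
      by (auto dest: openin_subset)
    show "h \<in> space (meas X) \<rightarrow> topspace (gds_topology Y)"
      by (auto simp: spX TY hA)
    fix U assume "U \<in> {U. openin (gds_topology Y) U}"
    then have "openin (gds_topology X) {x \<in> topspace (gds_topology X). h x \<in> U}"
      using homeomorphic_imp_continuous_map[OF hom] openin_continuous_map_preimage by blast
    moreover have "{x \<in> topspace (gds_topology X). h x \<in> U} = h -` U \<inter> space (meas X)"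
      by (auto simp: TX spX)
    moreover have "sets (meas X) = sigma_sets (topspace (gds_topology X)) {U. openin (gds_topology X) U}"
      using X by (auto simp: geometric_data_set_def borel_of_def intro!: sets_measure_of dest: openin_subset)
    ultimately show "h -` U \<inter> space (meas X) \<in> sets (meas X)"
      by (auto intro: sigma_sets.Basic)
  qed
  have prX: "prob_space (meas X)" using X by (simp add: geometric_data_set_def)
  have gY: "geometric_data_set Y"
    unfolding geometric_data_set_def
  proof (intro conjI allI impI ballI)
    show "feat Y \<noteq> {}" using X by (simp add: Y_simps G_def pull_def geometric_data_set_def)
    show "feat Y \<subseteq> extensional (pts Y)" by (auto simp: Y_simps G_def pull_def compose_def)
    show "bdd_above ((\<lambda>f. \<bar>f a - f b\<bar>) ` feat Y)" if "a \<in> pts Y" "b \<in> pts Y" for a b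
      using X kA that by (simp add: img Y_simps geometric_data_set_def)
    show "prob_space (meas Y)" unfolding Y_simps T0 by (rule prob_space.prob_space_distr[OF prX meas_h])
    show "sets (meas Y) = sets (borel_of (gds_topology Y))" by (simp add: Y_simps T0)
    fix U assume U: "openin (gds_topology Y) U \<and> U \<noteq> {}"
    let ?V = "h -` U \<inter> space (meas X)"
    have "openin (gds_topology X) {x \<in> topspace (gds_topology X). h x \<in> U}"
      using U homeomorphic_imp_continuous_map[OF hom] openin_continuous_map_preimage by blast
    moreover have "{x \<in> topspace (gds_topology X). h x \<in> U} = ?V"
      by (auto simp: TX spX)
    moreover have "U \<subseteq> A"
      using U openin_subset[of "gds_topology Y" U] by (simp add: TY)
    then have "U \<subseteq> h ` pts X" by (simp only: A_def)
    then have "?V \<noteq> {}"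
      using U by (auto simp: spX)
    ultimately have "emeasure (meas X) ?V > 0"
      using X by (auto simp: geometric_data_set_def)
    moreover have "U \<in> sets (borel_of (gds_topology Y))"
      using U by (auto simp: borel_of_def sets_measure_of_conv dest: openin_subset)
    ultimately show "emeasure (meas Y) U > 0"
      unfolding Y_simps T0 by (simp add: emeasure_distr[OF meas_h])
  qed (use compl sep MY.Metric_space_axioms in \<open>simp_all add: Y_simps(1)\<close>)
  have "gds_iso X Y"
    unfolding gds_iso_def
  proof (intro exI conjI)
    show "bij_betw h (pts X) (pts Y)" using inj by (auto simp: Y_simps A_def bij_betw_def)
    have sY: "sets (meas Y) = sets (borel_of (gds_topology Y))" by (simp add: Y_simps T0)
    show mh: "h \<in> measurable (meas X) (meas Y)" using meas_h measurable_cong_sets[OF refl sY] by blast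
    show "distr (meas X) (meas Y) h = meas Y"
      unfolding Y_simps T0 by (rule distr_cong) auto
    let ?PX = "product_topology (\<lambda>_. euclideanreal) (pts X)"
    let ?PY = "product_topology (\<lambda>_. euclideanreal) A"
    have "homeomorphic_maps ?PY ?PX (\<lambda>f. compose (pts X) f h) (\<lambda>f. compose A f k)"
      unfolding homeomorphic_maps_def
    proof (intro conjI ballI)
      show "continuous_map ?PY ?PX (\<lambda>f. compose (pts X) f h)"
        by (auto simp: continuous_map_componentwise compose_def hA intro!: continuous_map_product_projection)
      show "continuous_map ?PX ?PY (\<lambda>f. compose A f k)"
        by (auto simp: continuous_map_componentwise compose_def kA intro!: continuous_map_product_projection)
    qed (auto simp: compose_def fun_eq_iff hA kA kh PiE_def extensional_def)
    then have hm: "homeomorphic_map ?PY ?PX (\<lambda>f. compose (pts X) f h)"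
      by (meson homeomorphic_map_maps)
    have GA: "G \<subseteq> topspace ?PY" by (auto simp: G_def pull_def compose_def)
    have "compose (pts X) (compose A f k) h = f" if "f \<in> feat X" for f
    proof -
      have "f \<in> extensional (pts X)" using X that by (auto simp: geometric_data_set_def)
      then show ?thesis by (auto simp: compose_def fun_eq_iff hA kh extensional_def)
    qed
    then have "pull (pts X) h G = feat X"
      by (simp add: G_def pull_def image_image)
    then show "pull (pts X) h (feat_closure Y) = feat_closure X"
      using homeomorphic_map_closure_of[OF hm GA]
      by (simp add: feat_closure_def pull_def Y_simps)
  qed
  with gY show ?thesis by blast
qed

lemma geometric_data_set_real_copy:
  fixes X :: "'a gds"
  assumes X: "geometric_data_set X"
  shows "\<exists>Y::real gds. geometric_data_set Y \<and> gds_iso X Y"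
proof -
  interpret M: Metric_space "pts X" "gds_dist X" using X by (simp add: geometric_data_set_def)
  have TX: "gds_topology X = M.mtopology" by (simp add: gds_topology_def)
  obtain C where C: "countable C" "C \<subseteq> pts X" "M.mtopology closure_of C = pts X"
    using X by (auto simp: geometric_data_set_def separable_space_def TX)
  have dense: "\<exists>c\<in>C. gds_dist X x c < r" if "x \<in> pts X" "r > 0" for x r
    using that C(3) unfolding M.metric_closure_of by fastforce
  define code where
    "code x = {prod_encode (i, n) | i n. gds_dist X x (from_nat_into C i) < 1 / real (Suc n)}" for x
  have "inj_on code (pts X)"
  proof (rule inj_onI, rule ccontr)
    fix x y assume xy: "x \<in> pts X" "y \<in> pts X" "code x = code y" "x \<noteq> y"
    then have "gds_dist X x y > 0" by simp
    then obtain n where n: "1 / real (Suc n) < gds_dist X x y / 2"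
      by (meson half_gt_zero nat_approx_posE)
    obtain c where c: "c \<in> C" "gds_dist X x c < 1 / real (Suc n)"
      using dense[OF xy(1)] by (metis of_nat_0_less_iff zero_less_Suc zero_less_divide_1_iff)
    obtain i where i: "from_nat_into C i = c" using C(1) c(1) by (metis from_nat_into_surj)
    have "prod_encode (i, n) \<in> code y" using c i xy(3) unfolding code_def by blast
    then have "gds_dist X y c < 1 / real (Suc n)" by (auto simp: code_def i)
    then show False using M.triangle[of x c y] M.commute[of y c] c n xy C(2) by force
  qed
  moreover obtain g :: "nat set \<Rightarrow> real" where "inj g"
    using nat_sets_eqpoll_reals by (meson bij_betw_imp_inj_on eqpoll_def)
  ultimately have "inj_on (g \<circ> code) (pts X)"
    by (meson comp_inj_on inj_on_subset subset_UNIV)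
  then show ?thesis using geometric_data_set_transport[OF X] by blast
qed

text \<open>A complete separable metric space has at most the cardinality of the continuum, so every
  geometric data set is isomorphic to one whose underlying set is a set of real numbers, used as
  mere labels since the metric comes from the features (\<open>geometric_data_set_real_copy\<close>). The isomorphism classes of the latter
  therefore form the set of all isomorphism classes.\<close>

definition iso_rel :: "(real gds \<times> real gds) set" where
  "iso_rel = {(X, Y). geometric_data_set X \<and> geometric_data_set Y \<and> gds_iso X Y}"

definition classes :: "real gds set set" where
  "classes = {X. geometric_data_set X} // iso_rel"

definition l_classes :: "(real \<Rightarrow> real) set \<Rightarrow> real gds set set" where
  "l_classes L = {A \<in> classes. \<exists>X\<in>A. l_compact L X}"

definition dominated_class :: "real gds set \<Rightarrow> real gds set \<Rightarrow> bool" where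
  "dominated_class B A \<longleftrightarrow> (\<exists>Y\<in>B. \<exists>X\<in>A. dominated Y X)"

definition rep :: "real gds set \<Rightarrow> real gds" where
  "rep A = (SOME X. X \<in> A)"

text \<open>The observable distance is at most \<open>1\<close>, as the Ky Fan metric is.\<close>

definition dconc_class :: "real gds set \<Rightarrow> real gds set \<Rightarrow> real" where
  "dconc_class A B = enn2real (dconc (rep A) (rep B))"

definition box_class :: "real gds set \<Rightarrow> real gds set \<Rightarrow> ennreal" where
  "box_class A B = box_dist (rep A) (rep B)"

section \<open>Pyramids\<close>

definition box_closed :: "(real \<Rightarrow> real) set \<Rightarrow> real gds set set \<Rightarrow> bool" where
  "box_closed L P \<longleftrightarrow>
     (\<forall>A\<in>l_classes L. (\<forall>e>0. \<exists>B\<in>P. box_class A B < ennreal e) \<longrightarrow> A \<in> P)"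

definition l_pyramid :: "(real \<Rightarrow> real) set \<Rightarrow> real gds set set \<Rightarrow> bool" where
  "l_pyramid L P \<longleftrightarrow>
     P \<subseteq> l_classes L \<and>
     (\<forall>A\<in>l_classes L. \<forall>B\<in>P. dominated_class A B \<longrightarrow> A \<in> P) \<and>
     (\<forall>A\<in>P. \<forall>B\<in>P. \<exists>C\<in>P. dominated_class A C \<and> dominated_class B C) \<and>
     P \<noteq> {} \<and> box_closed L P"

definition l_pyramids :: "(real \<Rightarrow> real) set \<Rightarrow> real gds set set set" where
  "l_pyramids L = {P. l_pyramid L P}"

definition iota :: "(real \<Rightarrow> real) set \<Rightarrow> real gds set \<Rightarrow> real gds set set" where
  "iota L A = {B \<in> l_classes L. dominated_class B A}"

end

theory Submission
  imports Defs
begin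

text \<open>A data set \<open>X\<close> is encoded by its observables: the sequences \<open>(f\<^sub>i \<circ> \<phi>)\<^sub>i\<close> of random variables on
  the unit interval with \<open>f\<^sub>i\<close> in the closure of the features, \<open>\<bar>f\<^sub>i\<bar> \<le> i\<close> and \<open>\<phi>\<close> a parameter of \<open>X\<close>. Up to
  reparametrization an observable is just its law, and the space of such laws, with a weighted Ky Fan
  distance, is compact (Helly selection and Skorohod coupling). A pyramid is encoded by the union of the
  sets of observables of its members, and \<open>\<rho>\<close> is the Hausdorff distance of these sets. It is at
  most the observable distance, because reparametrizations can be glued. A limit of sets of observables of
  pyramids is again one, since every bounded sequence of random variables whose range is separable for the
  supremum distance is realized by a data set; with the compactness of the hyperspace this makes \<open>\<rho>\<close> compact.
  It separates pyramids because finitely many features of a member of one pyramid determine it up to a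
  small box distance, and pyramids are box closed. The clippings in \<open>L\<close> make unbounded features
  recoverable from bounded ones.\<close>

text \<open>Bounding the i-th entry by i and letting the weights 2^i hide all but finitely many
  entries at each scale is what makes the laws compact. The price: a limit of observables may have a
  range that is not separable for the supremum distance, and then it need not come from a data set.
  Limits are therefore treated as abstract closed sets of random sequences, and data sets are
  produced only from truncated sequences or from interleaved features of two given data sets.
  Couplings are never disintegrated: two parametrizations of one law are glued after discretization,
  at the cost of an arbitrarily small \<eta>; hence the slack in the triangle inequalities. The hard
  point is continuity of the inverse of the embedding. Nearness of observables compares finitely
  many features at a time, with parameters that depend on them, whereas the observable distance
  needs one pair of parameters for all features, and the second data set is not uniformly totally
  bounded. A maximal separated family in the first one supplies that pair. Compactness relative to L
  is automatic once the features are invariant, since L contains the translations.\<close>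

section \<open>Coding a sequence of bits by a real number\<close>

text \<open>Base 3 with the digits 0 and 1 leaves gaps between the cylinder sets. Hence the bits
  depend continuously on the code, which binary expansions do not provide.\<close>

definition enc :: "(nat \<Rightarrow> bool) \<Rightarrow> real" where
  "enc b = (\<Sum>j. of_bool (b j) / 3 ^ Suc j)"

definition ternary_bit :: "nat \<Rightarrow> real \<Rightarrow> bool" where
  "ternary_bit j t \<longleftrightarrow> \<lfloor>3 ^ Suc j * t\<rfloor> mod 3 = 1"

lemma enc_summable: "summable (\<lambda>j. of_bool (b j) / 3 ^ Suc j :: real)"
proof (rule summable_comparison_test')
  show "summable (\<lambda>j. (1/3::real) ^ Suc j)"
    by (simp add: summable_geometric)
  show "norm (of_bool (b j) / 3 ^ Suc j :: real) \<le> (1/3) ^ Suc j" if "j \<ge> 0" for j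
    by (simp add: power_divide)
qed

lemma enc_rec: "enc b = (of_bool (b 0) + enc (\<lambda>i. b (Suc i))) / 3"
proof -
  have "(\<Sum>j. of_bool (b (Suc j)) / 3 ^ Suc (Suc j)) = (\<Sum>j. of_bool (b (Suc j)) / 3 ^ Suc j) / (3::real)"
    using suminf_divide[OF enc_summable, of "\<lambda>i. b (Suc i)" 3] by (simp add: divide_simps mult.commute)
  then show ?thesis
    using suminf_split_head[OF enc_summable, of b] by (simp add: enc_def field_simps)
qed

lemma enc_bounds: "0 \<le> enc b" "enc b \<le> 1/2"
proof -
  show "0 \<le> enc b"
    unfolding enc_def by (rule suminf_nonneg[OF enc_summable]) auto
  have "enc b \<le> (\<Sum>j. (1/3::real) ^ Suc j)"
    unfolding enc_def
    by (rule suminf_le[OF _ enc_summable])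
      (simp_all only: summable_Suc_iff summable_geometric_iff, simp_all add: power_divide)
  also have "\<dots> = (1/3) * (\<Sum>j. (1/3::real) ^ j)"
    unfolding power_Suc by (rule suminf_mult) (simp add: summable_geometric)
  also have "\<dots> = 1/2"
    using suminf_geometric[of "1/3::real"] by simp
  finally show "enc b \<le> 1/2" .
qed

lemma enc_shift: "\<exists>n::int. 3 ^ j * enc b = of_int n + enc (\<lambda>i. b (i + j))"
proof (induction j arbitrary: b)
  case 0
  show ?case by (rule exI[of _ 0]) simp
next
  case (Suc j)
  obtain n where n: "3 ^ j * enc (\<lambda>i. b (Suc i)) = of_int n + enc (\<lambda>i. b (Suc (i + j)))"
    using Suc[of "\<lambda>i. b (Suc i)"] by auto
  have "3 ^ Suc j * enc b = 3 ^ j * (3 * enc b)" by simp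
  also have "\<dots> = 3 ^ j * of_bool (b 0) + 3 ^ j * enc (\<lambda>i. b (Suc i))"
    by (subst enc_rec) (simp add: distrib_left)
  also have "\<dots> = of_int (3 ^ j * of_bool (b 0) + n) + enc (\<lambda>i. b (i + Suc j))"
    using n by simp
  finally show ?case by blast
qed

lemma ternary_bit_enc [simp]: "ternary_bit j (enc b) = b j"
proof -
  obtain n where n: "3 ^ j * enc b = of_int n + enc (\<lambda>i. b (i + j))"
    using enc_shift by blast
  have "3 ^ Suc j * enc b = of_int (3 * n + of_bool (b j)) + enc (\<lambda>i. b (Suc i + j))"
  proof -
    have "3 ^ Suc j * enc b = 3 * (3 ^ j * enc b)" by simp
    also have "\<dots> = 3 * of_int n + 3 * enc (\<lambda>i. b (i + j))" by (simp only: n distrib_left)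
    also have "3 * enc (\<lambda>i. b (i + j)) = of_bool (b j) + enc (\<lambda>i. b (Suc i + j))" by (subst enc_rec) simp
    finally show ?thesis by simp
  qed
  moreover have "0 \<le> enc (\<lambda>i. b (Suc i + j))" "enc (\<lambda>i. b (Suc i + j)) < 1"
    using enc_bounds[of "\<lambda>i. b (Suc i + j)"] by auto
  ultimately have "\<lfloor>3 ^ Suc j * enc b\<rfloor> = 3 * n + of_bool (b j)"
    by (intro floor_unique) auto
  then show ?thesis
    by (auto simp: ternary_bit_def)
qed

text \<open>If the heads differ, the leading digit contributes 1/3, and the tails, each between 0
  and 1/2, take back at most 1/6 of it.\<close>

lemma enc_close_imp_head_eq:
  assumes "\<bar>enc b - enc b'\<bar> < 1 / 6"
  shows "b 0 = b' 0"
proof -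
  define s s' where "s = enc (\<lambda>i. b (Suc i))" and "s' = enc (\<lambda>i. b' (Suc i))"
  have bds: "0 \<le> s" "s \<le> 1/2" "0 \<le> s'" "s' \<le> 1/2" unfolding s_def s'_def by (rule enc_bounds)+
  have eq: "enc b = (of_bool (b 0) + s) / 3" "enc b' = (of_bool (b' 0) + s') / 3"
    unfolding s_def s'_def by (rule enc_rec)+
  have False if "enc b = (1 + s) / 3" "enc b' = s' / 3" using that bds assms by (simp add: abs_less_iff)
  moreover have False if "enc b = s / 3" "enc b' = (1 + s') / 3" using that bds assms by (simp add: abs_less_iff)
  ultimately show ?thesis using eq by (cases "b 0"; cases "b' 0") auto
qed

text \<open>The threshold is the gap 1/6 divided by 3^j: once the heads agree they cancel, and
  dropping them multiplies the distance by 3.\<close>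

lemma enc_close_imp_bit_eq:
  "\<bar>enc b - enc b'\<bar> < 1 / (2 * 3 ^ Suc j) \<Longrightarrow> b j = b' j"
proof (induction j arbitrary: b b')
  case 0
  then show ?case by (intro enc_close_imp_head_eq) simp
next
  case (Suc j)
  have le: "1 / (2 * 3 ^ Suc (Suc j)) \<le> (1 / (2 * 3) :: real)"
    using one_le_power[of "3::real" "Suc j"] by (intro divide_left_mono) auto
  have "\<bar>enc b - enc b'\<bar> < 1 / 6" using Suc.prems le by linarith
  then have "b 0 = b' 0" by (rule enc_close_imp_head_eq)
  then have "enc b - enc b' = (enc (\<lambda>i. b (Suc i)) - enc (\<lambda>i. b' (Suc i))) / 3"
    using enc_rec[of b] enc_rec[of b'] by (simp add: diff_divide_distrib[symmetric])
  with Suc.prems have "\<bar>enc (\<lambda>i. b (Suc i)) - enc (\<lambda>i. b' (Suc i))\<bar> < 1 / (2 * 3 ^ Suc j)"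
    by simp
  then show ?case using Suc.IH[of "\<lambda>i. b (Suc i)" "\<lambda>i. b' (Suc i)"] by simp
qed

lemma enc_agree_close: "(\<And>i. i < J \<Longrightarrow> b i = b' i) \<Longrightarrow> \<bar>enc b - enc b'\<bar> \<le> 1 / 3 ^ J"
proof (induction J arbitrary: b b')
  case 0
  show ?case using enc_bounds[of b] enc_bounds[of b'] by auto
next
  case (Suc J)
  have "\<bar>enc (\<lambda>i. b (Suc i)) - enc (\<lambda>i. b' (Suc i))\<bar> \<le> 1 / 3 ^ J"
    using Suc by simp
  moreover have "b 0 = b' 0" using Suc.prems by simp
  ultimately show ?case
    using enc_rec[of b] enc_rec[of b'] by (simp add: diff_divide_distrib[symmetric])
qed

text \<open>The codes form a closed set: the bits of a convergent sequence of codes stabilize one by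
  one, and the limit is the code of the stabilized bits, whose ternary digits are these
  bits.\<close>

lemma enc_limit_bits:
  assumes "(\<lambda>k. enc (b k)) \<longlonglongrightarrow> t"
  shows "\<forall>\<^sub>F k in sequentially. b k j = ternary_bit j t"
proof -
  have "Cauchy (\<lambda>k. enc (b k))" using assms LIMSEQ_imp_Cauchy by blast
  have "\<exists>v. \<forall>\<^sub>F k in sequentially. b k j = v" for j
  proof -
    have "1 / (2 * 3 ^ Suc j) > (0::real)" by simp
    then obtain M where M: "\<And>k. k \<ge> M \<Longrightarrow> \<bar>enc (b k) - enc (b M)\<bar> < 1 / (2 * 3 ^ Suc j)"
      using \<open>Cauchy _\<close> unfolding Cauchy_def dist_real_def by blast
    then have "b k j = b M j" if "k \<ge> M" for k
      using that enc_close_imp_bit_eq by blast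
    then show ?thesis unfolding eventually_sequentially by blast
  qed
  then obtain B where B: "\<And>j. \<forall>\<^sub>F k in sequentially. b k j = B j" by metis
  have "(\<lambda>k. enc (b k)) \<longlonglongrightarrow> enc B"
  proof (rule tendstoI)
    fix e :: real assume "e > 0"
    then obtain J where J: "(1/3) ^ J < e" using real_arch_pow_inv[of e "1/3"] by auto
    have "\<forall>\<^sub>F k in sequentially. \<forall>i\<in>{..<J}. b k i = B i"
      by (subst eventually_ball_finite_distrib) (use B in auto)
    then show "\<forall>\<^sub>F k in sequentially. dist (enc (b k)) (enc B) < e"
    proof eventually_elim
      case (elim k)
      then have "\<bar>enc (b k) - enc B\<bar> \<le> 1 / 3 ^ J" by (intro enc_agree_close) auto
      then show ?case using J by (simp add: dist_real_def power_divide)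
    qed
  qed
  then have "t = enc B" using assms LIMSEQ_unique by blast
  then show ?thesis using B by simp
qed

section \<open>Coding a sequence of reals by one real\<close>

abbreviation RN :: "(nat \<Rightarrow> real) measure" where
  "RN \<equiv> Pi\<^sub>M UNIV (\<lambda>_. borel)"

definition rat_seq :: "nat \<Rightarrow> real" where
  "rat_seq m = of_rat (nat_to_rat_surj m)"

text \<open>The bits describe the Dedekind cuts of all entries at once. The codes lie in [0, 1/2],
  so every family of laws of codes is tight.\<close>

definition encode :: "(nat \<Rightarrow> real) \<Rightarrow> real" where
  "encode x = enc (\<lambda>j. case prod_decode j of (n, m) \<Rightarrow> rat_seq m < x n)"

text \<open>The supremum is taken in the extended reals, with -\<infinity> standing for an absent
  rational, so that it makes sense before the cut is known to be proper.\<close>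

definition decode :: "real \<Rightarrow> nat \<Rightarrow> real" where
  "decode t n = real_of_ereal (SUP m. if ternary_bit (prod_encode (n, m)) t then ereal (rat_seq m) else -\<infinity>)"

lemma rat_seq_dense: "a < b \<Longrightarrow> \<exists>m. a < rat_seq m \<and> rat_seq m < b"
  unfolding rat_seq_def using of_rat_dense[of a b] surj_nat_to_rat_surj by (metis surjD)

lemma SUP_rat_below: "(SUP m. if rat_seq m < x then ereal (rat_seq m) else -\<infinity>) = ereal x"
proof (rule antisym)
  show "(SUP m. if rat_seq m < x then ereal (rat_seq m) else -\<infinity>) \<le> ereal x"
    by (rule SUP_least) auto
  show "ereal x \<le> (SUP m. if rat_seq m < x then ereal (rat_seq m) else -\<infinity>)"
    unfolding le_SUP_iff
  proof (intro allI impI)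
    fix y assume "y < ereal x"
    then obtain z where z: "y < ereal z" "z < x"
      by (metis ereal_dense2 less_ereal.simps(1))
    then obtain m where "z < rat_seq m" "rat_seq m < x" using rat_seq_dense by blast
    then show "\<exists>m\<in>UNIV. y < (if rat_seq m < x then ereal (rat_seq m) else -\<infinity>)"
      using z by (auto intro!: exI[of _ m] less_trans[OF z(1)])
  qed
qed

lemma decode_encode [simp]: "decode (encode x) = x"
  by (rule ext) (simp only: decode_def encode_def ternary_bit_enc prod_encode_inverse prod.case
      SUP_rat_below real_of_ereal.simps)

lemma measurable_encode [measurable]: "encode \<in> borel_measurable RN"
  unfolding encode_def enc_def case_prod_beta by measurable

lemma measurable_decode [measurable]: "decode \<in> measurable borel RN"
proof (rule measurable_PiM_single')
  fix i :: nat
  show "(\<lambda>t. decode t i) \<in> borel_measurable borel"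
    unfolding decode_def ternary_bit_def by measurable
qed auto

text \<open>Limits of codes of sequences need not be codes: if an entry decreases strictly to a
  rational, the bit of that rational stays true in the limit. The cut read off from the limit still
  has the correct supremum, and the bounds on the entries exclude infinite suprema.\<close>

lemma encode_limit:
  assumes lim: "(\<lambda>k. encode (x k)) \<longlonglongrightarrow> t" and bd: "\<And>k n. \<bar>x k n\<bar> \<le> real n"
  shows "(\<lambda>k. x k n) \<longlonglongrightarrow> decode t n"
proof -
  define B where "B m \<longleftrightarrow> ternary_bit (prod_encode (n, m)) t" for m
  have ev: "\<forall>\<^sub>F k in sequentially. (rat_seq m < x k n) = B m" for m
    using enc_limit_bits[OF lim[unfolded encode_def], of "prod_encode (n, m)"] by (simp add: B_def)
  define s where "s = (SUP m. if B m then ereal (rat_seq m) else -\<infinity>)"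
  have "s \<le> ereal (real n)"
    unfolding s_def
  proof (rule SUP_least)
    fix m
    have "rat_seq m \<le> real n" if Bm: "B m"
    proof -
      obtain k where "rat_seq m < x k n"
        using eventually_happens[OF ev[of m]] Bm by auto
      then show ?thesis using bd[of k n] by auto
    qed
    then show "(if B m then ereal (rat_seq m) else -\<infinity>) \<le> ereal (real n)" by auto
  qed
  \<comment> \<open>A rational below \<open>- real n\<close> belongs to every cut, hence to the
    limiting one, and keeps the supremum from being -\<infinity>.\<close>
  moreover obtain m0 where m0: "- real n - 1 < rat_seq m0" "rat_seq m0 < - real n"
    using rat_seq_dense[of "- real n - 1" "- real n"] by auto
  have "B m0"
  proof -
    obtain k where "(rat_seq m0 < x k n) = B m0"
      using eventually_happens[OF ev[of m0]] by auto
    then show ?thesis using bd[of k n] m0 by auto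
  qed
  then have "ereal (rat_seq m0) \<le> s" unfolding s_def by (intro SUP_upper2[of m0]) auto
  ultimately obtain r where r: "s = ereal r" by (cases s) auto
  have D: "decode t n = r" unfolding decode_def using r unfolding s_def B_def by simp
  show ?thesis unfolding D
  proof (rule tendstoI)
    fix e :: real assume e: "e > 0"
    \<comment> \<open>Two rationals, just above and just below r, with limiting bits false and true,
      eventually enclose the entries.\<close>
    obtain m1 where m1: "r < rat_seq m1" "rat_seq m1 < r + e" using rat_seq_dense[of r "r + e"] e by auto
    have "\<not> B m1"
    proof
      assume "B m1"
      then have "ereal (rat_seq m1) \<le> s" unfolding s_def by (intro SUP_upper2[of m1]) auto
      then show False using r m1 by auto
    qed
    have "ereal (r - e) < s" using r e by simp
    then obtain m2 where m2: "ereal (r - e) < (if B m2 then ereal (rat_seq m2) else -\<infinity>)"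
      unfolding s_def less_SUP_iff by blast
    then have "B m2" "r - e < rat_seq m2" by (auto split: if_splits)
    from ev[of m1] ev[of m2] show "\<forall>\<^sub>F k in sequentially. dist (x k n) r < e"
    proof eventually_elim
      case (elim k)
      then show ?case
        using \<open>\<not> B m1\<close> \<open>B m2\<close> \<open>r - e < rat_seq m2\<close> m1 by (auto simp: dist_real_def)
    qed
  qed
qed

section \<open>The unit interval as a universal probability space\<close>

lemma space_leb01 [simp]: "space leb01 = {0..1}"
  by (simp add: leb01_def space_restrict_space)

lemma prob_space_leb01: "prob_space leb01"
  by (rule prob_spaceI) (simp add: leb01_def space_restrict_space emeasure_restrict_space)

interpretation leb01: prob_space leb01 by (rule prob_space_leb01)

lemma measurable_ident_leb01 [measurable]: "(\<lambda>x. x) \<in> borel_measurable leb01"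
  unfolding leb01_def by (rule measurable_restrict_space1) simp

text \<open>A Borel embedding into the reals with a measurable left inverse: the part of being a
  standard Borel space that lets every law be realized on the unit interval.\<close>

definition standard :: "'a measure \<Rightarrow> bool" where
  "standard M \<longleftrightarrow> (\<exists>e\<in>borel_measurable M. \<exists>d\<in>measurable (borel :: real measure) M. \<forall>x\<in>space M. d (e x) = x)"

lemma standard_RN: "standard RN"
  unfolding standard_def by (intro bexI[of _ encode] bexI[of _ decode]) auto

lemma standard_leb01: "standard leb01"
  unfolding standard_def
proof (rule bexI[of _ "\<lambda>t. t"], rule bexI[of _ "\<lambda>t. max 0 (min 1 t)"])
  show "(\<lambda>t. max 0 (min 1 t)) \<in> measurable borel leb01"
    unfolding leb01_def by (rule measurable_restrict_space2) auto
qed auto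

text \<open>The two codes become entries of a sequence of reals, and this sequence is coded by a
  real again.\<close>

lemma standard_pair:
  assumes "standard M" "standard N"
  shows "standard (M \<Otimes>\<^sub>M N)"
proof -
  from assms obtain e d e' d' where *[measurable]: "e \<in> borel_measurable M" "d \<in> measurable borel M"
      "e' \<in> borel_measurable N" "d' \<in> measurable borel N"
    and inv: "\<And>x. x \<in> space M \<Longrightarrow> d (e x :: real) = x" "\<And>x. x \<in> space N \<Longrightarrow> d' (e' x :: real) = x"
    unfolding standard_def by blast
  define E where "E = (\<lambda>p. encode (\<lambda>i::nat. if i = 0 then e (fst p) else e' (snd p)))"
  define D where "D = (\<lambda>t. (d (decode t 0), d' (decode t 1)))"
  have [measurable]: "(\<lambda>t. decode t i) \<in> borel_measurable borel" for i
    using measurable_compose[OF measurable_decode measurable_component_singleton[of i UNIV]] by simp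
  have "(\<lambda>p. (\<lambda>i::nat. if i = 0 then e (fst p) else e' (snd p))) \<in> measurable (M \<Otimes>\<^sub>M N) RN"
    by (rule measurable_PiM_single') auto
  then have "E \<in> borel_measurable (M \<Otimes>\<^sub>M N)"
    unfolding E_def by measurable
  moreover have "D \<in> measurable borel (M \<Otimes>\<^sub>M N)" unfolding D_def by measurable
  moreover have "\<forall>x\<in>space (M \<Otimes>\<^sub>M N). D (E x) = x"
    by (auto simp: D_def E_def space_pair_measure inv)
  ultimately show ?thesis unfolding standard_def by blast
qed

text \<open>The map is the quantile function of \<open>M\<close>, which pushes the uniform law
  forward to \<open>M\<close>.\<close>

lemma real_law:
  assumes "real_distribution M"
  shows "\<exists>q\<in>borel_measurable leb01. distr leb01 borel q = M"
proof -
  interpret M: cdf_distribution M unfolding cdf_distribution_def by fact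
  \<comment> \<open>The quantile function is meaningful on the open interval; the endpoints form a
    null set and get the value 0.\<close>
  define q where "q t = (if t \<in> {0<..<1} then M.I t else 0)" for t
  have I: "M.I \<in> borel_measurable (restrict_space borel {0<..<1})" by (rule M.measurable_CI)
  have q0: "q \<in> borel_measurable borel"
    unfolding q_def using I by (subst (asm) measurable_restrict_space_iff[where c=0]) auto
  then have q: "q \<in> borel_measurable leb01"
    unfolding leb01_def by (intro measurable_restrict_space1) simp
  have "distr leb01 borel q = distr (restrict_space lborel {0<..<1::real}) borel M.I"
  proof (rule measure_eqI)
    fix A :: "real set" assume "A \<in> sets (distr leb01 borel q)"
    then have A: "A \<in> sets borel" by simp
    have S: "q -` A \<inter> {0..1} \<in> sets lborel" using measurable_sets[OF q0 A] by simp
    have *: "q -` A \<inter> {0<..<1} = M.I -` A \<inter> {0<..<1}" by (auto simp: q_def)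
    have "emeasure (distr leb01 borel q) A = emeasure lborel (q -` A \<inter> {0..1})"
      using S by (simp add: emeasure_distr[OF q A]) (simp add: leb01_def emeasure_restrict_space)
    also have "\<dots> = emeasure lborel (q -` A \<inter> {0<..<1})"
    proof (rule emeasure_eq_AE)
      have "AE x in lborel. x \<notin> {0, 1::real}"
        using AE_lborel_singleton[of 0] AE_lborel_singleton[of "1::real"] by eventually_elim auto
      then show "AE x in lborel. x \<in> q -` A \<inter> {0..1} \<longleftrightarrow> x \<in> q -` A \<inter> {0<..<1}"
        by eventually_elim (auto simp: less_le)
    qed (use S measurable_sets[OF q0 A] in auto)
    also have "\<dots> = emeasure (distr (restrict_space lborel {0<..<1::real}) borel M.I) A"
      unfolding * using A I
      by (subst emeasure_distr) (auto simp: space_restrict_space emeasure_restrict_space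
          measurable_cong_sets[OF sets_restrict_space_cong[OF sets_lborel] refl])
    finally show "emeasure (distr leb01 borel q) A = emeasure (distr (restrict_space lborel {0<..<1::real}) borel M.I) A" .
  qed simp
  then show ?thesis using q M.distr_I_eq_M by auto
qed

text \<open>The law is moved to the real line by the code, realized there by a quantile function,
  and moved back by the left inverse.\<close>

lemma standard_law:
  assumes "standard M" "prob_space M'" "sets M' = sets M"
  shows "\<exists>\<phi>\<in>measurable leb01 M. distr leb01 M \<phi> = M'"
proof -
  from assms(1) obtain e d where [measurable]: "e \<in> borel_measurable M" "d \<in> measurable borel M"
    and inv: "\<And>x. x \<in> space M \<Longrightarrow> d (e x :: real) = x"
    unfolding standard_def by blast
  have [measurable]: "e \<in> borel_measurable M'" by (simp add: measurable_cong_sets[OF assms(3) refl])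
  have "real_distribution (distr M' borel e)"
    by (intro prob_space.real_distribution_distr assms) auto
  then obtain q where [measurable]: "q \<in> borel_measurable leb01" and q: "distr leb01 borel q = distr M' borel e"
    using real_law by blast
  have "distr leb01 M (\<lambda>x. d (q x)) = distr (distr leb01 borel q) M d"
    by (subst distr_distr) (auto simp: comp_def)
  also have "\<dots> = distr M' M (\<lambda>x. d (e x))"
    unfolding q by (subst distr_distr) (auto simp: comp_def)
  also have "\<dots> = distr M' M' (\<lambda>x. x)"
    using inv sets_eq_imp_space_eq[OF assms(3)] by (intro distr_cong) (auto simp: assms)
  also have "\<dots> = M'" by (rule distr_id)
  finally show ?thesis by (intro bexI[of _ "\<lambda>x. d (q x)"]) auto
qed

section \<open>Measure-preserving reparametrizations and gluing\<close>

definition mp :: "(real \<Rightarrow> real) set" where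
  "mp = {\<tau> \<in> measurable leb01 leb01. distr leb01 leb01 \<tau> = leb01}"

lemma mp_measurable: "\<tau> \<in> mp \<Longrightarrow> \<tau> \<in> measurable leb01 leb01"
  by (simp add: mp_def)

lemma mp_distr_comp:
  assumes "\<tau> \<in> mp" "u \<in> measurable leb01 M"
  shows "distr leb01 M (\<lambda>t. u (\<tau> t)) = distr leb01 M u"
  using assms distr_distr[of u leb01 M \<tau> leb01] by (simp add: mp_def comp_def)

lemma mp_id: "(\<lambda>t. t) \<in> mp"
  by (simp add: mp_def distr_id)

lemma mp_comp: "\<tau> \<in> mp \<Longrightarrow> \<sigma> \<in> mp \<Longrightarrow> (\<lambda>t. \<tau> (\<sigma> t)) \<in> mp"
  using mp_distr_comp[of \<sigma> \<tau> leb01] by (auto simp: mp_def intro: measurable_compose)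

text \<open>The coupling has density \<open>1[u s = v t] / P(u = u s)\<close> with respect to the product measure.\<close>

lemma glue_discrete:
  fixes u v :: "real \<Rightarrow> nat"
  assumes [measurable]: "u \<in> measurable leb01 (count_space UNIV)" "v \<in> measurable leb01 (count_space UNIV)"
    and eq: "distr leb01 (count_space UNIV) u = distr leb01 (count_space UNIV) v"
  shows "\<exists>\<tau>\<in>mp. \<exists>\<sigma>\<in>mp. AE t in leb01. u (\<tau> t) = v (\<sigma> t)"
proof -
  define p where "p k = emeasure leb01 {t \<in> {0..1}. u t = k}" for k
  have pv: "p k = emeasure leb01 {t \<in> {0..1}. v t = k}" for k
  proof -
    have "p k = emeasure (distr leb01 (count_space UNIV) u) {k}"
      unfolding p_def by (subst emeasure_distr) (auto intro!: arg_cong[where f="emeasure leb01"])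
    also have "\<dots> = emeasure leb01 {t \<in> {0..1}. v t = k}"
      unfolding eq by (subst emeasure_distr) (auto intro!: arg_cong[where f="emeasure leb01"])
    finally show ?thesis .
  qed
  have sets_u: "{t \<in> {0..1}. u t = k} \<in> sets leb01" and sets_v: "{t \<in> {0..1}. v t = k} \<in> sets leb01" for k
    using measurable_sets[OF assms(1), of "{k}"] measurable_sets[OF assms(2), of "{k}"]
    by (auto simp: vimage_def Int_def conj_commute)
  have p_fin: "p k \<noteq> \<infinity>" for k unfolding p_def by simp
  \<comment> \<open>Only countably many values exist, so those of probability zero are avoided
    almost surely; at these the inverse in the density would be infinite.\<close>
  have pos: "AE t in leb01. p (w t) \<noteq> 0"
    if [measurable]: "w \<in> measurable leb01 (count_space UNIV)" and "\<And>k. p k = emeasure leb01 {t \<in> {0..1}. w t = k}" for w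
  proof -
    have "AE t in leb01. \<forall>k. p k = 0 \<longrightarrow> w t \<noteq> k"
      unfolding AE_all_countable
    proof
      fix k
      have "{t \<in> {0..1}. w t = k} \<in> sets leb01"
        using measurable_sets[OF that(1), of "{k}"] by (auto simp: vimage_def Int_def conj_commute)
      then show "AE t in leb01. p k = 0 \<longrightarrow> w t \<noteq> k"
        using that(2)[of k] by (cases "p k = 0") (auto intro!: AE_I[of _ _ "{t \<in> {0..1}. w t = k}"])
    qed
    then show ?thesis by eventually_elim auto
  qed
  define w where "w = (\<lambda>(s, t). if u s = v t then inverse (p (u s)) else 0)"
  have [measurable]: "(\<lambda>s. inverse (p (u s))) \<in> borel_measurable leb01"
    by (rule measurable_compose[OF assms(1)]) simp
  have "Measurable.pred (leb01 \<Otimes>\<^sub>M leb01) (\<lambda>x. \<exists>k. u (fst x) = k \<and> v (snd x) = k)"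
    by measurable
  moreover have "(\<lambda>x. \<exists>k. u (fst x) = k \<and> v (snd x) = k) = (\<lambda>x. u (fst x) = v (snd x))"
    by (intro ext) metis
  ultimately have [measurable]: "Measurable.pred (leb01 \<Otimes>\<^sub>M leb01) (\<lambda>x. u (fst x) = v (snd x))"
    by (rule back_subst)
  have [measurable]: "w \<in> borel_measurable (leb01 \<Otimes>\<^sub>M leb01)"
    unfolding w_def case_prod_beta by measurable
  have cancel: "inverse (p k) * p k = 1" if "p k \<noteq> 0" for k
    using ennreal_divide_self[OF that] p_fin[of k] by (simp add: divide_ennreal_def mult.commute less_top)
  have int_fst: "AE s in leb01. (\<integral>\<^sup>+ t. w (s, t) \<partial>leb01) = 1"
    using pos[OF assms(1) p_def]
  proof eventually_elim
    case (elim s)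
    have "(\<integral>\<^sup>+ t. w (s, t) \<partial>leb01) = (\<integral>\<^sup>+ t. inverse (p (u s)) * indicator {t \<in> {0..1}. v t = u s} t \<partial>leb01)"
      by (rule nn_integral_cong) (auto simp: w_def)
    also have "\<dots> = inverse (p (u s)) * p (u s)"
      unfolding pv[of "u s"] by (rule nn_integral_cmult_indicator[OF sets_v])
    finally show ?case using cancel[OF elim] by simp
  qed
  have int_snd: "AE t in leb01. (\<integral>\<^sup>+ s. w (s, t) \<partial>leb01) = 1"
    using pos[OF assms(2) pv]
  proof eventually_elim
    case (elim t)
    have "(\<integral>\<^sup>+ s. w (s, t) \<partial>leb01) = (\<integral>\<^sup>+ s. inverse (p (v t)) * indicator {s \<in> {0..1}. u s = v t} s \<partial>leb01)"
      by (rule nn_integral_cong) (auto simp: w_def)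
    also have "\<dots> = inverse (p (v t)) * p (v t)"
      unfolding p_def[of "v t"] by (rule nn_integral_cmult_indicator[OF sets_u])
    finally show ?case using cancel[OF elim] by simp
  qed
  define Q where "Q = density (leb01 \<Otimes>\<^sub>M leb01) w"
  have sQ: "sets Q = sets (leb01 \<Otimes>\<^sub>M leb01)" by (simp add: Q_def)
  interpret P: pair_sigma_finite leb01 leb01 ..
  have fst_Q: "distr Q leb01 fst = leb01"
  proof (rule measure_eqI)
    fix A assume "A \<in> sets (distr Q leb01 fst)"
    then have A[measurable]: "A \<in> sets leb01" by simp
    have "emeasure (distr Q leb01 fst) A = emeasure Q (A \<times> {0..1})"
      using sets.sets_into_space[OF A]
      by (subst emeasure_distr) (auto simp: Q_def space_pair_measure intro!: arg_cong[where f="emeasure _"])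
    also have "\<dots> = (\<integral>\<^sup>+ x. w x * indicator (A \<times> {0..1}) x \<partial>(leb01 \<Otimes>\<^sub>M leb01))"
      unfolding Q_def using sets.top[of leb01] by (intro emeasure_density) auto
    also have "\<dots> = (\<integral>\<^sup>+ s. (\<integral>\<^sup>+ t. w (s, t) * indicator (A \<times> {0..1}) (s, t) \<partial>leb01) \<partial>leb01)"
      using sets.top[of leb01] by (intro leb01.nn_integral_fst[symmetric]) simp
    also have "\<dots> = (\<integral>\<^sup>+ s. (\<integral>\<^sup>+ t. w (s, t) \<partial>leb01) * indicator A s \<partial>leb01)"
      by (intro nn_integral_cong, subst nn_integral_multc[symmetric]) (auto intro!: nn_integral_cong simp: indicator_def)
    also have "\<dots> = (\<integral>\<^sup>+ s. indicator A s \<partial>leb01)"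
      using int_fst by (intro nn_integral_cong_AE) (auto elim: eventually_mono)
    finally show "emeasure (distr Q leb01 fst) A = emeasure leb01 A" by simp
  qed simp
  have snd_Q: "distr Q leb01 snd = leb01"
  proof (rule measure_eqI)
    fix A assume "A \<in> sets (distr Q leb01 snd)"
    then have A[measurable]: "A \<in> sets leb01" by simp
    have "emeasure (distr Q leb01 snd) A = emeasure Q ({0..1} \<times> A)"
      using sets.sets_into_space[OF A]
      by (subst emeasure_distr) (auto simp: Q_def space_pair_measure intro!: arg_cong[where f="emeasure _"])
    also have "\<dots> = (\<integral>\<^sup>+ x. w x * indicator ({0..1} \<times> A) x \<partial>(leb01 \<Otimes>\<^sub>M leb01))"
      unfolding Q_def using sets.top[of leb01] by (intro emeasure_density) auto
    also have "\<dots> = (\<integral>\<^sup>+ t. (\<integral>\<^sup>+ s. w (s, t) * indicator ({0..1} \<times> A) (s, t) \<partial>leb01) \<partial>leb01)"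
      using sets.top[of leb01] by (intro P.nn_integral_snd[symmetric]) simp
    also have "\<dots> = (\<integral>\<^sup>+ t. (\<integral>\<^sup>+ s. w (s, t) \<partial>leb01) * indicator A t \<partial>leb01)"
      by (intro nn_integral_cong, subst nn_integral_multc[symmetric]) (auto intro!: nn_integral_cong simp: indicator_def)
    also have "\<dots> = (\<integral>\<^sup>+ t. indicator A t \<partial>leb01)"
      using int_snd by (intro nn_integral_cong_AE) (auto elim: eventually_mono)
    finally show "emeasure (distr Q leb01 snd) A = emeasure leb01 A" by simp
  qed simp
  have "prob_space Q"
  proof (rule prob_space_distrD[of fst])
    show "fst \<in> measurable Q leb01" by (simp add: Q_def)
    show "prob_space (distr Q leb01 fst)" unfolding fst_Q by (rule prob_space_leb01)
  qed
  \<comment> \<open>The coupling is a law on a standard space, so one map from the unit interval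
    realizes it, and its two components are the required reparametrizations.\<close>
  then obtain \<phi> where \<phi>[measurable]: "\<phi> \<in> measurable leb01 (leb01 \<Otimes>\<^sub>M leb01)"
    and d\<phi>: "distr leb01 (leb01 \<Otimes>\<^sub>M leb01) \<phi> = Q"
    using standard_law[OF standard_pair[OF standard_leb01 standard_leb01] _ sQ] by blast
  have 1: "(\<lambda>t. fst (\<phi> t)) \<in> mp"
    using fst_Q distr_distr[of fst "leb01 \<Otimes>\<^sub>M leb01" leb01 \<phi> leb01] unfolding d\<phi>[symmetric] mp_def
    by (simp add: comp_def)
  have 2: "(\<lambda>t. snd (\<phi> t)) \<in> mp"
    using snd_Q distr_distr[of snd "leb01 \<Otimes>\<^sub>M leb01" leb01 \<phi> leb01] unfolding d\<phi>[symmetric] mp_def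
    by (simp add: comp_def)
  have "AE x in Q. u (fst x) = v (snd x)"
    unfolding Q_def by (subst AE_density) (auto simp: w_def split: if_splits)
  then have "AE t in leb01. u (fst (\<phi> t)) = v (snd (\<phi> t))"
    unfolding d\<phi>[symmetric] by (subst (asm) AE_distr_iff) auto
  then show ?thesis using 1 2 by (intro bexI[of _ "\<lambda>t. fst (\<phi> t)"] bexI[of _ "\<lambda>t. snd (\<phi> t)"]) auto
qed

section \<open>Closeness in measure\<close>

text \<open>The condition under the infimum that defines the Ky Fan metric. For measurable functions
  on a probability space the infimum is attained (\<open>close_limit\<close>), so with e \<ge> 0
  this says that the distance is at most e, in terms of the real-valued measure.\<close>

definition close :: "'a measure \<Rightarrow> real \<Rightarrow> ('a \<Rightarrow> real) \<Rightarrow> ('a \<Rightarrow> real) \<Rightarrow> bool" where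
  "close M e u v \<longleftrightarrow> measure M {x \<in> space M. e < \<bar>u x - v x\<bar>} \<le> e"

lemma close_sym: "close M e u v \<Longrightarrow> close M e v u"
  by (simp add: close_def abs_minus_commute)

lemma close_cong:
  "(\<And>x. x \<in> space M \<Longrightarrow> u x = u' x) \<Longrightarrow> (\<And>x. x \<in> space M \<Longrightarrow> v x = v' x) \<Longrightarrow> close M e u v \<longleftrightarrow> close M e u' v'"
  unfolding close_def by (simp cong: conj_cong)

lemma close_distr:
  assumes [measurable]: "\<phi> \<in> measurable M N" "u \<in> borel_measurable N" "v \<in> borel_measurable N"
  shows "close (distr M N \<phi>) e u v \<longleftrightarrow> close M e (\<lambda>x. u (\<phi> x)) (\<lambda>x. v (\<phi> x))"
proof -
  have "measure (distr M N \<phi>) {x \<in> space N. e < \<bar>u x - v x\<bar>} = measure M {x \<in> space M. e < \<bar>u (\<phi> x) - v (\<phi> x)\<bar>}"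
    using measurable_space[OF assms(1)] by (subst measure_distr) (auto intro!: arg_cong[where f="measure M"])
  then show ?thesis by (simp add: close_def)
qed

context prob_space
begin

lemma close_mono:
  assumes "close M e u v" "e \<le> e'" and [measurable]: "u \<in> borel_measurable M" "v \<in> borel_measurable M"
  shows "close M e' u v"
proof -
  have "measure M {x \<in> space M. e' < \<bar>u x - v x\<bar>} \<le> measure M {x \<in> space M. e < \<bar>u x - v x\<bar>}"
    using assms(2) by (intro finite_measure_mono) auto
  then show ?thesis using assms by (simp add: close_def)
qed

lemma close_triangle:
  assumes "close M a u v" "close M b v w"
    and [measurable]: "u \<in> borel_measurable M" "v \<in> borel_measurable M" "w \<in> borel_measurable M"
  shows "close M (a + b) u w"
proof -
  have "measure M {x \<in> space M. a + b < \<bar>u x - w x\<bar>}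
     \<le> measure M ({x \<in> space M. a < \<bar>u x - v x\<bar>} \<union> {x \<in> space M. b < \<bar>v x - w x\<bar>})"
    by (intro finite_measure_mono) auto
  also have "\<dots> \<le> measure M {x \<in> space M. a < \<bar>u x - v x\<bar>} + measure M {x \<in> space M. b < \<bar>v x - w x\<bar>}"
    by (intro measure_Un_le) auto
  finally show ?thesis using assms by (simp add: close_def)
qed

lemma close_ge_1: "1 \<le> e \<Longrightarrow> close M e u v"
  unfolding close_def by (meson order_trans prob_le_1)

lemma close_pointwise:
  assumes "\<And>x. x \<in> space M \<Longrightarrow> \<bar>u x - v x\<bar> \<le> e" "0 \<le> e"
  shows "close M e u v"
proof -
  have "{x \<in> space M. e < \<bar>u x - v x\<bar>} = {}" using assms(1) by force
  then show ?thesis unfolding close_def using assms(2) by (simp only: measure_empty)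
qed

lemma close_on_set:
  assumes "\<And>x. x \<in> S \<Longrightarrow> \<bar>u x - v x\<bar> \<le> e" "S \<in> sets M" "1 - e \<le> measure M S"
    and [measurable]: "u \<in> borel_measurable M" "v \<in> borel_measurable M"
  shows "close M e u v"
proof -
  have "measure M {x \<in> space M. e < \<bar>u x - v x\<bar>} \<le> measure M (space M - S)"
    using assms(1,2) by (intro finite_measure_mono) force+
  also have "\<dots> = 1 - measure M S" using assms(2) by (rule prob_compl)
  finally show ?thesis using assms(3) by (simp add: close_def)
qed

lemma close_AE:
  assumes "AE x in M. u x = u' x" "close M e u v"
    and [measurable]: "u \<in> borel_measurable M" "u' \<in> borel_measurable M" "v \<in> borel_measurable M"
  shows "close M e u' v"
proof -
  have "measure M {x \<in> space M. e < \<bar>u x - v x\<bar>} = measure M {x \<in> space M. e < \<bar>u' x - v x\<bar>}"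
    using assms(1) by (intro measure_eq_AE) auto
  then show ?thesis using assms(2) by (simp add: close_def)
qed

text \<open>As \<eta> decreases to 0 the exceptional sets increase to the one for e, so continuity
  of the measure from below applies.\<close>

lemma close_limit:
  assumes cl: "\<And>\<eta>. 0 < \<eta> \<Longrightarrow> close M (e + \<eta>) u v"
    and [measurable]: "u \<in> borel_measurable M" "v \<in> borel_measurable M"
  shows "close M e u v"
proof -
  define A where "A n = {x \<in> space M. e + 1 / real (Suc n) < \<bar>u x - v x\<bar>}" for n :: nat
  have [measurable]: "A n \<in> events" for n unfolding A_def by measurable
  have "incseq A"
    unfolding incseq_def A_def
  proof safe
    fix m n :: nat and x assume "m \<le> n" "e + 1 / real (Suc m) < \<bar>u x - v x\<bar>"
    moreover have "1 / real (Suc n) \<le> 1 / real (Suc m)" using \<open>m \<le> n\<close> by (simp add: frac_le)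
    ultimately show "e + 1 / real (Suc n) < \<bar>u x - v x\<bar>" by linarith
  qed
  then have lim: "(\<lambda>n. measure M (A n)) \<longlonglongrightarrow> measure M (\<Union>n. A n)"
    by (intro finite_Lim_measure_incseq) auto
  have "(\<lambda>n. e + 1 / real (Suc n)) \<longlonglongrightarrow> e + 0"
    by (intro tendsto_intros LIMSEQ_Suc[OF lim_1_over_n])
  moreover have "measure M (A n) \<le> e + 1 / real (Suc n)" for n
    using cl[of "1 / real (Suc n)"] by (simp add: close_def A_def)
  ultimately have "measure M (\<Union>n. A n) \<le> e" using lim by (auto intro: LIMSEQ_le)
  moreover have "(\<Union>n. A n) = {x \<in> space M. e < \<bar>u x - v x\<bar>}"
  proof safe
    fix x assume "x \<in> space M" "e < \<bar>u x - v x\<bar>"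
    then obtain n where "1 / real (Suc n) < \<bar>u x - v x\<bar> - e"
      by (metis diff_gt_0_iff_gt nat_approx_posE)
    then show "x \<in> (\<Union>n. A n)" using \<open>x \<in> space M\<close> by (auto simp: A_def intro!: exI[of _ n])
  next
    fix x n assume *: "x \<in> A n"
    moreover have "0 < 1 / real (Suc n)" by simp
    ultimately show "x \<in> space M" "e < \<bar>u x - v x\<bar>" unfolding A_def mem_Collect_eq by linarith+
  qed
  ultimately show ?thesis by (simp add: close_def)
qed

end

lemma close_mp:
  assumes "\<tau> \<in> mp" "u \<in> borel_measurable leb01" "v \<in> borel_measurable leb01"
  shows "close leb01 e (\<lambda>t. u (\<tau> t)) (\<lambda>t. v (\<tau> t)) \<longleftrightarrow> close leb01 e u v"
  using close_distr[OF mp_measurable[OF assms(1)] assms(2,3)] assms(1) by (simp add: mp_def)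

section \<open>Couplings of random sequences\<close>

lemma measurable_RN_iff: "u \<in> measurable M RN \<longleftrightarrow> (\<forall>i. (\<lambda>t. u t i) \<in> borel_measurable M)"
proof (intro iffI allI)
  fix i assume "u \<in> measurable M RN"
  then show "(\<lambda>t. u t i) \<in> borel_measurable M"
    by (rule measurable_compose[OF _ measurable_component_singleton]) simp
next
  assume "\<forall>i. (\<lambda>t. u t i) \<in> borel_measurable M"
  then show "u \<in> measurable M RN" by (intro measurable_PiM_single') auto
qed

lemma RN_component [measurable]: "(\<lambda>y. y i) \<in> borel_measurable RN"
  by (rule measurable_component_singleton) simp

lemma RN_componentD: "u \<in> measurable M RN \<Longrightarrow> (\<lambda>t. u t i) \<in> borel_measurable M"
  by (simp add: measurable_RN_iff)

text \<open>A weighted Ky Fan distance of sequences: coordinates with \<open>2 ^ i * e \<ge> 1\<close> are ignored.\<close>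

definition near :: "real \<Rightarrow> (real \<Rightarrow> nat \<Rightarrow> real) \<Rightarrow> (real \<Rightarrow> nat \<Rightarrow> real) \<Rightarrow> bool" where
  "near e u v \<longleftrightarrow> (\<forall>i. close leb01 (2 ^ i * e) (\<lambda>t. u t i) (\<lambda>t. v t i))"

text \<open>Reparametrizing both sides makes the notion depend on the laws only, up to an
  arbitrarily small loss: the pair of reparametrizations plays the role of a coupling of the two
  laws.\<close>

definition coupled :: "real \<Rightarrow> (real \<Rightarrow> nat \<Rightarrow> real) \<Rightarrow> (real \<Rightarrow> nat \<Rightarrow> real) \<Rightarrow> bool" where
  "coupled e u v \<longleftrightarrow> (\<exists>\<tau>\<in>mp. \<exists>\<sigma>\<in>mp. near e (\<lambda>t. u (\<tau> t)) (\<lambda>t. v (\<sigma> t)))"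

lemma coupledE:
  assumes "coupled e u v"
  obtains \<tau> \<sigma> where "\<tau> \<in> mp" "\<sigma> \<in> mp" "near e (\<lambda>t. u (\<tau> t)) (\<lambda>t. v (\<sigma> t))"
  using assms unfolding coupled_def by (elim bexE) (rule that)

lemma coupledI:
  assumes "\<tau> \<in> mp" "\<sigma> \<in> mp" "near e (\<lambda>t. u (\<tau> t)) (\<lambda>t. v (\<sigma> t))"
  shows "coupled e u v"
  unfolding coupled_def by (rule bexI[of _ \<tau>], rule bexI[of _ \<sigma>]) (fact assms)+

lemma near_sym: "near e u v \<Longrightarrow> near e v u"
  by (simp add: near_def close_sym)

lemma near_mono:
  assumes "near e u v" "e \<le> e'" "u \<in> measurable leb01 RN" "v \<in> measurable leb01 RN"
  shows "near e' u v"
  unfolding near_def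
proof
  fix i
  show "close leb01 (2 ^ i * e') (\<lambda>t. u t i) (\<lambda>t. v t i)"
    by (rule leb01.close_mono[OF _ _ RN_componentD[OF assms(3)] RN_componentD[OF assms(4)], of "2 ^ i * e"])
      (use assms(1,2) in \<open>auto simp: near_def\<close>)
qed

lemma near_triangle:
  assumes "near a u v" "near b v w"
    and "u \<in> measurable leb01 RN" "v \<in> measurable leb01 RN" "w \<in> measurable leb01 RN"
  shows "near (a + b) u w"
  unfolding near_def distrib_left
proof
  fix i
  show "close leb01 (2 ^ i * a + 2 ^ i * b) (\<lambda>t. u t i) (\<lambda>t. w t i)"
    by (rule leb01.close_triangle[OF _ _ RN_componentD[OF assms(3)] RN_componentD[OF assms(4)] RN_componentD[OF assms(5)]])
      (use assms(1,2) in \<open>auto simp: near_def\<close>)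
qed

lemma near_mp:
  assumes "\<tau> \<in> mp" "near e u v" "u \<in> measurable leb01 RN" "v \<in> measurable leb01 RN"
  shows "near e (\<lambda>t. u (\<tau> t)) (\<lambda>t. v (\<tau> t))"
  unfolding near_def
proof
  fix i
  show "close leb01 (2 ^ i * e) (\<lambda>t. u (\<tau> t) i) (\<lambda>t. v (\<tau> t) i)"
    using close_mp[OF assms(1) RN_componentD[OF assms(3)] RN_componentD[OF assms(4)]] assms(2)
    by (simp add: near_def)
qed

lemma near_if_close:
  assumes "\<And>i. close leb01 e (\<lambda>t. u t i) (\<lambda>t. v t i)" "0 \<le> e"
    and "u \<in> measurable leb01 RN" "v \<in> measurable leb01 RN"
  shows "near e u v"
  unfolding near_def
proof
  fix i
  have "e \<le> 2 ^ i * e" using assms(2) by (simp add: mult_le_cancel_right1)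
  then show "close leb01 (2 ^ i * e) (\<lambda>t. u t i) (\<lambda>t. v t i)"
    by (rule leb01.close_mono[OF assms(1) _ RN_componentD[OF assms(3)] RN_componentD[OF assms(4)]])
qed

text \<open>From index n on the tolerance 2^i e is at least 1, where closeness in measure is
  automatic.\<close>

lemma near_if_close_initial:
  assumes "\<And>i. i < n \<Longrightarrow> close leb01 e (\<lambda>t. u t i) (\<lambda>t. v t i)" "0 \<le> e" "1 \<le> 2 ^ n * e"
    and "u \<in> measurable leb01 RN" "v \<in> measurable leb01 RN"
  shows "near e u v"
  unfolding near_def
proof
  fix i
  show "close leb01 (2 ^ i * e) (\<lambda>t. u t i) (\<lambda>t. v t i)"
  proof (cases "i < n")
    case True
    have "e \<le> 2 ^ i * e" using assms(2) by (simp add: mult_le_cancel_right1)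
    then show ?thesis
      by (rule leb01.close_mono[OF assms(1)[OF True] _ RN_componentD[OF assms(4)] RN_componentD[OF assms(5)]])
  next
    case False
    then have "(2::real) ^ n * e \<le> 2 ^ i * e" using assms(2) by (intro mult_right_mono power_increasing) auto
    then show ?thesis using assms(3) by (intro leb01.close_ge_1) linarith
  qed
qed

lemma measurable_mp_comp: "\<tau> \<in> mp \<Longrightarrow> u \<in> measurable leb01 M \<Longrightarrow> (\<lambda>t. u (\<tau> t)) \<in> measurable leb01 M"
  by (rule measurable_compose[OF mp_measurable])

text \<open>The cell of mesh \<eta> that contains the first n entries, numbered by a natural number
  so that discrete gluing applies.\<close>

definition grid_cell :: "nat \<Rightarrow> real \<Rightarrow> (nat \<Rightarrow> real) \<Rightarrow> nat" where
  "grid_cell n \<eta> y = to_nat (map (\<lambda>i. \<lfloor>y i / \<eta>\<rfloor>) [0..<n])"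

lemma measurable_grid_cell: "grid_cell n \<eta> \<in> measurable RN (count_space UNIV)"
proof -
  have "grid_cell n \<eta> -` {a} \<inter> space RN \<in> sets RN" for a
  proof -
    define l where "l = (from_nat a :: int list)"
    have [measurable]: "(\<lambda>y. \<lfloor>y i / \<eta>\<rfloor>) \<in> measurable RN (count_space UNIV)" for i
      using measurable_compose[OF borel_measurable_divide[OF RN_component borel_measurable_const] measurable_real_floor] .
    have "{y \<in> space RN. \<forall>i\<in>{..<n}. \<lfloor>y i / \<eta>\<rfloor> = l ! i} \<in> sets RN" by measurable
    moreover have "grid_cell n \<eta> -` {a} \<inter> space RN =
        (if to_nat l = a \<and> length l = n then {y \<in> space RN. \<forall>i\<in>{..<n}. \<lfloor>y i / \<eta>\<rfloor> = l ! i} else {})"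
    proof -
      have "grid_cell n \<eta> y = a \<longleftrightarrow> to_nat l = a \<and> map (\<lambda>i. \<lfloor>y i / \<eta>\<rfloor>) [0..<n] = l" for y
        unfolding grid_cell_def l_def by (metis from_nat_to_nat)
      moreover have "map (\<lambda>i. \<lfloor>y i / \<eta>\<rfloor>) [0..<n] = l \<longleftrightarrow> length l = n \<and> (\<forall>i\<in>{..<n}. \<lfloor>y i / \<eta>\<rfloor> = l ! i)" for y
        by (auto simp: list_eq_iff_nth_eq)
      ultimately show ?thesis by auto
    qed
    ultimately show ?thesis by simp
  qed
  then show ?thesis by (subst measurable_count_space_eq_countable) auto
qed

lemma grid_cell_eq_imp_close:
  assumes "grid_cell n \<eta> y = grid_cell n \<eta> z" "i < n" "0 < \<eta>"
  shows "\<bar>y i - z i\<bar> \<le> \<eta>"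
proof -
  have "\<lfloor>y i / \<eta>\<rfloor> = \<lfloor>z i / \<eta>\<rfloor>"
    using assms by (auto simp: grid_cell_def)
  then have "\<bar>y i / \<eta> - z i / \<eta>\<bar> \<le> 1"
    using floor_correct[of "y i / \<eta>"] floor_correct[of "z i / \<eta>"] by linarith
  moreover have "\<bar>y i / \<eta> - z i / \<eta>\<bar> = \<bar>y i - z i\<bar> / \<eta>"
    using assms by (simp add: abs_divide diff_divide_distrib[symmetric])
  ultimately show ?thesis using assms by simp
qed

text \<open>Equal laws have equal discretizations. Gluing the cell numbers puts the first n entries
  of both sequences into a common cell almost surely, and the remaining entries are ignored at scale
  \<eta>.\<close>

lemma glue_near:
  assumes u[measurable]: "u \<in> measurable leb01 RN" and v[measurable]: "v \<in> measurable leb01 RN"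
    and eq: "distr leb01 RN u = distr leb01 RN v" and \<eta>: "0 < \<eta>"
  shows "\<exists>\<tau>\<in>mp. \<exists>\<sigma>\<in>mp. near \<eta> (\<lambda>t. u (\<tau> t)) (\<lambda>t. v (\<sigma> t))"
proof -
  obtain n where n: "1 \<le> 2 ^ n * \<eta>"
    using real_arch_pow[of 2 "1 / \<eta>"] \<eta> by (metis less_imp_le one_less_numeral_iff pos_divide_less_eq semiring_norm(76))
  note [measurable] = measurable_grid_cell[of n \<eta>]
  have "distr leb01 (count_space UNIV) (\<lambda>t. grid_cell n \<eta> (u t)) = distr leb01 (count_space UNIV) (\<lambda>t. grid_cell n \<eta> (v t))"
    using distr_distr[OF measurable_grid_cell u] distr_distr[OF measurable_grid_cell v] eq by (simp add: comp_def)
  then obtain \<tau> \<sigma> where ts: "\<tau> \<in> mp" "\<sigma> \<in> mp" and AE: "AE t in leb01. grid_cell n \<eta> (u (\<tau> t)) = grid_cell n \<eta> (v (\<sigma> t))"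
    using glue_discrete[of "\<lambda>t. grid_cell n \<eta> (u t)" "\<lambda>t. grid_cell n \<eta> (v t)"] by auto
  note [measurable] = measurable_mp_comp[OF ts(1) u] measurable_mp_comp[OF ts(2) v]
  have "near \<eta> (\<lambda>t. u (\<tau> t)) (\<lambda>t. v (\<sigma> t))"
  proof (rule near_if_close_initial[OF _ _ n])
    fix i assume i: "i < n"
    have [measurable]: "(\<lambda>t. u (\<tau> t) i) \<in> borel_measurable leb01" "(\<lambda>t. v (\<sigma> t) i) \<in> borel_measurable leb01"
      using RN_componentD[OF measurable_mp_comp[OF ts(1) u]] RN_componentD[OF measurable_mp_comp[OF ts(2) v]] by auto
    have "AE t in leb01. \<not> \<eta> < \<bar>u (\<tau> t) i - v (\<sigma> t) i\<bar>"
      using AE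
    proof eventually_elim
      case (elim t)
      then show ?case using grid_cell_eq_imp_close[OF elim i \<eta>] by linarith
    qed
    then have "measure leb01 {t \<in> space leb01. \<eta> < \<bar>u (\<tau> t) i - v (\<sigma> t) i\<bar>} = 0"
      by (subst leb01.prob_Collect_eq_0) measurable
    then show "close leb01 \<eta> (\<lambda>t. u (\<tau> t) i) (\<lambda>t. v (\<sigma> t) i)" using \<eta> by (simp add: close_def)
  qed (use \<eta> in auto)
  then show ?thesis using ts by blast
qed

lemma coupled_law:
  assumes "u \<in> measurable leb01 RN" "v \<in> measurable leb01 RN" "distr leb01 RN u = distr leb01 RN v" "0 < \<eta>"
  shows "coupled \<eta> u v"
  unfolding coupled_def by (rule glue_near[OF assms])

lemma coupled_near: "near e u v \<Longrightarrow> coupled e u v"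
  using coupledI[OF mp_id mp_id] .

lemma coupled_sym: "coupled e u v \<Longrightarrow> coupled e v u"
  by (erule coupledE, rule coupledI, assumption, assumption, rule near_sym)

lemma coupled_mono:
  assumes "coupled e u v" "e \<le> e'" "u \<in> measurable leb01 RN" "v \<in> measurable leb01 RN"
  shows "coupled e' u v"
proof -
  obtain \<tau> \<sigma> where ts: "\<tau> \<in> mp" "\<sigma> \<in> mp" "near e (\<lambda>t. u (\<tau> t)) (\<lambda>t. v (\<sigma> t))"
    by (rule coupledE[OF assms(1)])
  then have "near e' (\<lambda>t. u (\<tau> t)) (\<lambda>t. v (\<sigma> t))"
    by (intro near_mono[OF ts(3) assms(2)] measurable_mp_comp[OF ts(1) assms(3)] measurable_mp_comp[OF ts(2) assms(4)])
  then show ?thesis by (rule coupledI[OF ts(1,2)])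
qed

text \<open>The two couplings use \<open>v\<close> with different reparametrizations. These have the
  same law and are glued up to \<eta>, which is the source of the extra term.\<close>

lemma coupled_triangle:
  assumes uv: "coupled a u v" and vw: "coupled b v w" and \<eta>: "0 < \<eta>"
    and u: "u \<in> measurable leb01 RN" and v: "v \<in> measurable leb01 RN" and w: "w \<in> measurable leb01 RN"
  shows "coupled (a + b + \<eta>) u w"
proof -
  obtain \<tau>1 \<tau>2 where t: "\<tau>1 \<in> mp" "\<tau>2 \<in> mp" "near a (\<lambda>t. u (\<tau>1 t)) (\<lambda>t. v (\<tau>2 t))"
    by (rule coupledE[OF uv])
  obtain \<sigma>1 \<sigma>2 where s: "\<sigma>1 \<in> mp" "\<sigma>2 \<in> mp" "near b (\<lambda>t. v (\<sigma>1 t)) (\<lambda>t. w (\<sigma>2 t))"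
    by (rule coupledE[OF vw])
  have "distr leb01 RN (\<lambda>t. v (\<tau>2 t)) = distr leb01 RN (\<lambda>t. v (\<sigma>1 t))"
    using t s v by (simp add: mp_distr_comp)
  from glue_near[OF measurable_mp_comp[OF t(2) v] measurable_mp_comp[OF s(1) v] this \<eta>]
  obtain \<rho> \<rho>' where r: "\<rho> \<in> mp" "\<rho>' \<in> mp" and n: "near \<eta> (\<lambda>t. v (\<tau>2 (\<rho> t))) (\<lambda>t. v (\<sigma>1 (\<rho>' t)))"
    by (elim bexE) (rule that)
  note m = mp_comp[OF t(1) r(1)] mp_comp[OF t(2) r(1)] mp_comp[OF s(1) r(2)] mp_comp[OF s(2) r(2)]
  have 1: "near a (\<lambda>t. u (\<tau>1 (\<rho> t))) (\<lambda>t. v (\<tau>2 (\<rho> t)))"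
    by (rule near_mp[OF r(1) t(3) measurable_mp_comp[OF t(1) u] measurable_mp_comp[OF t(2) v]])
  have 2: "near b (\<lambda>t. v (\<sigma>1 (\<rho>' t))) (\<lambda>t. w (\<sigma>2 (\<rho>' t)))"
    by (rule near_mp[OF r(2) s(3) measurable_mp_comp[OF s(1) v] measurable_mp_comp[OF s(2) w]])
  note ms = measurable_mp_comp[OF m(1) u] measurable_mp_comp[OF m(2) v]
    measurable_mp_comp[OF m(3) v] measurable_mp_comp[OF m(4) w]
  have "near (a + \<eta>) (\<lambda>t. u (\<tau>1 (\<rho> t))) (\<lambda>t. v (\<sigma>1 (\<rho>' t)))"
    by (rule near_triangle[OF 1 n ms(1,2,3)])
  then have "near (a + \<eta> + b) (\<lambda>t. u (\<tau>1 (\<rho> t))) (\<lambda>t. w (\<sigma>2 (\<rho>' t)))"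
    by (rule near_triangle[OF _ 2 ms(1,3,4)])
  then have "near (a + b + \<eta>) (\<lambda>t. u (\<tau>1 (\<rho> t))) (\<lambda>t. w (\<sigma>2 (\<rho>' t)))" by (simp add: add_ac)
  then show ?thesis by (rule coupledI[OF m(1,4)])
qed

section \<open>Small couplings and equality of laws\<close>

lemma sets_RN_sigma_boxes:
  "sets RN = sigma_sets UNIV {{y. \<forall>i\<in>I. y i \<le> a i} | I a. finite I}" (is "_ = sigma_sets UNIV ?E")
proof
  have "?E \<subseteq> sets RN"
  proof safe
    fix I :: "nat set" and a :: "nat \<Rightarrow> real" assume "finite I"
    then have "{y \<in> space RN. \<forall>i\<in>I. y i \<le> a i} \<in> sets RN" by measurable
    then show "{y. \<forall>i\<in>I. y i \<le> a i} \<in> sets RN" by (simp add: space_PiM)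
  qed
  then show "sigma_sets UNIV ?E \<subseteq> sets RN"
    using sets.sigma_sets_subset[of ?E RN] by (simp add: space_PiM)
  have "(\<lambda>y. y i) \<in> borel_measurable (sigma UNIV ?E)" for i
  proof (rule borel_measurableI_le)
    fix c
    have "{y. \<forall>j\<in>{i}. y j \<le> c} \<in> sigma_sets UNIV ?E"
      by (rule sigma_sets.Basic) (auto intro!: exI[of _ "{i}"] exI[of _ "\<lambda>_. c"])
    then show "{y \<in> space (sigma UNIV ?E). y i \<le> c} \<in> sets (sigma UNIV ?E)" by simp
  qed
  then have "(\<lambda>y. y) \<in> measurable (sigma UNIV ?E) RN" by (simp add: measurable_RN_iff)
  from measurable_sets[OF this] show "sets RN \<subseteq> sigma_sets UNIV ?E" by auto
qed

text \<open>Lower orthants in finitely many entries form a generator that is stable under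
  intersection.\<close>

lemma law_eqI:
  assumes P: "prob_space P" "prob_space Q" "sets P = sets RN" "sets Q = sets RN"
    and eq: "\<And>I a. finite I \<Longrightarrow> emeasure P {y. \<forall>i\<in>I. y i \<le> a i} = emeasure Q {y. \<forall>i\<in>I. y i \<le> (a i :: real)}"
  shows "P = Q"
proof (rule measure_eqI_generator_eq[where \<Omega>=UNIV and E="{{y. \<forall>i\<in>I. y i \<le> a i} | I a. finite I}" and A="\<lambda>_. UNIV"])
  show "Int_stable {{y. \<forall>i\<in>I. y i \<le> (a i :: real)} | I a. finite (I :: nat set)}"
  proof (rule Int_stableI, safe)
    fix I J :: "nat set" and a b :: "nat \<Rightarrow> real" assume "finite I" "finite J"
    define c where "c i = (if i \<in> I then if i \<in> J then min (a i) (b i) else a i else b i)" for i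
    have "{y. \<forall>i\<in>I. y i \<le> a i} \<inter> {y. \<forall>i\<in>J. y i \<le> b i} = {y. \<forall>i\<in>I \<union> J. y i \<le> c i}"
      by (auto simp: c_def split: if_splits)
    then show "\<exists>K d. {y. \<forall>i\<in>I. y i \<le> a i} \<inter> {y. \<forall>i\<in>J. y i \<le> b i} = {y. \<forall>i\<in>K. y i \<le> d i} \<and> finite K"
      using \<open>finite I\<close> \<open>finite J\<close> by (meson finite_UnI)
  qed
  show "emeasure P X = emeasure Q X" if "X \<in> {{y. \<forall>i\<in>I. y i \<le> a i} | I a. finite I}" for X
    using that eq by auto
  show "range (\<lambda>_. UNIV) \<subseteq> {{y. \<forall>i\<in>I. y i \<le> (a i :: real)} | I a. finite (I :: nat set)}"
    by (auto intro!: exI[of _ "{}"])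
  show "sets P = sigma_sets UNIV {{y. \<forall>i\<in>I. y i \<le> a i} | I a. finite I}"
    "sets Q = sigma_sets UNIV {{y. \<forall>i\<in>I. y i \<le> a i} | I a. finite I}"
    using P sets_RN_sigma_boxes by simp_all
  show "emeasure P UNIV \<noteq> \<infinity>"
    using prob_space.emeasure_space_1[OF P(1)] sets_eq_imp_space_eq[OF P(3)] by (simp add: space_PiM)
qed auto

text \<open>Off the exceptional sets of the entries in I, membership of \<open>u\<close> in the
  orthant forces membership of \<open>v\<close> in the slightly larger one, as in the comparison
  behind the Levy metric.\<close>

lemma coupled_box_le:
  assumes u: "u \<in> measurable leb01 RN" and v: "v \<in> measurable leb01 RN" and "coupled e u v" "finite I" "0 < e"
  shows "measure leb01 {t \<in> {0..1}. \<forall>i\<in>I. u t i \<le> a i}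
    \<le> measure leb01 {t \<in> {0..1}. \<forall>i\<in>I. v t i \<le> a i + 2 ^ i * e} + (\<Sum>i\<in>I. 2 ^ i * e)"
proof -
  obtain \<tau> \<sigma> where ts: "\<tau> \<in> mp" "\<sigma> \<in> mp" and n: "near e (\<lambda>t. u (\<tau> t)) (\<lambda>t. v (\<sigma> t))"
    by (rule coupledE[OF assms(3)])
  have mp_measure: "measure leb01 {t \<in> {0..1}. \<forall>i\<in>I. w t i \<le> b i} = measure leb01 {t \<in> {0..1}. \<forall>i\<in>I. w (\<rho> t) i \<le> b i}"
    if r: "\<rho> \<in> mp" and w: "w \<in> measurable leb01 RN" for \<rho> w and b :: "nat \<Rightarrow> real"
  proof -
    note [measurable] = RN_componentD[OF w] mp_measurable[OF r]
    have "measure leb01 {t \<in> {0..1}. \<forall>i\<in>I. w t i \<le> b i} = measure (distr leb01 leb01 \<rho>) {t \<in> space leb01. \<forall>i\<in>I. w t i \<le> b i}"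
      using r by (simp add: mp_def)
    also have "\<dots> = measure leb01 {t \<in> {0..1}. \<forall>i\<in>I. w (\<rho> t) i \<le> b i}"
    proof (subst measure_distr)
      show "{t \<in> space leb01. \<forall>i\<in>I. w t i \<le> b i} \<in> sets leb01"
        using \<open>finite I\<close> by measurable
    qed (use measurable_space[OF mp_measurable[OF r]] in \<open>auto intro!: arg_cong[where f="measure leb01"]\<close>)
    finally show ?thesis .
  qed
  note [measurable] = RN_componentD[OF measurable_mp_comp[OF ts(1) u]] RN_componentD[OF measurable_mp_comp[OF ts(2) v]]
  define B where "B i = {t \<in> space leb01. 2 ^ i * e < \<bar>u (\<tau> t) i - v (\<sigma> t) i\<bar>}" for i
  have [measurable]: "B i \<in> sets leb01" for i unfolding B_def by measurable
  have "measure leb01 {t \<in> {0..1}. \<forall>i\<in>I. u t i \<le> a i} = measure leb01 {t \<in> {0..1}. \<forall>i\<in>I. u (\<tau> t) i \<le> a i}"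
    by (rule mp_measure[OF ts(1) u])
  also have "\<dots> \<le> measure leb01 ({t \<in> space leb01. \<forall>i\<in>I. v (\<sigma> t) i \<le> a i + 2 ^ i * e} \<union> (\<Union>i\<in>I. B i))"
  proof (rule leb01.finite_measure_mono)
    show "{t \<in> {0..1}. \<forall>i\<in>I. u (\<tau> t) i \<le> a i} \<subseteq> {t \<in> space leb01. \<forall>i\<in>I. v (\<sigma> t) i \<le> a i + 2 ^ i * e} \<union> (\<Union>i\<in>I. B i)"
      unfolding B_def by force
    show "{t \<in> space leb01. \<forall>i\<in>I. v (\<sigma> t) i \<le> a i + 2 ^ i * e} \<union> (\<Union>i\<in>I. B i) \<in> sets leb01"
      using \<open>finite I\<close> by measurable
  qed
  also have "\<dots> \<le> measure leb01 {t \<in> space leb01. \<forall>i\<in>I. v (\<sigma> t) i \<le> a i + 2 ^ i * e} + measure leb01 (\<Union>i\<in>I. B i)"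
    using \<open>finite I\<close> by (intro measure_Un_le) measurable
  also have "measure leb01 (\<Union>i\<in>I. B i) \<le> (\<Sum>i\<in>I. measure leb01 (B i))"
    using \<open>finite I\<close> by (intro measure_UNION_le) auto
  also have "\<dots> \<le> (\<Sum>i\<in>I. 2 ^ i * e)"
    using n by (intro sum_mono) (simp add: near_def close_def B_def)
  finally show ?thesis using mp_measure[OF ts(2) v, of "\<lambda>i. a i + 2 ^ i * e"] by simp
qed

text \<open>As the coupling distance tends to 0 the enlarged orthants shrink to the closed orthant,
  so continuity from above compares the distribution functions; symmetry turns the inequality into
  an equality.\<close>

lemma coupled_imp_law:
  assumes u: "u \<in> measurable leb01 RN" and v: "v \<in> measurable leb01 RN" and c: "\<And>e. 0 < e \<Longrightarrow> coupled e u v"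
  shows "distr leb01 RN u = distr leb01 RN v"
proof -
  have le: "measure leb01 {t \<in> {0..1}. \<forall>i\<in>I. u t i \<le> a i} \<le> measure leb01 {t \<in> {0..1}. \<forall>i\<in>I. v t i \<le> a i}"
    if I: "finite I" and u: "u \<in> measurable leb01 RN" and v: "v \<in> measurable leb01 RN"
      and c: "\<And>e. 0 < e \<Longrightarrow> coupled e u v" for I u v and a :: "nat \<Rightarrow> real"
  proof -
    note [measurable] = RN_componentD[OF v]
    define A where "A n = {t \<in> space leb01. \<forall>i\<in>I. v t i \<le> a i + 2 ^ i * (1 / real (Suc n))}" for n
    have [measurable]: "A n \<in> sets leb01" for n unfolding A_def using I by measurable
    have "decseq A"
      unfolding decseq_def A_def
    proof safe
      fix m n :: nat and t i assume "m \<le> n" and *: "\<forall>i\<in>I. v t i \<le> a i + 2 ^ i * (1 / real (Suc n))" "i \<in> I"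
      have "2 ^ i * (1 / real (Suc n)) \<le> 2 ^ i * (1 / real (Suc m))"
        using \<open>m \<le> n\<close> by (intro mult_left_mono frac_le) auto
      then show "v t i \<le> a i + 2 ^ i * (1 / real (Suc m))" using * by force
    qed
    then have lim: "(\<lambda>n. measure leb01 (A n)) \<longlonglongrightarrow> measure leb01 (\<Inter>n. A n)"
      by (intro leb01.finite_Lim_measure_decseq) auto
    have INT: "(\<Inter>n. A n) = {t \<in> {0..1}. \<forall>i\<in>I. v t i \<le> a i}"
    proof safe
      fix t assume *: "t \<in> (\<Inter>n. A n)"
      then show "t \<in> {0..1}" by (auto simp: A_def)
      fix i assume "i \<in> I"
      have "(\<lambda>n. a i + 2 ^ i * (1 / real (Suc n))) \<longlonglongrightarrow> a i + 2 ^ i * 0"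
        by (intro tendsto_intros LIMSEQ_Suc[OF lim_1_over_n])
      moreover have "v t i \<le> a i + 2 ^ i * (1 / real (Suc n))" for n
        using * \<open>i \<in> I\<close> by (auto simp: A_def)
      ultimately show "v t i \<le> a i" using LIMSEQ_le_const by fastforce
    next
      fix t n assume t: "t \<in> {0..1}" "\<forall>i\<in>I. v t i \<le> a i"
      have "0 \<le> 2 ^ i * (1 / real (Suc n))" for i :: nat by simp
      then show "t \<in> A n" using t unfolding A_def by (auto intro: add_increasing2)
    qed
    have "(\<lambda>n. measure leb01 (A n) + (\<Sum>i\<in>I. 2 ^ i * (1 / real (Suc n)))) \<longlonglongrightarrow> measure leb01 (\<Inter>n. A n) + (\<Sum>i\<in>I. 2 ^ i * 0)"
      by (intro tendsto_intros lim LIMSEQ_Suc[OF lim_1_over_n])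
    moreover have "measure leb01 {t \<in> {0..1}. \<forall>i\<in>I. u t i \<le> a i} \<le> measure leb01 (A n) + (\<Sum>i\<in>I. 2 ^ i * (1 / real (Suc n)))" for n
      using coupled_box_le[OF u v c I, of "1 / real (Suc n)" a] by (simp add: A_def)
    ultimately show ?thesis unfolding INT using LIMSEQ_le_const by force
  qed
  have eq: "emeasure leb01 {t \<in> {0..1}. \<forall>i\<in>I. u t i \<le> a i} = emeasure leb01 {t \<in> {0..1}. \<forall>i\<in>I. v t i \<le> a i}"
    if "finite I" for I and a :: "nat \<Rightarrow> real"
    unfolding leb01.emeasure_eq_measure
    using le[OF that u v c, of a] le[OF that v u coupled_sym[OF c], of a] by simp
  have em: "emeasure (distr leb01 RN w) {y. \<forall>i\<in>I. y i \<le> a i} = emeasure leb01 {t \<in> {0..1}. \<forall>i\<in>I. w t i \<le> a i}"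
    if "finite I" "w \<in> measurable leb01 RN" for I w and a :: "nat \<Rightarrow> real"
  proof -
    have "{y. \<forall>i\<in>I. y i \<le> a i} \<in> sets RN"
      unfolding sets_RN_sigma_boxes using that by (intro sigma_sets.Basic) auto
    then show ?thesis using that
      by (subst emeasure_distr) (auto intro!: arg_cong[where f="emeasure leb01"])
  qed
  show ?thesis
  proof (rule law_eqI)
    fix I :: "nat set" and a :: "nat \<Rightarrow> real" assume I: "finite I"
    show "emeasure (distr leb01 RN u) {y. \<forall>i\<in>I. y i \<le> a i} = emeasure (distr leb01 RN v) {y. \<forall>i\<in>I. y i \<le> a i}"
      by (simp only: em[OF I u] em[OF I v] eq[OF I])
  qed (simp_all add: leb01.prob_space_distr u v)
qed

section \<open>Compactness of the space of bounded random sequences\<close>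

text \<open>The indicators of the exceptional sets tend to 0 almost everywhere and are bounded by 1,
  so their integrals tend to 0.\<close>

lemma (in prob_space) AE_convergence_imp_close:
  assumes conv: "AE x in M. (\<lambda>n. f n x) \<longlonglongrightarrow> g x" and "0 < e"
    and [measurable]: "\<And>n. f n \<in> borel_measurable M" "g \<in> borel_measurable M"
  shows "\<forall>\<^sub>F n in sequentially. close M e (f n) g"
proof -
  define A where "A n = {x \<in> space M. e < \<bar>f n x - g x\<bar>}" for n
  have [measurable]: "A n \<in> events" for n unfolding A_def by measurable
  have "(\<lambda>n. \<integral>x. indicator (A n) x \<partial>M) \<longlonglongrightarrow> (\<integral>x. (0::real) \<partial>M)"
  proof (rule integral_dominated_convergence[where w="\<lambda>_. 1"])
    show "AE x in M. (\<lambda>n. indicator (A n) x :: real) \<longlonglongrightarrow> 0"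
      using conv
    proof eventually_elim
      case (elim x)
      then have "\<forall>\<^sub>F n in sequentially. dist (f n x) (g x) < e" using \<open>0 < e\<close> tendstoD by blast
      then have "\<forall>\<^sub>F n in sequentially. indicator (A n) x = (0::real)"
        by eventually_elim (auto simp: A_def dist_real_def)
      then show ?case by (rule tendsto_eventually)
    qed
  qed auto
  then have "(\<lambda>n. measure M (A n)) \<longlonglongrightarrow> 0" by simp
  then have "\<forall>\<^sub>F n in sequentially. measure M (A n) < e" using \<open>0 < e\<close> by (rule order_tendstoD)
  then show ?thesis by eventually_elim (simp add: close_def A_def)
qed

lemma ex_pow2_mult_gt_1: "0 < e \<Longrightarrow> \<exists>n. 1 < 2 ^ n * (e::real)"
proof -
  assume e: "0 < e"
  obtain n where "1 / e < 2 ^ n" using real_arch_pow[of 2 "1 / e"] by auto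
  then have "1 < 2 ^ n * e" using e by (simp add: pos_divide_less_eq)
  then show ?thesis ..
qed

text \<open>Two sequences on an arbitrary probability space are replaced by the components of one
  map on the unit interval that realizes their joint law. The given \<open>u'\<close> and
  \<open>v'\<close> agree with these components in law only, which costs \<eta>.\<close>

lemma coupled_from_joint:
  assumes \<Omega>: "prob_space \<Omega>" and u[measurable]: "u \<in> measurable \<Omega> RN" and v[measurable]: "v \<in> measurable \<Omega> RN"
    and cl: "\<And>i. close \<Omega> (2 ^ i * e) (\<lambda>x. u x i) (\<lambda>x. v x i)"
    and u': "u' \<in> measurable leb01 RN" "distr leb01 RN u' = distr \<Omega> RN u"
    and v': "v' \<in> measurable leb01 RN" "distr leb01 RN v' = distr \<Omega> RN v" and "0 < \<eta>"
  shows "coupled (e + \<eta>) u' v'"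
proof -
  define J where "J = distr \<Omega> (RN \<Otimes>\<^sub>M RN) (\<lambda>x. (u x, v x))"
  have "prob_space J" unfolding J_def by (intro prob_space.prob_space_distr \<Omega>) measurable
  from standard_law[OF standard_pair[OF standard_RN standard_RN] this]
  obtain \<phi> where \<phi>[measurable]: "\<phi> \<in> measurable leb01 (RN \<Otimes>\<^sub>M RN)" and d: "distr leb01 (RN \<Otimes>\<^sub>M RN) \<phi> = J"
    by (auto simp only: J_def sets_distr)
  have m: "(\<lambda>t. fst (\<phi> t)) \<in> measurable leb01 RN" "(\<lambda>t. snd (\<phi> t)) \<in> measurable leb01 RN" by measurable
  have law: "distr leb01 RN (\<lambda>t. fst (\<phi> t)) = distr leb01 RN u'" "distr leb01 RN (\<lambda>t. snd (\<phi> t)) = distr leb01 RN v'"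
    using distr_distr[of fst "RN \<Otimes>\<^sub>M RN" RN \<phi> leb01] distr_distr[of snd "RN \<Otimes>\<^sub>M RN" RN \<phi> leb01]
      distr_distr[of fst "RN \<Otimes>\<^sub>M RN" RN "\<lambda>x. (u x, v x)" \<Omega>] distr_distr[of snd "RN \<Otimes>\<^sub>M RN" RN "\<lambda>x. (u x, v x)" \<Omega>]
    by (simp_all add: d comp_def u' v' J_def)
  have "near e (\<lambda>t. fst (\<phi> t)) (\<lambda>t. snd (\<phi> t))"
    unfolding near_def
  proof
    fix i
    have ms: "(\<lambda>p. fst p i) \<in> borel_measurable (RN \<Otimes>\<^sub>M RN)" "(\<lambda>p. snd p i) \<in> borel_measurable (RN \<Otimes>\<^sub>M RN)"
      by (rule RN_componentD[OF measurable_fst], rule RN_componentD[OF measurable_snd])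
    have "close J (2 ^ i * e) (\<lambda>p. fst p i) (\<lambda>p. snd p i)"
      unfolding J_def by (subst close_distr[OF _ ms]) (use cl in auto)
    then show "close leb01 (2 ^ i * e) (\<lambda>t. fst (\<phi> t) i) (\<lambda>t. snd (\<phi> t) i)"
      unfolding d[symmetric] using close_distr[OF \<phi> ms] by simp
  qed
  then have "coupled e (\<lambda>t. fst (\<phi> t)) (\<lambda>t. snd (\<phi> t))" by (rule coupled_near)
  moreover have c2: "coupled (\<eta>/4) (\<lambda>t. snd (\<phi> t)) v'"
    by (rule coupled_law[OF m(2) v'(1) law(2)]) (use \<open>0 < \<eta>\<close> in simp)
  moreover have "coupled (\<eta>/4) u' (\<lambda>t. fst (\<phi> t))"
    by (rule coupled_law[OF u'(1) m(1) law(1)[symmetric]]) (use \<open>0 < \<eta>\<close> in simp)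
  ultimately have "coupled (\<eta>/4 + e + \<eta>/4) u' (\<lambda>t. snd (\<phi> t))"
    using \<open>0 < \<eta>\<close> by (intro coupled_triangle[OF _ _ _ u'(1) m]) auto
  then have "coupled (\<eta>/4 + e + \<eta>/4 + \<eta>/4 + \<eta>/4) u' v'"
    by (rule coupled_triangle[OF _ c2 _ u'(1) m(2) v'(1)]) (use \<open>0 < \<eta>\<close> in simp)
  moreover have "\<eta>/4 + e + \<eta>/4 + \<eta>/4 + \<eta>/4 = e + \<eta>" by simp
  ultimately show ?thesis by (simp only:)
qed

text \<open>The selection theorem is applied to the real codes, whose laws live on a fixed bounded
  interval. Skorohod variables turn weak convergence of codes into pointwise convergence, and
  \<open>encode_limit\<close> passes it on to the entries.\<close>

lemma bounded_sequences_compact: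
  assumes g: "\<And>k. g k \<in> measurable leb01 RN" and bd: "\<And>k t i. t \<in> {0..1} \<Longrightarrow> \<bar>g k t i\<bar> \<le> real i"
  shows "\<exists>(r :: nat \<Rightarrow> nat) h. strict_mono r \<and> h \<in> measurable leb01 RN \<and> (\<forall>t i. \<bar>h t i\<bar> \<le> real i) \<and>
    (\<forall>e>0. \<forall>\<^sub>F k in sequentially. coupled e (g (r k)) h)"
proof -
  define \<mu> where "\<mu> k = distr leb01 borel (\<lambda>t. encode (g k t))" for k
  have meg: "(\<lambda>t. encode (g k t)) \<in> borel_measurable leb01" for k
    by (rule measurable_compose[OF g measurable_encode])
  have rd: "real_distribution (\<mu> k)" for k
    unfolding \<mu>_def by (rule leb01.real_distribution_distr[OF meg])
  have "tight \<mu>"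
    unfolding tight_def
  proof (intro conjI allI impI rd)
    fix \<epsilon> :: real assume "\<epsilon> > 0"
    have "measure (\<mu> k) {-1<..1} = 1" for k
    proof -
      have "-1 < encode y \<and> encode y \<le> 1" for y
        using enc_bounds[of "\<lambda>j. case prod_decode j of (n, m) \<Rightarrow> rat_seq m < y n"] unfolding encode_def by linarith
      then have "(\<lambda>t. encode (g k t)) -` {-1<..1} \<inter> space leb01 = space leb01" by auto
      then show ?thesis unfolding \<mu>_def by (subst measure_distr[OF meg]) (auto simp: leb01.prob_space[simplified])
    qed
    then show "\<exists>a b. a < b \<and> (\<forall>n. 1 - \<epsilon> < measure (\<mu> n) {a<..b})"
      using \<open>\<epsilon> > 0\<close> by (intro exI[of _ "-1"] exI[of _ 1]) auto
  qed
  from tight_imp_convergent_subsubsequence[OF this, of id]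
  obtain r M where r: "strict_mono (r :: nat \<Rightarrow> nat)" and M: "real_distribution M" and w: "weak_conv_m (\<mu> \<circ> id \<circ> r) M"
    by (auto simp: strict_mono_def)
  have "\<exists>(\<Omega>::real measure) Yn Y. prob_space \<Omega> \<and> (\<forall>n. Yn n \<in> measurable \<Omega> borel) \<and> (\<forall>n. distr \<Omega> borel (Yn n) = (\<mu> \<circ> id \<circ> r) n) \<and>
    Y \<in> measurable \<Omega> lborel \<and> distr \<Omega> borel Y = M \<and> (\<forall>x \<in> space \<Omega>. (\<lambda>n. Yn n x) \<longlonglongrightarrow> Y x)"
    by (rule Skorohod[OF _ M w]) (simp add: rd)
  then obtain \<Omega> :: "real measure" and Yn Y where S: "prob_space \<Omega> \<and> (\<forall>n. Yn n \<in> measurable \<Omega> borel) \<and>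
      (\<forall>n. distr \<Omega> borel (Yn n) = (\<mu> \<circ> id \<circ> r) n) \<and> Y \<in> measurable \<Omega> lborel \<and> distr \<Omega> borel Y = M \<and>
      (\<forall>x \<in> space \<Omega>. (\<lambda>n. Yn n x) \<longlonglongrightarrow> Y x)"
    by (elim exE) (rule that)
  then have \<Omega>: "prob_space \<Omega>" and Yn[measurable]: "\<And>n. Yn n \<in> borel_measurable \<Omega>"
    and dYn: "\<And>n. distr \<Omega> borel (Yn n) = \<mu> (r n)"
    and Y[measurable]: "Y \<in> borel_measurable \<Omega>"
    and conv: "\<And>x. x \<in> space \<Omega> \<Longrightarrow> (\<lambda>n. Yn n x) \<longlonglongrightarrow> Y x"
    by auto
  interpret \<Omega>: prob_space \<Omega> by fact
  note dec = RN_componentD[OF measurable_decode]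
  \<comment> \<open>A Skorohod variable merely has the law of a code, so it is the code of a bounded
    sequence almost surely only.\<close>
  have good: "AE x in \<Omega>. encode (decode (Yn n x)) = Yn n x \<and> (\<forall>i. \<bar>decode (Yn n x) i\<bar> \<le> real i)" for n
  proof -
    note [measurable] = dec
    have md: "(\<lambda>s. encode (decode s)) \<in> borel_measurable borel" by measurable
    have "AE t in leb01. encode (decode (encode (g (r n) t))) = encode (g (r n) t) \<and> (\<forall>i. \<bar>decode (encode (g (r n) t)) i\<bar> \<le> real i)"
      by (rule AE_I2) (use bd in auto)
    then have "AE s in \<mu> (r n). encode (decode s) = s \<and> (\<forall>i. \<bar>decode s i\<bar> \<le> real i)"
      unfolding \<mu>_def using md by (subst AE_distr_iff[OF meg]) auto
    then show ?thesis
      unfolding dYn[symmetric] using md by (subst (asm) AE_distr_iff[OF Yn]) auto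
  qed
  have good': "AE x in \<Omega>. \<forall>n. encode (decode (Yn n x)) = Yn n x \<and> (\<forall>i. \<bar>decode (Yn n x) i\<bar> \<le> real i)"
    using good by (simp add: AE_all_countable)
  have lim: "AE x in \<Omega>. \<forall>i. (\<lambda>n. decode (Yn n x) i) \<longlonglongrightarrow> decode (Y x) i"
    using good'
  proof (rule AE_mp, intro AE_I2 impI allI)
    fix x i assume x: "x \<in> space \<Omega>" and *: "\<forall>n. encode (decode (Yn n x)) = Yn n x \<and> (\<forall>i. \<bar>decode (Yn n x) i\<bar> \<le> real i)"
    show "(\<lambda>n. decode (Yn n x) i) \<longlonglongrightarrow> decode (Y x) i"
      by (rule encode_limit) (use * conv[OF x] in auto)
  qed
  have u: "(\<lambda>x. decode (Yn n x)) \<in> measurable \<Omega> RN" for n by (rule measurable_compose[OF Yn measurable_decode])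
  have v: "(\<lambda>x. decode (Y x)) \<in> measurable \<Omega> RN" by (rule measurable_compose[OF Y measurable_decode])
  have bdv: "AE x in \<Omega>. \<forall>i. \<bar>decode (Y x) i\<bar> \<le> real i"
    using lim good'
  proof eventually_elim
    case (elim x)
    show ?case
    proof
      fix i
      have "(\<lambda>n. \<bar>decode (Yn n x) i\<bar>) \<longlonglongrightarrow> \<bar>decode (Y x) i\<bar>" using elim(1) by (intro tendsto_rabs) auto
      then show "\<bar>decode (Y x) i\<bar> \<le> real i" by (rule LIMSEQ_le_const2) (use elim(2) in auto)
    qed
  qed
  \<comment> \<open>The limit satisfies the bounds almost everywhere; truncation makes them hold
    everywhere without changing the law.\<close>
  define trunc where "trunc y i = max (- real i) (min (real i) (y i))" for y :: "nat \<Rightarrow> real" and i :: nat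
  have trunc_m: "trunc \<in> measurable RN RN"
    unfolding measurable_RN_iff trunc_def by (intro allI borel_measurable_max borel_measurable_min borel_measurable_const RN_component)
  from standard_law[OF standard_RN \<Omega>.prob_space_distr[OF measurable_compose[OF v trunc_m]] sets_distr]
  obtain q where q: "q \<in> measurable leb01 RN" and dq: "distr leb01 RN q = distr \<Omega> RN (\<lambda>x. trunc (decode (Y x)))"
    by (elim bexE) (rule that)
  define h where "h t = trunc (q t)" for t
  have h: "h \<in> measurable leb01 RN" unfolding h_def by (rule measurable_compose[OF q trunc_m])
  have tt: "trunc (trunc y) = trunc y" for y by (auto simp: trunc_def fun_eq_iff)
  have "distr leb01 RN h = distr (distr leb01 RN q) RN trunc"
    unfolding h_def by (subst distr_distr[OF trunc_m q]) (simp add: comp_def)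
  also have "\<dots> = distr \<Omega> RN (\<lambda>x. trunc (decode (Y x)))"
    unfolding dq by (subst distr_distr[OF trunc_m measurable_compose[OF v trunc_m]]) (simp add: comp_def tt)
  also have "\<dots> = distr \<Omega> RN (\<lambda>x. decode (Y x))"
  proof (rule distr_cong_AE)
    show "AE x in \<Omega>. trunc (decode (Y x)) = decode (Y x)"
      using bdv
    proof eventually_elim
      case (elim x)
      then show ?case by (auto simp: trunc_def fun_eq_iff abs_le_iff minus_le_iff)
    qed
  qed (use measurable_compose[OF v trunc_m] v in auto)
  finally have dh: "distr leb01 RN h = distr \<Omega> RN (\<lambda>x. decode (Y x))" .
  have dg: "distr leb01 RN (g (r n)) = distr \<Omega> RN (\<lambda>x. decode (Yn n x))" for n
  proof -
    have "distr \<Omega> RN (\<lambda>x. decode (Yn n x)) = distr (distr \<Omega> borel (Yn n)) RN decode"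
      by (subst distr_distr[OF measurable_decode Yn]) (simp add: comp_def)
    also have "\<dots> = distr leb01 RN (\<lambda>t. decode (encode (g (r n) t)))"
      unfolding dYn \<mu>_def by (subst distr_distr[OF measurable_decode meg]) (simp add: comp_def)
    finally show ?thesis by simp
  qed
  have "\<forall>\<^sub>F k in sequentially. coupled e (g (r k)) h" if e: "0 < e" for e
  proof -
    \<comment> \<open>Only the entries below n are visible at scale e/2; the other half of e pays
      for the passage back to the unit interval.\<close>
    obtain n where n: "1 < 2 ^ n * (e / 2)"
      using ex_pow2_mult_gt_1[of "e / 2"] e by auto
    have "\<forall>\<^sub>F k in sequentially. \<forall>i\<in>{..<n}. close \<Omega> (2 ^ i * (e / 2)) (\<lambda>x. decode (Yn k x) i) (\<lambda>x. decode (Y x) i)"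
    proof (rule eventually_ball_finite)
      show "\<forall>i\<in>{..<n}. \<forall>\<^sub>F k in sequentially. close \<Omega> (2 ^ i * (e / 2)) (\<lambda>x. decode (Yn k x) i) (\<lambda>x. decode (Y x) i)"
      proof
        fix i
        show "\<forall>\<^sub>F k in sequentially. close \<Omega> (2 ^ i * (e / 2)) (\<lambda>x. decode (Yn k x) i) (\<lambda>x. decode (Y x) i)"
        proof (rule \<Omega>.AE_convergence_imp_close)
          show "AE x in \<Omega>. (\<lambda>n. decode (Yn n x) i) \<longlonglongrightarrow> decode (Y x) i"
            using lim by eventually_elim auto
        qed (use e RN_componentD[OF u] RN_componentD[OF v] in auto)
      qed
    qed simp
    then show ?thesis
    proof eventually_elim
      case (elim k)
      have "close \<Omega> (2 ^ i * (e / 2)) (\<lambda>x. decode (Yn k x) i) (\<lambda>x. decode (Y x) i)" for i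
      proof (cases "i < n")
        case False
        then have "(2::real) ^ n * (e / 2) \<le> 2 ^ i * (e / 2)" using e by (intro mult_right_mono power_increasing) auto
        then show ?thesis using n by (intro \<Omega>.close_ge_1) linarith
      qed (use elim in auto)
      from coupled_from_joint[OF \<Omega> u v this g dg h dh, of "e / 2"] e show ?case by simp
    qed
  qed
  moreover have "\<bar>h t i\<bar> \<le> real i" for t i by (auto simp: h_def trunc_def)
  ultimately show ?thesis using r h by (intro exI[of _ r], intro exI[of _ h]) simp
qed

section \<open>Postcomposition with 1-Lipschitz functions\<close>

lemma Lip1D: "q \<in> Lip1 \<Longrightarrow> \<bar>q a - q b\<bar> \<le> \<bar>a - b\<bar>"
  using lipschitz_onD[of 1 UNIV q a b] by (simp add: Lip1_def dist_real_def)

lemma Lip1I: "(\<And>a b. \<bar>q a - q b\<bar> \<le> \<bar>a - b\<bar>) \<Longrightarrow> q \<in> Lip1"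
  by (simp add: Lip1_def lipschitz_on_def dist_real_def)

lemma measurable_Lip1: "q \<in> Lip1 \<Longrightarrow> q \<in> borel_measurable borel"
  by (auto simp: Lip1_def intro!: borel_measurable_continuous_onI lipschitz_on_continuous_on)

lemma (in prob_space) close_Lip1:
  assumes "q \<in> Lip1" "close M e u v" and [measurable]: "u \<in> borel_measurable M" "v \<in> borel_measurable M"
  shows "close M e (\<lambda>x. q (u x)) (\<lambda>x. q (v x))"
proof -
  have "measure M {x \<in> space M. e < \<bar>q (u x) - q (v x)\<bar>} \<le> measure M {x \<in> space M. e < \<bar>u x - v x\<bar>}"
    using Lip1D[OF assms(1)] by (intro finite_measure_mono) (auto intro: less_le_trans)
  then show ?thesis using assms(2) by (simp add: close_def)
qed

definition reindex :: "(nat \<Rightarrow> nat) \<Rightarrow> (nat \<Rightarrow> real \<Rightarrow> real) \<Rightarrow> (nat \<Rightarrow> real) \<Rightarrow> nat \<Rightarrow> real" where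
  "reindex s q y j = q j (y (s j))"

lemma measurable_reindex:
  assumes "\<And>j. q j \<in> Lip1"
  shows "reindex s q \<in> measurable RN RN"
  unfolding measurable_RN_iff reindex_def
  by (intro allI measurable_compose[OF RN_component measurable_Lip1[OF assms]])

text \<open>The first n new entries read old entries of index at most \<open>S\<close>, so a scale
  of e / 2^S suffices. The choice depends on \<open>s\<close> and e but is uniform in the functions
  \<open>q\<close>.\<close>

lemma coupled_reindex:
  assumes "0 < e"
  shows "\<exists>\<delta>>0. \<forall>q u v. (\<forall>j. q j \<in> Lip1) \<longrightarrow> u \<in> measurable leb01 RN \<longrightarrow> v \<in> measurable leb01 RN \<longrightarrow>
    coupled \<delta> u v \<longrightarrow> coupled e (\<lambda>t. reindex s q (u t)) (\<lambda>t. reindex s q (v t))"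
proof -
  obtain n where n: "1 < 2 ^ n * e"
    using ex_pow2_mult_gt_1[OF assms] by (elim exE)
  define S where "S = (\<Sum>j<n. s j)"
  define \<delta> where "\<delta> = e / 2 ^ S"
  have \<delta>: "0 < \<delta>" using assms by (simp add: \<delta>_def)
  show ?thesis
  proof (rule exI[of _ \<delta>], rule conjI[OF \<delta>], intro allI impI)
    fix q :: "nat \<Rightarrow> real \<Rightarrow> real" and u v :: "real \<Rightarrow> nat \<Rightarrow> real"
    assume "\<forall>j. q j \<in> Lip1" and u: "u \<in> measurable leb01 RN" and v: "v \<in> measurable leb01 RN" and c: "coupled \<delta> u v"
    then have q: "q j \<in> Lip1" for j by simp
    obtain \<tau> \<sigma> where ts: "\<tau> \<in> mp" "\<sigma> \<in> mp" and nr: "near \<delta> (\<lambda>t. u (\<tau> t)) (\<lambda>t. v (\<sigma> t))"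
      by (rule coupledE[OF c])
    note u' = measurable_mp_comp[OF ts(1) u] and v' = measurable_mp_comp[OF ts(2) v]
    have "near e (\<lambda>t. reindex s q (u (\<tau> t))) (\<lambda>t. reindex s q (v (\<sigma> t)))"
    proof (rule near_if_close_initial[OF _ _ less_imp_le[OF n]])
      fix j assume j: "j < n"
      have "s j \<le> S" unfolding S_def using j by (intro member_le_sum) auto
      then have "2 ^ s j * \<delta> \<le> 2 ^ S * \<delta>" using \<open>0 < \<delta>\<close> by (intro mult_right_mono power_increasing) auto
      also have "\<dots> = e" by (simp add: \<delta>_def)
      finally have le: "2 ^ s j * \<delta> \<le> e" .
      have cl: "close leb01 (2 ^ s j * \<delta>) (\<lambda>t. u (\<tau> t) (s j)) (\<lambda>t. v (\<sigma> t) (s j))"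
        by (rule spec[OF nr[unfolded near_def]])
      have "close leb01 e (\<lambda>t. u (\<tau> t) (s j)) (\<lambda>t. v (\<sigma> t) (s j))"
        by (rule leb01.close_mono[OF cl le RN_componentD[OF u'] RN_componentD[OF v']])
      then show "close leb01 e (\<lambda>t. reindex s q (u (\<tau> t)) j) (\<lambda>t. reindex s q (v (\<sigma> t)) j)"
        unfolding reindex_def by (rule leb01.close_Lip1[OF q _ RN_componentD[OF u'] RN_componentD[OF v']])
    next
      show "0 \<le> e" using assms by simp
      show "(\<lambda>t. reindex s q (u (\<tau> t))) \<in> measurable leb01 RN" "(\<lambda>t. reindex s q (v (\<sigma> t))) \<in> measurable leb01 RN"
        by (rule measurable_compose[OF u' measurable_reindex[OF q]], rule measurable_compose[OF v' measurable_reindex[OF q]])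
    qed
    then show "coupled e (\<lambda>t. reindex s q (u t)) (\<lambda>t. reindex s q (v t))" by (rule coupledI[OF ts])
  qed
qed

section \<open>Features of a geometric data set\<close>

locale gds =
  fixes X :: "'a gds"
  assumes gds: "geometric_data_set X"
begin

sublocale M: Metric_space "pts X" "gds_dist X"
  using gds by (simp add: geometric_data_set_def)

sublocale P: prob_space "meas X"
  using gds by (simp add: geometric_data_set_def)

definition lip :: "('a \<Rightarrow> real) \<Rightarrow> bool" where
  "lip f \<longleftrightarrow> (\<forall>x\<in>pts X. \<forall>y\<in>pts X. \<bar>f x - f y\<bar> \<le> gds_dist X x y)"

lemma lipD: "lip f \<Longrightarrow> x \<in> pts X \<Longrightarrow> y \<in> pts X \<Longrightarrow> \<bar>f x - f y\<bar> \<le> gds_dist X x y"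
  by (simp add: lip_def)

lemma topology: "gds_topology X = M.mtopology"
  by (simp add: gds_topology_def)

lemma feat_nonempty: "feat X \<noteq> {}" and feat_ext: "f \<in> feat X \<Longrightarrow> f \<in> extensional (pts X)"
  and mcomplete: "M.mcomplete"
  and full_support: "openin M.mtopology U \<Longrightarrow> U \<noteq> {} \<Longrightarrow> emeasure (meas X) U > 0"
  using gds by (auto simp: geometric_data_set_def topology)

lemma sets_meas: "sets (meas X) = sigma_sets (pts X) {U. openin M.mtopology U}"
proof -
  have "{U. openin M.mtopology U} \<subseteq> Pow (pts X)" using openin_subset by fastforce
  then show ?thesis
    using gds by (simp add: geometric_data_set_def borel_of_def topology)
qed

lemma space_meas: "space (meas X) = pts X"
proof -
  have "space (meas X) = space (borel_of (gds_topology X))"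
    using gds by (intro sets_eq_imp_space_eq) (simp add: geometric_data_set_def)
  then show ?thesis by (simp add: borel_of_def topology space_measure_of_conv)
qed

lemma sets_open: "openin M.mtopology U \<Longrightarrow> U \<in> sets (meas X)"
  by (simp add: sets_meas sigma_sets.Basic)

lemma sets_closed: "closedin M.mtopology C \<Longrightarrow> C \<in> sets (meas X)"
proof -
  assume C: "closedin M.mtopology C"
  then have "pts X - C \<in> sets (meas X)" by (intro sets_open) (simp add: closedin_def)
  then have "space (meas X) - (pts X - C) \<in> sets (meas X)" by (rule sets.compl_sets)
  moreover have "C \<subseteq> pts X" using C closedin_subset by fastforce
  ultimately show ?thesis by (simp add: space_meas double_diff)
qed

lemma nonempty: "pts X \<noteq> {}"
  using P.not_empty by (simp add: space_meas)

lemma feat_bdd: "x \<in> pts X \<Longrightarrow> y \<in> pts X \<Longrightarrow> bdd_above ((\<lambda>f. \<bar>f x - f y\<bar>) ` feat X)"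
  using gds by (simp add: geometric_data_set_def)

lemma feat_lip: "f \<in> feat X \<Longrightarrow> lip f"
  by (auto simp: lip_def gds_dist_def intro!: cSUP_upper2 feat_bdd)

lemma dist_attained:
  assumes "x \<in> pts X" "y \<in> pts X" "r < gds_dist X x y"
  shows "\<exists>f\<in>feat X. r < \<bar>f x - f y\<bar>"
  using assms less_cSUP_iff[OF feat_nonempty feat_bdd] by (auto simp: gds_dist_def)

lemma dist_le:
  assumes "x \<in> pts X" "y \<in> pts X" "\<And>f. f \<in> feat X \<Longrightarrow> \<bar>f x - f y\<bar> \<le> r"
  shows "gds_dist X x y \<le> r"
  using dist_attained[OF assms(1,2), of r] assms(3) by force

lemma lip_ball_open:
  assumes "lip f" "open V"
  shows "openin M.mtopology {x \<in> pts X. f x \<in> V}"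
  unfolding M.openin_mtopology
proof (intro conjI allI impI)
  fix x assume x: "x \<in> {x \<in> pts X. f x \<in> V}"
  then obtain e where e: "0 < e" "\<And>r. dist r (f x) < e \<Longrightarrow> r \<in> V" using assms(2) unfolding open_dist by blast
  have "M.mball x e \<subseteq> {x \<in> pts X. f x \<in> V}"
  proof
    fix y assume y: "y \<in> M.mball x e"
    then have "\<bar>f x - f y\<bar> < e" using lipD[OF assms(1), of x y] by simp
    then show "y \<in> {x \<in> pts X. f x \<in> V}" using y e(2)[of "f y"] by (simp add: dist_real_def abs_minus_commute)
  qed
  then show "\<exists>r>0. M.mball x r \<subseteq> {x \<in> pts X. f x \<in> V}" using e(1) by blast
qed auto

lemma lip_measurable: "lip f \<Longrightarrow> f \<in> borel_measurable (meas X)"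
proof (rule borel_measurableI)
  fix V :: "real set" assume "lip f" "open V"
  then have "{x \<in> pts X. f x \<in> V} \<in> sets (meas X)" by (intro sets_open lip_ball_open)
  then show "f -` V \<inter> space (meas X) \<in> sets (meas X)"
    by (simp add: space_meas vimage_def Int_def conj_commute)
qed

text \<open>Basic neighbourhoods of the product topology constrain finitely many points. The closure
  is used in this \<epsilon>-form later on.\<close>

lemma feat_closure_iff:
  "f \<in> feat_closure X \<longleftrightarrow> f \<in> extensional (pts X) \<and>
     (\<forall>T e. finite T \<longrightarrow> T \<subseteq> pts X \<longrightarrow> 0 < e \<longrightarrow> (\<exists>g\<in>feat X. \<forall>x\<in>T. \<bar>f x - g x\<bar> < e))"
proof (intro iffI conjI allI impI)
  assume f: "f \<in> feat_closure X"
  then have f': "f \<in> extensional (pts X)"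
    and cl: "\<forall>T. f \<in> T \<and> openin (product_topology (\<lambda>_. euclideanreal) (pts X)) T \<longrightarrow> (\<exists>y. y \<in> feat X \<and> y \<in> T)"
    by (simp_all add: feat_closure_def in_closure_of PiE_def)
  then show "f \<in> extensional (pts X)" by simp
  fix T e assume T: "finite T" "T \<subseteq> pts X" and e: "0 < (e::real)"
  define V where "V x = (if x \<in> T then ball (f x) e else UNIV)" for x
  have "{i \<in> pts X. V i \<noteq> UNIV} \<subseteq> T" by (auto simp: V_def)
  then have "finite {i \<in> pts X. V i \<noteq> UNIV}" using T(1) finite_subset by blast
  then have "openin (product_topology (\<lambda>_. euclideanreal) (pts X)) (PiE (pts X) V)"
    by (subst openin_PiE_gen) (auto simp: V_def)
  moreover have "f \<in> PiE (pts X) V" using f' e by (auto simp: V_def PiE_def)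
  ultimately have "\<exists>y. y \<in> feat X \<and> y \<in> PiE (pts X) V" using cl by simp
  then obtain g where "g \<in> feat X" "g \<in> PiE (pts X) V" by (elim exE conjE)
  then show "\<exists>g\<in>feat X. \<forall>x\<in>T. \<bar>f x - g x\<bar> < e"
    using T by (intro bexI[of _ g] ballI) (auto simp: V_def PiE_def Pi_def dist_real_def split: if_splits)
next
  assume *: "f \<in> extensional (pts X) \<and>
     (\<forall>T e. finite T \<longrightarrow> T \<subseteq> pts X \<longrightarrow> 0 < e \<longrightarrow> (\<exists>g\<in>feat X. \<forall>x\<in>T. \<bar>f x - g x\<bar> < e))"
  show "f \<in> feat_closure X"
    unfolding feat_closure_def in_closure_of
  proof (intro conjI allI impI)
    show "f \<in> topspace (product_topology (\<lambda>_. euclideanreal) (pts X))" using * by (simp add: PiE_def)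
    fix U assume U: "f \<in> U \<and> openin (product_topology (\<lambda>_. euclideanreal) (pts X)) U"
    then obtain V where V: "finite {i \<in> pts X. V i \<noteq> UNIV}" "\<And>i. i \<in> pts X \<Longrightarrow> open (V i)"
      "f \<in> PiE (pts X) V" "PiE (pts X) V \<subseteq> U"
      unfolding openin_product_topology_alt by auto
    define T where "T = {i \<in> pts X. V i \<noteq> UNIV}"
    have "\<exists>e>0. ball (f i) e \<subseteq> V i" if "i \<in> T" for i
    proof -
      have "i \<in> pts X" using that by (simp add: T_def)
      then have "open (V i)" "f i \<in> V i" using V(2,3) by (auto simp: PiE_def Pi_def)
      then show ?thesis by (simp add: open_contains_ball)
    qed
    then obtain \<epsilon> where \<epsilon>: "\<And>i. i \<in> T \<Longrightarrow> 0 < \<epsilon> i" "\<And>i. i \<in> T \<Longrightarrow> ball (f i) (\<epsilon> i) \<subseteq> V i" by metis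
    define e where "e = Min (insert 1 (\<epsilon> ` T))"
    have T: "finite T" "T \<subseteq> pts X" using V(1) by (auto simp: T_def)
    have "0 < e" using T \<epsilon>(1) by (simp add: e_def)
    then have "\<exists>g\<in>feat X. \<forall>x\<in>T. \<bar>f x - g x\<bar> < e" using * T by simp
    then obtain g where g: "g \<in> feat X" "\<And>x. x \<in> T \<Longrightarrow> \<bar>f x - g x\<bar> < e"
      by (elim bexE) (rule that, assumption, erule bspec)
    have "g x \<in> V x" if x: "x \<in> pts X" for x
    proof (cases "x \<in> T")
      case True
      then have "e \<le> \<epsilon> x" using T unfolding e_def by (intro Min_le) auto
      then have "g x \<in> ball (f x) (\<epsilon> x)" using g(2)[OF True] by (simp add: dist_real_def)
      then show ?thesis using \<epsilon>(2)[OF True] by blast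
    next
      case False
      then show ?thesis using x by (simp add: T_def)
    qed
    then have "g \<in> PiE (pts X) V" using feat_ext[OF g(1)] by (simp add: PiE_def)
    then show "\<exists>y. y \<in> feat X \<and> y \<in> U" using g(1) V(4) by blast
  qed
qed

lemma feat_closure_ext: "f \<in> feat_closure X \<Longrightarrow> f \<in> extensional (pts X)"
  by (simp add: feat_closure_iff)

lemma feat_closureE:
  assumes "f \<in> feat_closure X" "finite T" "T \<subseteq> pts X" "0 < e"
  obtains g where "g \<in> feat X" "\<And>x. x \<in> T \<Longrightarrow> \<bar>f x - g x\<bar> < e"
proof -
  have "\<exists>g\<in>feat X. \<forall>x\<in>T. \<bar>f x - g x\<bar> < e" using assms by (simp add: feat_closure_iff)
  then show ?thesis by (elim bexE) (rule that, assumption, erule bspec)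
qed

lemma feat_subset_closure: "f \<in> feat X \<Longrightarrow> f \<in> feat_closure X"
  unfolding feat_closure_iff by (intro conjI allI impI bexI[of _ f] feat_ext) auto

lemma feat_closure_closed:
  assumes "f \<in> extensional (pts X)"
    and "\<And>T e. finite T \<Longrightarrow> T \<subseteq> pts X \<Longrightarrow> 0 < e \<Longrightarrow> \<exists>g\<in>feat_closure X. \<forall>x\<in>T. \<bar>f x - g x\<bar> < e"
  shows "f \<in> feat_closure X"
  unfolding feat_closure_iff
proof (intro conjI allI impI)
  fix T :: "'a set" and e :: real assume T: "finite T" "T \<subseteq> pts X" "0 < e"
  obtain g where g: "g \<in> feat_closure X" "\<And>x. x \<in> T \<Longrightarrow> \<bar>f x - g x\<bar> < e / 2"
    using assms(2)[of T "e / 2"] T by auto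
  obtain h where h: "h \<in> feat X" "\<And>x. x \<in> T \<Longrightarrow> \<bar>g x - h x\<bar> < e / 2"
    by (rule feat_closureE[OF g(1) T(1,2), of "e / 2"]) (use T(3) in auto)
  have "\<bar>f x - h x\<bar> < e" if "x \<in> T" for x
    using g(2)[OF that] h(2)[OF that] by linarith
  then show "\<exists>g\<in>feat X. \<forall>x\<in>T. \<bar>f x - g x\<bar> < e" using h(1) by blast
qed (fact assms(1))

lemma closure_lip: "f \<in> feat_closure X \<Longrightarrow> lip f"
  unfolding lip_def
proof (intro ballI)
  fix x y assume f: "f \<in> feat_closure X" and xy: "x \<in> pts X" "y \<in> pts X"
  show "\<bar>f x - f y\<bar> \<le> gds_dist X x y"
  proof (rule field_le_epsilon)
    fix e :: real assume e: "0 < e"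
    obtain g where g: "g \<in> feat X" "\<And>z. z \<in> {x, y} \<Longrightarrow> \<bar>f z - g z\<bar> < e / 2"
      by (rule feat_closureE[OF f, of "{x, y}" "e / 2"]) (use xy e in auto)
    have "\<bar>f x - g x\<bar> < e / 2" "\<bar>f y - g y\<bar> < e / 2" by (rule g(2), simp)+
    then show "\<bar>f x - f y\<bar> \<le> gds_dist X x y + e"
      using lipD[OF feat_lip[OF g(1)] xy] by linarith
  qed
qed

lemma countable_dense:
  obtains C where "countable C" "C \<subseteq> pts X" "C \<noteq> {}" "\<And>x r. x \<in> pts X \<Longrightarrow> 0 < r \<Longrightarrow> \<exists>c\<in>C. gds_dist X x c < r"
proof -
  have "separable_space M.mtopology" using gds by (simp add: geometric_data_set_def topology)
  then obtain C where C: "countable C" "C \<subseteq> pts X" "M.mtopology closure_of C = pts X"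
    by (auto simp: separable_space_def)
  have d: "\<exists>c\<in>C. gds_dist X x c < r" if x: "x \<in> pts X" and r: "0 < r" for x r
  proof -
    have "x \<in> M.mtopology closure_of C" using x C(3) by simp
    then obtain y where "y \<in> C" "y \<in> M.mball x r" using r unfolding M.metric_closure_of by blast
    then show ?thesis by auto
  qed
  obtain x where "x \<in> pts X" using nonempty by blast
  then have ne: "C \<noteq> {}" using d[of x 1] by auto
  show ?thesis by (rule that[OF C(1,2) ne d])
qed

lemma dense_seq:
  obtains c :: "nat \<Rightarrow> 'a" where "\<And>i. c i \<in> pts X" "\<And>x r. x \<in> pts X \<Longrightarrow> 0 < r \<Longrightarrow> \<exists>i. gds_dist X x (c i) < r"
proof -
  obtain C where C: "countable C" "C \<subseteq> pts X" "C \<noteq> {}" "\<And>x r. x \<in> pts X \<Longrightarrow> 0 < r \<Longrightarrow> \<exists>c\<in>C. gds_dist X x c < r"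
    by (rule countable_dense) blast
  have "from_nat_into C i \<in> pts X" for i using from_nat_into[OF C(3)] C(2) by blast
  moreover have "\<exists>i. gds_dist X x (from_nat_into C i) < r" if xr: "x \<in> pts X" "0 < r" for x r
  proof -
    obtain y where "y \<in> C" "gds_dist X x y < r" using C(4)[OF xr] by blast
    then show ?thesis using from_nat_into_surj[OF C(1)] by metis
  qed
  ultimately show ?thesis by (rule that)
qed

text \<open>The balls of radius e around a dense sequence exhaust the space, so finitely many carry
  all but e of the mass. This takes the place of compactness for functions that are compared in
  measure.\<close>

lemma finite_net:
  assumes "0 < e"
  obtains T where "finite T" "T \<subseteq> pts X" "T \<noteq> {}" "1 - e < measure (meas X) (\<Union>x\<in>T. M.mball x e)"
proof -
  obtain c where cp: "\<And>i :: nat. c i \<in> pts X" and dense: "\<And>x r. x \<in> pts X \<Longrightarrow> 0 < r \<Longrightarrow> \<exists>i. gds_dist X x (c i) < r"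
    by (rule dense_seq) blast
  define A where "A n = (\<Union>i\<le>n. M.mball (c i) e)" for n :: nat
  have [measurable]: "A n \<in> sets (meas X)" for n
    unfolding A_def by (intro sets.finite_UN sets_open) auto
  have "incseq A" unfolding incseq_def A_def by force
  then have "(\<lambda>n. measure (meas X) (A n)) \<longlonglongrightarrow> measure (meas X) (\<Union>n. A n)"
    by (intro P.finite_Lim_measure_incseq) auto
  moreover have "(\<Union>n. A n) = space (meas X)"
  proof
    show "(\<Union>n. A n) \<subseteq> space (meas X)" by (auto simp: A_def space_meas)
    show "space (meas X) \<subseteq> (\<Union>n. A n)"
    proof
      fix x assume "x \<in> space (meas X)"
      then have x: "x \<in> pts X" by (simp add: space_meas)
      then obtain i where "gds_dist X x (c i) < e" using dense[OF x assms] by blast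
      then have "x \<in> A i" using x cp by (auto simp: A_def M.commute)
      then show "x \<in> (\<Union>n. A n)" by blast
    qed
  qed
  ultimately have "(\<lambda>n. measure (meas X) (A n)) \<longlonglongrightarrow> 1" using P.prob_space by simp
  then have "\<forall>\<^sub>F n in sequentially. 1 - e < measure (meas X) (A n)" using assms by (intro order_tendstoD) auto
  then obtain n where "1 - e < measure (meas X) (A n)" by (auto simp: eventually_sequentially)
  moreover have "A n = (\<Union>x\<in>c ` {..n}. M.mball x e)" by (simp add: A_def)
  ultimately show ?thesis using cp by (intro that[of "c ` {..n}"]) auto
qed

lemma agree_on_balls:
  assumes "lip f" "lip g" "T \<subseteq> pts X" "\<And>x. x \<in> T \<Longrightarrow> \<bar>f x - g x\<bar> \<le> b" "y \<in> (\<Union>x\<in>T. M.mcball x a)"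
  shows "\<bar>f y - g y\<bar> \<le> 2 * a + b"
proof -
  obtain x where x: "x \<in> T" "y \<in> pts X" "x \<in> pts X" "gds_dist X x y \<le> a" using assms(5) by auto
  then show ?thesis
    using lipD[OF assms(1) x(3,2)] lipD[OF assms(2) x(3,2)] assms(4)[OF x(1)] by linarith
qed

text \<open>Each of the two Lipschitz functions varies by at most e on a ball, and they differ by at
  most e at its centre; hence the constant 3.\<close>

lemma close_of_agree:
  assumes "lip f" "lip g" "T \<subseteq> pts X" "finite T" "1 - e < measure (meas X) (\<Union>x\<in>T. M.mball x e)"
    and "\<And>x. x \<in> T \<Longrightarrow> \<bar>f x - g x\<bar> \<le> e" "0 < e"
  shows "close (meas X) (3 * e) f g"
proof (rule P.close_on_set[OF _ _ _ lip_measurable lip_measurable])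
  show "(\<Union>x\<in>T. M.mball x e) \<in> sets (meas X)" using assms(4) by (intro sets.finite_UN sets_open) auto
  show "\<bar>f y - g y\<bar> \<le> 3 * e" if y: "y \<in> (\<Union>x\<in>T. M.mball x e)" for y
  proof -
    have "y \<in> (\<Union>x\<in>T. M.mcball x e)" using y by force
    then show ?thesis using agree_on_balls[OF assms(1,2,3,6), of y e] by simp
  qed
qed (use assms in auto)

text \<open>Functions that differ by more than e at x differ by more than e/3 on the whole ball of
  radius e/3, whose mass is positive by full support. Hence \<delta> serves all pairs of Lipschitz
  functions at once.\<close>

lemma close_imp_pointwise:
  assumes "x \<in> pts X" "0 < e"
  shows "\<exists>\<delta>>0. \<forall>f g. lip f \<longrightarrow> lip g \<longrightarrow> close (meas X) \<delta> f g \<longrightarrow> \<bar>f x - g x\<bar> \<le> e"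
proof -
  define m where "m = measure (meas X) (M.mball x (e/3))"
  have "emeasure (meas X) (M.mball x (e/3)) > 0"
  proof (rule full_support)
    have "x \<in> M.mball x (e/3)" using assms by simp
    then show "M.mball x (e/3) \<noteq> {}" by blast
  qed simp
  then have m: "0 < m" unfolding m_def P.emeasure_eq_measure by simp
  define \<delta> where "\<delta> = min (e/3) (m/2)"
  have "\<forall>f g. lip f \<longrightarrow> lip g \<longrightarrow> close (meas X) \<delta> f g \<longrightarrow> \<bar>f x - g x\<bar> \<le> e"
  proof (intro allI impI, rule ccontr)
    fix f g assume fg: "lip f" "lip g" "close (meas X) \<delta> f g"
    assume gt: "\<not> \<bar>f x - g x\<bar> \<le> e"
    note [measurable] = lip_measurable[OF fg(1)] lip_measurable[OF fg(2)]
    have "M.mball x (e/3) \<subseteq> {y \<in> space (meas X). \<delta> < \<bar>f y - g y\<bar>}"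
    proof
      fix y assume y: "y \<in> M.mball x (e/3)"
      then have "\<bar>f x - f y\<bar> < e/3" "\<bar>g x - g y\<bar> < e/3"
        using lipD[OF fg(1), of x y] lipD[OF fg(2), of x y] by auto
      then have "\<delta> < \<bar>f y - g y\<bar>" using gt unfolding \<delta>_def by linarith
      then show "y \<in> {y \<in> space (meas X). \<delta> < \<bar>f y - g y\<bar>}" using y by (simp add: space_meas)
    qed
    then have "m \<le> measure (meas X) {y \<in> space (meas X). \<delta> < \<bar>f y - g y\<bar>}"
      unfolding m_def by (intro P.finite_measure_mono) auto
    also have "\<dots> \<le> m / 2" using fg(3) by (simp add: close_def \<delta>_def)
    finally show False using m by simp
  qed
  moreover have "0 < \<delta>" using assms m by (simp add: \<delta>_def)
  ultimately show ?thesis by (intro exI[of _ \<delta>] conjI)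
qed

text \<open>Pointwise approximation on a finite net is approximation in measure, so passing to the
  closure does not affect distances in measure.\<close>

lemma closure_approx_feat:
  assumes f: "f \<in> feat_closure X" and "0 < e"
  obtains g where "g \<in> feat X" "close (meas X) e f g"
proof -
  obtain T where T: "finite T" "T \<subseteq> pts X" "1 - e / 3 < measure (meas X) (\<Union>x\<in>T. M.mball x (e / 3))"
    by (rule finite_net[of "e / 3"]) (use assms(2) in auto)
  obtain g where g: "g \<in> feat X" "\<And>x. x \<in> T \<Longrightarrow> \<bar>f x - g x\<bar> < e / 3"
    by (rule feat_closureE[OF f T(1,2), of "e / 3"]) (use assms(2) in auto)
  have "close (meas X) (3 * (e / 3)) f g"
    by (rule close_of_agree[OF closure_lip[OF f] feat_lip[OF g(1)] T(2,1,3) less_imp_le[OF g(2)]]) (use assms(2) in auto)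
  then have "close (meas X) e f g" by simp
  then show ?thesis by (rule that[OF g(1)])
qed

lemma closure_measurable: "f \<in> feat_closure X \<Longrightarrow> f \<in> borel_measurable (meas X)"
  by (rule lip_measurable[OF closure_lip])

lemma AE_eq_imp_eq:
  assumes "lip f" "lip g" "AE x in meas X. f x = g x" "x \<in> pts X"
  shows "f x = g x"
proof -
  have "\<bar>f x - g x\<bar> \<le> e" if e: "0 < e" for e
  proof -
    obtain \<delta> where \<delta>: "0 < \<delta>" "\<forall>f g. lip f \<longrightarrow> lip g \<longrightarrow> close (meas X) \<delta> f g \<longrightarrow> \<bar>f x - g x\<bar> \<le> e"
      using close_imp_pointwise[OF assms(4) e] by (elim exE conjE)
    have "close (meas X) \<delta> f g"
    proof (rule P.close_AE[of g f])
      show "AE x in meas X. g x = f x" using assms(3) by eventually_elim simp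
      show "close (meas X) \<delta> g g" using \<delta>(1) by (intro P.close_pointwise) auto
    qed (rule lip_measurable[OF assms(1)] lip_measurable[OF assms(2)])+
    then show ?thesis by (rule \<delta>(2)[rule_format, OF assms(1,2)])
  qed
  then have "\<bar>f x - g x\<bar> \<le> 0" by (rule dense_ge)
  then show ?thesis by simp
qed

end

text \<open>With a countable dense set, every open set is a countable union of closed balls centred
  in it. In the applications closed balls are cut out by countably many inequalities between
  sequence entries.\<close>

lemma (in Metric_space) open_preimage_measurable:
  assumes C: "countable C" "C \<subseteq> M" "\<And>x r. x \<in> M \<Longrightarrow> 0 < r \<Longrightarrow> \<exists>c\<in>C. d x c < r"
    and ball: "\<And>c r. c \<in> C \<Longrightarrow> f -` mcball c r \<inter> space N \<in> sets N"
    and U: "openin mtopology U"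
  shows "f -` U \<inter> space N \<in> sets N"
proof -
  define K where "K = {p \<in> C \<times> (UNIV :: nat set). mcball (fst p) (1 / real (Suc (snd p))) \<subseteq> U}"
  have "countable K" unfolding K_def using C(1) by (intro countable_Collect countable_SIGMA) auto
  have UK: "U = (\<Union>p\<in>K. mcball (fst p) (1 / real (Suc (snd p))))"
  proof
    show "(\<Union>p\<in>K. mcball (fst p) (1 / real (Suc (snd p)))) \<subseteq> U" by (auto simp: K_def)
    show "U \<subseteq> (\<Union>p\<in>K. mcball (fst p) (1 / real (Suc (snd p))))"
    proof
      fix x assume "x \<in> U"
      then obtain r where r: "0 < r" "mball x r \<subseteq> U" and x: "x \<in> M"
        using U unfolding openin_mtopology by blast
      obtain m where m: "1 / real (Suc m) < r / 2" using nat_approx_posE[of "r / 2"] r(1) by auto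
      obtain c where c: "c \<in> C" "d x c < 1 / real (Suc m)" using C(3)[OF x, of "1 / real (Suc m)"] by auto
      then have cM: "c \<in> M" using C(2) by blast
      have "mcball c (1 / real (Suc m)) \<subseteq> mball x r"
      proof
        fix z assume z: "z \<in> mcball c (1 / real (Suc m))"
        then have "z \<in> M" "d c z \<le> 1 / real (Suc m)" by auto
        then show "z \<in> mball x r" using triangle[OF x cM, of z] c(2) m x by simp
      qed
      then have "(c, m) \<in> K" using r(2) c(1) by (auto simp: K_def)
      moreover have "x \<in> mcball (fst (c, m)) (1 / real (Suc (snd (c, m))))" using c(2) x cM by (simp add: commute)
      ultimately show "x \<in> (\<Union>p\<in>K. mcball (fst p) (1 / real (Suc (snd p))))" by (rule UN_I)
    qed
  qed
  have "(\<Union>p\<in>K. f -` mcball (fst p) (1 / real (Suc (snd p))) \<inter> space N) \<in> sets N"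
    using \<open>countable K\<close> by (intro sets.countable_UN' ) (auto simp: K_def simp del: in_mcball intro!: ball)
  moreover have "f -` U \<inter> space N = (\<Union>p\<in>K. f -` mcball (fst p) (1 / real (Suc (snd p))) \<inter> space N)"
    by (subst UK) (auto simp del: in_mcball)
  ultimately show ?thesis by simp
qed

section \<open>Parametrizations by the unit interval\<close>

context gds
begin

lemma param_measurable: "\<phi> \<in> parameters X \<Longrightarrow> \<phi> \<in> measurable leb01 (meas X)"
  by (simp add: parameters_def)

lemma param_distr: "\<phi> \<in> parameters X \<Longrightarrow> distr leb01 (meas X) \<phi> = meas X"
  by (simp add: parameters_def)

lemma param_pts: "\<phi> \<in> parameters X \<Longrightarrow> t \<in> {0..1} \<Longrightarrow> \<phi> t \<in> pts X"
  using measurable_space[OF param_measurable, of \<phi> t] by (simp add: space_meas)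

lemma param_close:
  assumes "\<phi> \<in> parameters X" "f \<in> borel_measurable (meas X)" "g \<in> borel_measurable (meas X)"
  shows "close leb01 e (\<lambda>t. f (\<phi> t)) (\<lambda>t. g (\<phi> t)) \<longleftrightarrow> close (meas X) e f g"
  using close_distr[OF param_measurable[OF assms(1)] assms(2,3)] param_distr[OF assms(1)] by simp

lemma param_comp_measurable:
  "\<phi> \<in> parameters X \<Longrightarrow> f \<in> borel_measurable (meas X) \<Longrightarrow> (\<lambda>t. f (\<phi> t)) \<in> borel_measurable leb01"
  by (rule measurable_compose[OF param_measurable])

lemma param_closure_measurable:
  "\<phi> \<in> parameters X \<Longrightarrow> f \<in> feat_closure X \<Longrightarrow> (\<lambda>t. f (\<phi> t)) \<in> borel_measurable leb01"
  by (rule param_comp_measurable[OF _ closure_measurable])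

lemma param_mp:
  assumes "\<phi> \<in> parameters X" "\<tau> \<in> mp"
  shows "(\<lambda>t. \<phi> (\<tau> t)) \<in> parameters X"
  using measurable_mp_comp[OF assms(2) param_measurable[OF assms(1)]] mp_distr_comp[OF assms(2) param_measurable[OF assms(1)]]
    param_distr[OF assms(1)]
  by (simp add: parameters_def)

text \<open>Otherwise the ball would have measure zero, against full support. Hence a parameter maps
  every set of full measure to a dense set.\<close>

lemma param_in_ball:
  assumes \<psi>: "\<psi> \<in> parameters X" and Q: "AE t in leb01. Q t" and x: "x \<in> pts X" and r: "0 < r"
  shows "\<exists>t\<in>{0..1}. Q t \<and> gds_dist X x (\<psi> t) < r"
proof (rule ccontr)
  assume no: "\<not> ?thesis"
  have "AE t in leb01. \<psi> t \<notin> M.mball x r"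
    using Q
  proof (rule AE_mp, intro AE_I2 impI)
    fix t assume "t \<in> space leb01" "Q t"
    then have "\<not> gds_dist X x (\<psi> t) < r" using no by auto
    then show "\<psi> t \<notin> M.mball x r" by simp
  qed
  then have "AE y in distr leb01 (meas X) \<psi>. y \<notin> M.mball x r"
  proof (subst AE_distr_iff[OF param_measurable[OF \<psi>]])
    have "{y \<in> space (meas X). y \<notin> M.mball x r} = space (meas X) - M.mball x r" by auto
    then show "{y \<in> space (meas X). y \<notin> M.mball x r} \<in> sets (meas X)"
      using sets.compl_sets[OF sets_open[OF M.openin_mball[of x r]]] by (simp only:)
  qed
  then have "AE y in meas X. y \<notin> M.mball x r" by (simp only: param_distr[OF \<psi>])
  then have "emeasure (meas X) (M.mball x r) = 0"
    using sets_open[OF M.openin_mball, of x r] by (subst (asm) AE_iff_measurable[of "M.mball x r"]) (auto simp: space_meas)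
  moreover have "emeasure (meas X) (M.mball x r) > 0"
  proof (rule full_support)
    have "x \<in> M.mball x r" using x r by simp
    then show "M.mball x r \<noteq> {}" by blast
  qed simp
  ultimately show False by simp
qed

text \<open>Closeness in measure of 1-Lipschitz functions forces pointwise closeness, as \<open>\<mu>\<^sub>X\<close> has full support.\<close>

lemma closure_complete:
  assumes \<psi>: "\<psi> \<in> parameters X" and u: "u \<in> borel_measurable leb01"
    and approx: "\<And>e. 0 < e \<Longrightarrow> \<exists>f\<in>feat_closure X. close leb01 e u (\<lambda>t. f (\<psi> t))"
  shows "\<exists>f\<in>feat_closure X. AE t in leb01. u t = f (\<psi> t)"
proof -
  have "\<forall>n. \<exists>f. f \<in> feat_closure X \<and> close leb01 (1 / real (Suc n)) u (\<lambda>t. f (\<psi> t))"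
  proof
    fix n
    have "0 < 1 / real (Suc n)" by simp
    from approx[OF this] show "\<exists>f. f \<in> feat_closure X \<and> close leb01 (1 / real (Suc n)) u (\<lambda>t. f (\<psi> t))"
      unfolding Bex_def .
  qed
  from choice[OF this] obtain F where F0: "\<forall>n. F n \<in> feat_closure X \<and> close leb01 (1 / real (Suc n)) u (\<lambda>t. F n (\<psi> t))"
    by (elim exE)
  note F = conjunct1[OF spec[OF F0]] conjunct2[OF spec[OF F0]]
  note mF = param_closure_measurable[OF \<psi> F(1)]
  have conv: "convergent (\<lambda>n. F n x)" if x: "x \<in> pts X" for x
  proof -
    have "Cauchy (\<lambda>n. F n x)"
    proof (rule metric_CauchyI)
      fix e :: real assume e: "0 < e"
      then obtain \<delta> where \<delta>: "0 < \<delta>" and cl: "\<forall>f g. lip f \<longrightarrow> lip g \<longrightarrow> close (meas X) \<delta> f g \<longrightarrow> \<bar>f x - g x\<bar> \<le> e / 2"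
        using close_imp_pointwise[OF x, of "e / 2"] by (elim meta_impE exE conjE) (simp, rule that)
      obtain N where N: "1 / real (Suc N) < \<delta> / 2" using \<delta> nat_approx_posE[of "\<delta> / 2"] by auto
      have "dist (F m x) (F n x) < e" if mn: "m \<ge> N" "n \<ge> N" for m n
      proof -
        have "close leb01 (1 / real (Suc m) + 1 / real (Suc n)) (\<lambda>t. F m (\<psi> t)) (\<lambda>t. F n (\<psi> t))"
          by (rule leb01.close_triangle[OF close_sym[OF F(2)] F(2) mF u mF])
        moreover have "1 / real (Suc m) + 1 / real (Suc n) \<le> \<delta>"
        proof -
          have "1 / real (Suc m) \<le> 1 / real (Suc N)" "1 / real (Suc n) \<le> 1 / real (Suc N)"
            using mn by (auto intro!: frac_le)
          then show ?thesis using N by linarith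
        qed
        ultimately have "close leb01 \<delta> (\<lambda>t. F m (\<psi> t)) (\<lambda>t. F n (\<psi> t))"
          by (rule leb01.close_mono[OF _ _ mF mF])
        then have "close (meas X) \<delta> (F m) (F n)"
          by (subst (asm) param_close[OF \<psi> closure_measurable[OF F(1)] closure_measurable[OF F(1)]])
        then have "\<bar>F m x - F n x\<bar> \<le> e / 2"
          by (rule cl[rule_format, OF closure_lip[OF F(1)] closure_lip[OF F(1)]])
        then show ?thesis using e by (simp add: dist_real_def)
      qed
      then show "\<exists>M. \<forall>m\<ge>M. \<forall>n\<ge>M. dist (F m x) (F n x) < e" by blast
    qed
    then show ?thesis by (simp add: Cauchy_convergent_iff)
  qed
  define f where "f = restrict (\<lambda>x. lim (\<lambda>n. F n x)) (pts X)"
  have lim: "(\<lambda>n. F n x) \<longlonglongrightarrow> f x" if "x \<in> pts X" for x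
    using conv[OF that] that by (simp add: f_def convergent_LIMSEQ_iff)
  have f: "f \<in> feat_closure X"
  proof (rule feat_closure_closed)
    show "f \<in> extensional (pts X)" by (simp add: f_def)
    fix T :: "'a set" and e :: real assume T: "finite T" "T \<subseteq> pts X" "0 < e"
    have "\<forall>x\<in>T. \<forall>\<^sub>F n in sequentially. \<bar>f x - F n x\<bar> < e"
    proof
      fix x assume "x \<in> T"
      then have "\<forall>\<^sub>F n in sequentially. dist (F n x) (f x) < e" using lim T by (intro tendstoD) auto
      then show "\<forall>\<^sub>F n in sequentially. \<bar>f x - F n x\<bar> < e"
        by (rule eventually_mono) (simp add: dist_real_def abs_minus_commute)
    qed
    then have "\<forall>\<^sub>F n in sequentially. \<forall>x\<in>T. \<bar>f x - F n x\<bar> < e"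
      using T(1) by (simp add: eventually_ball_finite_distrib)
    then obtain n where "\<forall>x\<in>T. \<bar>f x - F n x\<bar> < e" by (auto simp: eventually_sequentially)
    then show "\<exists>g\<in>feat_closure X. \<forall>x\<in>T. \<bar>f x - g x\<bar> < e" using F(1) by (intro bexI[of _ "F n"])
  qed
  note mf = param_closure_measurable[OF \<psi> f]
  \<comment> \<open>Pointwise convergence gives convergence in measure, so \<open>u\<close> and the
    limit are at Ky Fan distance 0 and agree almost everywhere.\<close>
  have "close leb01 (0 + \<eta>) u (\<lambda>t. f (\<psi> t))" if \<eta>: "0 < \<eta>" for \<eta>
  proof -
    have "\<forall>\<^sub>F n in sequentially. close leb01 (\<eta> / 2) (\<lambda>t. F n (\<psi> t)) (\<lambda>t. f (\<psi> t))"
    proof (rule leb01.AE_convergence_imp_close)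
      show "AE t in leb01. (\<lambda>n. F n (\<psi> t)) \<longlonglongrightarrow> f (\<psi> t)"
        by (rule AE_I2) (use lim param_pts[OF \<psi>] in simp)
    qed (use \<eta> mF mf in auto)
    moreover have "\<forall>\<^sub>F n in sequentially. 1 / real (Suc n) < \<eta> / 2"
      using \<eta> by (intro order_tendstoD(2)[OF LIMSEQ_Suc[OF lim_1_over_n]]) auto
    ultimately have "\<forall>\<^sub>F n in sequentially. close leb01 (\<eta> / 2) (\<lambda>t. F n (\<psi> t)) (\<lambda>t. f (\<psi> t)) \<and> 1 / real (Suc n) < \<eta> / 2"
      by (rule eventually_conj)
    from eventually_happens'[OF sequentially_bot this] obtain n where n: "close leb01 (\<eta> / 2) (\<lambda>t. F n (\<psi> t)) (\<lambda>t. f (\<psi> t))" "1 / real (Suc n) < \<eta> / 2"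
      by (elim exE conjE)
    have "close leb01 (1 / real (Suc n) + \<eta> / 2) u (\<lambda>t. f (\<psi> t))"
      by (rule leb01.close_triangle[OF F(2) n(1) u mF mf])
    then show ?thesis by (rule leb01.close_mono[OF _ _ u mf]) (use n(2) in simp)
  qed
  then have "close leb01 0 u (\<lambda>t. f (\<psi> t))" by (rule leb01.close_limit[OF _ u mf])
  then have "measure leb01 {t \<in> space leb01. 0 < \<bar>u t - f (\<psi> t)\<bar>} = 0"
    using measure_nonneg[of leb01] by (simp add: close_def order_antisym)
  moreover have "{t \<in> space leb01. 0 < \<bar>u t - f (\<psi> t)\<bar>} \<in> sets leb01"
    by (rule borel_measurable_less[OF borel_measurable_const borel_measurable_abs[OF borel_measurable_diff[OF u mf]]])
  ultimately have "AE t in leb01. \<not> 0 < \<bar>u t - f (\<psi> t)\<bar>"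
    using leb01.prob_Collect_eq_0[of "\<lambda>t. 0 < \<bar>u t - f (\<psi> t)\<bar>"] by (simp only: simp_thms)
  then have "AE t in leb01. u t = f (\<psi> t)" by eventually_elim simp
  then show ?thesis by (rule bexI[OF _ f])
qed

end

section \<open>Clipping families and a dense sequence of bounded features\<close>

locale clipped =
  fixes L :: "(real \<Rightarrow> real) set"
  assumes monoidal: "monoidal L" and clippings: "clippings \<subseteq> L"
begin

lemma L_Lip1: "p \<in> L \<Longrightarrow> p \<in> Lip1"
  using monoidal by (auto simp: monoidal_def)

lemma L_comp: "p \<in> L \<Longrightarrow> q \<in> L \<Longrightarrow> (\<lambda>x. p (q x)) \<in> L"
  using monoidal by (auto simp: monoidal_def comp_def)

lemma L_id: "(\<lambda>x. x) \<in> L"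
  using monoidal by (simp add: monoidal_def id_def)

lemma L_shift: "(\<lambda>x. x + c) \<in> L"
proof -
  have "(\<lambda>x. x + c) \<in> clippings"
    unfolding clippings_def by (intro CollectI exI[of _ c] exI[of _ "-\<infinity>"] exI[of _ "\<infinity>"]) auto
  then show ?thesis using clippings by blast
qed

text \<open>A clipping whose lower and upper bounds coincide.\<close>

lemma L_const: "(\<lambda>x. c) \<in> L"
proof -
  have "(\<lambda>x. c) \<in> clippings"
    unfolding clippings_def by (intro CollectI exI[of _ 0] exI[of _ "ereal c"]) (auto simp: max_def min_def)
  then show ?thesis using clippings by blast
qed

definition clip :: "real \<Rightarrow> real \<Rightarrow> real" where
  "clip R x = max (- R) (min R x)"

lemma L_clip: "0 \<le> R \<Longrightarrow> clip R \<in> L"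
proof -
  assume "0 \<le> R"
  then have "clip R \<in> clippings"
    unfolding clippings_def clip_def
    by (intro CollectI exI[of _ 0] exI[of _ "ereal (-R)"] exI[of _ "ereal R"]) (auto simp: max_def min_def)
  then show ?thesis using clippings by blast
qed

lemma clip_id: "\<bar>x\<bar> \<le> R \<Longrightarrow> clip R x = x"
  by (auto simp: clip_def)

lemma abs_clip: "0 \<le> R \<Longrightarrow> \<bar>clip R x\<bar> \<le> R"
  by (auto simp: clip_def)

lemma clip_Lip: "\<bar>clip R x - clip R y\<bar> \<le> \<bar>x - y\<bar>"
  by (auto simp: clip_def max_def min_def)

end

text \<open>Invariance under L is the whole of L-compactness here: the covering condition follows in
  \<open>l_compact\<close>, because L contains the translations.\<close>

locale cgds = gds X + clipped L for X :: "'a gds" and L +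
  assumes inv: "lcomp (pts X) L (feat_closure X) \<subseteq> feat_closure X"
begin

lemma post: "p \<in> L \<Longrightarrow> f \<in> feat_closure X \<Longrightarrow> compose (pts X) p f \<in> feat_closure X"
  using inv by (auto simp: lcomp_def)

text \<open>The bound i on the i-th feature is the one demanded of observables, so along any
  parameter such a sequence is itself an observable.\<close>

definition seq_dense :: "(nat \<Rightarrow> 'a \<Rightarrow> real) \<Rightarrow> bool" where
  "seq_dense e \<longleftrightarrow> (\<forall>i. e i \<in> feat_closure X) \<and> (\<forall>i. \<forall>x\<in>pts X. \<bar>e i x\<bar> \<le> real i) \<and>
    (\<forall>f T \<epsilon>. f \<in> feat_closure X \<longrightarrow> finite T \<longrightarrow> T \<subseteq> pts X \<longrightarrow> 0 < \<epsilon> \<longrightarrow> (\<exists>i. \<forall>x\<in>T. \<bar>f x - e i x\<bar> < \<epsilon>))"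

text \<open>Rounding the values at the first n points of a dense sequence with mesh 1/(k+1) has
  countably many outcomes, and one feature is chosen for each. By equicontinuity, features with
  equal outcome are close on a finite set as soon as the dense points come close to it.\<close>

lemma seq_dense_exists: "\<exists>e. seq_dense e"
proof -
  obtain c where cp: "\<And>i :: nat. c i \<in> pts X" and dense: "\<And>x r. x \<in> pts X \<Longrightarrow> 0 < r \<Longrightarrow> \<exists>i. gds_dist X x (c i) < r"
    by (rule dense_seq) blast
  obtain f0 where f0: "f0 \<in> feat_closure X" using feat_nonempty feat_subset_closure by blast
  define code where "code n k f = map (\<lambda>i. \<lfloor>f (c i) * real (Suc k)\<rfloor>) [0..<n]" for n k :: nat and f :: "'a \<Rightarrow> real"
  \<comment> \<open>Outcomes attained by no feature get the arbitrary feature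
    \<open>f0\<close>.\<close>
  define g where "g a = (case a of (n, k, l) \<Rightarrow>
      if \<exists>f\<in>feat_closure X. code n k f = l then SOME f. f \<in> feat_closure X \<and> code n k f = l else f0)"
    for a :: "nat \<times> nat \<times> int list"
  have g_code: "g (n, k, code n k f) \<in> feat_closure X \<and> code n k (g (n, k, code n k f)) = code n k f"
    if "f \<in> feat_closure X" for n k f
  proof -
    have ex: "\<exists>f'\<in>feat_closure X. code n k f' = code n k f" using that by (intro bexI[of _ f]) auto
    then have "g (n, k, code n k f) = (SOME f'. f' \<in> feat_closure X \<and> code n k f' = code n k f)"
      by (simp add: g_def)
    moreover have "(SOME f'. f' \<in> feat_closure X \<and> code n k f' = code n k f) \<in> feat_closure X \<and>
        code n k (SOME f'. f' \<in> feat_closure X \<and> code n k f' = code n k f) = code n k f"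
      by (rule someI[of _ f]) (simp add: that)
    ultimately show ?thesis by simp
  qed
  have g_in: "g a \<in> feat_closure X" for a
  proof (cases a)
    case (fields n k l)
    show ?thesis
    proof (cases "\<exists>f\<in>feat_closure X. code n k f = l")
      case True
      then obtain f where f: "f \<in> feat_closure X" "code n k f = l" by (elim bexE)
      show ?thesis using g_code[OF f(1), of n k] by (simp add: fields f(2))
    next
      case False
      then show ?thesis using f0 by (simp only: g_def fields prod.case if_False)
    qed
  qed
  \<comment> \<open>The clipping radius is the second component of the decoded index, hence at most
    the index itself.\<close>
  define e where "e i = compose (pts X) (clip (real (snd (prod_decode i)))) (g (from_nat (fst (prod_decode i))))" for i
  have "seq_dense e"
    unfolding seq_dense_def
  proof (intro conjI allI ballI impI)
    show "e i \<in> feat_closure X" for i unfolding e_def by (intro post L_clip g_in) simp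
    show "\<bar>e i x\<bar> \<le> real i" if "x \<in> pts X" for i x
    proof -
      have "snd (prod_decode i) \<le> i"
        using le_prod_encode_2[of "snd (prod_decode i)" "fst (prod_decode i)"] by simp
      moreover have "\<bar>e i x\<bar> \<le> real (snd (prod_decode i))"
        unfolding e_def using that by (simp add: compose_def abs_clip)
      ultimately show ?thesis by linarith
    qed
    fix f T and \<epsilon> :: real assume f: "f \<in> feat_closure X" and T: "finite T" "T \<subseteq> pts X" and \<epsilon>: "0 < \<epsilon>"
    have "\<exists>i. gds_dist X x (c i) < \<epsilon> / 4" if "x \<in> T" for x
      using dense[of x "\<epsilon> / 4"] that T \<epsilon> by auto
    then obtain I where I: "\<And>x. x \<in> T \<Longrightarrow> gds_dist X x (c (I x)) < \<epsilon> / 4" by metis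
    define n where "n = Suc (Max (insert 0 (I ` T)))"
    have In: "I x < n" if "x \<in> T" for x
      unfolding n_def using that T(1) by (intro le_imp_less_Suc Max_ge) auto
    obtain k where k: "1 / real (Suc k) < \<epsilon> / 4" using nat_approx_posE[of "\<epsilon> / 4"] \<epsilon> by auto
    define g' where "g' = g (n, k, code n k f)"
    have g': "g' \<in> feat_closure X" "code n k g' = code n k f" using g_code[OF f] by (auto simp: g'_def)
    obtain R :: nat where R: "\<And>x. x \<in> T \<Longrightarrow> \<bar>f x\<bar> \<le> real R"
    proof -
      obtain R :: nat where "Max (insert 0 ((\<lambda>x. \<bar>f x\<bar>) ` T)) \<le> real R" using real_arch_simple by blast
      moreover have "\<bar>f x\<bar> \<le> Max (insert 0 ((\<lambda>x. \<bar>f x\<bar>) ` T))" if "x \<in> T" for x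
        using that T(1) by (intro Max_ge) auto
      ultimately show thesis by (intro that[of R]) (meson order_trans)
    qed
    define i where "i = prod_encode (to_nat (n, k, code n k f), R)"
    have ei: "e i = compose (pts X) (clip (real R)) g'" unfolding e_def i_def g'_def by simp
    have "\<bar>f x - e i x\<bar> < \<epsilon>" if x: "x \<in> T" for x
    proof -
      have xp: "x \<in> pts X" using x T by blast
      have "code n k g' ! I x = code n k f ! I x" using g'(2) by simp
      then have "\<lfloor>g' (c (I x)) * real (Suc k)\<rfloor> = \<lfloor>f (c (I x)) * real (Suc k)\<rfloor>"
        using In[OF x] by (simp add: code_def)
      then have "\<bar>g' (c (I x)) * real (Suc k) - f (c (I x)) * real (Suc k)\<bar> \<le> 1"
        using floor_correct[of "g' (c (I x)) * real (Suc k)"] floor_correct[of "f (c (I x)) * real (Suc k)"] by linarith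
      then have "\<bar>g' (c (I x)) - f (c (I x))\<bar> * real (Suc k) \<le> 1"
        by (simp add: abs_mult[symmetric] left_diff_distrib[symmetric] del: of_nat_Suc)
      then have "\<bar>g' (c (I x)) - f (c (I x))\<bar> \<le> 1 / real (Suc k)"
        by (simp add: pos_le_divide_eq del: of_nat_Suc)
      then have "\<bar>g' (c (I x)) - f (c (I x))\<bar> < \<epsilon> / 4" using k by linarith
      moreover have "\<bar>f x - f (c (I x))\<bar> < \<epsilon> / 4" "\<bar>g' x - g' (c (I x))\<bar> < \<epsilon> / 4"
        using lipD[OF closure_lip[OF f] xp cp[of "I x"]] lipD[OF closure_lip[OF g'(1)] xp cp[of "I x"]] I[OF x] by linarith+
      ultimately have "\<bar>f x - g' x\<bar> < \<epsilon>" by linarith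
      moreover have "f x = clip (real R) (f x)" using clip_id[OF R[OF x]] by simp
      ultimately show ?thesis
        using clip_Lip[of "real R" "f x" "g' x"] xp by (simp add: ei compose_def)
    qed
    then show "\<exists>i. \<forall>x\<in>T. \<bar>f x - e i x\<bar> < \<epsilon>" by (intro exI[of _ i] ballI)
  qed
  then show ?thesis by blast
qed

definition bseq :: "nat \<Rightarrow> 'a \<Rightarrow> real" where
  "bseq = (SOME e. seq_dense e)"

lemma bseq_dense: "seq_dense bseq"
  unfolding bseq_def using seq_dense_exists by (rule someI_ex)

lemma bseq_closure: "bseq i \<in> feat_closure X"
  using bseq_dense by (simp add: seq_dense_def)

lemma bseq_bound: "x \<in> pts X \<Longrightarrow> \<bar>bseq i x\<bar> \<le> real i"
  using bseq_dense by (simp add: seq_dense_def)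

lemma bseq_approx:
  "f \<in> feat_closure X \<Longrightarrow> finite T \<Longrightarrow> T \<subseteq> pts X \<Longrightarrow> 0 < \<epsilon> \<Longrightarrow> \<exists>i. \<forall>x\<in>T. \<bar>f x - bseq i x\<bar> < \<epsilon>"
  using bseq_dense unfolding seq_dense_def by blast

text \<open>Every feature is approximated by the sequence at any two given points, so the metric is
  the supremum distance of the sequences of values.\<close>

lemma bseq_dist_le:
  assumes xy: "x \<in> pts X" "y \<in> pts X" and le: "\<And>i. \<bar>bseq i x - bseq i y\<bar> \<le> r"
  shows "gds_dist X x y \<le> r"
proof (rule dist_le[OF xy])
  fix f assume "f \<in> feat X"
  then have f: "f \<in> feat_closure X" by (rule feat_subset_closure)
  show "\<bar>f x - f y\<bar> \<le> r"
  proof (rule field_le_epsilon)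
    fix e :: real assume "0 < e"
    then obtain i where "\<forall>z\<in>{x, y}. \<bar>f z - bseq i z\<bar> < e / 2"
      using bseq_approx[OF f, of "{x, y}" "e / 2"] xy by auto
    then have "\<bar>f x - bseq i x\<bar> < e / 2" "\<bar>f y - bseq i y\<bar> < e / 2" by auto
    then show "\<bar>f x - f y\<bar> \<le> r + e" using le[of i] by linarith
  qed
qed

lemma measurable_bseq: "(\<lambda>x i. bseq i x) \<in> measurable (meas X) RN"
  by (simp add: measurable_RN_iff closure_measurable[OF bseq_closure])

text \<open>By completeness, the image of the space under its feature sequence is closed for the
  supremum distance.\<close>

lemma bseq_limit:
  assumes app: "\<And>e. 0 < e \<Longrightarrow> \<exists>x\<in>pts X. \<forall>i. \<bar>bseq i x - y i\<bar> \<le> e"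
  shows "\<exists>x\<in>pts X. \<forall>i. bseq i x = y i"
proof -
  have "\<forall>m. \<exists>x. x \<in> pts X \<and> (\<forall>i. \<bar>bseq i x - y i\<bar> \<le> 1 / real (Suc m))"
  proof
    fix m
    have "0 < 1 / real (Suc m)" by simp
    from app[OF this] show "\<exists>x. x \<in> pts X \<and> (\<forall>i. \<bar>bseq i x - y i\<bar> \<le> 1 / real (Suc m))" unfolding Bex_def .
  qed
  from choice[OF this] obtain s where s: "\<forall>m. s m \<in> pts X \<and> (\<forall>i. \<bar>bseq i (s m) - y i\<bar> \<le> 1 / real (Suc m))" by (elim exE)
  note sp = conjunct1[OF spec[OF s]] and sy = spec[OF conjunct2[OF spec[OF s]]]
  have le: "1 / real (Suc n) \<le> 1 / real (Suc N)" if "N \<le> n" for N n using that by (auto intro!: frac_le)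
  have "M.MCauchy s"
    unfolding M.MCauchy_def
  proof (intro conjI allI impI)
    show "range s \<subseteq> pts X" using sp by blast
    fix \<epsilon> :: real assume "0 < \<epsilon>"
    then obtain N where N: "1 / real (Suc N) < \<epsilon> / 2" using nat_approx_posE[of "\<epsilon> / 2"] by auto
    have "gds_dist X (s n) (s n') < \<epsilon>" if n: "N \<le> n" "N \<le> n'" for n n'
    proof (rule le_less_trans[OF bseq_dist_le[OF sp sp]])
      show "\<bar>bseq i (s n) - bseq i (s n')\<bar> \<le> 2 * (1 / real (Suc N))" for i
        using sy[of i n] sy[of i n'] le[OF n(1)] le[OF n(2)] by linarith
    qed (use N in linarith)
    then show "\<exists>N. \<forall>n n'. N \<le> n \<longrightarrow> N \<le> n' \<longrightarrow> gds_dist X (s n) (s n') < \<epsilon>" by blast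
  qed
  then obtain x where "limitin M.mtopology s x sequentially" using mcomplete unfolding M.mcomplete_def by blast
  then have x: "x \<in> pts X" "\<And>\<epsilon>. 0 < \<epsilon> \<Longrightarrow> \<exists>N. \<forall>n\<ge>N. gds_dist X (s n) x < \<epsilon>"
    using sp unfolding M.limit_metric_sequentially by blast+
  have "bseq i x = y i" for i
  proof -
    have "\<bar>bseq i x - y i\<bar> \<le> \<epsilon>" if \<epsilon>: "0 < \<epsilon>" for \<epsilon>
    proof -
      obtain N1 where N1: "\<forall>n\<ge>N1. gds_dist X (s n) x < \<epsilon> / 2" using x(2)[of "\<epsilon> / 2"] \<epsilon> by auto
      obtain N2 where N2: "1 / real (Suc N2) < \<epsilon> / 2" using nat_approx_posE[of "\<epsilon> / 2"] \<epsilon> by auto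
      have "gds_dist X (s (max N1 N2)) x < \<epsilon> / 2" using N1 by simp
      then show ?thesis
        using sy[of i "max N1 N2"] le[of N2 "max N1 N2"] N2 lipD[OF closure_lip[OF bseq_closure[of i]] sp[of "max N1 N2"] x(1)] by simp
    qed
    then have "\<bar>bseq i x - y i\<bar> \<le> 0" by (rule dense_ge)
    then show ?thesis by simp
  qed
  then show ?thesis using x(1) by blast
qed

text \<open>By \<open>bseq_limit\<close>, the image consists of the sequences that lie within every
  1/(m+1) of the values at a countable dense set; this makes it Borel. The inverse is measurable
  because preimages of closed balls are given by countably many inequalities.\<close>

lemma bseq_inverse_exists: "\<exists>\<Psi>\<in>measurable RN (meas X). \<forall>x\<in>pts X. \<Psi> (\<lambda>i. bseq i x) = x"
proof -
  obtain C where C: "countable C" "C \<subseteq> pts X" "C \<noteq> {}" "\<And>x r. x \<in> pts X \<Longrightarrow> 0 < r \<Longrightarrow> \<exists>c\<in>C. gds_dist X x c < r"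
    by (rule countable_dense) blast
  obtain x0 where x0: "x0 \<in> pts X" using nonempty by blast
  define B where "B = {y \<in> space RN. \<forall>m::nat. \<exists>c\<in>C. \<forall>i. \<bar>bseq i c - y i\<bar> \<le> 1 / real (Suc m)}"
  have [measurable]: "B \<in> sets RN" unfolding B_def using C(1) by measurable
  have img: "\<exists>x. x \<in> pts X \<and> (\<lambda>i. bseq i x) = y" if y: "y \<in> B" for y
  proof -
    have "\<exists>x\<in>pts X. \<forall>i. bseq i x = y i"
    proof (rule bseq_limit)
      fix e :: real assume "0 < e"
      then obtain m where m: "1 / real (Suc m) < e" using nat_approx_posE by blast
      obtain c where "c \<in> C" "\<forall>i. \<bar>bseq i c - y i\<bar> \<le> 1 / real (Suc m)" using y unfolding B_def by blast
      then show "\<exists>x\<in>pts X. \<forall>i. \<bar>bseq i x - y i\<bar> \<le> e" using m C(2) by (intro bexI[of _ c]) (auto intro: order.trans)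
    qed
    then show ?thesis by (auto simp: fun_eq_iff)
  qed
  have BI: "(\<lambda>i. bseq i x) \<in> B" if x: "x \<in> pts X" for x
  proof -
    have "\<exists>c\<in>C. \<forall>i. \<bar>bseq i c - bseq i x\<bar> \<le> 1 / real (Suc m)" for m
    proof -
      obtain c where c: "c \<in> C" "gds_dist X x c < 1 / real (Suc m)" using C(4)[OF x, of "1 / real (Suc m)"] by auto
      then have "\<bar>bseq i c - bseq i x\<bar> \<le> 1 / real (Suc m)" for i
        using lipD[OF closure_lip[OF bseq_closure[of i]] x, of c] C(2) by fastforce
      then show ?thesis using c(1) by blast
    qed
    then show ?thesis by (simp add: B_def space_PiM)
  qed
  define \<Psi> where "\<Psi> y = (if y \<in> B then SOME x. x \<in> pts X \<and> (\<lambda>i. bseq i x) = y else x0)" for y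
  have \<Psi>B: "\<Psi> y \<in> pts X" "(\<lambda>i. bseq i (\<Psi> y)) = y" if "y \<in> B" for y
    using someI_ex[OF img[OF that]] that by (simp_all add: \<Psi>_def)
  have \<Psi>p: "\<Psi> y \<in> pts X" for y
    using \<Psi>B(1)[of y] x0 by (cases "y \<in> B") (simp_all add: \<Psi>_def)
  have inv: "\<Psi> (\<lambda>i. bseq i x) = x" if x: "x \<in> pts X" for x
  proof -
    have "gds_dist X (\<Psi> (\<lambda>i. bseq i x)) x \<le> 0"
    proof (rule bseq_dist_le[OF \<Psi>p x])
      show "\<bar>bseq i (\<Psi> (\<lambda>i. bseq i x)) - bseq i x\<bar> \<le> 0" for i
        using fun_cong[OF \<Psi>B(2)[OF BI[OF x]], of i] by simp
    qed
    then show ?thesis using M.zero[OF \<Psi>p x] M.nonneg[of "\<Psi> (\<lambda>i. bseq i x)" x] by simp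
  qed
  have "\<Psi> -` M.mcball c r \<inter> space RN \<in> sets RN" if c: "c \<in> C" for c r
  proof -
    have cp: "c \<in> pts X" using c C(2) by blast
    have iff: "\<Psi> y \<in> M.mcball c r \<longleftrightarrow> (\<forall>i. \<bar>bseq i c - y i\<bar> \<le> r)" if y: "y \<in> B" for y
    proof
      assume "\<Psi> y \<in> M.mcball c r"
      then show "\<forall>i. \<bar>bseq i c - y i\<bar> \<le> r"
        using lipD[OF closure_lip[OF bseq_closure] cp \<Psi>p, of _ y] fun_cong[OF \<Psi>B(2)[OF y]]
        by (metis M.in_mcball order_trans)
    next
      assume *: "\<forall>i. \<bar>bseq i c - y i\<bar> \<le> r"
      have "gds_dist X c (\<Psi> y) \<le> r"
        by (rule bseq_dist_le[OF cp \<Psi>p]) (use * fun_cong[OF \<Psi>B(2)[OF y]] in simp)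
      then show "\<Psi> y \<in> M.mcball c r" using cp \<Psi>p by simp
    qed
    have no: "\<Psi> y = x0" if "y \<notin> B" for y using that by (simp add: \<Psi>_def)
    have "\<Psi> -` M.mcball c r \<inter> space RN = (B \<inter> {y \<in> space RN. \<forall>i. \<bar>bseq i c - y i\<bar> \<le> r}) \<union>
        (if x0 \<in> M.mcball c r then space RN - B else {})" (is "?l = ?r")
    proof (rule set_eqI)
      show "y \<in> ?l \<longleftrightarrow> y \<in> ?r" for y
        by (cases "y \<in> B"; cases "x0 \<in> M.mcball c r") (simp_all add: iff no space_PiM del: M.in_mcball)
    qed
    moreover have "{y \<in> space RN. \<forall>i. \<bar>bseq i c - y i\<bar> \<le> r} \<in> sets RN" by measurable
    ultimately show ?thesis by auto
  qed
  from M.open_preimage_measurable[OF C(1,2,4) this] have "\<Psi> -` U \<inter> space RN \<in> sets RN" if "openin M.mtopology U" for U using that by blast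
  then have "\<Psi> \<in> measurable RN (meas X)"
    by (intro measurable_sigma_sets[OF sets_meas]) (use \<Psi>p openin_subset in fastforce)+
  then show ?thesis using inv by blast
qed

definition decode_bseq :: "(nat \<Rightarrow> real) \<Rightarrow> 'a" where
  "decode_bseq = (SOME \<Psi>. \<Psi> \<in> measurable RN (meas X) \<and> (\<forall>x\<in>pts X. \<Psi> (\<lambda>i. bseq i x) = x))"

lemma decode_bseq: "decode_bseq \<in> measurable RN (meas X)" "x \<in> pts X \<Longrightarrow> decode_bseq (\<lambda>i. bseq i x) = x"
proof -
  have "decode_bseq \<in> measurable RN (meas X) \<and> (\<forall>x\<in>pts X. decode_bseq (\<lambda>i. bseq i x) = x)"
    unfolding decode_bseq_def by (rule someI_ex[OF bseq_inverse_exists[unfolded Bex_def]])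
  then show "decode_bseq \<in> measurable RN (meas X)" "x \<in> pts X \<Longrightarrow> decode_bseq (\<lambda>i. bseq i x) = x" by simp_all
qed

text \<open>The feature sequence followed by the real code embeds the data set into the real line;
  this guarantees the existence of parameters.\<close>

lemma standard_meas: "standard (meas X)"
  unfolding standard_def
proof (rule bexI[of _ "\<lambda>x. encode (\<lambda>i. bseq i x)"], rule bexI[of _ "\<lambda>s. decode_bseq (decode s)"])
  show "\<forall>x\<in>space (meas X). decode_bseq (decode (encode (\<lambda>i. bseq i x))) = x"
    by (simp add: space_meas decode_bseq(2))
  show "(\<lambda>s. decode_bseq (decode s)) \<in> measurable borel (meas X)"
    by (rule measurable_compose[OF measurable_decode decode_bseq(1)])
  show "(\<lambda>x. encode (\<lambda>i. bseq i x)) \<in> borel_measurable (meas X)"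
    by (rule measurable_compose[OF measurable_bseq measurable_encode])
qed

lemma params_nonempty: "\<exists>\<phi>. \<phi> \<in> parameters X"
  using standard_law[OF standard_meas P.prob_space_axioms refl] by (auto simp: parameters_def)

text \<open>Decoding \<open>c\<close> gives a point-valued map of law \<open>meas X\<close>, and
  equality of laws also transfers the fact that decoding inverts the feature sequence. This recovers
  parameters from limits that are known in law only.\<close>

lemma param_of_law:
  assumes \<phi>: "\<phi> \<in> parameters X" and c: "c \<in> measurable leb01 RN"
    and eq: "distr leb01 RN c = distr leb01 RN (\<lambda>t i. bseq i (\<phi> t))"
  shows "\<exists>\<phi>'\<in>parameters X. AE t in leb01. \<forall>i. bseq i (\<phi>' t) = c t i"
proof -
  have mb: "(\<lambda>t i. bseq i (\<phi> t)) \<in> measurable leb01 RN"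
    by (rule measurable_compose[OF param_measurable[OF \<phi>] measurable_bseq])
  have "distr leb01 (meas X) (\<lambda>t. decode_bseq (c t)) = distr (distr leb01 RN c) (meas X) decode_bseq"
    by (subst distr_distr[OF decode_bseq(1) c]) (simp add: comp_def)
  also have "\<dots> = distr leb01 (meas X) (\<lambda>t. decode_bseq (\<lambda>i. bseq i (\<phi> t)))"
    unfolding eq by (subst distr_distr[OF decode_bseq(1) mb]) (simp add: comp_def)
  also have "\<dots> = distr leb01 (meas X) \<phi>"
    by (rule distr_cong) (simp_all add: decode_bseq(2) param_pts[OF \<phi>, simplified])
  also have "\<dots> = meas X" by (rule param_distr[OF \<phi>])
  finally have 1: "(\<lambda>t. decode_bseq (c t)) \<in> parameters X"
    using measurable_compose[OF c decode_bseq(1)] by (simp add: parameters_def)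
  have m: "(\<lambda>y. bseq i (decode_bseq y)) \<in> borel_measurable RN" for i
    by (rule measurable_compose[OF decode_bseq(1) closure_measurable[OF bseq_closure]])
  have S: "{y \<in> space RN. \<forall>i. bseq i (decode_bseq y) = y i} \<in> sets RN"
    by (rule sets.sets_Collect_countable_All) (rule borel_measurable_eq[OF m RN_component])
  have "AE t in leb01. \<forall>i. bseq i (decode_bseq (\<lambda>i. bseq i (\<phi> t))) = bseq i (\<phi> t)"
    by (rule AE_I2) (simp add: decode_bseq(2) param_pts[OF \<phi>, simplified])
  then have "AE y in distr leb01 RN (\<lambda>t i. bseq i (\<phi> t)). \<forall>i. bseq i (decode_bseq y) = y i"
    by (subst AE_distr_iff[OF mb S])
  then have "AE y in distr leb01 RN c. \<forall>i. bseq i (decode_bseq y) = y i" unfolding eq .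
  then have "AE t in leb01. \<forall>i. bseq i (decode_bseq (c t)) = c t i"
    by (subst (asm) AE_distr_iff[OF c S])
  then show ?thesis using 1 by (intro bexI[of _ "\<lambda>t. decode_bseq (c t)"])
qed

end

section \<open>Domination\<close>

lemma (in gds) closure_pullback:
  assumes Y: "gds Y" and h: "\<And>x. x \<in> pts X \<Longrightarrow> h x \<in> pts Y" and sub: "pull (pts X) h (feat Y) \<subseteq> feat_closure X"
    and f: "f \<in> feat_closure Y"
  shows "compose (pts X) f h \<in> feat_closure X"
proof (rule feat_closure_closed)
  interpret Y: gds Y by fact
  show "compose (pts X) f h \<in> extensional (pts X)" by (rule compose_extensional)
  fix T :: "'a set" and e :: real assume T: "finite T" "T \<subseteq> pts X" "0 < e"
  obtain g where g: "g \<in> feat Y" "\<And>y. y \<in> h ` T \<Longrightarrow> \<bar>f y - g y\<bar> < e"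
    by (rule Y.feat_closureE[OF f, of "h ` T" e]) (use T h in auto)
  have "compose (pts X) g h \<in> feat_closure X" using subsetD[OF sub] g(1) unfolding pull_def by (meson imageI)
  moreover have "\<bar>compose (pts X) f h x - compose (pts X) g h x\<bar> < e" if "x \<in> T" for x
  proof -
    have "x \<in> pts X" "h x \<in> h ` T" using that T by auto
    then show ?thesis using g(2)[of "h x"] by (simp add: compose_def)
  qed
  ultimately show "\<exists>g\<in>feat_closure X. \<forall>x\<in>T. \<bar>compose (pts X) f h x - g x\<bar> < e"
    by (intro bexI[of _ "compose (pts X) g h"] ballI)
qed

lemma (in gds) map_pts: "gds Y \<Longrightarrow> h \<in> measurable (meas X) (meas Y) \<Longrightarrow> x \<in> pts X \<Longrightarrow> h x \<in> pts Y"
  using measurable_space[of h "meas X" "meas Y" x] by (simp add: space_meas gds.space_meas)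

lemma param_image:
  assumes X: "gds X" and h: "h \<in> measurable (meas X) (meas Y)" "distr (meas X) (meas Y) h = meas Y" and \<psi>: "\<psi> \<in> parameters X"
  shows "(\<lambda>t. h (\<psi> t)) \<in> parameters Y"
proof -
  interpret gds X by fact
  show ?thesis
    using measurable_compose[OF param_measurable[OF \<psi>] h(1)] h(2) param_distr[OF \<psi>] distr_distr[OF h(1) param_measurable[OF \<psi>]]
    by (simp add: parameters_def comp_def)
qed

lemma (in gds) param_AE_imp_eq:
  assumes \<psi>: "\<psi> \<in> parameters X" and f: "lip f" and g: "lip g" and ae: "AE t in leb01. f (\<psi> t) = g (\<psi> t)" and x: "x \<in> pts X"
  shows "f x = g x"
proof -
  have "AE x in distr leb01 (meas X) \<psi>. f x = g x"
    using ae by (subst AE_distr_iff[OF param_measurable[OF \<psi>] borel_measurable_eq[OF lip_measurable[OF f] lip_measurable[OF g]]])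
  then show ?thesis unfolding param_distr[OF \<psi>] by (rule AE_eq_imp_eq[OF f g _ x])
qed

lemma dominated_param:
  assumes X: "gds X" and Y: "gds Y" and dom: "dominated Y X" and \<psi>: "\<psi> \<in> parameters X"
  shows "\<exists>\<phi>\<in>parameters Y. \<forall>f\<in>feat_closure Y. \<exists>f'\<in>feat_closure X. \<forall>t\<in>{0..1}. f (\<phi> t) = f' (\<psi> t)"
proof -
  interpret X: gds X by fact
  interpret Y: gds Y by fact
  obtain h where h: "h \<in> measurable (meas X) (meas Y)" "distr (meas X) (meas Y) h = meas Y"
    "pull (pts X) h (feat Y) \<subseteq> feat_closure X"
    using dom unfolding dominated_def by (elim exE conjE) (rule that)
  note hp = X.map_pts[OF Y h(1)]
  have "\<exists>f'\<in>feat_closure X. \<forall>t\<in>{0..1}. f (h (\<psi> t)) = f' (\<psi> t)" if "f \<in> feat_closure Y" for f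
    by (rule bexI[OF _ X.closure_pullback[OF Y hp h(3) that]]) (use X.param_pts[OF \<psi>] in \<open>simp add: compose_def\<close>)
  then show ?thesis by (intro bexI[OF _ param_image[OF X h(1,2) \<psi>]] ballI)
qed

text \<open>By \<open>param_in_ball\<close>, the partial map sending \<open>\<psi> t\<close> to \<open>\<phi> t\<close> has dense domain; it is \<open>1\<close>-Lipschitz and extends by completeness.\<close>

lemma dominated_map:
  assumes Y: "cgds Y L" and X: "gds X" and \<phi>: "\<phi> \<in> parameters Y" and \<psi>: "\<psi> \<in> parameters X"
    and approx: "\<And>f e. f \<in> feat_closure Y \<Longrightarrow> 0 < e \<Longrightarrow> \<exists>f'\<in>feat_closure X. close leb01 e (\<lambda>t. f (\<phi> t)) (\<lambda>t. f' (\<psi> t))"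
  obtains h where "h \<in> measurable (meas X) (meas Y)" "distr (meas X) (meas Y) h = meas Y" "pull (pts X) h (feat Y) \<subseteq> feat_closure X"
    "AE t in leb01. h (\<psi> t) = \<phi> t" "\<And>x. x \<in> pts X \<Longrightarrow> h x \<in> pts Y"
    "\<And>x x'. x \<in> pts X \<Longrightarrow> x' \<in> pts X \<Longrightarrow> gds_dist Y (h x) (h x') \<le> gds_dist X x x'"
proof -
  interpret Y: cgds Y L by fact
  interpret X: gds X by fact
  have eq: "\<exists>f'\<in>feat_closure X. AE t in leb01. f (\<phi> t) = f' (\<psi> t)" if f: "f \<in> feat_closure Y" for f
    by (rule X.closure_complete[OF \<psi> Y.param_closure_measurable[OF \<phi> f] approx[OF f]])
  have "\<forall>i. \<exists>f'. f' \<in> feat_closure X \<and> (AE t in leb01. Y.bseq i (\<phi> t) = f' (\<psi> t))"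
    using eq[OF Y.bseq_closure] by (simp add: Bex_def)
  from choice[OF this] obtain z where z0: "\<forall>i. z i \<in> feat_closure X \<and> (AE t in leb01. Y.bseq i (\<phi> t) = z i (\<psi> t))"
    by (elim exE)
  note zc = conjunct1[OF spec[OF z0]] and zAE = conjunct2[OF spec[OF z0]]
  have zall: "AE t in leb01. \<forall>i. Y.bseq i (\<phi> t) = z i (\<psi> t)"
    unfolding AE_all_countable by (intro allI zAE)
  define h where "h x = Y.decode_bseq (\<lambda>i. z i x)" for x
  have h_ex: "h x \<in> pts Y \<and> (\<forall>i. Y.bseq i (h x) = z i x)" if x: "x \<in> pts X" for x
  proof -
    have "\<exists>y\<in>pts Y. \<forall>i. Y.bseq i y = z i x"
    proof (rule Y.bseq_limit)
      fix e :: real assume "0 < e"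
      \<comment> \<open>Arbitrarily near x there is a parameter value at which all the countably
        many identities hold, so the values \<open>z i x\<close> are approximated by those of an
        actual point of Y.\<close>
      from X.param_in_ball[OF \<psi> zall x this] obtain t where t: "t \<in> {0..1}" "\<forall>i. Y.bseq i (\<phi> t) = z i (\<psi> t)" "gds_dist X x (\<psi> t) < e"
        by (elim bexE conjE)
      have "\<bar>Y.bseq i (\<phi> t) - z i x\<bar> \<le> e" for i
        using X.lipD[OF X.closure_lip[OF zc[of i]] x X.param_pts[OF \<psi> t(1)]] t(3) unfolding spec[OF t(2)] by linarith
      then show "\<exists>y\<in>pts Y. \<forall>i. \<bar>Y.bseq i y - z i x\<bar> \<le> e" using Y.param_pts[OF \<phi> t(1)] by blast
    qed
    then obtain y where y: "y \<in> pts Y" "\<forall>i. Y.bseq i y = z i x" by (elim bexE)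
    then have "(\<lambda>i. z i x) = (\<lambda>i. Y.bseq i y)" by simp
    then have "h x = y" unfolding h_def using Y.decode_bseq(2)[OF y(1)] by simp
    then show ?thesis using y by simp
  qed
  note h = conjunct1[OF h_ex] spec[OF conjunct2[OF h_ex]]
  have hlip: "gds_dist Y (h x) (h x') \<le> gds_dist X x x'" if x: "x \<in> pts X" "x' \<in> pts X" for x x'
  proof (rule Y.bseq_dist_le[OF h(1)[OF x(1)] h(1)[OF x(2)]])
    fix i
    show "\<bar>Y.bseq i (h x) - Y.bseq i (h x')\<bar> \<le> gds_dist X x x'"
      unfolding h(2)[OF x(1)] h(2)[OF x(2)] by (rule X.lipD[OF X.closure_lip[OF zc] x])
  qed
  have "(\<lambda>x i. z i x) \<in> measurable (meas X) RN" unfolding measurable_RN_iff by (intro allI X.closure_measurable zc)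
  then have hm: "h \<in> measurable (meas X) (meas Y)" unfolding h_def by (rule measurable_compose[OF _ Y.decode_bseq(1)])
  have hAE: "AE t in leb01. h (\<psi> t) = \<phi> t"
    using zall
  proof (rule AE_mp, intro AE_I2 impI)
    fix t assume t: "t \<in> space leb01" and e: "\<forall>i. Y.bseq i (\<phi> t) = z i (\<psi> t)"
    then have "(\<lambda>i. z i (\<psi> t)) = (\<lambda>i. Y.bseq i (\<phi> t))" by simp
    then show "h (\<psi> t) = \<phi> t" unfolding h_def using Y.decode_bseq(2)[OF Y.param_pts[OF \<phi>, of t]] t by simp
  qed
  have "distr (meas X) (meas Y) h = distr leb01 (meas Y) (\<lambda>t. h (\<psi> t))"
    using distr_distr[OF hm X.param_measurable[OF \<psi>]] X.param_distr[OF \<psi>] by (simp add: comp_def)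
  also have "\<dots> = distr leb01 (meas Y) \<phi>"
    by (rule distr_cong_AE[OF refl refl hAE measurable_compose[OF X.param_measurable[OF \<psi>] hm] Y.param_measurable[OF \<phi>]])
  also have "\<dots> = meas Y" by (rule Y.param_distr[OF \<phi>])
  finally have hd: "distr (meas X) (meas Y) h = meas Y" .
  have "pull (pts X) h (feat Y) \<subseteq> feat_closure X"
  proof
    fix g assume "g \<in> pull (pts X) h (feat Y)"
    then obtain f where f: "f \<in> feat Y" and g: "g = compose (pts X) f h" by (auto simp: pull_def)
    from eq[OF Y.feat_subset_closure[OF f]] obtain f' where f': "f' \<in> feat_closure X" and e: "AE t in leb01. f (\<phi> t) = f' (\<psi> t)"
      by (elim bexE)
    have glip: "X.lip g"
      unfolding X.lip_def
    proof (intro ballI)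
      fix x x' assume x: "x \<in> pts X" "x' \<in> pts X"
      have "\<bar>f (h x) - f (h x')\<bar> \<le> gds_dist Y (h x) (h x')"
        by (rule Y.lipD[OF Y.feat_lip[OF f] h(1)[OF x(1)] h(1)[OF x(2)]])
      then show "\<bar>g x - g x'\<bar> \<le> gds_dist X x x'" using hlip[OF x] x by (simp add: g compose_def)
    qed
    have ae: "AE t in leb01. g (\<psi> t) = f' (\<psi> t)"
      using e hAE
    proof (rule AE_mp[OF _ AE_mp], intro AE_I2 impI)
      fix t assume t: "t \<in> space leb01" and "h (\<psi> t) = \<phi> t" "f (\<phi> t) = f' (\<psi> t)"
      then show "g (\<psi> t) = f' (\<psi> t)" using X.param_pts[OF \<psi>, of t] by (simp add: g compose_def)
    qed
    \<comment> \<open>Both functions are Lipschitz and agree almost everywhere along \<psi>, hence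
      everywhere by full support.\<close>
    have "g = f'"
    proof (rule extensionalityI)
      show "g \<in> extensional (pts X)" unfolding g by (rule compose_extensional)
      show "f' \<in> extensional (pts X)" by (rule X.feat_closure_ext[OF f'])
      show "g x = f' x" if "x \<in> pts X" for x by (rule X.param_AE_imp_eq[OF \<psi> glip X.closure_lip[OF f'] ae that])
    qed
    then show "g \<in> feat_closure X" using f' by simp
  qed
  then show thesis using that hm hd hAE h(1) hlip by blast
qed

text \<open>The working form of domination: one pair of parameters suffices, tested approximately
  and feature by feature.\<close>

lemma dominated_criterion:
  assumes Y: "cgds Y L" and X: "gds X" and \<phi>: "\<phi> \<in> parameters Y" and \<psi>: "\<psi> \<in> parameters X"
    and approx: "\<And>f e. f \<in> feat_closure Y \<Longrightarrow> 0 < e \<Longrightarrow> \<exists>f'\<in>feat_closure X. close leb01 e (\<lambda>t. f (\<phi> t)) (\<lambda>t. f' (\<psi> t))"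
  shows "dominated Y X"
  by (rule dominated_map[OF assms]) (unfold dominated_def, blast+)

lemma dominated_trans:
  assumes X: "cgds X L" and Y: "gds Y" and Z: "cgds Z L" and ZY: "dominated Z Y" and YX: "dominated Y X"
  shows "dominated Z X"
proof -
  interpret X: cgds X L by fact
  interpret Z: cgds Z L by fact
  obtain \<psi> where \<psi>: "\<psi> \<in> parameters X" using X.params_nonempty by (elim exE)
  from dominated_param[OF X.gds_axioms Y YX \<psi>] obtain \<phi> where \<phi>: "\<phi> \<in> parameters Y"
    and 1: "\<forall>f\<in>feat_closure Y. \<exists>f'\<in>feat_closure X. \<forall>t\<in>{0..1}. f (\<phi> t) = f' (\<psi> t)" by (elim bexE)
  from dominated_param[OF Y Z.gds_axioms ZY \<phi>] obtain \<xi> where \<xi>: "\<xi> \<in> parameters Z"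
    and 2: "\<forall>f\<in>feat_closure Z. \<exists>f'\<in>feat_closure Y. \<forall>t\<in>{0..1}. f (\<xi> t) = f' (\<phi> t)" by (elim bexE)
  show ?thesis
  proof (rule dominated_criterion[OF Z X.gds_axioms \<xi> \<psi>])
    fix f and e :: real assume f: "f \<in> feat_closure Z" and e: "0 < e"
    from bspec[OF 2 f] obtain f' where f': "f' \<in> feat_closure Y" "\<forall>t\<in>{0..1}. f (\<xi> t) = f' (\<phi> t)" by (elim bexE)
    from bspec[OF 1 f'(1)] obtain g where g: "g \<in> feat_closure X" "\<forall>t\<in>{0..1}. f' (\<phi> t) = g (\<psi> t)" by (elim bexE)
    have "close leb01 e (\<lambda>t. f (\<xi> t)) (\<lambda>t. g (\<psi> t))"
      by (rule leb01.close_pointwise) (use f'(2) g(2) e in auto)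
    then show "\<exists>g\<in>feat_closure X. close leb01 e (\<lambda>t. f (\<xi> t)) (\<lambda>t. g (\<psi> t))" by (rule bexI[OF _ g(1)])
  qed
qed

lemma dominated_refl: "gds X \<Longrightarrow> dominated X X"
proof -
  assume "gds X"
  then interpret X: gds X .
  have "pull (pts X) (\<lambda>x. x) (feat X) \<subseteq> feat_closure X"
  proof
    fix g assume "g \<in> pull (pts X) (\<lambda>x. x) (feat X)"
    then obtain f where f: "f \<in> feat X" "g = compose (pts X) f (\<lambda>x. x)" by (auto simp: pull_def)
    have "compose (pts X) f (\<lambda>x. x) = f"
      using X.feat_ext[OF f(1)] by (auto simp: compose_def fun_eq_iff extensional_def)
    then show "g \<in> feat_closure X" using f X.feat_subset_closure by simp
  qed
  then show ?thesis
    unfolding dominated_def by (intro exI[of _ "\<lambda>x. x"]) (simp add: distr_id)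
qed

text \<open>For the direction against the isomorphism a parameter of X is pushed forward to Y; each
  feature of X is a pullback, so the features match exactly along the two parameters.\<close>

lemma iso_imp_dominated:
  assumes X: "cgds X L" and Y: "cgds Y L" and iso: "gds_iso X Y"
  shows "dominated Y X" "dominated X Y"
proof -
  interpret X: cgds X L by fact
  interpret Y: cgds Y L by fact
  obtain h where h: "h \<in> measurable (meas X) (meas Y)" "distr (meas X) (meas Y) h = meas Y"
    and F: "pull (pts X) h (feat_closure Y) = feat_closure X"
    using iso unfolding gds_iso_def by (elim exE conjE) (rule that)
  have "pull (pts X) h (feat Y) \<subseteq> pull (pts X) h (feat_closure Y)"
    unfolding pull_def by (intro image_mono subsetI Y.feat_subset_closure)
  then show "dominated Y X" unfolding dominated_def using h F by blast
  obtain \<phi> where \<phi>: "\<phi> \<in> parameters X" using X.params_nonempty by (elim exE)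
  have h\<phi>: "(\<lambda>t. h (\<phi> t)) \<in> parameters Y" by (rule param_image[OF X.gds_axioms h \<phi>])
  show "dominated X Y"
  proof (rule dominated_criterion[OF X Y.gds_axioms \<phi> h\<phi>])
    fix f and e :: real assume f: "f \<in> feat_closure X" and e: "0 < e"
    then obtain g where g: "g \<in> feat_closure Y" "f = compose (pts X) g h" unfolding F[symmetric] pull_def by blast
    have "close leb01 e (\<lambda>t. f (\<phi> t)) (\<lambda>t. g (h (\<phi> t)))"
      by (rule leb01.close_pointwise) (use X.param_pts[OF \<phi>] e in \<open>auto simp: g(2) compose_def\<close>)
    then show "\<exists>g\<in>feat_closure Y. close leb01 e (\<lambda>t. f (\<phi> t)) (\<lambda>t. g (h (\<phi> t)))" by (rule bexI[OF _ g(1)])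
  qed
qed

lemma iso_cgds:
  assumes X: "gds X" and Y: "gds Y" and iso: "gds_iso X Y"
  shows "cgds X L \<longleftrightarrow> cgds Y L"
proof -
  interpret X: gds X by fact
  interpret Y: gds Y by fact
  obtain h where bij: "bij_betw h (pts X) (pts Y)"
    and F: "pull (pts X) h (feat_closure Y) = feat_closure X"
    using iso unfolding gds_iso_def by (elim exE conjE) (rule that)
  have hp: "h x \<in> pts Y" if "x \<in> pts X" for x using bij that by (auto simp: bij_betw_def)
  have cc: "compose (pts X) (compose (pts Y) p f) h = compose (pts X) p (compose (pts X) f h)" for p :: "real \<Rightarrow> real" and f
    by (rule ext) (simp add: compose_def hp)
  have "lcomp (pts X) L (feat_closure X) \<subseteq> feat_closure X \<longleftrightarrow> lcomp (pts Y) L (feat_closure Y) \<subseteq> feat_closure Y"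
  proof
    assume Yi: "lcomp (pts Y) L (feat_closure Y) \<subseteq> feat_closure Y"
    show "lcomp (pts X) L (feat_closure X) \<subseteq> feat_closure X"
    proof
      fix g assume "g \<in> lcomp (pts X) L (feat_closure X)"
      then obtain p f where pf: "p \<in> L" "f \<in> feat_closure X" "g = compose (pts X) p f" by (auto simp: lcomp_def)
      then obtain f' where f': "f' \<in> feat_closure Y" "f = compose (pts X) f' h" unfolding F[symmetric] pull_def by blast
      have "compose (pts Y) p f' \<in> feat_closure Y" using Yi pf(1) f'(1) by (auto simp: lcomp_def)
      then have "compose (pts X) (compose (pts Y) p f') h \<in> feat_closure X" unfolding F[symmetric] pull_def by (rule imageI)
      then show "g \<in> feat_closure X" unfolding cc pf(3) f'(2) .
    qed
  next
    assume Xi: "lcomp (pts X) L (feat_closure X) \<subseteq> feat_closure X"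
    show "lcomp (pts Y) L (feat_closure Y) \<subseteq> feat_closure Y"
    proof
      fix g assume "g \<in> lcomp (pts Y) L (feat_closure Y)"
      then obtain p f where pf: "p \<in> L" "f \<in> feat_closure Y" "g = compose (pts Y) p f" by (auto simp: lcomp_def)
      have "compose (pts X) f h \<in> feat_closure X" unfolding F[symmetric] pull_def using pf(2) by (rule imageI)
      then have "compose (pts X) g h \<in> feat_closure X" unfolding pf(3) cc using Xi pf(1) by (auto simp: lcomp_def)
      then obtain g' where g': "g' \<in> feat_closure Y" "compose (pts X) g h = compose (pts X) g' h"
        unfolding F[symmetric] pull_def by blast
      have "g = g'"
      proof (rule extensionalityI)
        show "g \<in> extensional (pts Y)" unfolding pf(3) by (rule compose_extensional)
        show "g' \<in> extensional (pts Y)" by (rule Y.feat_closure_ext[OF g'(1)])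
        fix y assume "y \<in> pts Y"
        then have "y \<in> h ` pts X" using bij by (simp add: bij_betw_def)
        then obtain x where x: "x \<in> pts X" "h x = y" by (elim imageE) (rule that, auto)
        show "g y = g' y" using fun_cong[OF g'(2), of x] x by (simp add: compose_def)
      qed
      then show "g \<in> feat_closure Y" using g'(1) by simp
    qed
  qed
  then show ?thesis
    unfolding cgds_def cgds_axioms_def using X Y by simp
qed

section \<open>Total boundedness of features and compactness relative to L\<close>

context cgds
begin

lemma floor_code_finite:
  assumes "finite T" "T \<subseteq> pts X" "0 < a" "\<And>f x. f \<in> F \<Longrightarrow> x \<in> T \<Longrightarrow> \<bar>f x\<bar> \<le> R"
  shows "finite ((\<lambda>f. restrict (\<lambda>x. \<lfloor>f x / a\<rfloor>) T) ` F)"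
proof (rule finite_subset)
  show "finite (PiE T (\<lambda>_. {\<lfloor>- R / a\<rfloor>..\<lfloor>R / a\<rfloor>}))" using assms(1) by (intro finite_PiE) auto
  have "\<lfloor>- R / a\<rfloor> \<le> \<lfloor>f x / a\<rfloor> \<and> \<lfloor>f x / a\<rfloor> \<le> \<lfloor>R / a\<rfloor>" if "f \<in> F" "x \<in> T" for f x
    using assms(4)[OF that] assms(3) by (intro conjI floor_mono divide_right_mono) (auto simp: abs_le_iff)
  then show "(\<lambda>f. restrict (\<lambda>x. \<lfloor>f x / a\<rfloor>) T) ` F \<subseteq> PiE T (\<lambda>_. {\<lfloor>- R / a\<rfloor>..\<lfloor>R / a\<rfloor>})"
    by auto
qed

lemma floor_code_eq_imp_close:
  assumes "restrict (\<lambda>x. \<lfloor>f x / a\<rfloor>) T = restrict (\<lambda>x. \<lfloor>g x / a\<rfloor>) T" "x \<in> T" "0 < (a::real)"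
  shows "\<bar>f x - g x\<bar> \<le> a"
proof -
  have "\<lfloor>f x / a\<rfloor> = \<lfloor>g x / a\<rfloor>" using fun_cong[OF assms(1), of x] assms(2) by simp
  then have "\<bar>f x / a - g x / a\<bar> \<le> 1"
    using floor_correct[of "f x / a"] floor_correct[of "g x / a"] by linarith
  moreover have "\<bar>f x / a - g x / a\<bar> = \<bar>f x - g x\<bar> / a"
    using assms(3) by (simp add: abs_divide diff_divide_distrib[symmetric])
  ultimately show ?thesis using assms(3) by simp
qed

text \<open>Since the features are equicontinuous, they are totally bounded up to translation.\<close>

lemma finite_feature_net:
  assumes T: "finite T" "T \<subseteq> pts X" "T \<noteq> {}" and a: "0 < a"
  shows "\<exists>N. finite N \<and> N \<subseteq> feat_closure X \<and> (\<forall>f\<in>feat_closure X. \<exists>n\<in>N. \<exists>c. \<forall>x\<in>T. \<bar>f x - (n x + c)\<bar> \<le> a)"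
proof -
  \<comment> \<open>Subtracting the value at \<open>x1\<close> removes the translations. The
    remaining values on \<open>T\<close> are bounded by distances within \<open>T\<close>, so
    rounding leaves finitely many codes.\<close>
  obtain x1 where x1: "x1 \<in> T" using T by blast
  define code where "code f = restrict (\<lambda>x. \<lfloor>(f x - f x1) / a\<rfloor>) T" for f :: "'a \<Rightarrow> real"
  define R where "R = Max ((\<lambda>x. gds_dist X x x1) ` T)"
  have "finite ((\<lambda>f. restrict (\<lambda>x. \<lfloor>f x / a\<rfloor>) T) ` ((\<lambda>f x. f x - f x1) ` feat_closure X))"
  proof (rule floor_code_finite[OF T(1,2) a, of _ R])
    fix g x assume "g \<in> (\<lambda>f x. f x - f x1) ` feat_closure X" and x: "x \<in> T"
    then obtain f where f: "f \<in> feat_closure X" "g = (\<lambda>x. f x - f x1)" by blast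
    have "gds_dist X x x1 \<le> R" unfolding R_def using T x by (intro Max_ge) auto
    then show "\<bar>g x\<bar> \<le> R" unfolding f(2) using lipD[OF closure_lip[OF f(1)], of x x1] x x1 T by force
  qed
  then have fin: "finite (code ` feat_closure X)" by (simp add: image_image code_def)
  define N where "N = inv_into (feat_closure X) code ` (code ` feat_closure X)"
  have "finite N" using fin by (simp add: N_def)
  moreover have "N \<subseteq> feat_closure X" unfolding N_def by (auto intro: inv_into_into)
  moreover have "\<exists>n\<in>N. \<exists>c. \<forall>x\<in>T. \<bar>f x - (n x + c)\<bar> \<le> a" if f: "f \<in> feat_closure X" for f
  proof -
    define n where "n = inv_into (feat_closure X) code (code f)"
    have "n \<in> N" unfolding N_def n_def by (rule imageI, rule imageI, rule f)
    moreover have "code n = code f" unfolding n_def by (rule f_inv_into_f[of "code f" code "feat_closure X", OF imageI[OF f]])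
    then have "\<bar>(f x - f x1) - (n x - n x1)\<bar> \<le> a" if "x \<in> T" for x
      unfolding code_def using floor_code_eq_imp_close[of "\<lambda>x. f x - f x1" a T "\<lambda>x. n x - n x1" x] that a by simp
    then have "\<forall>x\<in>T. \<bar>f x - (n x + (f x1 - n x1))\<bar> \<le> a" by (simp add: algebra_simps)
    ultimately show ?thesis by (intro bexI[of _ n] exI[of _ "f x1 - n x1"])
  qed
  ultimately show ?thesis by (intro exI[of _ N] conjI ballI)
qed

lemma closure_shift: "f \<in> feat_closure X \<Longrightarrow> restrict (\<lambda>x. f x + c) (pts X) \<in> feat_closure X"
  using post[OF L_shift, of f c] by (simp add: compose_def)

lemma closure_clip: "f \<in> feat_closure X \<Longrightarrow> 0 \<le> R \<Longrightarrow> restrict (\<lambda>x. clip R (f x)) (pts X) \<in> feat_closure X"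
  using post[OF L_clip, of R f] by (simp add: compose_def)

lemma closure_const: "restrict (\<lambda>x. c) (pts X) \<in> feat_closure X"
proof -
  obtain f where "f \<in> feat_closure X" using feat_nonempty feat_subset_closure by blast
  then show ?thesis using post[OF L_const, of f c] by (simp add: compose_def)
qed

end

context prob_space
begin

lemma ky_fan_le:
  assumes "close M e u v" "0 \<le> e"
  shows "ky_fan M u v \<le> ennreal e"
  unfolding ky_fan_def
proof (rule Inf_lower, rule CollectI)
  have "{x \<in> space M. ennreal e < ennreal \<bar>u x - v x\<bar>} = {x \<in> space M. e < \<bar>u x - v x\<bar>}"
    using assms(2) by (simp add: ennreal_less_iff)
  then show "emeasure M {x \<in> space M. ennreal e < ennreal \<bar>u x - v x\<bar>} \<le> ennreal e"
    using assms(1) by (simp add: emeasure_eq_measure close_def ennreal_leI)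
qed

lemma ky_fan_less:
  assumes "ky_fan M u v < ennreal e"
  shows "\<exists>e'. 0 \<le> e' \<and> e' < e \<and> close M e' u v"
proof -
  obtain r where r: "emeasure M {x \<in> space M. r < ennreal \<bar>u x - v x\<bar>} \<le> r" "r < ennreal e"
    using assms unfolding ky_fan_def Inf_less_iff by blast
  then obtain e' where e': "r = ennreal e'" "0 \<le> e'" by (cases r) auto
  have lt: "e' < e" using r(2) e' by (simp add: ennreal_less_iff)
  have "{x \<in> space M. r < ennreal \<bar>u x - v x\<bar>} = {x \<in> space M. e' < \<bar>u x - v x\<bar>}"
    using e' by (simp add: ennreal_less_iff)
  then have "ennreal (measure M {x \<in> space M. e' < \<bar>u x - v x\<bar>}) \<le> ennreal e'"
    using r(1) e'(1) by (simp add: emeasure_eq_measure)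
  then have "close M e' u v" using e'(2) by (simp add: close_def)
  then show ?thesis using lt e'(2) by blast
qed

end

text \<open>A finite net up to translation is a net relative to L, as L contains the translations.
  With mesh e/6 the Ky Fan distance is at most e/2, which leaves the inequality strict.\<close>

lemma (in cgds) l_compact: "l_compact L X"
  unfolding l_compact_def
proof (intro conjI inv allI impI)
  fix e :: real assume e: "0 < e"
  obtain T where T: "finite T" "T \<subseteq> pts X" "T \<noteq> {}" "1 - e / 6 < measure (meas X) (\<Union>x\<in>T. M.mball x (e / 6))"
    by (rule finite_net[of "e / 6"]) (use e in auto)
  have e6: "0 < e / 6" using e by simp
  from finite_feature_net[OF T(1-3) e6] obtain N where N: "finite N" "N \<subseteq> feat_closure X"
    and net: "\<forall>f\<in>feat_closure X. \<exists>n\<in>N. \<exists>c. \<forall>x\<in>T. \<bar>f x - (n x + c)\<bar> \<le> e / 6"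
    by (elim exE conjE)
  have "feat_closure X \<subseteq> nbhd (ky_fan (meas X)) (lcomp (pts X) L N) (ennreal e)"
  proof
    fix f assume f: "f \<in> feat_closure X"
    from bspec[OF net f] obtain n c where n: "n \<in> N" and le: "\<forall>x\<in>T. \<bar>f x - (n x + c)\<bar> \<le> e / 6" by (elim bexE exE)
    define g where "g = compose (pts X) (\<lambda>r. r + c) n"
    have nF: "n \<in> feat_closure X" using n N(2) by blast
    have gF: "g \<in> feat_closure X" unfolding g_def by (rule post[OF L_shift nF])
    have gL: "g \<in> lcomp (pts X) L N" unfolding g_def lcomp_def using n L_shift[of c] by (intro image_eqI[of _ _ "(\<lambda>r. r + c, n)"]) auto
    have "close (meas X) (3 * (e / 6)) g f"
    proof (rule close_of_agree[OF closure_lip[OF gF] closure_lip[OF f] T(2,1,4) _ e6])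
      fix x assume x: "x \<in> T"
      then have "g x = n x + c" using T(2) by (auto simp: g_def compose_def)
      then show "\<bar>g x - f x\<bar> \<le> e / 6" using bspec[OF le x] by (simp add: abs_minus_commute)
    qed
    then have "ky_fan (meas X) g f \<le> ennreal (3 * (e / 6))" by (rule P.ky_fan_le) (use e in simp)
    also have "\<dots> < ennreal e" using e by (intro ennreal_lessI) auto
    finally show "f \<in> nbhd (ky_fan (meas X)) (lcomp (pts X) L N) (ennreal e)"
      unfolding nbhd_def using gL by blast
  qed
  then have "Cov L X (feat_closure X) e \<le> enat (card N)"
    unfolding Cov_def using N by (intro Inf_lower) blast
  then show "Cov L X (feat_closure X) e < \<infinity>" by (rule le_less_trans) simp
qed

text \<open>Iterating the two dominating maps turns a feature \<open>f\<close> into a sequence in a totally bounded set;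
  two terms of it are close, and cancelling the common iterate shows that \<open>f\<close> almost factors through \<open>h\<close>.\<close>

lemma mutual_factor:
  assumes X: "cgds X L" and Y: "cgds Y L"
    and h: "h \<in> measurable (meas X) (meas Y)" "distr (meas X) (meas Y) h = meas Y" "pull (pts X) h (feat Y) \<subseteq> feat_closure X"
    and k: "k \<in> measurable (meas Y) (meas X)" "distr (meas Y) (meas X) k = meas X" "pull (pts Y) k (feat X) \<subseteq> feat_closure Y"
    and f: "f \<in> feat_closure X" and \<epsilon>: "0 < \<epsilon>"
  shows "\<exists>g\<in>feat_closure Y. close (meas X) \<epsilon> f (\<lambda>x. g (h x))"
proof -
  interpret X: cgds X L by fact
  interpret Y: cgds Y L by fact
  note hp = X.map_pts[OF Y.gds_axioms h(1)]
  note kp = Y.map_pts[OF X.gds_axioms k(1)]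
  define w where "w x = k (h x)" for x
  have wm: "w \<in> measurable (meas X) (meas X)" unfolding w_def by (rule measurable_compose[OF h(1) k(1)])
  have wd: "distr (meas X) (meas X) w = meas X"
    using distr_distr[OF k(1) h(1)] unfolding h(2) k(2) comp_def w_def by simp
  from \<epsilon> have d: "0 < \<epsilon> / 6" by simp
  obtain S where S: "finite S" "S \<subseteq> pts X" "1 - \<epsilon> / 6 < measure (meas X) (\<Union>x\<in>S. X.M.mball x (\<epsilon> / 6))" by (rule X.finite_net[OF d])
  \<comment> \<open>Clipping at a bound for the values on the net changes f little in measure and
    bounds all iterates, so that their codes lie in a finite set.\<close>
  define R where "R = (\<Sum>x\<in>S. \<bar>f x\<bar>)"
  have R: "0 \<le> R" "\<And>x. x \<in> S \<Longrightarrow> \<bar>f x\<bar> \<le> R" unfolding R_def using S(1) by (auto intro: sum_nonneg member_le_sum)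
  define f0 where "f0 = restrict (\<lambda>x. X.clip R (f x)) (pts X)"
  have f0F: "f0 \<in> feat_closure X" unfolding f0_def by (rule X.closure_clip[OF f R(1)])
  have ff0: "close (meas X) (3 * (\<epsilon> / 6)) f f0"
    by (rule X.close_of_agree[OF X.closure_lip[OF f] X.closure_lip[OF f0F] S(2,1,3) _ d])
      (use R(2) S(2) \<epsilon> in \<open>auto simp: f0_def X.clip_id subset_iff\<close>)
  define step where "step g = compose (pts Y) g k" for g :: "'a \<Rightarrow> real"
  \<comment> \<open>\<open>F n\<close> is \<open>f0\<close> composed with the n-th iterate of
    \<open>w\<close>, written so that every positive iterate visibly factors through
    \<open>h\<close>.\<close>
  define F where "F = rec_nat f0 (\<lambda>_ g. compose (pts X) (step g) h)"
  have F0: "F 0 = f0" and FS: "F (Suc n) = compose (pts X) (step (F n)) h" for n by (simp_all add: F_def)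
  have stepF: "step g \<in> feat_closure Y" if "g \<in> feat_closure X" for g
    unfolding step_def by (rule Y.closure_pullback[OF X.gds_axioms kp k(3) that])
  have FX: "F n \<in> feat_closure X" for n
    by (induction n) (simp_all only: F0 FS f0F X.closure_pullback[OF Y.gds_axioms hp h(3) stepF])
  note Fm = X.closure_measurable[OF FX]
  have Fw: "F (Suc n) x = F n (w x)" if "x \<in> pts X" for n x
    unfolding FS using that hp by (simp add: compose_def step_def w_def)
  have FR: "\<bar>F n x\<bar> \<le> R" if "x \<in> pts X" for n x
    using that
  proof (induction n arbitrary: x)
    case 0
    then show ?case using X.abs_clip[OF R(1)] by (simp add: F0 f0_def)
  next
    case (Suc n)
    then show ?case using Fw hp kp by (simp add: w_def)
  qed
  define code where "code g = restrict (\<lambda>x. \<lfloor>g x / (\<epsilon> / 6)\<rfloor>) S" for g :: "'a \<Rightarrow> real"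
  have "finite (code ` range F)"
    unfolding code_def by (rule X.floor_code_finite[OF S(1,2) d, of _ R]) (use FR S(2) in auto)
  then have "finite (range (\<lambda>n. code (F n)))" by (simp add: image_image)
  then have "\<not> inj (\<lambda>n. code (F n))" using finite_imageD infinite_UNIV_nat by blast
  then have "\<exists>n m. n < m \<and> code (F n) = code (F m)"
    unfolding inj_on_def by (metis linorder_neqE_nat)
  then obtain n m where nm: "n < m" "code (F n) = code (F m)" by (elim exE conjE)
  have "close (meas X) (3 * (\<epsilon> / 6)) (F n) (F m)"
    by (rule X.close_of_agree[OF X.closure_lip[OF FX] X.closure_lip[OF FX] S(2,1,3) _ d])
      (rule X.floor_code_eq_imp_close[OF nm(2)[unfolded code_def] _ d])
  then have cl: "close (meas X) (\<epsilon> / 2) (F n) (F m)" by simp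
  \<comment> \<open>Since \<open>w\<close> preserves the measure, it can be cancelled from both
    sides.\<close>
  have down: "close (meas X) (\<epsilon> / 2) (F (Suc i)) (F (Suc j)) \<Longrightarrow> close (meas X) (\<epsilon> / 2) (F i) (F j)" for i j
  proof -
    assume "close (meas X) (\<epsilon> / 2) (F (Suc i)) (F (Suc j))"
    then have "close (meas X) (\<epsilon> / 2) (\<lambda>x. F i (w x)) (\<lambda>x. F j (w x))"
      by (subst (asm) close_cong[of _ _ "\<lambda>x. F i (w x)" _ "\<lambda>x. F j (w x)"]) (simp_all add: X.space_meas Fw)
    then have "close (distr (meas X) (meas X) w) (\<epsilon> / 2) (F i) (F j)" by (subst close_distr[OF wm Fm Fm])
    then show ?thesis by (simp only: wd)
  qed
  have "close (meas X) (\<epsilon> / 2) (F (i + l)) (F (j + l)) \<Longrightarrow> close (meas X) (\<epsilon> / 2) (F i) (F j)" for i j l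
  proof (induction l)
    case (Suc l)
    have "close (meas X) (\<epsilon> / 2) (F (Suc (i + l))) (F (Suc (j + l)))" using Suc.prems by simp
    from Suc.IH[OF down[OF this]] show ?case .
  qed simp
  from this[of 0 n "m - n"] have cl0: "close (meas X) (\<epsilon> / 2) (F 0) (F (m - n))" using cl nm(1) by simp
  obtain j where j: "m - n = Suc j" using nm(1) by (metis Suc_diff_Suc)
  from X.P.close_triangle[OF ff0 cl0[unfolded F0] X.closure_measurable[OF f] X.closure_measurable[OF f0F] Fm]
  have "close (meas X) \<epsilon> f (F (Suc j))" by (simp add: j)
  then have "close (meas X) \<epsilon> f (\<lambda>x. step (F j) (h x))"
    by (subst (asm) close_cong[of _ f f _ "\<lambda>x. step (F j) (h x)"]) (simp_all add: X.space_meas FS compose_def)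
  then show ?thesis by (rule bexI[OF _ stepF[OF FX]])
qed

text \<open>Along a parameter, hence on a dense set, \<open>k\<close> inverts \<open>h\<close>; both
  maps are 1-Lipschitz, so the identity extends to every point.\<close>

lemma (in cgds) AE_inverse_imp_inverse:
  assumes Y: "gds Y" and \<phi>: "\<phi> \<in> parameters X" and h: "\<And>x. x \<in> pts X \<Longrightarrow> h x \<in> pts Y" and k: "\<And>y. y \<in> pts Y \<Longrightarrow> k y \<in> pts X"
    and hl: "\<And>x x'. x \<in> pts X \<Longrightarrow> x' \<in> pts X \<Longrightarrow> gds_dist Y (h x) (h x') \<le> gds_dist X x x'"
    and kl: "\<And>y y'. y \<in> pts Y \<Longrightarrow> y' \<in> pts Y \<Longrightarrow> gds_dist X (k y) (k y') \<le> gds_dist Y y y'"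
    and 1: "AE t in leb01. h (\<phi> t) = \<psi> t" and 2: "AE t in leb01. k (\<psi> t) = \<phi> t" and x: "x \<in> pts X"
  shows "k (h x) = x"
proof -
  have "bseq i (k (h x)) = bseq i x" for i
  proof (rule param_AE_imp_eq[OF \<phi> _ closure_lip[OF bseq_closure] _ x])
    show "lip (\<lambda>x. bseq i (k (h x)))"
      unfolding lip_def
    proof (intro ballI)
      fix x y assume xy: "x \<in> pts X" "y \<in> pts X"
      from lipD[OF closure_lip[OF bseq_closure[of i]] k[OF h[OF xy(1)]] k[OF h[OF xy(2)]]] kl[OF h[OF xy(1)] h[OF xy(2)]] hl[OF xy]
      show "\<bar>bseq i (k (h x)) - bseq i (k (h y))\<bar> \<le> gds_dist X x y" by linarith
    qed
    show "AE t in leb01. bseq i (k (h (\<phi> t))) = bseq i (\<phi> t)"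
      using 1 2 by eventually_elim simp
  qed
  then have "gds_dist X (k (h x)) x \<le> 0" by (intro bseq_dist_le k h x) simp
  then show ?thesis using M.zero[OF k[OF h[OF x]] x] M.nonneg[of "k (h x)" x] by simp
qed

text \<open>The two given dominating maps need not be inverse to each other. They only serve to
  match the features of X and Y in both directions along one pair of parameters; the maps rebuilt
  from this matching are inverse to each other.\<close>

lemma mutual_iso:
  assumes X: "cgds X L" and Y: "cgds Y L" and YX: "dominated Y X" and XY: "dominated X Y"
  shows "gds_iso X Y"
proof -
  interpret X: cgds X L by fact
  interpret Y: cgds Y L by fact
  obtain h0 where h0: "h0 \<in> measurable (meas X) (meas Y)" "distr (meas X) (meas Y) h0 = meas Y" "pull (pts X) h0 (feat Y) \<subseteq> feat_closure X"
    using YX unfolding dominated_def by (elim exE conjE) (rule that)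
  obtain k0 where k0: "k0 \<in> measurable (meas Y) (meas X)" "distr (meas Y) (meas X) k0 = meas X" "pull (pts Y) k0 (feat X) \<subseteq> feat_closure Y"
    using XY unfolding dominated_def by (elim exE conjE) (rule that)
  obtain \<phi> where \<phi>: "\<phi> \<in> parameters X" using X.params_nonempty by (elim exE)
  note hp0 = X.map_pts[OF Y.gds_axioms h0(1)]
  \<comment> \<open>The parameter of Y is the image of that of X, so features of Y pull back
    exactly; the converse matching comes from \<open>mutual_factor\<close>.\<close>
  define \<psi> where "\<psi> t = h0 (\<phi> t)" for t
  have \<psi>: "\<psi> \<in> parameters Y" unfolding \<psi>_def by (rule param_image[OF X.gds_axioms h0(1,2) \<phi>])
  have YX': "\<exists>f\<in>feat_closure X. close leb01 e (\<lambda>t. g (\<psi> t)) (\<lambda>t. f (\<phi> t))" if g: "g \<in> feat_closure Y" and e: "0 < e" for g e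
    by (rule bexI[OF _ X.closure_pullback[OF Y.gds_axioms hp0 h0(3) g]], rule leb01.close_pointwise)
      (use X.param_pts[OF \<phi>] e in \<open>simp_all add: compose_def \<psi>_def\<close>)
  have XY': "\<exists>g\<in>feat_closure Y. close leb01 e (\<lambda>t. f (\<phi> t)) (\<lambda>t. g (\<psi> t))" if f: "f \<in> feat_closure X" and e: "0 < e" for f e
  proof -
    from mutual_factor[OF X Y h0 k0 f e] obtain g where g: "g \<in> feat_closure Y" and c: "close (meas X) e f (\<lambda>x. g (h0 x))" by (elim bexE)
    have "close leb01 e (\<lambda>t. f (\<phi> t)) (\<lambda>t. g (\<psi> t))"
      using X.param_close[OF \<phi> X.closure_measurable[OF f] measurable_compose[OF h0(1) Y.closure_measurable[OF g]]] c unfolding \<psi>_def by (simp only: simp_thms)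
    then show ?thesis using g by (rule bexI)
  qed
  obtain h where h: "h \<in> measurable (meas X) (meas Y)" "distr (meas X) (meas Y) h = meas Y" "pull (pts X) h (feat Y) \<subseteq> feat_closure X"
    and hAE: "AE t in leb01. h (\<phi> t) = \<psi> t" and hp: "\<And>x. x \<in> pts X \<Longrightarrow> h x \<in> pts Y"
    and hl: "\<And>x x'. x \<in> pts X \<Longrightarrow> x' \<in> pts X \<Longrightarrow> gds_dist Y (h x) (h x') \<le> gds_dist X x x'"
    by (rule dominated_map[OF Y X.gds_axioms \<psi> \<phi> YX']) (assumption+, rule that)
  obtain k where k: "k \<in> measurable (meas Y) (meas X)" "distr (meas Y) (meas X) k = meas X" "pull (pts Y) k (feat X) \<subseteq> feat_closure Y"
    and kAE: "AE t in leb01. k (\<psi> t) = \<phi> t" and kp: "\<And>y. y \<in> pts Y \<Longrightarrow> k y \<in> pts X"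
    and kl: "\<And>y y'. y \<in> pts Y \<Longrightarrow> y' \<in> pts Y \<Longrightarrow> gds_dist X (k y) (k y') \<le> gds_dist Y y y'"
    by (rule dominated_map[OF X Y.gds_axioms \<phi> \<psi> XY']) (assumption+, rule that)
  have kh: "k (h x) = x" if "x \<in> pts X" for x by (rule X.AE_inverse_imp_inverse[OF Y.gds_axioms \<phi> hp kp hl kl hAE kAE that])
  have hk: "h (k y) = y" if "y \<in> pts Y" for y by (rule Y.AE_inverse_imp_inverse[OF X.gds_axioms \<psi> kp hp kl hl kAE hAE that])
  have "bij_betw h (pts X) (pts Y)" by (rule bij_betw_byWitness[where f' = k]) (use kh hk hp kp in auto)
  moreover have "pull (pts X) h (feat_closure Y) = feat_closure X"
  proof
    show "pull (pts X) h (feat_closure Y) \<subseteq> feat_closure X"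
      unfolding pull_def by (rule image_subsetI) (rule X.closure_pullback[OF Y.gds_axioms hp h(3)])
    show "feat_closure X \<subseteq> pull (pts X) h (feat_closure Y)"
    proof
      fix f assume f: "f \<in> feat_closure X"
      have eq: "f = compose (pts X) (compose (pts Y) f k) h"
        by (rule extensionalityI[OF X.feat_closure_ext[OF f] compose_extensional]) (simp add: compose_def hp kh)
      from imageI[OF Y.closure_pullback[OF X.gds_axioms kp k(3) f], of "\<lambda>f. compose (pts X) f h"]
      show "f \<in> pull (pts X) h (feat_closure Y)" unfolding pull_def eq[symmetric] .
    qed
  qed
  ultimately show ?thesis unfolding gds_iso_def using h by blast
qed

lemma gds_iso_refl: "gds X \<Longrightarrow> gds_iso X X"
proof -
  assume "gds X"
  then interpret X: gds X .
  have "compose (pts X) f (\<lambda>x. x) = f" if "f \<in> feat_closure X" for f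
    using X.feat_closure_ext[OF that] by (auto simp: compose_def fun_eq_iff extensional_def)
  then have "pull (pts X) (\<lambda>x. x) (feat_closure X) = feat_closure X" by (simp add: pull_def)
  then show ?thesis
    unfolding gds_iso_def by (intro exI[of _ "\<lambda>x. x"]) (auto simp: distr_id bij_betw_def)
qed

section \<open>Isomorphism classes and their representatives\<close>

context clipped
begin

text \<open>Invariance under L passes from the one L-compact member to all others; the needed
  symmetry and transitivity of isomorphism then come from mutual domination through
  \<open>mutual_iso\<close>.\<close>

lemma l_class_rep:
  assumes A: "A \<in> l_classes L"
  shows "rep A \<in> A" "cgds (rep A) L" "Z \<in> A \<Longrightarrow> cgds Z L" "Z \<in> A \<Longrightarrow> gds_iso (rep A) Z"
    "gds (Z :: real gds) \<Longrightarrow> gds_iso (rep A) Z \<Longrightarrow> Z \<in> A"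
proof -
  obtain X where X: "geometric_data_set X" "A = iso_rel `` {X}"
    using A by (auto simp: l_classes_def classes_def elim!: quotientE)
  obtain W where W: "W \<in> A" "l_compact L W" using A by (auto simp: l_classes_def)
  have gX: "gds X" using X(1) by unfold_locales
  have inA: "Z \<in> A \<longleftrightarrow> gds Z \<and> gds_iso X Z" for Z
    using X(1) unfolding X(2) iso_rel_def gds_def by auto
  then have "X \<in> A" using gds_iso_refl[OF gX] gX by simp
  then show r: "rep A \<in> A" unfolding rep_def by (rule someI)
  have gW: "gds W" "gds_iso X W" using inA W(1) by auto
  have "cgds W L"
    unfolding cgds_def cgds_axioms_def using W(2) gW(1) clipped_axioms by (simp add: l_compact_def)
  then have cX: "cgds X L" using iso_cgds[OF gX gW(1,2)] by simp
  have cA: "cgds Z L" if "Z \<in> A" for Z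
    using that inA iso_cgds[OF gX, of Z] cX by simp
  then show "Z \<in> A \<Longrightarrow> cgds Z L" and cr: "cgds (rep A) L" using r by auto
  have dom: "dominated Z X" "dominated X Z" if "Z \<in> A" for Z
    using iso_imp_dominated[OF cX cA[OF that]] inA that by auto
  show "gds_iso (rep A) Z" if "Z \<in> A"
  proof (rule mutual_iso[OF cr cA[OF that]])
    show "dominated Z (rep A)"
      by (rule dominated_trans[OF cr gX cA[OF that] dom(1)[OF that] dom(2)[OF r]])
    show "dominated (rep A) Z"
      by (rule dominated_trans[OF cA[OF that] gX cr dom(1)[OF r] dom(2)[OF that]])
  qed
  show "Z \<in> A" if Z: "gds Z" "gds_iso (rep A) Z"
  proof -
    have gr: "gds (rep A)" using cr by (simp add: cgds_def)
    have cZ: "cgds Z L" using iso_cgds[OF gr Z] cr by simp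
    have "gds_iso X Z"
    proof (rule mutual_iso[OF cX cZ])
      show "dominated Z X"
        by (rule dominated_trans[OF cX gr cZ iso_imp_dominated(1)[OF cr cZ Z(2)] dom(1)[OF r]])
      show "dominated X Z"
        by (rule dominated_trans[OF cZ gr cX dom(2)[OF r] iso_imp_dominated(2)[OF cr cZ Z(2)]])
    qed
    then show ?thesis using inA Z(1) by simp
  qed
qed

lemma dominated_class_iff:
  assumes A: "A \<in> l_classes L" and B: "B \<in> l_classes L"
  shows "dominated_class A B \<longleftrightarrow> dominated (rep A) (rep B)"
proof
  assume "dominated (rep A) (rep B)"
  then show "dominated_class A B"
    unfolding dominated_class_def using l_class_rep(1)[OF A] l_class_rep(1)[OF B] by blast
next
  note cA = l_class_rep(2)[OF A] and cB = l_class_rep(2)[OF B]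
  assume "dominated_class A B"
  then obtain Y X where Y: "Y \<in> A" and X: "X \<in> B" and d: "dominated Y X" by (auto simp: dominated_class_def)
  note cY = l_class_rep(3)[OF A Y] and cX = l_class_rep(3)[OF B X]
  have gX: "gds X" and gY: "gds Y" using cX cY by (simp_all add: cgds_def)
  have "dominated (rep A) X"
    by (rule dominated_trans[OF cX gY cA iso_imp_dominated(2)[OF cA cY l_class_rep(4)[OF A Y]] d])
  then show "dominated (rep A) (rep B)"
    by (rule dominated_trans[OF cB gX cA _ iso_imp_dominated(1)[OF cB cX l_class_rep(4)[OF B X]]])
qed

lemma l_class_eqI:
  assumes A: "A \<in> l_classes L" and B: "B \<in> l_classes L"
    and "dominated (rep A) (rep B)" "dominated (rep B) (rep A)"
  shows "A = B"
proof -
  have sub: "A \<subseteq> B" if A: "A \<in> l_classes L" and B: "B \<in> l_classes L"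
    and d: "dominated (rep A) (rep B)" "dominated (rep B) (rep A)" for A B
  proof
    note cA = l_class_rep(2)[OF A] and cB = l_class_rep(2)[OF B]
    have gA: "gds (rep A)" using cA by (simp add: cgds_def)
    fix Z assume Z: "Z \<in> A"
    note cZ = l_class_rep(3)[OF A Z] and i = l_class_rep(4)[OF A Z]
    have "gds_iso (rep B) Z"
    proof (rule mutual_iso[OF cB cZ])
      show "dominated Z (rep B)" by (rule dominated_trans[OF cB gA cZ iso_imp_dominated(1)[OF cA cZ i] d(1)])
      show "dominated (rep B) Z" by (rule dominated_trans[OF cZ gA cB d(2) iso_imp_dominated(2)[OF cA cZ i]])
    qed
    then show "Z \<in> B" using l_class_rep(5)[OF B] cZ by (simp add: cgds_def)
  qed
  show ?thesis using sub[OF A B assms(3,4)] sub[OF B A assms(4,3)] by (rule equalityI)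
qed

lemma l_class_exists:
  fixes X :: "real gds"
  assumes X: "cgds X L"
  shows "\<exists>A\<in>l_classes L. X \<in> A"
proof (intro bexI)
  interpret X: cgds X L by fact
  show XA: "X \<in> iso_rel `` {X}" using gds_iso_refl[OF X.gds_axioms] X.gds by (simp add: iso_rel_def)
  have "iso_rel `` {X} \<in> classes" unfolding classes_def using X.gds by (intro quotientI) simp
  then show "iso_rel `` {X} \<in> l_classes L"
    unfolding l_classes_def using XA X.l_compact by blast
qed

end

section \<open>The observable distance\<close>

text \<open>One half of the Hausdorff condition for fixed parameters, with the features replaced by
  their closure and strict neighbourhoods by closed Ky Fan balls.\<close>

definition matched :: "real \<Rightarrow> 'a gds \<Rightarrow> (real \<Rightarrow> 'a) \<Rightarrow> 'b gds \<Rightarrow> (real \<Rightarrow> 'b) \<Rightarrow> bool" where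
  "matched e X \<phi> Y \<psi> \<longleftrightarrow> (\<forall>f\<in>feat_closure X. \<exists>g\<in>feat_closure Y. close leb01 e (\<lambda>t. f (\<phi> t)) (\<lambda>t. g (\<psi> t)))"

definition conc :: "real \<Rightarrow> 'a gds \<Rightarrow> 'b gds \<Rightarrow> bool" where
  "conc e X Y \<longleftrightarrow> (\<exists>\<phi>\<in>parameters X. \<exists>\<psi>\<in>parameters Y. matched e X \<phi> Y \<psi> \<and> matched e Y \<psi> X \<phi>)"

lemma matchedI:
  "(\<And>f. f \<in> feat_closure X \<Longrightarrow> \<exists>g\<in>feat_closure Y. close leb01 e (\<lambda>t. f (\<phi> t)) (\<lambda>t. g (\<psi> t))) \<Longrightarrow> matched e X \<phi> Y \<psi>"
  unfolding matched_def by (rule ballI)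

lemma matchedE:
  assumes "matched e X \<phi> Y \<psi>" "f \<in> feat_closure X"
  obtains g where "g \<in> feat_closure Y" "close leb01 e (\<lambda>t. f (\<phi> t)) (\<lambda>t. g (\<psi> t))"
  using assms(1)[unfolded matched_def, THEN bspec, OF assms(2)] by (elim bexE) (rule that)

lemma concI: "\<phi> \<in> parameters X \<Longrightarrow> \<psi> \<in> parameters Y \<Longrightarrow> matched e X \<phi> Y \<psi> \<Longrightarrow> matched e Y \<psi> X \<phi> \<Longrightarrow> conc e X Y"
  unfolding conc_def by blast

lemma concE:
  assumes "conc e X Y"
  obtains \<phi> \<psi> where "\<phi> \<in> parameters X" "\<psi> \<in> parameters Y" "matched e X \<phi> Y \<psi>" "matched e Y \<psi> X \<phi>"
  using assms unfolding conc_def by blast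

lemma conc_sym: "conc e X Y \<Longrightarrow> conc e Y X"
  unfolding conc_def by blast

lemma (in gds) closure_nonempty: "\<exists>f. f \<in> feat_closure X"
  using feat_nonempty feat_subset_closure by blast

lemma conc_ge_1:
  assumes X: "cgds X L" and Y: "cgds Y L" and "1 \<le> e"
  shows "conc e X Y"
proof -
  interpret X: cgds X L by fact
  interpret Y: cgds Y L by fact
  have "matched e X \<phi> Y \<psi>" "matched e Y \<psi> X \<phi>" for \<phi> \<psi>
    unfolding matched_def using X.closure_nonempty Y.closure_nonempty leb01.close_ge_1[OF assms(3)] by blast+
  then show ?thesis unfolding conc_def using X.params_nonempty Y.params_nonempty by blast
qed

lemma conc_refl:
  assumes X: "cgds X L"
  shows "conc 0 X X"
proof -
  obtain \<phi> where p: "\<phi> \<in> parameters X" using cgds.params_nonempty[OF X] by (elim exE)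
  have "close leb01 0 (\<lambda>t. f (\<phi> t)) (\<lambda>t. f (\<phi> t))" for f :: "'a \<Rightarrow> real" by (rule leb01.close_pointwise) auto
  then have "matched 0 X \<phi> X \<phi>" by (intro matchedI) (rule bexI)
  then show ?thesis using p by (intro concI)
qed

text \<open>Cut the space into countably many pieces of radius \<eta>/2 and glue the piece numbers,
  whose law is the same for all parameters.\<close>

lemma (in gds) glue_params:
  assumes \<psi>: "\<psi> \<in> parameters X" and \<psi>': "\<psi>' \<in> parameters X" and \<eta>: "0 < \<eta>"
  shows "\<exists>\<tau>\<in>mp. \<exists>\<sigma>\<in>mp. AE t in leb01. gds_dist X (\<psi> (\<tau> t)) (\<psi>' (\<sigma> t)) \<le> \<eta>"
proof -
  obtain c where cp: "\<And>i :: nat. c i \<in> pts X" and dense: "\<And>x r. x \<in> pts X \<Longrightarrow> 0 < r \<Longrightarrow> \<exists>i. gds_dist X x (c i) < r"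
    by (rule dense_seq) blast
  define piece where "piece x = (LEAST i. x \<in> M.mball (c i) (\<eta> / 2))" for x
  have pm: "piece \<in> measurable (meas X) (count_space UNIV)"
    unfolding piece_def
  proof (rule measurable_Least)
    fix i
    have "{x \<in> space (meas X). x \<in> M.mball (c i) (\<eta> / 2)} = M.mball (c i) (\<eta> / 2)" by (auto simp: space_meas)
    then show "Measurable.pred (meas X) (\<lambda>x. x \<in> M.mball (c i) (\<eta> / 2))"
      using sets_open[OF M.openin_mball[of "c i" "\<eta> / 2"]] by (simp add: pred_def)
  qed
  have piece: "x \<in> M.mball (c (piece x)) (\<eta> / 2)" if x: "x \<in> pts X" for x
    unfolding piece_def
  proof (rule LeastI_ex)
    obtain i where "gds_dist X x (c i) < \<eta> / 2" using dense[OF x, of "\<eta> / 2"] \<eta> by auto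
    then have "x \<in> M.mball (c i) (\<eta> / 2)" using x cp by (simp add: M.commute)
    then show "\<exists>i. x \<in> M.mball (c i) (\<eta> / 2)" by blast
  qed
  have law: "distr leb01 (count_space UNIV) (\<lambda>t. piece (\<psi> t)) = distr (meas X) (count_space UNIV) piece" if "\<psi> \<in> parameters X" for \<psi>
    using distr_distr[OF pm param_measurable[OF that]] param_distr[OF that] by (simp add: comp_def)
  have "distr leb01 (count_space UNIV) (\<lambda>t. piece (\<psi> t)) = distr leb01 (count_space UNIV) (\<lambda>t. piece (\<psi>' t))"
    unfolding law[OF \<psi>] law[OF \<psi>'] ..
  from glue_discrete[OF measurable_compose[OF param_measurable[OF \<psi>] pm] measurable_compose[OF param_measurable[OF \<psi>'] pm] this]
  obtain \<tau> \<sigma> where ts: "\<tau> \<in> mp" "\<sigma> \<in> mp" and ae: "AE t in leb01. piece (\<psi> (\<tau> t)) = piece (\<psi>' (\<sigma> t))" by (elim bexE)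
  have AE: "AE t in leb01. gds_dist X (\<psi> (\<tau> t)) (\<psi>' (\<sigma> t)) \<le> \<eta>"
    using ae
  proof (rule AE_mp, intro AE_I2 impI)
    fix t assume "t \<in> space leb01" and e: "piece (\<psi> (\<tau> t)) = piece (\<psi>' (\<sigma> t))"
    then have t: "t \<in> {0..1}" by simp
    note 1 = piece[OF param_pts[OF param_mp[OF \<psi> ts(1)] t]] and 2 = piece[OF param_pts[OF param_mp[OF \<psi>' ts(2)] t]]
    define z where "z = c (piece (\<psi> (\<tau> t)))"
    have "\<psi> (\<tau> t) \<in> M.mball z (\<eta> / 2)" "\<psi>' (\<sigma> t) \<in> M.mball z (\<eta> / 2)"
      using 1 2 unfolding z_def e by simp_all
    then show "gds_dist X (\<psi> (\<tau> t)) (\<psi>' (\<sigma> t)) \<le> \<eta>"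
      using M.triangle[of "\<psi> (\<tau> t)" z "\<psi>' (\<sigma> t)"] M.commute[of z "\<psi> (\<tau> t)"] by auto
  qed
  show ?thesis by (rule bexI[OF _ ts(1)], rule bexI[OF _ ts(2)], rule AE)
qed

text \<open>The intermediate feature is 1-Lipschitz, so the gluing error between points of Y bounds
  the one between its values; this is the term \<eta>.\<close>

lemma matched_trans:
  assumes X: "gds X" and Y: "gds Y" and Z: "gds Z" and p: "\<phi> \<in> parameters X" "\<psi> \<in> parameters Y" and q: "\<psi>' \<in> parameters Y" "\<omega> \<in> parameters Z"
    and XY: "matched a X \<phi> Y \<psi>" and YZ: "matched b Y \<psi>' Z \<omega>" and ts: "\<tau> \<in> mp" "\<sigma> \<in> mp" and \<eta>: "0 < \<eta>"
    and ae: "AE t in leb01. gds_dist Y (\<psi> (\<tau> t)) (\<psi>' (\<sigma> t)) \<le> \<eta>"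
  shows "matched (a + \<eta> + b) X (\<lambda>t. \<phi> (\<tau> t)) Z (\<lambda>t. \<omega> (\<sigma> t))"
proof (rule matchedI)
  interpret X: gds X by fact
  interpret Y: gds Y by fact
  interpret Z: gds Z by fact
  fix f assume f: "f \<in> feat_closure X"
  obtain g where g: "g \<in> feat_closure Y" and c1: "close leb01 a (\<lambda>t. f (\<phi> t)) (\<lambda>t. g (\<psi> t))" by (rule matchedE[OF XY f])
  obtain h where h: "h \<in> feat_closure Z" and c2: "close leb01 b (\<lambda>t. g (\<psi>' t)) (\<lambda>t. h (\<omega> t))" by (rule matchedE[OF YZ g])
  note P' = Y.param_mp[OF p(2) ts(1)] and Q' = Y.param_mp[OF q(1) ts(2)]
  note m = X.param_closure_measurable[OF X.param_mp[OF p(1) ts(1)] f] Y.param_closure_measurable[OF P' g]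
    Y.param_closure_measurable[OF Q' g] Z.param_closure_measurable[OF Z.param_mp[OF q(2) ts(2)] h]
  have "AE t in leb01. \<not> \<eta> < \<bar>g (\<psi> (\<tau> t)) - g (\<psi>' (\<sigma> t))\<bar>"
    using ae
  proof (rule AE_mp, intro AE_I2 impI)
    fix t assume "t \<in> space leb01" and e: "gds_dist Y (\<psi> (\<tau> t)) (\<psi>' (\<sigma> t)) \<le> \<eta>"
    then have "t \<in> {0..1}" by simp
    from Y.lipD[OF Y.closure_lip[OF g] Y.param_pts[OF P' this] Y.param_pts[OF Q' this]] e
    show "\<not> \<eta> < \<bar>g (\<psi> (\<tau> t)) - g (\<psi>' (\<sigma> t))\<bar>" by linarith
  qed
  moreover have "{t \<in> space leb01. \<eta> < \<bar>g (\<psi> (\<tau> t)) - g (\<psi>' (\<sigma> t))\<bar>} \<in> sets leb01"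
    by (rule borel_measurable_less[OF borel_measurable_const borel_measurable_abs[OF borel_measurable_diff[OF m(2,3)]]])
  ultimately have "measure leb01 {t \<in> space leb01. \<eta> < \<bar>g (\<psi> (\<tau> t)) - g (\<psi>' (\<sigma> t))\<bar>} = 0"
    using leb01.prob_Collect_eq_0[of "\<lambda>t. \<eta> < \<bar>g (\<psi> (\<tau> t)) - g (\<psi>' (\<sigma> t))\<bar>"] by (simp only: simp_thms)
  then have mid: "close leb01 \<eta> (\<lambda>t. g (\<psi> (\<tau> t))) (\<lambda>t. g (\<psi>' (\<sigma> t)))" using \<eta> by (simp add: close_def)
  have 1: "close leb01 a (\<lambda>t. f (\<phi> (\<tau> t))) (\<lambda>t. g (\<psi> (\<tau> t)))"
    using close_mp[OF ts(1) X.param_closure_measurable[OF p(1) f] Y.param_closure_measurable[OF p(2) g]] c1 by (simp only: simp_thms)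
  have 2: "close leb01 b (\<lambda>t. g (\<psi>' (\<sigma> t))) (\<lambda>t. h (\<omega> (\<sigma> t)))"
    using close_mp[OF ts(2) Y.param_closure_measurable[OF q(1) g] Z.param_closure_measurable[OF q(2) h]] c2 by (simp only: simp_thms)
  show "\<exists>h\<in>feat_closure Z. close leb01 (a + \<eta> + b) (\<lambda>t. f (\<phi> (\<tau> t))) (\<lambda>t. h (\<omega> (\<sigma> t)))"
    by (rule bexI[OF _ h], rule leb01.close_triangle[OF leb01.close_triangle[OF 1 mid m(1,2,3)] 2 m(1,3,4)])
qed

lemma conc_triangle:
  assumes X: "gds X" and Y: "gds Y" and Z: "gds Z" and XY: "conc a X Y" and YZ: "conc b Y Z" and \<eta>: "0 < \<eta>"
  shows "conc (a + \<eta> + b) X Z"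
proof -
  interpret Y: gds Y by fact
  obtain \<phi> \<psi> where p: "\<phi> \<in> parameters X" "\<psi> \<in> parameters Y" and 1: "matched a X \<phi> Y \<psi>" "matched a Y \<psi> X \<phi>" by (rule concE[OF XY])
  obtain \<psi>' \<omega> where q: "\<psi>' \<in> parameters Y" "\<omega> \<in> parameters Z" and 2: "matched b Y \<psi>' Z \<omega>" "matched b Z \<omega> Y \<psi>'" by (rule concE[OF YZ])
  from Y.glue_params[OF p(2) q(1) \<eta>] obtain \<tau> \<sigma> where ts: "\<tau> \<in> mp" "\<sigma> \<in> mp"
    and ae: "AE t in leb01. gds_dist Y (\<psi> (\<tau> t)) (\<psi>' (\<sigma> t)) \<le> \<eta>" by (elim bexE)
  have eq: "b + \<eta> + a = a + \<eta> + b" by simp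
  show ?thesis
    by (rule concI[OF gds.param_mp[OF X p(1) ts(1)] gds.param_mp[OF Z q(2) ts(2)] matched_trans[OF X Y Z p q 1(1) 2(1) ts \<eta> ae]
          matched_trans[OF Z Y X q(2,1) p(2,1) 2(2) 1(2) ts(2,1) \<eta> ae[unfolded Y.M.commute[of "\<psi> (\<tau> _)"]], unfolded eq]])
qed

lemma hausdorff_pull_less:
  assumes less: "hausdorff d (pull A h F) (pull B k G) < r" and sym: "\<And>x y. d x y = d y x"
  obtains e where "e < r" "\<And>f. f \<in> F \<Longrightarrow> \<exists>g\<in>G. d (compose A f h) (compose B g k) < e"
    "\<And>g. g \<in> G \<Longrightarrow> \<exists>f\<in>F. d (compose B g k) (compose A f h) < e"
proof -
  from less obtain e where e: "e \<in> {e. e > 0 \<and> pull A h F \<subseteq> nbhd d (pull B k G) e \<and> pull B k G \<subseteq> nbhd d (pull A h F) e}" "e < r"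
    unfolding hausdorff_def Inf_less_iff by (elim bexE)
  show ?thesis
  proof (rule that[OF e(2)])
    show "\<exists>g\<in>G. d (compose A f h) (compose B g k) < e" if "f \<in> F" for f
      using e(1) that sym[of "compose A f h"] by (auto simp: nbhd_def pull_def)
    show "\<exists>f\<in>F. d (compose B g k) (compose A f h) < e" if "g \<in> G" for g
      using e(1) that sym[of "compose B g k"] by (auto simp: nbhd_def pull_def)
  qed
qed

lemma hausdorff_pull_le:
  assumes "0 < r" and sym: "\<And>x y. d x y = d y x" and "\<And>f. f \<in> F \<Longrightarrow> \<exists>g\<in>G. d (compose A f h) (compose B g k) < r"
    "\<And>g. g \<in> G \<Longrightarrow> \<exists>f\<in>F. d (compose B g k) (compose A f h) < r"
  shows "hausdorff d (pull A h F) (pull B k G) \<le> r"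
proof -
  have "pull A h F \<subseteq> nbhd d (pull B k G) r"
  proof
    fix u assume "u \<in> pull A h F"
    then obtain f where f: "f \<in> F" "u = compose A f h" by (auto simp: pull_def)
    from assms(3)[OF f(1)] show "u \<in> nbhd d (pull B k G) r" using sym[of u] by (auto simp: nbhd_def pull_def f(2))
  qed
  moreover have "pull B k G \<subseteq> nbhd d (pull A h F) r"
  proof
    fix u assume "u \<in> pull B k G"
    then obtain g where g: "g \<in> G" "u = compose B g k" by (auto simp: pull_def)
    from assms(4)[OF g(1)] show "u \<in> nbhd d (pull A h F) r" using sym[of u] by (auto simp: nbhd_def pull_def g(2))
  qed
  ultimately show ?thesis unfolding hausdorff_def using assms(1) by (intro Inf_lower) blast
qed

lemma ky_fan_sym: "ky_fan M u v = ky_fan M v u"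
  by (simp add: ky_fan_def abs_minus_commute)

lemma sup_dist_sym: "sup_dist S u v = sup_dist S v u"
  by (simp add: sup_dist_def abs_minus_commute)

lemma ky_fan_cong:
  "(\<And>x. x \<in> space M \<Longrightarrow> u x = u' x) \<Longrightarrow> (\<And>x. x \<in> space M \<Longrightarrow> v x = v' x) \<Longrightarrow> ky_fan M u v = ky_fan M u' v'"
  unfolding ky_fan_def by (simp cong: conj_cong)

text \<open>The room between s and e pays for approximating an element of the closure by a
  feature.\<close>

lemma matched_if_feat:
  assumes X: "gds X" and Y: "gds Y" and p: "\<phi> \<in> parameters X" and q: "\<psi> \<in> parameters Y" and se: "s < e"
    and kf: "\<And>f. f \<in> feat X \<Longrightarrow> \<exists>g\<in>feat Y. ky_fan leb01 (compose {0..1} f \<phi>) (compose {0..1} g \<psi>) < ennreal s"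
  shows "matched e X \<phi> Y \<psi>"
proof (rule matchedI)
  interpret X: gds X by fact
  interpret Y: gds Y by fact
  fix f assume f: "f \<in> feat_closure X"
  from se have "0 < e - s" by simp
  from X.closure_approx_feat[OF f this] obtain f0 where f0: "f0 \<in> feat X" and c0: "close (meas X) (e - s) f f0" .
  note f0' = X.feat_subset_closure[OF f0]
  have c1: "close leb01 (e - s) (\<lambda>t. f (\<phi> t)) (\<lambda>t. f0 (\<phi> t))"
    using X.param_close[OF p X.closure_measurable[OF f] X.closure_measurable[OF f0']] c0 by (simp only: simp_thms)
  from kf[OF f0] obtain g where g: "g \<in> feat Y" and k: "ky_fan leb01 (compose {0..1} f0 \<phi>) (compose {0..1} g \<psi>) < ennreal s" by (elim bexE)
  note m = X.param_closure_measurable[OF p f] X.param_closure_measurable[OF p f0'] Y.param_closure_measurable[OF q Y.feat_subset_closure[OF g]]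
  have "ky_fan leb01 (\<lambda>t. f0 (\<phi> t)) (\<lambda>t. g (\<psi> t)) < ennreal s"
    using k by (subst ky_fan_cong[of _ _ "compose {0..1} f0 \<phi>" _ "compose {0..1} g \<psi>"]) (simp_all add: compose_def)
  from leb01.ky_fan_less[OF this] obtain e' where "e' < s" "close leb01 e' (\<lambda>t. f0 (\<phi> t)) (\<lambda>t. g (\<psi> t))" by (elim exE conjE)
  then have "close leb01 s (\<lambda>t. f0 (\<phi> t)) (\<lambda>t. g (\<psi> t))" using leb01.close_mono[OF _ _ m(2,3)] by (simp only: less_imp_le)
  from leb01.close_triangle[OF c1 this m] have "close leb01 e (\<lambda>t. f (\<phi> t)) (\<lambda>t. g (\<psi> t))" by simp
  then show "\<exists>g\<in>feat_closure Y. close leb01 e (\<lambda>t. f (\<phi> t)) (\<lambda>t. g (\<psi> t))" by (rule bexI[OF _ Y.feat_subset_closure[OF g]])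
qed

lemma matched_imp_feat:
  assumes X: "gds X" and Y: "gds Y" and p: "\<phi> \<in> parameters X" and q: "\<psi> \<in> parameters Y" and c: "matched e X \<phi> Y \<psi>"
    and e: "0 \<le> e" and \<eta>: "0 < \<eta>" and f: "f \<in> feat X"
  shows "\<exists>g\<in>feat Y. ky_fan leb01 (compose {0..1} f \<phi>) (compose {0..1} g \<psi>) < ennreal (e + \<eta>)"
proof -
  interpret X: gds X by fact
  interpret Y: gds Y by fact
  from \<eta> have \<eta>2: "0 < \<eta> / 2" by simp
  note f' = X.feat_subset_closure[OF f]
  obtain g where g: "g \<in> feat_closure Y" and c1: "close leb01 e (\<lambda>t. f (\<phi> t)) (\<lambda>t. g (\<psi> t))" by (rule matchedE[OF c f'])
  obtain g0 where g0: "g0 \<in> feat Y" and c0: "close (meas Y) (\<eta> / 2) g g0" by (rule Y.closure_approx_feat[OF g \<eta>2])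
  note g0' = Y.feat_subset_closure[OF g0]
  have c2: "close leb01 (\<eta> / 2) (\<lambda>t. g (\<psi> t)) (\<lambda>t. g0 (\<psi> t))"
    using Y.param_close[OF q Y.closure_measurable[OF g] Y.closure_measurable[OF g0']] c0 by (simp only: simp_thms)
  have c3: "close leb01 (e + \<eta> / 2) (\<lambda>t. f (\<phi> t)) (\<lambda>t. g0 (\<psi> t))"
    by (rule leb01.close_triangle[OF c1 c2 X.param_closure_measurable[OF p f'] Y.param_closure_measurable[OF q g] Y.param_closure_measurable[OF q g0']])
  have "ky_fan leb01 (compose {0..1} f \<phi>) (compose {0..1} g0 \<psi>) = ky_fan leb01 (\<lambda>t. f (\<phi> t)) (\<lambda>t. g0 (\<psi> t))"
    by (rule ky_fan_cong) (simp_all add: compose_def)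
  also have "\<dots> \<le> ennreal (e + \<eta> / 2)" by (rule leb01.ky_fan_le[OF c3]) (use e \<eta> in simp)
  also have "\<dots> < ennreal (e + \<eta>)" using e \<eta> by (intro ennreal_lessI) auto
  finally show ?thesis using g0 by (rule bexI)
qed

lemma dconc_less_imp_conc:
  assumes X: "gds X" and Y: "gds Y" and less: "dconc X Y < ennreal e"
  shows "conc e X Y"
proof -
  from less obtain \<phi> \<psi> where p: "\<phi> \<in> parameters X" and q: "\<psi> \<in> parameters Y"
    and H: "hausdorff (ky_fan leb01) (pull {0..1} \<phi> (feat X)) (pull {0..1} \<psi> (feat Y)) < ennreal e"
    unfolding dconc_def INF_less_iff by auto
  obtain r where r: "r < ennreal e"
    and 1: "\<And>f. f \<in> feat X \<Longrightarrow> \<exists>g\<in>feat Y. ky_fan leb01 (compose {0..1} f \<phi>) (compose {0..1} g \<psi>) < r"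
    and 2: "\<And>g. g \<in> feat Y \<Longrightarrow> \<exists>f\<in>feat X. ky_fan leb01 (compose {0..1} g \<psi>) (compose {0..1} f \<phi>) < r"
    by (rule hausdorff_pull_less[OF H ky_fan_sym]) (rule that)
  obtain s where s: "r = ennreal s" "0 \<le> s" using r by (cases r) auto
  have "s < e" using r s by (simp add: ennreal_less_iff)
  then show ?thesis
    by (intro concI[OF p q] matched_if_feat[OF X Y p q _ 1[unfolded s(1)]] matched_if_feat[OF Y X q p _ 2[unfolded s(1)]])
qed

lemma conc_imp_dconc_le:
  assumes X: "gds X" and Y: "gds Y" and c: "conc e X Y" and e: "0 \<le> e"
  shows "dconc X Y \<le> ennreal e"
proof (rule ennreal_le_epsilon)
  fix \<eta> :: real assume \<eta>: "0 < \<eta>"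
  obtain \<phi> \<psi> where p: "\<phi> \<in> parameters X" and q: "\<psi> \<in> parameters Y" and m: "matched e X \<phi> Y \<psi>" "matched e Y \<psi> X \<phi>" by (rule concE[OF c])
  have "dconc X Y \<le> hausdorff (ky_fan leb01) (pull {0..1} \<phi> (feat X)) (pull {0..1} \<psi> (feat Y))"
    unfolding dconc_def using p q by (intro INF_lower2[of "(\<phi>, \<psi>)"]) auto
  also have "\<dots> \<le> ennreal (e + \<eta>)"
    by (rule hausdorff_pull_le[OF _ ky_fan_sym matched_imp_feat[OF X Y p q m(1) e \<eta>] matched_imp_feat[OF Y X q p m(2) e \<eta>]])
      (use e \<eta> in \<open>simp_all only: ennreal_less_zero_iff\<close>)
  finally show "dconc X Y \<le> ennreal e + ennreal \<eta>" using e \<eta> by (simp add: ennreal_plus)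
qed

section \<open>The box distance\<close>

text \<open>A coupling on the product is the joint law of two parameters. On the closed set the
  features are matched uniformly, and its complement is an exceptional set of mass at most
  e.\<close>

lemma box_dist_less_imp_conc:
  assumes X: "cgds X L" and Y: "cgds Y L" and less: "box_dist X Y < ennreal e"
  shows "conc e X Y"
proof (cases "1 \<le> e")
  case True
  then show ?thesis by (rule conc_ge_1[OF X Y])
next
  case e1: False
  interpret X: cgds X L by fact
  interpret Y: cgds Y L by fact
  have e0: "0 < e" using less by (cases "0 < e") (auto simp: ennreal_neg)
  from less obtain P S where P: "P \<in> couplings (meas X) (meas Y)"
    and S: "closedin (prod_topology (gds_topology X) (gds_topology Y)) S"
    and m: "max (ennreal (1 - measure P S)) (2 * hausdorff (sup_dist S) (pull (pts X \<times> pts Y) fst (feat_closure X))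
                                        (pull (pts X \<times> pts Y) snd (feat_closure Y))) < ennreal e"
    unfolding box_dist_def INF_less_iff by auto
  define H where "H = hausdorff (sup_dist S) (pull (pts X \<times> pts Y) fst (feat_closure X)) (pull (pts X \<times> pts Y) snd (feat_closure Y))"
  have "1 - measure P S < e" using m e0 by (cases "1 - measure P S < 0") (simp_all add: ennreal_less_iff)
  then have mS: "1 - e \<le> measure P S" by simp
  \<comment> \<open>A set that is not measurable has measure 0 by convention, so nonzero measure
    shows that S is measurable.\<close>
  then have "measure P S \<noteq> 0" using e1 by auto
  then have SP: "S \<in> sets P" by (metis measure_notin_sets)
  have "2 * H < ennreal e" using m by (simp add: H_def)
  have "H < ennreal (e / 2)"
  proof (rule ccontr)
    assume "\<not> H < ennreal (e / 2)"
    then have "2 * ennreal (e / 2) \<le> 2 * H" by (intro mult_left_mono) auto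
    moreover have "2 * ennreal (e / 2) = ennreal e" using e0 by (simp add: ennreal_mult''[symmetric] flip: ennreal_numeral)
    ultimately show False using \<open>2 * H < ennreal e\<close> by simp
  qed
  then obtain r where r: "r < ennreal (e / 2)"
    and 1: "\<And>f. f \<in> feat_closure X \<Longrightarrow> \<exists>g\<in>feat_closure Y. sup_dist S (compose (pts X \<times> pts Y) f fst) (compose (pts X \<times> pts Y) g snd) < r"
    and 2: "\<And>g. g \<in> feat_closure Y \<Longrightarrow> \<exists>f\<in>feat_closure X. sup_dist S (compose (pts X \<times> pts Y) g snd) (compose (pts X \<times> pts Y) f fst) < r"
    unfolding H_def by (rule hausdorff_pull_less[OF _ sup_dist_sym]) (rule that)
  have sP: "sets P = sets (meas X \<Otimes>\<^sub>M meas Y)" and fP: "distr P (meas X) fst = meas X" and gP: "distr P (meas Y) snd = meas Y"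
    using P by (auto simp: couplings_def)
  have "prob_space P"
  proof (rule prob_space_distrD[of fst])
    show "fst \<in> measurable P (meas X)" by (simp add: measurable_cong_sets[OF sP refl])
    show "prob_space (distr P (meas X) fst)" unfolding fP by (rule X.P.prob_space_axioms)
  qed
  from standard_law[OF standard_pair[OF X.standard_meas Y.standard_meas] this sP]
  obtain \<omega> where \<omega>: "\<omega> \<in> measurable leb01 (meas X \<Otimes>\<^sub>M meas Y)" and d: "distr leb01 (meas X \<Otimes>\<^sub>M meas Y) \<omega> = P" by (elim bexE)
  have p: "(\<lambda>t. fst (\<omega> t)) \<in> parameters X"
    using distr_distr[OF measurable_fst \<omega>] measurable_compose[OF \<omega> measurable_fst] fP
    unfolding d by (simp add: parameters_def comp_def)
  have q: "(\<lambda>t. snd (\<omega> t)) \<in> parameters Y"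
    using distr_distr[OF measurable_snd \<omega>] measurable_compose[OF \<omega> measurable_snd] gP
    unfolding d by (simp add: parameters_def comp_def)
  define A where "A = \<omega> -` S \<inter> space leb01"
  have S': "S \<in> sets (meas X \<Otimes>\<^sub>M meas Y)" using SP sP by simp
  have A: "A \<in> sets leb01" unfolding A_def by (rule measurable_sets[OF \<omega> S'])
  have mA: "1 - e \<le> measure leb01 A"
    using mS measure_distr[OF \<omega> S'] by (simp add: A_def d)
  have SXY: "S \<subseteq> pts X \<times> pts Y" using closedin_subset[OF S] by (simp add: X.topology Y.topology)
  have fin: "close leb01 e (\<lambda>t. f (fst (\<omega> t))) (\<lambda>t. g (snd (\<omega> t)))"
    if f: "f \<in> feat_closure X" and g: "g \<in> feat_closure Y"
      and s: "sup_dist S (compose (pts X \<times> pts Y) f fst) (compose (pts X \<times> pts Y) g snd) < r" for f g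
  proof (rule leb01.close_on_set[OF _ A mA X.param_closure_measurable[OF p f] Y.param_closure_measurable[OF q g]])
    fix t assume "t \<in> A"
    then have tS: "\<omega> t \<in> S" by (simp add: A_def)
    then have tp: "\<omega> t \<in> pts X \<times> pts Y" using SXY by blast
    have "ennreal \<bar>compose (pts X \<times> pts Y) f fst (\<omega> t) - compose (pts X \<times> pts Y) g snd (\<omega> t)\<bar>
      \<le> sup_dist S (compose (pts X \<times> pts Y) f fst) (compose (pts X \<times> pts Y) g snd)"
      unfolding sup_dist_def using tS by (rule SUP_upper)
    also have "\<dots> < ennreal (e / 2)" using s r by (rule less_trans)
    finally have "\<bar>f (fst (\<omega> t)) - g (snd (\<omega> t))\<bar> < e / 2" using tp by (simp add: compose_def ennreal_less_iff)
    then show "\<bar>f (fst (\<omega> t)) - g (snd (\<omega> t))\<bar> \<le> e" using e0 by simp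
  qed
  show ?thesis
  proof (rule concI[OF p q]; rule matchedI)
    fix f assume f: "f \<in> feat_closure X"
    from 1[OF f] obtain g where g: "g \<in> feat_closure Y" and s: "sup_dist S (compose (pts X \<times> pts Y) f fst) (compose (pts X \<times> pts Y) g snd) < r" by (elim bexE)
    from fin[OF f g s] show "\<exists>g\<in>feat_closure Y. close leb01 e (\<lambda>t. f (fst (\<omega> t))) (\<lambda>t. g (snd (\<omega> t)))" by (rule bexI[OF _ g])
  next
    fix g assume g: "g \<in> feat_closure Y"
    from 2[OF g] obtain f where f: "f \<in> feat_closure X" and s: "sup_dist S (compose (pts X \<times> pts Y) g snd) (compose (pts X \<times> pts Y) f fst) < r" by (elim bexE)
    from close_sym[OF fin[OF f g s[unfolded sup_dist_sym[of S "compose _ g _"]]]]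
    show "\<exists>f\<in>feat_closure X. close leb01 e (\<lambda>t. g (snd (\<omega> t))) (\<lambda>t. f (fst (\<omega> t)))" by (rule bexI[OF _ f])
  qed
qed

text \<open>The factor 4 combines the 2 in the definition of the box distance with a doubling that
  makes the Hausdorff inequality strict.\<close>

lemma box_dist_le:
  assumes X: "gds X" and Y: "gds Y" and \<phi>: "\<phi> \<in> parameters X" and \<psi>: "\<psi> \<in> parameters Y" and e: "0 < e"
    and S: "closedin (prod_topology (gds_topology X) (gds_topology Y)) S" "S \<noteq> {}" "S \<in> sets (meas X \<Otimes>\<^sub>M meas Y)"
    and m: "1 - e \<le> measure leb01 {t \<in> {0..1}. (\<phi> t, \<psi> t) \<in> S}"
    and 1: "\<And>f. f \<in> feat_closure X \<Longrightarrow> \<exists>g\<in>feat_closure Y. \<forall>(x, y)\<in>S. \<bar>f x - g y\<bar> \<le> e"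
    and 2: "\<And>g. g \<in> feat_closure Y \<Longrightarrow> \<exists>f\<in>feat_closure X. \<forall>(x, y)\<in>S. \<bar>f x - g y\<bar> \<le> e"
  shows "box_dist X Y \<le> ennreal (4 * e)"
proof -
  interpret X: gds X by fact
  interpret Y: gds Y by fact
  note [measurable] = X.param_measurable[OF \<phi>] Y.param_measurable[OF \<psi>]
  define P where "P = distr leb01 (meas X \<Otimes>\<^sub>M meas Y) (\<lambda>t. (\<phi> t, \<psi> t))"
  have mp: "(\<lambda>t. (\<phi> t, \<psi> t)) \<in> measurable leb01 (meas X \<Otimes>\<^sub>M meas Y)" by measurable
  have "distr P (meas X) fst = meas X" "distr P (meas Y) snd = meas Y"
    unfolding P_def using X.param_distr[OF \<phi>] Y.param_distr[OF \<psi>]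
    by (simp_all add: distr_distr[OF measurable_fst mp] distr_distr[OF measurable_snd mp] comp_def)
  then have P: "P \<in> couplings (meas X) (meas Y)" by (simp add: couplings_def P_def)
  have "measure P S = measure leb01 {t \<in> {0..1}. (\<phi> t, \<psi> t) \<in> S}"
    unfolding P_def by (subst measure_distr[OF mp S(3)]) (auto intro!: arg_cong[where f="measure leb01"])
  then have mS: "ennreal (1 - measure P S) \<le> ennreal (4 * e)" using m e by (intro ennreal_leI) simp
  have SXY: "S \<subseteq> pts X \<times> pts Y" using closedin_subset[OF S(1)] by (simp add: X.topology Y.topology)
  have sd: "sup_dist S (compose (pts X \<times> pts Y) f fst) (compose (pts X \<times> pts Y) g snd) < ennreal (2 * e)"
    if "\<forall>(x, y)\<in>S. \<bar>f x - g y\<bar> \<le> e" for f :: "'a \<Rightarrow> real" and g :: "'b \<Rightarrow> real"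
  proof -
    have "sup_dist S (compose (pts X \<times> pts Y) f fst) (compose (pts X \<times> pts Y) g snd) \<le> ennreal e"
      unfolding sup_dist_def
    proof (rule SUP_least)
      fix p assume p: "p \<in> S"
      then have "p \<in> pts X \<times> pts Y" "\<bar>f (fst p) - g (snd p)\<bar> \<le> e" using SXY that by auto
      then show "ennreal \<bar>compose (pts X \<times> pts Y) f fst p - compose (pts X \<times> pts Y) g snd p\<bar> \<le> ennreal e"
        by (simp add: compose_def ennreal_leI)
    qed
    also have "\<dots> < ennreal (2 * e)" using e by (intro ennreal_lessI) auto
    finally show ?thesis .
  qed
  have "hausdorff (sup_dist S) (pull (pts X \<times> pts Y) fst (feat_closure X)) (pull (pts X \<times> pts Y) snd (feat_closure Y)) \<le> ennreal (2 * e)"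
  proof (rule hausdorff_pull_le[OF _ sup_dist_sym])
    show "0 < ennreal (2 * e)" using e by simp
    fix f assume "f \<in> feat_closure X"
    from 1[OF this] obtain g where g: "g \<in> feat_closure Y" and le: "\<forall>(x, y)\<in>S. \<bar>f x - g y\<bar> \<le> e" by (elim bexE)
    from sd[OF le] g show "\<exists>g\<in>feat_closure Y. sup_dist S (compose (pts X \<times> pts Y) f fst) (compose (pts X \<times> pts Y) g snd) < ennreal (2 * e)" by (rule bexI)
  next
    fix g assume "g \<in> feat_closure Y"
    from 2[OF this] obtain f where f: "f \<in> feat_closure X" and le: "\<forall>(x, y)\<in>S. \<bar>f x - g y\<bar> \<le> e" by (elim bexE)
    from sd[OF le, unfolded sup_dist_sym[of S "compose _ f _"]] f
    show "\<exists>f\<in>feat_closure X. sup_dist S (compose (pts X \<times> pts Y) g snd) (compose (pts X \<times> pts Y) f fst) < ennreal (2 * e)" by (rule bexI)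
  qed
  then have "2 * hausdorff (sup_dist S) (pull (pts X \<times> pts Y) fst (feat_closure X)) (pull (pts X \<times> pts Y) snd (feat_closure Y)) \<le> 2 * ennreal (2 * e)"
    by (intro mult_left_mono) auto
  also have "2 * ennreal (2 * e) = ennreal (4 * e)" using e by (simp add: ennreal_mult''[symmetric] flip: ennreal_numeral)
  finally have "max (ennreal (1 - measure P S)) (2 * hausdorff (sup_dist S) (pull (pts X \<times> pts Y) fst (feat_closure X)) (pull (pts X \<times> pts Y) snd (feat_closure Y))) \<le> ennreal (4 * e)"
    using mS by simp
  then show ?thesis
    unfolding box_dist_def using P S by (intro INF_lower2[of "(P, S)"]) auto
qed

section \<open>Realizing random sequences by data sets\<close>

text \<open>The last clause says that the functions \<open>p \<circ> z n\<close> with p in L are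
  pointwise dense in the features, so the data set is generated by \<open>c\<close> alone.\<close>

definition realizes :: "(real \<Rightarrow> real) set \<Rightarrow> 'a gds \<Rightarrow> (real \<Rightarrow> 'a) \<Rightarrow> (real \<Rightarrow> nat \<Rightarrow> real) \<Rightarrow> (nat \<Rightarrow> 'a \<Rightarrow> real) \<Rightarrow> bool" where
  "realizes L Z \<zeta> c z \<longleftrightarrow> \<zeta> \<in> parameters Z \<and> (\<forall>n. z n \<in> feat_closure Z) \<and> (AE t in leb01. \<forall>n. z n (\<zeta> t) = c t n) \<and>
     (\<forall>f T e. f \<in> feat_closure Z \<longrightarrow> finite T \<longrightarrow> T \<subseteq> pts Z \<longrightarrow> 0 < e \<longrightarrow> (\<exists>p\<in>L. \<exists>n. \<forall>x\<in>T. \<bar>f x - p (z n x)\<bar> < e))"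

text \<open>The points are the support of the law of \<open>c\<close> for the supremum distance, the
  features are functions of L applied to coordinates, and the measure is the law of
  \<open>c\<close>. Separability of the range makes the support carry full mass; the bounds on
  differences make the metric finite.\<close>

lemma (in clipped) realization_exists:
  assumes c: "c \<in> measurable leb01 RN"
    and C: "countable C" "C \<subseteq> {0..1}" "\<And>t e. t \<in> {0..1} \<Longrightarrow> 0 < e \<Longrightarrow> \<exists>s\<in>C. \<forall>n. \<bar>c t n - c s n\<bar> \<le> e"
    and bdd: "\<And>s t. s \<in> {0..1} \<Longrightarrow> t \<in> {0..1} \<Longrightarrow> \<exists>B. \<forall>n. \<bar>c s n - c t n\<bar> \<le> B"
  shows "\<exists>(Z :: (nat \<Rightarrow> real) gds) \<zeta> z. cgds Z L \<and> realizes L Z \<zeta> c z"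
proof -
  note mc = RN_componentD[OF c]
  define V where "V z e = {t \<in> space leb01. \<forall>n. \<bar>c t n - z n\<bar> \<le> e}" for z :: "nat \<Rightarrow> real" and e :: real
  have V[measurable]: "V z e \<in> sets leb01" for z e
    unfolding V_def
    by (rule sets.sets_Collect_countable_All)
      (rule borel_measurable_le[OF borel_measurable_abs[OF borel_measurable_diff[OF mc borel_measurable_const]] borel_measurable_const])
  have V_mono: "V z e \<subseteq> V z' e'" if "\<And>n. \<bar>z n - z' n\<bar> \<le> e' - e" for z z' e e'
    unfolding V_def
  proof safe
    fix t n assume "\<forall>n. \<bar>c t n - z n\<bar> \<le> e"
    then have "\<bar>c t n - z n\<bar> \<le> e" by simp
    then show "\<bar>c t n - z' n\<bar> \<le> e'" using that[of n] by linarith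
  qed
  define P where "P = {z. \<forall>e>0. 0 < measure leb01 (V z e)}"
  define F where "F = {restrict (\<lambda>x. p (x n)) P | p n. p \<in> L}"
  have wit: "\<exists>t\<in>{0..1}. \<forall>n. \<bar>c t n - z n\<bar> \<le> e" if "z \<in> P" "0 < e" for z e
  proof -
    have "measure leb01 (V z e) \<noteq> 0" using that unfolding P_def by force
    then have "V z e \<noteq> {}" by (metis measure_empty)
    then show ?thesis by (auto simp: V_def)
  qed
  have Pbdd: "\<exists>B. \<forall>n. \<bar>x n - y n\<bar> \<le> B" if xy: "x \<in> P" "y \<in> P" for x y
  proof -
    obtain s where s: "s \<in> {0..1}" "\<forall>n. \<bar>c s n - x n\<bar> \<le> 1" using wit[OF xy(1), of 1] by auto
    obtain t where t: "t \<in> {0..1}" "\<forall>n. \<bar>c t n - y n\<bar> \<le> 1" using wit[OF xy(2), of 1] by auto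
    obtain B where B: "\<forall>n. \<bar>c s n - c t n\<bar> \<le> B" using bdd[OF s(1) t(1)] by blast
    have "\<bar>x n - y n\<bar> \<le> B + 2" for n
      using spec[OF s(2), of n] spec[OF t(2), of n] spec[OF B, of n] by linarith
    then show ?thesis by blast
  qed
  \<comment> \<open>The massless balls of radius 1/(m+1) around the countably many values on
    \<open>C\<close>; outside their preimage every value of \<open>c\<close> lies in the
    support.\<close>
  define bad where "bad = (\<Union>s\<in>C. \<Union>m\<in>{m::nat. measure leb01 (V (c s) (1 / real (Suc m))) = 0}. V (c s) (1 / real (Suc m)))"
  have bad_null: "bad \<in> null_sets leb01"
    unfolding bad_def using C(1) V
    by (intro null_sets_UN') (auto simp: null_sets_def leb01.emeasure_eq_measure)
  define good where "good = space leb01 - bad"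
  have good_sets: "good \<in> sets leb01" unfolding good_def by (rule sets.Diff[OF sets.top null_setsD2[OF bad_null]])
  have good_AE: "AE t in leb01. t \<in> good"
    using AE_not_in[OF bad_null] by (rule AE_mp) (auto simp: good_def)
  have goodP: "c t \<in> P" if t: "t \<in> good" for t
    unfolding P_def
  proof (intro CollectI allI impI)
    fix e :: real assume e: "0 < e"
    obtain m where m: "1 / real (Suc m) < e / 2" using nat_approx_posE[of "e / 2"] e by auto
    have t01: "t \<in> {0..1}" using t by (simp add: good_def)
    obtain s where s: "s \<in> C" "\<forall>n. \<bar>c t n - c s n\<bar> \<le> 1 / real (Suc m)" using C(3)[OF t01, of "1 / real (Suc m)"] by auto
    have "t \<in> V (c s) (1 / real (Suc m))" using s(2) t01 by (simp add: V_def)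
    then have "measure leb01 (V (c s) (1 / real (Suc m))) \<noteq> 0" using t s(1) by (auto simp: good_def bad_def)
    then have "0 < measure leb01 (V (c s) (1 / real (Suc m)))" by (simp add: zero_less_measure_iff)
    also have "\<dots> \<le> measure leb01 (V (c t) e)"
    proof (rule leb01.finite_measure_mono[OF V_mono V])
      fix n
      show "\<bar>c s n - c t n\<bar> \<le> e - 1 / real (Suc m)" using spec[OF s(2), of n] m by linarith
    qed
    finally show "0 < measure leb01 (V (c t) e)" .
  qed
  have "good \<noteq> {}"
  proof
    assume "good = {}"
    then have "space leb01 = bad" using null_setsD2[OF bad_null] sets.sets_into_space[OF null_setsD2[OF bad_null]] by (auto simp: good_def)
    then show False using bad_null leb01.emeasure_space_1 by auto
  qed
  then obtain t0 where t0: "t0 \<in> good" by blast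
  define z0 where "z0 = c t0"
  have z0: "z0 \<in> P" unfolding z0_def by (rule goodP[OF t0])
  define \<zeta> where "\<zeta> t = (if t \<in> good then c t else z0)" for t
  have \<zeta>P: "\<zeta> t \<in> P" for t using goodP z0 by (simp add: \<zeta>_def)
  define Z0 where "Z0 = \<lparr>pts = P, feat = F, meas = undefined\<rparr>"
  define Z where "Z = \<lparr>pts = P, feat = F, meas = distr leb01 (borel_of (gds_topology Z0)) \<zeta>\<rparr>"
  have Z_simps: "pts Z = P" "feat Z = F" "meas Z = distr leb01 (borel_of (gds_topology Z0)) \<zeta>"
    by (simp_all add: Z_def)
  have dZ0: "gds_dist Z0 = gds_dist Z" by (auto simp: fun_eq_iff gds_dist_def Z0_def Z_def)
  have T0: "gds_topology Z0 = gds_topology Z" unfolding gds_topology_def dZ0 by (simp add: Z0_def Z_def)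
  have Fbound: "\<bar>f x - f y\<bar> \<le> B" if fF: "f \<in> F" and xyP: "x \<in> P" "y \<in> P" and le: "\<forall>n. \<bar>x n - y n\<bar> \<le> B" for f x y B
  proof -
    obtain p n where p: "p \<in> L" "f = restrict (\<lambda>x. p (x n)) P" using fF unfolding F_def by blast
    have "\<bar>p (x n) - p (y n)\<bar> \<le> \<bar>x n - y n\<bar>" by (rule Lip1D[OF L_Lip1[OF p(1)]])
    then show ?thesis using xyP spec[OF le, of n] by (simp add: p(2))
  qed
  have Fne: "F \<noteq> {}" using L_id by (auto simp: F_def)
  have projF: "restrict (\<lambda>x. x n) P \<in> F" for n using L_id by (auto simp: F_def)
  have bddF: "bdd_above ((\<lambda>f. \<bar>f x - f y\<bar>) ` F)" if xy: "x \<in> P" "y \<in> P" for x y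
  proof -
    obtain B where "\<forall>n. \<bar>x n - y n\<bar> \<le> B" using Pbdd[OF xy] by blast
    then show ?thesis using Fbound[OF _ xy] by (intro bdd_aboveI2[of _ _ B]) blast
  qed
  \<comment> \<open>Coordinates are features because L contains the identity, and every feature is
    1-Lipschitz in one coordinate; hence the metric is the supremum distance.\<close>
  have d_le: "gds_dist Z x y \<le> r \<longleftrightarrow> (\<forall>n. \<bar>x n - y n\<bar> \<le> r)" if xy: "x \<in> P" "y \<in> P" for x y r
  proof
    assume le: "gds_dist Z x y \<le> r"
    show "\<forall>n. \<bar>x n - y n\<bar> \<le> r"
    proof
      fix n
      have "\<bar>restrict (\<lambda>x. x n) P x - restrict (\<lambda>x. x n) P y\<bar> \<le> (SUP f\<in>F. \<bar>f x - f y\<bar>)"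
        by (rule cSUP_upper[OF projF bddF[OF xy]])
      then show "\<bar>x n - y n\<bar> \<le> r" using le xy by (simp add: gds_dist_def Z_simps)
    qed
  next
    assume "\<forall>n. \<bar>x n - y n\<bar> \<le> r"
    then show "gds_dist Z x y \<le> r"
      using xy Fbound[OF _ xy] unfolding gds_dist_def Z_simps by (auto intro!: cSUP_least Fne)
  qed
  have proj_le: "\<bar>x n - y n\<bar> \<le> gds_dist Z x y" if "x \<in> P" "y \<in> P" for x y n
    using d_le[OF that, of "gds_dist Z x y"] by simp
  have d_nonneg: "0 \<le> gds_dist Z x y" for x y
  proof (cases "x \<in> P \<and> y \<in> P")
    case True
    then show ?thesis using proj_le[of x y 0] by linarith
  next
    case False
    then show ?thesis by (auto simp: gds_dist_def Z_simps)
  qed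
  interpret M: Metric_space P "gds_dist Z"
  proof
    fix x y z
    show "0 \<le> gds_dist Z x y" by (rule d_nonneg)
    show "gds_dist Z x y = gds_dist Z y x" by (simp add: gds_dist_def abs_minus_commute conj_commute)
    show "gds_dist Z x y = 0 \<longleftrightarrow> x = y" if xy: "x \<in> P" "y \<in> P"
    proof
      assume "gds_dist Z x y = 0"
      then have "\<bar>x n - y n\<bar> \<le> 0" for n using proj_le[OF xy, of n] by simp
      then show "x = y" by (simp add: fun_eq_iff)
    next
      assume "x = y"
      then have "gds_dist Z x y \<le> 0" using d_le[OF xy, of 0] by simp
      then show "gds_dist Z x y = 0" using d_nonneg[of x y] by simp
    qed
    show "gds_dist Z x z \<le> gds_dist Z x y + gds_dist Z y z" if xyz: "x \<in> P" "y \<in> P" "z \<in> P"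
    proof (subst d_le[OF xyz(1,3)], rule allI)
      fix n
      show "\<bar>x n - z n\<bar> \<le> gds_dist Z x y + gds_dist Z y z"
        using proj_le[OF xyz(1,2), of n] proj_le[OF xyz(2,3), of n] by linarith
    qed
  qed
  have TZ: "gds_topology Z = M.mtopology" by (simp add: gds_topology_def Z_simps)
  have complete: "M.mcomplete"
    unfolding M.mcomplete_def
  proof (intro allI impI)
    fix \<sigma> assume \<sigma>: "M.MCauchy \<sigma>"
    then have \<sigma>P: "\<sigma> m \<in> P" for m by (auto simp: M.MCauchy_def)
    have cau: "\<exists>N. \<forall>m m'. N \<le> m \<longrightarrow> N \<le> m' \<longrightarrow> gds_dist Z (\<sigma> m) (\<sigma> m') < e" if "0 < e" for e
      using \<sigma> that by (auto simp: M.MCauchy_def)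
    have "convergent (\<lambda>m. \<sigma> m n)" for n
    proof -
      have "Cauchy (\<lambda>m. \<sigma> m n)"
      proof (rule metric_CauchyI)
        fix e :: real assume "0 < e"
        then obtain N where N: "\<forall>m m'. N \<le> m \<longrightarrow> N \<le> m' \<longrightarrow> gds_dist Z (\<sigma> m) (\<sigma> m') < e" using cau by blast
        have "dist (\<sigma> m n) (\<sigma> m' n) < e" if "N \<le> m" "N \<le> m'" for m m'
          using N that proj_le[OF \<sigma>P[of m] \<sigma>P[of m'], of n] by (fastforce simp: dist_real_def)
        then show "\<exists>M. \<forall>m\<ge>M. \<forall>m'\<ge>M. dist (\<sigma> m n) (\<sigma> m' n) < e" by blast
      qed
      then show ?thesis by (simp add: Cauchy_convergent_iff)
    qed
    then have "\<forall>n. \<exists>l. (\<lambda>m. \<sigma> m n) \<longlonglongrightarrow> l" by (simp add: convergent_def)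
    from choice[OF this] obtain z where z: "\<And>n. (\<lambda>m. \<sigma> m n) \<longlonglongrightarrow> z n" by blast
    have unif: "\<exists>N. \<forall>m\<ge>N. \<forall>n. \<bar>\<sigma> m n - z n\<bar> \<le> e" if e: "0 < e" for e
    proof -
      obtain N where N: "\<forall>m m'. N \<le> m \<longrightarrow> N \<le> m' \<longrightarrow> gds_dist Z (\<sigma> m) (\<sigma> m') < e" using cau[OF e] by blast
      have "\<bar>\<sigma> m n - z n\<bar> \<le> e" if m: "N \<le> m" for m n
      proof (rule LIMSEQ_le_const2)
        show "(\<lambda>m'. \<bar>\<sigma> m n - \<sigma> m' n\<bar>) \<longlonglongrightarrow> \<bar>\<sigma> m n - z n\<bar>" by (intro tendsto_intros z)
        have "\<bar>\<sigma> m n - \<sigma> m' n\<bar> \<le> e" if "N \<le> m'" for m'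
          using N m that proj_le[OF \<sigma>P[of m] \<sigma>P[of m'], of n] by fastforce
        then show "\<exists>N. \<forall>m'\<ge>N. \<bar>\<sigma> m n - \<sigma> m' n\<bar> \<le> e" by blast
      qed
      then show ?thesis by blast
    qed
    \<comment> \<open>The support is closed: the ball of radius e around the limit contains a ball
      of radius e/2 around a point of the support.\<close>
    have zP: "z \<in> P"
      unfolding P_def
    proof (intro CollectI allI impI)
      fix e :: real assume e: "0 < e"
      then obtain N where N: "\<forall>m\<ge>N. \<forall>n. \<bar>\<sigma> m n - z n\<bar> \<le> e / 2" using unif[of "e / 2"] by auto
      have "0 < measure leb01 (V (\<sigma> N) (e / 2))" using \<sigma>P[of N] e by (simp add: P_def)
      also have "\<dots> \<le> measure leb01 (V z e)"
        by (rule leb01.finite_measure_mono[OF V_mono V]) (use N in simp)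
      finally show "0 < measure leb01 (V z e)" .
    qed
    have "limitin M.mtopology \<sigma> z sequentially"
      unfolding M.limit_metric_sequentially
    proof (intro conjI allI impI zP)
      fix e :: real assume e: "0 < e"
      then obtain N where N: "\<forall>m\<ge>N. \<forall>n. \<bar>\<sigma> m n - z n\<bar> \<le> e / 2" using unif[of "e / 2"] by auto
      have "\<sigma> m \<in> P \<and> gds_dist Z (\<sigma> m) z < e" if "N \<le> m" for m
      proof -
        have "gds_dist Z (\<sigma> m) z \<le> e / 2" using d_le[OF \<sigma>P zP] N that by blast
        then show ?thesis using \<sigma>P e by simp
      qed
      then show "\<exists>N. \<forall>n\<ge>N. \<sigma> n \<in> P \<and> gds_dist Z (\<sigma> n) z < e" by blast
    qed
    then show "\<exists>x. limitin M.mtopology \<sigma> x sequentially" by blast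
  qed
  \<comment> \<open>The values on \<open>C\<close> may lie outside the support, so a nearby point of
    the support is chosen wherever there is one.\<close>
  define pick where "pick = (\<lambda>(s, m::nat). if \<exists>y. y \<in> P \<and> (\<forall>n. \<bar>y n - c s n\<bar> \<le> 1 / real (Suc m))
      then SOME y. y \<in> P \<and> (\<forall>n. \<bar>y n - c s n\<bar> \<le> 1 / real (Suc m)) else z0)"
  define D where "D = pick ` (C \<times> UNIV)"
  have cD: "countable D" unfolding D_def using C(1) by auto
  have pick: "pick (s, m) \<in> P \<and> (\<forall>n. \<bar>pick (s, m) n - c s n\<bar> \<le> 1 / real (Suc m))"
    if ex: "\<exists>y. y \<in> P \<and> (\<forall>n. \<bar>y n - c s n\<bar> \<le> 1 / real (Suc m))" for s m
  proof -
    have "pick (s, m) = (SOME y. y \<in> P \<and> (\<forall>n. \<bar>y n - c s n\<bar> \<le> 1 / real (Suc m)))"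
      unfolding pick_def prod.case using ex by (rule if_P)
    then show ?thesis using someI_ex[OF ex] by simp
  qed
  have DP: "D \<subseteq> P"
  proof
    fix y assume "y \<in> D"
    then obtain s m where y: "y = pick (s, m)" by (auto simp: D_def)
    show "y \<in> P"
    proof (cases "\<exists>y. y \<in> P \<and> (\<forall>n. \<bar>y n - c s n\<bar> \<le> 1 / real (Suc m))")
      case True
      then show ?thesis using pick unfolding y by blast
    next
      case False
      then have "pick (s, m) = z0" unfolding pick_def prod.case by (rule if_not_P)
      then show ?thesis using z0 y by simp
    qed
  qed
  have Ddense: "\<exists>y\<in>D. gds_dist Z x y < r" if x: "x \<in> P" and r: "0 < r" for x r
  proof -
    obtain m where m: "1 / real (Suc m) < r / 2" using nat_approx_posE[of "r / 2"] r by auto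
    define e where "e = 1 / real (Suc m) / 2"
    have e: "0 < e" by (simp add: e_def)
    have ee: "1 / real (Suc m) = e + e" by (simp add: e_def del: of_nat_Suc)
    obtain t where t: "t \<in> {0..1}" "\<forall>n. \<bar>c t n - x n\<bar> \<le> e" using wit[OF x e] by blast
    obtain s where s: "s \<in> C" "\<forall>n. \<bar>c t n - c s n\<bar> \<le> e" using C(3)[OF t(1) e] by blast
    have xs: "\<bar>x n - c s n\<bar> \<le> 1 / real (Suc m)" for n
      using spec[OF t(2), of n] spec[OF s(2), of n] unfolding ee by linarith
    have ex: "\<exists>y. y \<in> P \<and> (\<forall>n. \<bar>y n - c s n\<bar> \<le> 1 / real (Suc m))" by (rule exI[of _ x], intro conjI x allI xs)
    note p = pick[OF ex]
    have "gds_dist Z x (pick (s, m)) \<le> 1 / real (Suc m) + 1 / real (Suc m)"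
    proof (subst d_le[OF x conjunct1[OF p]], rule allI)
      fix n
      show "\<bar>x n - pick (s, m) n\<bar> \<le> 1 / real (Suc m) + 1 / real (Suc m)"
        using xs[of n] spec[OF conjunct2[OF p], of n] by linarith
    qed
    then have "gds_dist Z x (pick (s, m)) < r" using m by linarith
    moreover have "pick (s, m) \<in> D" unfolding D_def using s(1) by (intro imageI) simp
    ultimately show ?thesis by (rule bexI)
  qed
  have sep: "separable_space (gds_topology Z)"
    unfolding separable_space_def TZ
  proof (intro exI[of _ D] conjI cD)
    show "D \<subseteq> topspace M.mtopology" using DP by simp
    have "P \<subseteq> M.mtopology closure_of D"
    proof
      fix x assume x: "x \<in> P"
      have "\<exists>y\<in>D. y \<in> M.mball x r" if r: "0 < r" for r
      proof -
        obtain y where "y \<in> D" "gds_dist Z x y < r" using Ddense[OF x r] by blast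
        then show ?thesis using x DP by (intro bexI[of _ y]) auto
      qed
      then show "x \<in> M.mtopology closure_of D" unfolding M.metric_closure_of using x by simp
    qed
    then show "M.mtopology closure_of D = topspace M.mtopology"
      using closure_of_subset_topspace[of M.mtopology D] by auto
  qed
  have ball_eq: "M.mcball y r = {x \<in> P. \<forall>n. \<bar>y n - x n\<bar> \<le> r}" if "y \<in> P" for y r
    using that d_le by auto
  have Vset: "{t \<in> space leb01. \<forall>n. \<bar>y n - c t n\<bar> \<le> r} = V y r" for y r
    by (simp add: V_def abs_minus_commute)
  have \<zeta>_ball: "\<zeta> -` M.mcball y r \<inter> space leb01 \<in> sets leb01" if y: "y \<in> P" for y r
  proof -
    have "\<zeta> -` M.mcball y r \<inter> space leb01 = (good \<inter> V y r) \<union> (if z0 \<in> M.mcball y r then space leb01 - good else {})"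
    proof (rule set_eqI)
      fix t
      have "t \<in> good \<Longrightarrow> t \<in> space leb01" by (simp add: good_def)
      then show "t \<in> \<zeta> -` M.mcball y r \<inter> space leb01 \<longleftrightarrow> t \<in> (good \<inter> V y r) \<union> (if z0 \<in> M.mcball y r then space leb01 - good else {})"
        unfolding ball_eq[OF y] Vset[symmetric]
        by (cases "t \<in> good"; cases "\<forall>n. \<bar>y n - z0 n\<bar> \<le> r") (simp_all add: \<zeta>_def z0 goodP)
    qed
    moreover have "good \<inter> V y r \<in> sets leb01" "space leb01 - good \<in> sets leb01"
      by (rule sets.Int[OF good_sets V], rule sets.Diff[OF sets.top good_sets])
    ultimately show ?thesis by (simp only: sets.Un sets.empty_sets simp_thms split: if_split)
  qed
  have \<zeta>_open: "\<zeta> -` U \<inter> space leb01 \<in> sets leb01" if "openin M.mtopology U" for U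
    by (rule M.open_preimage_measurable[OF cD DP Ddense \<zeta>_ball that]) (use DP in auto)
  have \<zeta>m: "\<zeta> \<in> measurable leb01 (borel_of (gds_topology Z))"
    unfolding borel_of_def TZ
  proof (rule measurable_measure_of)
    show "{U. openin M.mtopology U} \<subseteq> Pow (topspace M.mtopology)" using openin_subset by blast
    show "\<zeta> \<in> space leb01 \<rightarrow> topspace M.mtopology" using \<zeta>P by simp
  qed (use \<zeta>_open in simp)
  have mZ: "meas Z = distr leb01 (borel_of (gds_topology Z)) \<zeta>" by (simp add: Z_simps T0)
  have gZ: "geometric_data_set Z"
    unfolding geometric_data_set_def
  proof (intro conjI allI impI ballI)
    show "feat Z \<noteq> {}" using Fne by (simp add: Z_simps)
    show "feat Z \<subseteq> extensional (pts Z)" by (auto simp: Z_simps F_def)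
    show "bdd_above ((\<lambda>f. \<bar>f a - f b\<bar>) ` feat Z)" if "a \<in> pts Z" "b \<in> pts Z" for a b
      using bddF that by (simp add: Z_simps)
    show "Metric_space (pts Z) (gds_dist Z)" using M.Metric_space_axioms by (simp add: Z_simps)
    show "Metric_space.mcomplete (pts Z) (gds_dist Z)" using complete by (simp add: Z_simps)
    show "separable_space (gds_topology Z)" by (rule sep)
    show "prob_space (meas Z)" unfolding mZ by (rule leb01.prob_space_distr[OF \<zeta>m])
    show "sets (meas Z) = sets (borel_of (gds_topology Z))" by (simp add: mZ)
    fix U assume U: "openin (gds_topology Z) U \<and> U \<noteq> {}"
    then obtain x where x: "x \<in> U" by blast
    then obtain r where r: "0 < r" "M.mball x r \<subseteq> U" and xP: "x \<in> P"
      using U unfolding TZ M.openin_mtopology by blast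
    have Us: "U \<in> sets (borel_of (gds_topology Z))"
      using U by (auto simp: borel_of_def sets_measure_of_conv dest: openin_subset)
    have "0 < measure leb01 (V x (r / 2))" using xP r(1) by (simp add: P_def)
    also have "measure leb01 (V x (r / 2)) = measure leb01 (good \<inter> V x (r / 2))"
      using good_AE good_sets by (intro measure_eq_AE) auto
    also have "\<dots> \<le> measure leb01 (\<zeta> -` U \<inter> space leb01)"
    proof (rule leb01.finite_measure_mono)
      show "good \<inter> V x (r / 2) \<subseteq> \<zeta> -` U \<inter> space leb01"
      proof
        fix t assume t: "t \<in> good \<inter> V x (r / 2)"
        then have "c t \<in> P" "\<forall>n. \<bar>x n - c t n\<bar> \<le> r / 2" "t \<in> space leb01"
          using goodP by (auto simp: V_def abs_minus_commute)
        then have "gds_dist Z x (c t) \<le> r / 2" using d_le[OF xP] by blast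
        then have "c t \<in> M.mball x r" using \<open>c t \<in> P\<close> xP r(1) by simp
        then show "t \<in> \<zeta> -` U \<inter> space leb01" using r(2) t \<open>t \<in> space leb01\<close> by (auto simp: \<zeta>_def)
      qed
      show "\<zeta> -` U \<inter> space leb01 \<in> sets leb01" using \<zeta>_open U by (simp add: TZ)
    qed
    finally show "emeasure (meas Z) U > 0"
      unfolding mZ emeasure_distr[OF \<zeta>m Us] by (simp add: leb01.emeasure_eq_measure)
  qed
  interpret Z: gds Z by unfold_locales (rule gZ)
  have "lcomp (pts Z) L (feat_closure Z) \<subseteq> feat_closure Z"
  proof
    fix g assume "g \<in> lcomp (pts Z) L (feat_closure Z)"
    then obtain p f where p: "p \<in> L" and f: "f \<in> feat_closure Z" and g: "g = compose (pts Z) p f" by (auto simp: lcomp_def)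
    show "g \<in> feat_closure Z"
    proof (rule Z.feat_closure_closed)
      show "g \<in> extensional (pts Z)" unfolding g by (rule compose_extensional)
      fix T :: "(nat \<Rightarrow> real) set" and e :: real assume T: "finite T" "T \<subseteq> pts Z" "0 < e"
      obtain h where h: "h \<in> feat Z" "\<And>x. x \<in> T \<Longrightarrow> \<bar>f x - h x\<bar> < e" by (rule Z.feat_closureE[OF f T]) (rule that)
      obtain q n where q: "q \<in> L" "h = restrict (\<lambda>x. q (x n)) P" using h(1) by (auto simp: Z_simps F_def)
      have "restrict (\<lambda>x. p (q (x n))) P \<in> feat Z" unfolding Z_simps F_def
        by (intro CollectI exI[of _ "\<lambda>r. p (q r)"] exI[of _ n] conjI refl L_comp[OF p q(1)])
      then have 1: "restrict (\<lambda>x. p (q (x n))) P \<in> feat_closure Z" by (rule Z.feat_subset_closure)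
      have "\<bar>g x - restrict (\<lambda>x. p (q (x n))) P x\<bar> < e" if x: "x \<in> T" for x
      proof -
        have "x \<in> P" using x T(2) by (auto simp: Z_simps)
        then show ?thesis
          using Lip1D[OF L_Lip1[OF p], of "f x" "h x"] h(2)[OF x] by (simp add: g compose_def Z_simps q(2))
      qed
      then show "\<exists>h\<in>feat_closure Z. \<forall>x\<in>T. \<bar>g x - h x\<bar> < e" by (intro bexI[OF _ 1] ballI)
    qed
  qed
  then have cZ: "cgds Z L"
    unfolding cgds_def cgds_axioms_def using Z.gds_axioms clipped_axioms by simp
  have "realizes L Z \<zeta> c (\<lambda>n. restrict (\<lambda>x. x n) P)"
    unfolding realizes_def
  proof (intro conjI allI impI)
    have sZ: "sets (meas Z) = sets (borel_of (gds_topology Z))" by (simp add: mZ)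
    have "distr leb01 (meas Z) \<zeta> = distr leb01 (borel_of (gds_topology Z)) \<zeta>" by (rule distr_cong[OF refl sZ refl])
    then have "distr leb01 (meas Z) \<zeta> = meas Z" by (simp only: mZ)
    then show "\<zeta> \<in> parameters Z" using \<zeta>m by (simp add: parameters_def measurable_cong_sets[OF refl sZ])
    show "restrict (\<lambda>x. x n) P \<in> feat_closure Z" for n by (rule Z.feat_subset_closure) (simp add: Z_simps projF)
    show "AE t in leb01. \<forall>n. restrict (\<lambda>x. x n) P (\<zeta> t) = c t n"
      using good_AE by (rule AE_mp) (simp add: \<zeta>_def goodP)
    fix f and T :: "(nat \<Rightarrow> real) set" and e :: real assume f: "f \<in> feat_closure Z" and T: "finite T" "T \<subseteq> pts Z" "0 < e"
    obtain h where h: "h \<in> feat Z" "\<And>x. x \<in> T \<Longrightarrow> \<bar>f x - h x\<bar> < e" by (rule Z.feat_closureE[OF f T]) (rule that)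
    obtain q n where q: "q \<in> L" "h = restrict (\<lambda>x. q (x n)) P" using h(1) by (auto simp: Z_simps F_def)
    have "\<bar>f x - q (restrict (\<lambda>x. x n) P x)\<bar> < e" if x: "x \<in> T" for x
    proof -
      have "x \<in> P" using x T(2) by (auto simp: Z_simps)
      then show ?thesis using h(2)[OF x] by (simp add: q(2))
    qed
    then show "\<exists>p\<in>L. \<exists>n. \<forall>x\<in>T. \<bar>f x - p (restrict (\<lambda>x. x n) P x)\<bar> < e"
      by (intro bexI[OF _ q(1)] exI[of _ n] ballI)
  qed
  then show ?thesis using cZ by blast
qed

lemma realizes_transfer:
  assumes Z: "gds Z" and W: "gds W" and iso: "gds_iso Z W" and real: "realizes L Z \<zeta> c z"
  shows "\<exists>\<zeta>' z'. realizes L W \<zeta>' c z'"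
proof -
  interpret Z: gds Z by fact
  interpret W: gds W by fact
  obtain h where bij: "bij_betw h (pts Z) (pts W)" and h: "h \<in> measurable (meas Z) (meas W)" "distr (meas Z) (meas W) h = meas W"
    and F: "pull (pts Z) h (feat_closure W) = feat_closure Z"
    using iso unfolding gds_iso_def by (elim exE conjE) (rule that)
  have \<zeta>: "\<zeta> \<in> parameters Z" and z: "\<And>n. z n \<in> feat_closure Z" and ae: "AE t in leb01. \<forall>n. z n (\<zeta> t) = c t n"
    and gen: "\<forall>f T e. f \<in> feat_closure Z \<longrightarrow> finite T \<longrightarrow> T \<subseteq> pts Z \<longrightarrow> 0 < e \<longrightarrow> (\<exists>p\<in>L. \<exists>n. \<forall>x\<in>T. \<bar>f x - p (z n x)\<bar> < e)"
    using real unfolding realizes_def by blast+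
  have h\<zeta>: "(\<lambda>t. h (\<zeta> t)) \<in> parameters W"
    using measurable_compose[OF Z.param_measurable[OF \<zeta>] h(1)] h(2) Z.param_distr[OF \<zeta>]
      distr_distr[OF h(1) Z.param_measurable[OF \<zeta>]]
    by (simp add: parameters_def comp_def)
  have "\<forall>n. \<exists>g. g \<in> feat_closure W \<and> z n = compose (pts Z) g h"
  proof
    fix n
    have "z n \<in> pull (pts Z) h (feat_closure W)" unfolding F by (rule z)
    then show "\<exists>g. g \<in> feat_closure W \<and> z n = compose (pts Z) g h" unfolding pull_def by blast
  qed
  from choice[OF this] obtain z' where z'0: "\<forall>n. z' n \<in> feat_closure W \<and> z n = compose (pts Z) (z' n) h" by (elim exE)
  note z' = conjunct1[OF spec[OF z'0]] conjunct2[OF spec[OF z'0]]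
  have zz: "z n x = z' n (h x)" if "x \<in> pts Z" for n x using fun_cong[OF z'(2)[of n], of x] that by (simp add: compose_def)
  have "realizes L W (\<lambda>t. h (\<zeta> t)) c z'"
    unfolding realizes_def
  proof (intro conjI allI impI h\<zeta> z'(1))
    show "AE t in leb01. \<forall>n. z' n (h (\<zeta> t)) = c t n"
      using ae
    proof (rule AE_mp, intro AE_I2 impI allI)
      fix t n assume "t \<in> space leb01" and e: "\<forall>n. z n (\<zeta> t) = c t n"
      then have "\<zeta> t \<in> pts Z" using Z.param_pts[OF \<zeta>] by simp
      then show "z' n (h (\<zeta> t)) = c t n" using spec[OF e, of n] zz[of "\<zeta> t" n] by simp
    qed
    fix f and T and e :: real assume f: "f \<in> feat_closure W" and T: "finite T" "T \<subseteq> pts W" "0 < e"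
    define k where "k = inv_into (pts Z) h"
    have k: "k y \<in> pts Z" "h (k y) = y" if "y \<in> pts W" for y
    proof -
      have "y \<in> h ` pts Z" using bij that by (simp add: bij_betw_def)
      then show "k y \<in> pts Z" "h (k y) = y" unfolding k_def by (rule inv_into_into, rule f_inv_into_f)
    qed
    have fh: "compose (pts Z) f h \<in> feat_closure Z" unfolding F[symmetric] pull_def using f by (rule imageI)
    have "finite (k ` T)" "k ` T \<subseteq> pts Z" using T k by auto
    from gen[rule_format, OF fh this T(3)] obtain p n where p: "p \<in> L"
      and le: "\<forall>x\<in>k ` T. \<bar>compose (pts Z) f h x - p (z n x)\<bar> < e" by (elim bexE exE)
    have "\<bar>f y - p (z' n y)\<bar> < e" if y: "y \<in> T" for y
    proof -
      have "y \<in> pts W" using y T(2) by blast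
      then show ?thesis using bspec[OF le imageI[OF y]] k[of y] zz[of "k y" n] by (simp add: compose_def)
    qed
    then show "\<exists>p\<in>L. \<exists>n. \<forall>y\<in>T. \<bar>f y - p (z' n y)\<bar> < e" by (intro bexI[OF _ p] exI[of _ n] ballI)
  qed
  then show ?thesis by (intro exI)
qed

text \<open>The realization lives on a set of sequences; its points are relabelled by reals, and the
  data set is then replaced by the chosen representative of its class.\<close>

lemma (in clipped) class_realization:
  assumes c: "c \<in> measurable leb01 RN"
    and C: "countable C" "C \<subseteq> {0..1}" "\<And>t e. t \<in> {0..1} \<Longrightarrow> 0 < e \<Longrightarrow> \<exists>s\<in>C. \<forall>n. \<bar>c t n - c s n\<bar> \<le> e"
    and bdd: "\<And>s t. s \<in> {0..1} \<Longrightarrow> t \<in> {0..1} \<Longrightarrow> \<exists>B. \<forall>n. \<bar>c s n - c t n\<bar> \<le> B"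
  shows "\<exists>A\<in>l_classes L. \<exists>\<zeta> z. realizes L (rep A) \<zeta> c z"
proof -
  have "\<exists>(Z :: (nat \<Rightarrow> real) gds) \<zeta> z. cgds Z L \<and> realizes L Z \<zeta> c z"
  proof (rule realization_exists[OF c C(1,2)])
    show "\<exists>s\<in>C. \<forall>n. \<bar>c t n - c s n\<bar> \<le> e" if "t \<in> {0..1}" "0 < e" for t e by (rule C(3)[OF that])
    show "\<exists>B. \<forall>n. \<bar>c s n - c t n\<bar> \<le> B" if "s \<in> {0..1}" "t \<in> {0..1}" for s t by (rule bdd[OF that])
  qed
  then obtain Z :: "(nat \<Rightarrow> real) gds" and \<zeta> z where Z: "cgds Z L" and r: "realizes L Z \<zeta> c z"
    by (elim exE conjE)
  interpret Z: cgds Z L by fact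
  from geometric_data_set_real_copy[OF Z.gds] obtain Y :: "real gds" where gY: "geometric_data_set Y" and ZY: "gds_iso Z Y"
    by (elim exE conjE)
  have Y: "gds Y" by unfold_locales (rule gY)
  have cY: "cgds Y L" using iso_cgds[OF Z.gds_axioms Y ZY] Z by simp
  from l_class_exists[OF cY] obtain A where A: "A \<in> l_classes L" and YA: "Y \<in> A" by (elim bexE)
  note cA = l_class_rep(2)[OF A] and AY = l_class_rep(4)[OF A YA]
  have gA: "gds (rep A)" using cA by (simp add: cgds_def)
  have "gds_iso Z (rep A)"
  proof (rule mutual_iso[OF Z cA])
    show "dominated (rep A) Z"
      by (rule dominated_trans[OF Z Y cA iso_imp_dominated(2)[OF cA cY AY] iso_imp_dominated(1)[OF Z cY ZY]])
    show "dominated Z (rep A)"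
      by (rule dominated_trans[OF cA Y Z iso_imp_dominated(2)[OF Z cY ZY] iso_imp_dominated(1)[OF cA cY AY]])
  qed
  from realizes_transfer[OF Z.gds_axioms gA this r] show ?thesis using A by (intro bexI[of _ A])
qed

section \<open>Observables of a data set\<close>

definition obs :: "'a gds \<Rightarrow> (real \<Rightarrow> nat \<Rightarrow> real) set" where
  "obs X = {g \<in> measurable leb01 RN. \<exists>\<phi>\<in>parameters X. \<exists>f. (\<forall>i. f i \<in> feat_closure X) \<and>
     (\<forall>i. \<forall>x\<in>pts X. \<bar>f i x\<bar> \<le> real i) \<and> (\<forall>t\<in>{0..1}. \<forall>i. g t i = f i (\<phi> t))}"

lemma obs_measurable: "g \<in> obs X \<Longrightarrow> g \<in> measurable leb01 RN"
  by (simp add: obs_def)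

lemma obsE:
  assumes "g \<in> obs X"
  obtains \<phi> f where "\<phi> \<in> parameters X" "\<And>i. f i \<in> feat_closure X" "\<And>i x. x \<in> pts X \<Longrightarrow> \<bar>f i x\<bar> \<le> real i"
    "\<And>t i. t \<in> {0..1} \<Longrightarrow> g t i = f i (\<phi> t)"
proof -
  from assms have "\<exists>\<phi>\<in>parameters X. \<exists>f. (\<forall>i. f i \<in> feat_closure X) \<and>
     (\<forall>i. \<forall>x\<in>pts X. \<bar>f i x\<bar> \<le> real i) \<and> (\<forall>t\<in>{0..1}. \<forall>i. g t i = f i (\<phi> t))" by (simp add: obs_def)
  then obtain \<phi> f where 0: "\<phi> \<in> parameters X" and 1: "\<forall>i. f i \<in> feat_closure X"
    and 2: "\<forall>i. \<forall>x\<in>pts X. \<bar>f i x\<bar> \<le> real i" and 3: "\<forall>t\<in>{0..1}. \<forall>i. g t i = f i (\<phi> t)" by (elim bexE exE conjE)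
  show ?thesis by (rule that[OF 0 spec[OF 1] bspec[OF spec[OF 2]] spec[OF bspec[OF 3]]])
qed

lemma (in gds) measurable_feature_seq:
  assumes "\<phi> \<in> parameters X" "\<And>i. f i \<in> feat_closure X"
  shows "(\<lambda>t i. f i (\<phi> t)) \<in> measurable leb01 RN"
  unfolding measurable_RN_iff by (intro allI param_closure_measurable assms)

lemma (in gds) obsI:
  assumes "\<phi> \<in> parameters X" "\<And>i. f i \<in> feat_closure X" "\<And>i x. x \<in> pts X \<Longrightarrow> \<bar>f i x\<bar> \<le> real i"
  shows "(\<lambda>t i. f i (\<phi> t)) \<in> obs X"
  unfolding obs_def
  by (rule CollectI, rule conjI[OF measurable_feature_seq[OF assms(1,2)]], rule bexI[OF _ assms(1)], rule exI[of _ f])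
    (simp add: assms(2,3))

lemma (in gds) law_feature_seq:
  assumes "\<phi> \<in> parameters X" "\<psi> \<in> parameters X" "\<And>i. f i \<in> feat_closure X"
  shows "distr leb01 RN (\<lambda>t i. f i (\<phi> t)) = distr leb01 RN (\<lambda>t i. f i (\<psi> t))"
proof -
  have m: "(\<lambda>x i. f i x) \<in> measurable (meas X) RN"
    unfolding measurable_RN_iff by (intro allI closure_measurable assms)
  have "distr leb01 RN (\<lambda>t i. f i (\<chi>' t)) = distr (meas X) RN (\<lambda>x i. f i x)" if "\<chi>' \<in> parameters X" for \<chi>'
    using distr_distr[OF m param_measurable[OF that]] param_distr[OF that] by (simp add: comp_def)
  then show ?thesis using assms by simp
qed

text \<open>The law of a sequence of features does not depend on the parameter, so up to law one
  parameter serves all observables.\<close>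

lemma (in gds) obs_change_param:
  assumes g: "g \<in> obs X" and \<psi>: "\<psi> \<in> parameters X"
  shows "\<exists>f. (\<forall>i. f i \<in> feat_closure X) \<and> (\<forall>i. \<forall>x\<in>pts X. \<bar>f i x\<bar> \<le> real i) \<and>
    distr leb01 RN g = distr leb01 RN (\<lambda>t i. f i (\<psi> t))"
proof -
  obtain \<phi> f where \<phi>: "\<phi> \<in> parameters X" and f: "\<And>i. f i \<in> feat_closure X" "\<And>i x. x \<in> pts X \<Longrightarrow> \<bar>f i x\<bar> \<le> real i"
    and eq: "\<And>t i. t \<in> {0..1} \<Longrightarrow> g t i = f i (\<phi> t)" by (rule obsE[OF g]) (rule that)
  have "distr leb01 RN g = distr leb01 RN (\<lambda>t i. f i (\<phi> t))"
    by (rule distr_cong[OF refl refl]) (simp add: eq fun_eq_iff)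
  also have "\<dots> = distr leb01 RN (\<lambda>t i. f i (\<psi> t))" by (rule law_feature_seq[OF \<phi> \<psi> f(1)])
  finally show ?thesis using f by (intro exI[of _ f]) simp
qed

lemma (in cgds) obs_nonempty: "\<exists>g. g \<in> obs X"
proof -
  obtain \<psi> where \<psi>: "\<psi> \<in> parameters X" using params_nonempty by (elim exE)
  show ?thesis by (rule exI, rule obsI[OF \<psi> bseq_closure bseq_bound])
qed

lemma (in cgds) obs_reindex:
  assumes g: "g \<in> obs X" and q: "\<And>j. q j \<in> L" and b: "\<And>j r. \<bar>q j r\<bar> \<le> real j"
  shows "(\<lambda>t. reindex s q (g t)) \<in> obs X"
proof -
  obtain \<phi> f where \<phi>: "\<phi> \<in> parameters X" and f: "\<And>i. f i \<in> feat_closure X" "\<And>i x. x \<in> pts X \<Longrightarrow> \<bar>f i x\<bar> \<le> real i"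
    and eq: "\<And>t i. t \<in> {0..1} \<Longrightarrow> g t i = f i (\<phi> t)" by (rule obsE[OF g]) (rule that)
  have "(\<lambda>t. reindex s q (g t)) \<in> measurable leb01 RN"
    by (rule measurable_compose[OF obs_measurable[OF g] measurable_reindex]) (rule L_Lip1[OF q])
  moreover have "\<forall>i. compose (pts X) (q i) (f (s i)) \<in> feat_closure X" by (intro allI post q f(1))
  moreover have "\<forall>i. \<forall>x\<in>pts X. \<bar>compose (pts X) (q i) (f (s i)) x\<bar> \<le> real i" using b by (simp add: compose_def)
  moreover have "\<forall>t\<in>{0..1}. \<forall>i. reindex s q (g t) i = compose (pts X) (q i) (f (s i)) (\<phi> t)"
    using param_pts[OF \<phi>] by (simp add: reindex_def compose_def eq)
  ultimately show ?thesis
    unfolding obs_def using \<phi> by (intro CollectI conjI bexI[OF _ \<phi>] exI[of _ "\<lambda>i. compose (pts X) (q i) (f (s i))"])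
qed

text \<open>Entries are matched one by one. Clipping the i-th partner at i restores the bound; as
  clipping is 1-Lipschitz and fixes the given entry, it does not increase the distance.\<close>

lemma matched_obs:
  assumes X: "gds X" and Y: "cgds Y L" and p: "\<phi> \<in> parameters X" and q: "\<psi> \<in> parameters Y"
    and c: "matched e X \<phi> Y \<psi>" and e: "0 \<le> e" and g: "g \<in> obs X"
  shows "\<exists>h\<in>obs Y. \<forall>\<eta>>0. coupled (e + \<eta>) g h"
proof -
  interpret X: gds X by fact
  interpret Y: cgds Y L by fact
  from X.obs_change_param[OF g p] obtain f where f: "\<forall>i. f i \<in> feat_closure X" "\<forall>i. \<forall>x\<in>pts X. \<bar>f i x\<bar> \<le> real i"
    and law: "distr leb01 RN g = distr leb01 RN (\<lambda>t i. f i (\<phi> t))" by (elim exE conjE)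
  note fF = spec[OF f(1)]
  have "\<forall>i. \<exists>h. h \<in> feat_closure Y \<and> close leb01 e (\<lambda>t. f i (\<phi> t)) (\<lambda>t. h (\<psi> t))"
  proof
    fix i
    from bspec[OF c[unfolded matched_def] fF] show "\<exists>h. h \<in> feat_closure Y \<and> close leb01 e (\<lambda>t. f i (\<phi> t)) (\<lambda>t. h (\<psi> t))" unfolding Bex_def .
  qed
  from choice[OF this] obtain h where h0: "\<forall>i. h i \<in> feat_closure Y \<and> close leb01 e (\<lambda>t. f i (\<phi> t)) (\<lambda>t. h i (\<psi> t))" by (elim exE)
  note hF = conjunct1[OF spec[OF h0]] and hc = conjunct2[OF spec[OF h0]]
  define k where "k i = restrict (\<lambda>x. Y.clip (real i) (h i x)) (pts Y)" for i
  have kF: "k i \<in> feat_closure Y" for i unfolding k_def by (rule Y.closure_clip[OF hF]) simp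
  have kb: "\<bar>k i x\<bar> \<le> real i" if "x \<in> pts Y" for i x using that by (simp add: k_def Y.abs_clip)
  have mf: "(\<lambda>t i. f i (\<phi> t)) \<in> measurable leb01 RN" by (rule X.measurable_feature_seq[OF p fF])
  have mk: "(\<lambda>t i. k i (\<psi> t)) \<in> measurable leb01 RN" by (rule Y.measurable_feature_seq[OF q kF])
  have "near e (\<lambda>t i. f i (\<phi> t)) (\<lambda>t i. k i (\<psi> t))"
  proof (rule near_if_close[OF _ e mf mk])
    fix i
    have "close leb01 e (\<lambda>t. Y.clip (real i) (f i (\<phi> t))) (\<lambda>t. Y.clip (real i) (h i (\<psi> t)))"
      by (rule leb01.close_Lip1[OF _ hc X.param_closure_measurable[OF p fF] Y.param_closure_measurable[OF q hF]])
        (rule Lip1I, rule Y.clip_Lip)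
    moreover have "Y.clip (real i) (f i (\<phi> t)) = f i (\<phi> t)" if "t \<in> space leb01" for t
      using f(2) X.param_pts[OF p, of t] that by (intro Y.clip_id) simp
    moreover have "Y.clip (real i) (h i (\<psi> t)) = k i (\<psi> t)" if "t \<in> space leb01" for t
      using Y.param_pts[OF q, of t] that by (simp add: k_def)
    ultimately show "close leb01 e (\<lambda>t. f i (\<phi> t)) (\<lambda>t. k i (\<psi> t))"
      by (subst (asm) close_cong[of leb01 _ "\<lambda>t. f i (\<phi> t)" _ "\<lambda>t. k i (\<psi> t)"])
  qed
  then have c1: "coupled e (\<lambda>t i. f i (\<phi> t)) (\<lambda>t i. k i (\<psi> t))" by (rule coupled_near)
  have "coupled (e + \<eta>) g (\<lambda>t i. k i (\<psi> t))" if \<eta>: "0 < \<eta>" for \<eta>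
  proof -
    have "coupled (\<eta> / 2) g (\<lambda>t i. f i (\<phi> t))"
      by (rule coupled_law[OF obs_measurable[OF g] mf law]) (use \<eta> in simp)
    from coupled_triangle[OF this c1, of "\<eta> / 2"] \<eta>
    have "coupled (\<eta> / 2 + e + \<eta> / 2) g (\<lambda>t i. k i (\<psi> t))" using obs_measurable[OF g] mf mk by simp
    then show ?thesis by (simp add: add.commute add.left_commute)
  qed
  then show ?thesis by (intro bexI[OF _ Y.obsI[OF q kF kb]] allI impI)
qed

lemma conc_coupled:
  assumes X: "cgds X L" and Y: "cgds Y L" and c: "conc e X Y" and e: "0 \<le> e" and g: "g \<in> obs X"
  shows "\<exists>h\<in>obs Y. \<forall>\<eta>>0. coupled (e + \<eta>) g h"
  by (rule concE[OF c]) (rule matched_obs[OF cgds.axioms(1)[OF X] Y _ _ _ e g])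

text \<open>Along the parameters of \<open>dominated_param\<close> features match exactly, so the
  coupling distance is arbitrarily small and the laws coincide.\<close>

lemma obs_dominated:
  assumes X: "cgds X L" and Y: "gds Y" and dom: "dominated Y X" and g: "g \<in> obs Y"
  shows "\<exists>h\<in>obs X. distr leb01 RN g = distr leb01 RN h"
proof -
  obtain \<psi> where \<psi>: "\<psi> \<in> parameters X" using cgds.params_nonempty[OF X] by (elim exE)
  from dominated_param[OF cgds.axioms(1)[OF X] Y dom \<psi>] obtain \<phi> where \<phi>: "\<phi> \<in> parameters Y"
    and lift: "\<forall>f\<in>feat_closure Y. \<exists>f'\<in>feat_closure X. \<forall>t\<in>{0..1}. f (\<phi> t) = f' (\<psi> t)" by (elim bexE)
  have "matched 0 Y \<phi> X \<psi>"
  proof (rule matchedI)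
    fix f assume "f \<in> feat_closure Y"
    from bspec[OF lift this] obtain f' where f': "f' \<in> feat_closure X" and eq: "\<forall>t\<in>{0..1}. f (\<phi> t) = f' (\<psi> t)" by (elim bexE)
    have "close leb01 0 (\<lambda>t. f (\<phi> t)) (\<lambda>t. f' (\<psi> t))" by (rule leb01.close_pointwise) (simp_all add: eq)
    then show "\<exists>f'\<in>feat_closure X. close leb01 0 (\<lambda>t. f (\<phi> t)) (\<lambda>t. f' (\<psi> t))" using f' by (rule bexI)
  qed
  from matched_obs[OF Y X \<phi> \<psi> this order_refl g] obtain h where h: "h \<in> obs X" and c: "\<forall>\<eta>>0. coupled (0 + \<eta>) g h" by (elim bexE)
  have "distr leb01 RN g = distr leb01 RN h"
    by (rule coupled_imp_law[OF obs_measurable[OF g] obs_measurable[OF h]]) (use c in simp)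
  then show ?thesis using h by (rule bexI)
qed

section \<open>Limits of feature sequences and closedness of domination\<close>

lemma diagonal_convergent:
  fixes u :: "nat \<Rightarrow> nat \<Rightarrow> real"
  assumes bd: "\<And>n k. \<bar>u n k\<bar> \<le> B k"
  shows "\<exists>r. strict_mono r \<and> (\<forall>k. convergent (\<lambda>n. u (r n) k))"
proof -
  interpret S: subseqs "\<lambda>k s. convergent (\<lambda>n. u (s n) k)"
  proof
    fix k :: nat and s :: "nat \<Rightarrow> nat" assume "strict_mono s"
    have "\<forall>n. u (s n) k \<in> {- B k..B k}" using bd by (simp add: abs_le_iff minus_le_iff)
    then obtain l r where "strict_mono r" "((\<lambda>n. u (s n) k) \<circ> r) \<longlonglongrightarrow> l"
      using compact_Icc[of "- B k" "B k"] unfolding compact_def by meson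
    then show "\<exists>r. strict_mono r \<and> convergent (\<lambda>n. u ((s \<circ> r) n) k)"
      by (intro exI[of _ r]) (auto simp: convergent_def comp_def)
  qed
  have "convergent (\<lambda>n. u (S.diagseq n) k)" for k
  proof -
    have "convergent (\<lambda>n. u ((S.diagseq \<circ> ((+) (Suc k))) n) k)"
    proof (rule S.diagseq_holds)
      fix r s :: "nat \<Rightarrow> nat" and n :: nat assume r: "strict_mono r" and "convergent (\<lambda>k. u (s k) n)"
      then obtain l where "(\<lambda>k. u (s k) n) \<longlonglongrightarrow> l" by (auto simp: convergent_def)
      from LIMSEQ_subseq_LIMSEQ[OF this r] show "convergent (\<lambda>k. u ((s \<circ> r) k) n)"
        by (auto simp: convergent_def comp_def)
    qed
    from convergentD[OF this] obtain l where "(\<lambda>n. u ((S.diagseq \<circ> ((+) (Suc k))) n) k) \<longlonglongrightarrow> l" by (elim exE)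
    then have "(\<lambda>n. u (S.diagseq (n + Suc k)) k) \<longlonglongrightarrow> l" by (simp only: comp_def add.commute)
    then show ?thesis by (rule convergentI[OF LIMSEQ_offset[of "\<lambda>n. u (S.diagseq n) k" "Suc k"]])
  qed
  then show ?thesis by (intro exI[of _ S.diagseq] conjI allI S.subseq_diagseq)
qed

text \<open>Arzela-Ascoli: a diagonal sequence converges on a countable dense set and, by
  equicontinuity, everywhere.\<close>

lemma (in gds) feature_seqs_compact:
  assumes F: "\<And>n i. F n i \<in> feat_closure X" "\<And>n i x. x \<in> pts X \<Longrightarrow> \<bar>F n i x\<bar> \<le> real i"
  shows "\<exists>r G. strict_mono (r :: nat \<Rightarrow> nat) \<and> (\<forall>i. G i \<in> feat_closure X) \<and> (\<forall>i. \<forall>x\<in>pts X. \<bar>G i x\<bar> \<le> real i) \<and>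
    (\<forall>i. \<forall>x\<in>pts X. (\<lambda>n. F (r n) i x) \<longlonglongrightarrow> G i x)"
proof -
  obtain c where cp: "\<And>i :: nat. c i \<in> pts X" and dense: "\<And>x r. x \<in> pts X \<Longrightarrow> 0 < r \<Longrightarrow> \<exists>i. gds_dist X x (c i) < r"
    by (rule dense_seq) blast
  have "\<exists>r. strict_mono r \<and> (\<forall>k. convergent (\<lambda>n. F (r n) (fst (prod_decode k)) (c (snd (prod_decode k)))))"
    by (rule diagonal_convergent[of "\<lambda>n k. F n (fst (prod_decode k)) (c (snd (prod_decode k)))" "\<lambda>k. real (fst (prod_decode k))"])
      (rule F(2)[OF cp])
  then obtain r where r: "strict_mono r" and cv: "\<forall>k. convergent (\<lambda>n. F (r n) (fst (prod_decode k)) (c (snd (prod_decode k))))"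
    by (elim exE conjE)
  have cvc: "convergent (\<lambda>n. F (r n) i (c j))" for i j using spec[OF cv, of "prod_encode (i, j)"] by simp
  have conv: "convergent (\<lambda>n. F (r n) i x)" if x: "x \<in> pts X" for i x
  proof -
    have "Cauchy (\<lambda>n. F (r n) i x)"
    proof (rule metric_CauchyI)
      fix e :: real assume e: "0 < e"
      obtain j where j: "gds_dist X x (c j) < e / 3" using dense[OF x, of "e / 3"] e by auto
      have "Cauchy (\<lambda>n. F (r n) i (c j))" using cvc by (simp add: Cauchy_convergent_iff)
      then obtain N where N: "\<forall>m\<ge>N. \<forall>n\<ge>N. dist (F (r m) i (c j)) (F (r n) i (c j)) < e / 3"
        using e unfolding Cauchy_def by (meson divide_pos_pos zero_less_numeral)
      have "dist (F (r m) i x) (F (r n) i x) < e" if mn: "N \<le> m" "N \<le> n" for m n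
      proof -
        have "\<bar>F (r m) i (c j) - F (r n) i (c j)\<bar> < e / 3" using N mn by (simp add: dist_real_def)
        then have "\<bar>F (r m) i x - F (r n) i x\<bar> < e"
          using lipD[OF closure_lip[OF F(1)[of "r m" i]] x cp[of j]] lipD[OF closure_lip[OF F(1)[of "r n" i]] x cp[of j]] j by linarith
        then show ?thesis by (simp add: dist_real_def)
      qed
      then show "\<exists>M. \<forall>m\<ge>M. \<forall>n\<ge>M. dist (F (r m) i x) (F (r n) i x) < e" by blast
    qed
    then show ?thesis by (simp add: Cauchy_convergent_iff)
  qed
  define G where "G i = restrict (\<lambda>x. lim (\<lambda>n. F (r n) i x)) (pts X)" for i
  have lim: "(\<lambda>n. F (r n) i x) \<longlonglongrightarrow> G i x" if "x \<in> pts X" for i x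
    using conv[OF that] that by (simp add: G_def convergent_LIMSEQ_iff)
  have GF: "G i \<in> feat_closure X" for i
  proof (rule feat_closure_closed)
    show "G i \<in> extensional (pts X)" by (simp add: G_def)
    fix T :: "'a set" and e :: real assume T: "finite T" "T \<subseteq> pts X" "0 < e"
    have "\<forall>x\<in>T. \<forall>\<^sub>F n in sequentially. \<bar>G i x - F (r n) i x\<bar> < e"
    proof
      fix x assume "x \<in> T"
      then have "\<forall>\<^sub>F n in sequentially. dist (F (r n) i x) (G i x) < e" using lim T by (intro tendstoD) auto
      then show "\<forall>\<^sub>F n in sequentially. \<bar>G i x - F (r n) i x\<bar> < e"
        by (rule eventually_mono) (simp add: dist_real_def abs_minus_commute)
    qed
    then have "\<forall>\<^sub>F n in sequentially. \<forall>x\<in>T. \<bar>G i x - F (r n) i x\<bar> < e"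
      using T(1) by (simp add: eventually_ball_finite_distrib)
    from eventually_happens'[OF sequentially_bot this] obtain n where "\<forall>x\<in>T. \<bar>G i x - F (r n) i x\<bar> < e" by (elim exE)
    then show "\<exists>g\<in>feat_closure X. \<forall>x\<in>T. \<bar>G i x - g x\<bar> < e" using F(1) by (intro bexI[of _ "F (r n) i"])
  qed
  have Gb: "\<bar>G i x\<bar> \<le> real i" if "x \<in> pts X" for i x
    by (rule LIMSEQ_le_const2[OF tendsto_rabs[OF lim[OF that]]]) (use F(2)[OF that] in auto)
  show ?thesis using r GF Gb lim by (intro exI[of _ r] exI[of _ G] conjI allI ballI)
qed

lemma (in cgds) close_bseq:
  assumes f: "f \<in> feat_closure X" and e: "0 < e"
  shows "\<exists>i. close (meas X) e f (bseq i)"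
proof -
  have e3: "0 < e / 3" using e by simp
  obtain T where T: "finite T" "T \<subseteq> pts X" "1 - e / 3 < measure (meas X) (\<Union>x\<in>T. M.mball x (e / 3))"
    by (rule finite_net[OF e3])
  from bseq_approx[OF f T(1,2) e3] obtain i where i: "\<forall>x\<in>T. \<bar>f x - bseq i x\<bar> < e / 3" by (elim exE)
  have "close (meas X) (3 * (e / 3)) f (bseq i)"
    by (rule close_of_agree[OF closure_lip[OF f] closure_lip[OF bseq_closure] T(2,1,3) less_imp_le[OF bspec[OF i]] e3])
  then show ?thesis by (intro exI[of _ i]) simp
qed

text \<open>The bounded feature sequence is dense in measure, so testing domination on it is
  enough.\<close>

lemma (in cgds) dominated_if_bseq:
  assumes Z: "gds Z" and \<phi>: "\<phi> \<in> parameters X" and \<zeta>: "\<zeta> \<in> parameters Z" and G: "\<And>i. G i \<in> feat_closure Z"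
    and ae: "AE t in leb01. \<forall>i. bseq i (\<phi> t) = G i (\<zeta> t)"
  shows "dominated X Z"
proof (rule dominated_criterion[OF cgds_axioms Z \<phi> \<zeta>])
  interpret Z: gds Z by fact
  fix f and e :: real assume f: "f \<in> feat_closure X" and e: "0 < e"
  from close_bseq[OF f e] obtain i where i: "close (meas X) e f (bseq i)" by (elim exE)
  have c: "close leb01 e (\<lambda>t. f (\<phi> t)) (\<lambda>t. bseq i (\<phi> t))"
    using param_close[OF \<phi> closure_measurable[OF f] closure_measurable[OF bseq_closure]] i by (simp only: simp_thms)
  have "AE t in leb01. bseq i (\<phi> t) = G i (\<zeta> t)" using ae by (rule AE_mp) simp
  from close_sym[OF leb01.close_AE[OF this close_sym[OF c] param_closure_measurable[OF \<phi> bseq_closure]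
      Z.param_closure_measurable[OF \<zeta> G] param_closure_measurable[OF \<phi> f]]]
  show "\<exists>f'\<in>feat_closure Z. close leb01 e (\<lambda>t. f (\<phi> t)) (\<lambda>t. f' (\<zeta> t))" by (rule bexI[OF _ G])
qed

text \<open>The hypothesis is applied to the observable that consists of the dense feature sequence
  of Y. Its approximations are feature sequences of X along one parameter; a pointwise limit of them
  has the same law, and \<open>param_of_law\<close> turns equality of laws into equality along
  parameters. This makes principal pyramids closed.\<close>

lemma limit_dominated:
  assumes X: "cgds X L" and Y: "cgds Y L" and lim: "\<And>g e. g \<in> obs Y \<Longrightarrow> 0 < e \<Longrightarrow> \<exists>h\<in>obs X. coupled e g h"
  shows "dominated Y X"
proof -
  interpret X: cgds X L by fact
  interpret Y: cgds Y L by fact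
  obtain \<phi> where \<phi>: "\<phi> \<in> parameters Y" using Y.params_nonempty by (elim exE)
  obtain \<psi> where \<psi>: "\<psi> \<in> parameters X" using X.params_nonempty by (elim exE)
  define g where "g = (\<lambda>t i. Y.bseq i (\<phi> t))"
  have gO: "g \<in> obs Y" unfolding g_def by (rule Y.obsI[OF \<phi> Y.bseq_closure Y.bseq_bound])
  note mg = obs_measurable[OF gO]
  have "\<forall>n. \<exists>f. (\<forall>i. f i \<in> feat_closure X) \<and> (\<forall>i. \<forall>x\<in>pts X. \<bar>f i x\<bar> \<le> real i) \<and> coupled (2 / real (Suc n)) g (\<lambda>t i. f i (\<psi> t))"
  proof
    fix n
    \<comment> \<open>Half of 1/(n+1), so that two errors a and the slack a + a add up to
      2/(n+1).\<close>
    define a where "a = 1 / real (Suc n) / 2"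
    have a: "0 < a" by (simp add: a_def)
    have a4: "a + a + (a + a) = 2 / real (Suc n)" by (simp add: a_def del: of_nat_Suc)
    from lim[OF gO a] obtain h where h: "h \<in> obs X" and c: "coupled a g h" by (elim bexE)
    from X.obs_change_param[OF h \<psi>] obtain f where f: "\<forall>i. f i \<in> feat_closure X" "\<forall>i. \<forall>x\<in>pts X. \<bar>f i x\<bar> \<le> real i"
      and law: "distr leb01 RN h = distr leb01 RN (\<lambda>t i. f i (\<psi> t))" by (elim exE conjE)
    note mf = X.measurable_feature_seq[OF \<psi> spec[OF f(1)]]
    have "coupled a h (\<lambda>t i. f i (\<psi> t))" by (rule coupled_law[OF obs_measurable[OF h] mf law a])
    from coupled_triangle[OF c this _ mg obs_measurable[OF h] mf, of "a + a"] a
    have "coupled (a + a + (a + a)) g (\<lambda>t i. f i (\<psi> t))" by simp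
    then have "coupled (2 / real (Suc n)) g (\<lambda>t i. f i (\<psi> t))" by (simp only: a4)
    then show "\<exists>f. (\<forall>i. f i \<in> feat_closure X) \<and> (\<forall>i. \<forall>x\<in>pts X. \<bar>f i x\<bar> \<le> real i) \<and> coupled (2 / real (Suc n)) g (\<lambda>t i. f i (\<psi> t))"
      using f by (intro exI[of _ f] conjI)
  qed
  from choice[OF this] obtain F where F0: "\<forall>n. (\<forall>i. F n i \<in> feat_closure X) \<and> (\<forall>i. \<forall>x\<in>pts X. \<bar>F n i x\<bar> \<le> real i) \<and>
    coupled (2 / real (Suc n)) g (\<lambda>t i. F n i (\<psi> t))" by (elim exE)
  have F: "F n i \<in> feat_closure X" "x \<in> pts X \<Longrightarrow> \<bar>F n i x\<bar> \<le> real i" "coupled (2 / real (Suc n)) g (\<lambda>t i. F n i (\<psi> t))" for n i x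
    using spec[OF F0, of n] by blast+
  have "\<exists>r G. strict_mono (r :: nat \<Rightarrow> nat) \<and> (\<forall>i. G i \<in> feat_closure X) \<and> (\<forall>i. \<forall>x\<in>pts X. \<bar>G i x\<bar> \<le> real i) \<and>
    (\<forall>i. \<forall>x\<in>pts X. (\<lambda>n. F (r n) i x) \<longlonglongrightarrow> G i x)"
    by (rule X.feature_seqs_compact; rule F(1,2))
  then obtain r G where r: "strict_mono (r :: nat \<Rightarrow> nat)" and G: "\<forall>i. G i \<in> feat_closure X"
    and cv: "\<forall>i. \<forall>x\<in>pts X. (\<lambda>n. F (r n) i x) \<longlonglongrightarrow> G i x" by (elim exE conjE)
  note mG = X.measurable_feature_seq[OF \<psi> spec[OF G]] and mF = X.measurable_feature_seq[OF \<psi> F(1)]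
  have "coupled e g (\<lambda>t i. G i (\<psi> t))" if e: "0 < e" for e
  proof -
    have e3: "0 < e / 3" using e by simp
    obtain m where m: "1 < 2 ^ m * (e / 3)" using ex_pow2_mult_gt_1[OF e3] by (elim exE)
    have "\<forall>\<^sub>F n in sequentially. \<forall>i\<in>{..<m}. close leb01 (e / 3) (\<lambda>t. F (r n) i (\<psi> t)) (\<lambda>t. G i (\<psi> t))"
    proof (rule eventually_ball_finite)
      show "\<forall>i\<in>{..<m}. \<forall>\<^sub>F n in sequentially. close leb01 (e / 3) (\<lambda>t. F (r n) i (\<psi> t)) (\<lambda>t. G i (\<psi> t))"
      proof
        fix i
        show "\<forall>\<^sub>F n in sequentially. close leb01 (e / 3) (\<lambda>t. F (r n) i (\<psi> t)) (\<lambda>t. G i (\<psi> t))"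
        proof (rule leb01.AE_convergence_imp_close[OF _ e3 X.param_closure_measurable[OF \<psi> F(1)] X.param_closure_measurable[OF \<psi> spec[OF G]]])
          show "AE t in leb01. (\<lambda>n. F (r n) i (\<psi> t)) \<longlonglongrightarrow> G i (\<psi> t)"
            by (rule AE_I2) (use cv X.param_pts[OF \<psi>] in simp)
        qed
      qed
    qed simp
    moreover have "\<forall>\<^sub>F n in sequentially. 2 / real (Suc n) < e / 3"
    proof -
      have "(\<lambda>n. 2 * (1 / real (Suc n))) \<longlonglongrightarrow> 2 * 0" by (intro tendsto_intros LIMSEQ_Suc[OF lim_1_over_n])
      then have "(\<lambda>n. 2 / real (Suc n)) \<longlonglongrightarrow> 0" by simp
      then show ?thesis using e3 by (rule order_tendstoD)
    qed
    ultimately have "\<forall>\<^sub>F n in sequentially. (\<forall>i\<in>{..<m}. close leb01 (e / 3) (\<lambda>t. F (r n) i (\<psi> t)) (\<lambda>t. G i (\<psi> t))) \<and> 2 / real (Suc n) < e / 3"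
      by (rule eventually_conj)
    from eventually_happens'[OF sequentially_bot this] obtain n
      where n: "\<forall>i\<in>{..<m}. close leb01 (e / 3) (\<lambda>t. F (r n) i (\<psi> t)) (\<lambda>t. G i (\<psi> t))" "2 / real (Suc n) < e / 3" by (elim exE conjE)
    have "near (e / 3) (\<lambda>t i. F (r n) i (\<psi> t)) (\<lambda>t i. G i (\<psi> t))"
      by (rule near_if_close_initial[OF _ _ less_imp_le[OF m] mF mG]) (use n(1) e in auto)
    then have c2: "coupled (e / 3) (\<lambda>t i. F (r n) i (\<psi> t)) (\<lambda>t i. G i (\<psi> t))" by (rule coupled_near)
    have "2 / real (Suc (r n)) \<le> 2 / real (Suc n)" using seq_suble[OF r, of n] by (intro divide_left_mono) auto
    then have "2 / real (Suc (r n)) \<le> e / 3" using n(2) by linarith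
    from coupled_mono[OF F(3) this mg mF] have c1: "coupled (e / 3) g (\<lambda>t i. F (r n) i (\<psi> t))" .
    from coupled_triangle[OF c1 c2 e3 mg mF mG] show ?thesis by simp
  qed
  from coupled_imp_law[OF mg mG this] have "distr leb01 RN (\<lambda>t i. G i (\<psi> t)) = distr leb01 RN (\<lambda>t i. Y.bseq i (\<phi> t))" by (simp add: g_def)
  from Y.param_of_law[OF \<phi> mG this] obtain \<phi>' where \<phi>': "\<phi>' \<in> parameters Y" and ae: "AE t in leb01. \<forall>i. Y.bseq i (\<phi>' t) = G i (\<psi> t)" by (elim bexE)
  show ?thesis by (rule Y.dominated_if_bseq[OF X.gds_axioms \<phi>' \<psi> spec[OF G] ae])
qed

section \<open>Compactness of the hyperspace of bounded random sequences\<close>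

definition bounded_obs :: "(real \<Rightarrow> nat \<Rightarrow> real) set" where
  "bounded_obs = {g \<in> measurable leb01 RN. \<forall>t\<in>{0..1}. \<forall>i. \<bar>g t i\<bar> \<le> real i}"

lemma bounded_obsD: "g \<in> bounded_obs \<Longrightarrow> g \<in> measurable leb01 RN" "g \<in> bounded_obs \<Longrightarrow> t \<in> {0..1} \<Longrightarrow> \<bar>g t i\<bar> \<le> real i"
  unfolding bounded_obs_def by blast+

lemma (in gds) obs_bounded: "g \<in> obs X \<Longrightarrow> g \<in> bounded_obs"
proof -
  assume g: "g \<in> obs X"
  obtain \<phi> f where \<phi>: "\<phi> \<in> parameters X" and f: "\<And>i x. x \<in> pts X \<Longrightarrow> \<bar>f i x\<bar> \<le> real i"
    and eq: "\<And>t i. t \<in> {0..1} \<Longrightarrow> g t i = f i (\<phi> t)" by (rule obsE[OF g]) (rule that)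
  have "\<bar>g t i\<bar> \<le> real i" if "t \<in> {0..1}" for t i unfolding eq[OF that] by (rule f[OF param_pts[OF \<phi> that]])
  then show ?thesis using obs_measurable[OF g] unfolding bounded_obs_def by blast
qed

lemma coupled_trans:
  assumes "coupled a u v" "coupled b v w" "a + b < c" "u \<in> bounded_obs" "v \<in> bounded_obs" "w \<in> bounded_obs"
  shows "coupled c u w"
proof -
  have "coupled (a + b + (c - a - b)) u w"
    by (rule coupled_triangle[OF assms(1,2)]) (use assms(3-) bounded_obsD(1) in auto)
  then show ?thesis by simp
qed

lemma bounded_obs_limit:
  assumes g: "\<And>k. g k \<in> bounded_obs"
  shows "\<exists>(r :: nat \<Rightarrow> nat) h. strict_mono r \<and> h \<in> bounded_obs \<and> (\<forall>e>0. \<forall>\<^sub>F k in sequentially. coupled e (g (r k)) h)"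
proof -
  have "\<exists>(r :: nat \<Rightarrow> nat) h. strict_mono r \<and> h \<in> measurable leb01 RN \<and> (\<forall>t i. \<bar>h t i\<bar> \<le> real i) \<and>
    (\<forall>e>0. \<forall>\<^sub>F k in sequentially. coupled e (g (r k)) h)"
    by (rule bounded_sequences_compact) (rule bounded_obsD[OF g], assumption?)+
  then obtain r :: "nat \<Rightarrow> nat" and h where r: "strict_mono r" "h \<in> measurable leb01 RN" "\<forall>t i. \<bar>h t i\<bar> \<le> real i"
    and c: "\<forall>e>0. \<forall>\<^sub>F k in sequentially. coupled e (g (r k)) h" by (elim exE conjE)
  have "h \<in> bounded_obs" unfolding bounded_obs_def using r(2,3) by blast
  then show ?thesis using r(1) c by (intro exI[of _ r] exI[of _ h] conjI)
qed

text \<open>Otherwise an infinite sequence could be chosen no two terms of which are coupled at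
  scale e, against \<open>bounded_obs_limit\<close>.\<close>

lemma bounded_obs_net:
  assumes e: "0 < e"
  shows "\<exists>N. finite N \<and> N \<subseteq> bounded_obs \<and> (\<forall>g\<in>bounded_obs. \<exists>h\<in>N. coupled e g h)"
proof (rule ccontr)
  assume no: "\<nexists>N. finite N \<and> N \<subseteq> bounded_obs \<and> (\<forall>g\<in>bounded_obs. \<exists>h\<in>N. coupled e g h)"
  define Q :: "(nat \<Rightarrow> real \<Rightarrow> nat \<Rightarrow> real) \<Rightarrow> nat \<Rightarrow> (real \<Rightarrow> nat \<Rightarrow> real) \<Rightarrow> bool"
    where "Q = (\<lambda>f n g. g \<in> bounded_obs \<and> (\<forall>m<n. \<not> coupled e g (f m)))"
  have "\<exists>f. \<forall>n. Q f n (f n)"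
  proof (rule dependent_wellorder_choice)
    show "Q f n g = Q f' n g" if "\<And>m. m < n \<Longrightarrow> f m = f' m" for g f f' n using that by (simp add: Q_def)
    fix n f assume f: "\<And>m. m < n \<Longrightarrow> Q f m (f m)"
    then have "finite (f ` {..<n})" "f ` {..<n} \<subseteq> bounded_obs" by (auto simp: Q_def)
    with no have "\<not> (\<forall>g\<in>bounded_obs. \<exists>h\<in>f ` {..<n}. coupled e g h)" by blast
    then show "\<exists>g. Q f n g" unfolding Q_def by blast
  qed
  then obtain f where f: "\<forall>n. Q f n (f n)" by (elim exE)
  have fb: "f n \<in> bounded_obs" for n using f by (simp add: Q_def)
  from bounded_obs_limit[of f, OF fb] obtain r :: "nat \<Rightarrow> nat" and h where r: "strict_mono r" and h: "h \<in> bounded_obs"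
    and c: "\<forall>e>0. \<forall>\<^sub>F k in sequentially. coupled e (f (r k)) h" by (elim exE conjE)
  have "\<forall>\<^sub>F k in sequentially. coupled (e / 3) (f (r k)) h" using c e by simp
  then obtain K where K: "\<forall>k\<ge>K. coupled (e / 3) (f (r k)) h" unfolding eventually_sequentially by (elim exE)
  have "coupled e (f (r (Suc K))) (f (r K))"
    by (rule coupled_trans[OF K[rule_format] coupled_sym[OF K[rule_format]] _ fb h fb]) (use e in auto)
  moreover have "r K < r (Suc K)" using r by (simp add: strict_mono_Suc_iff)
  ultimately show False using f by (auto simp: Q_def)
qed

definition covered :: "real \<Rightarrow> (real \<Rightarrow> nat \<Rightarrow> real) set \<Rightarrow> (real \<Rightarrow> nat \<Rightarrow> real) set \<Rightarrow> bool" where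
  "covered e S T \<longleftrightarrow> (\<forall>g\<in>S. \<exists>h\<in>T. coupled e g h)"

lemma covered_trans:
  assumes "covered a S T" "covered b T U" "a + b < c" "S \<subseteq> bounded_obs" "T \<subseteq> bounded_obs" "U \<subseteq> bounded_obs"
  shows "covered c S U"
  unfolding covered_def
proof
  fix g assume g: "g \<in> S"
  from assms(1) g obtain h where h: "h \<in> T" "coupled a g h" unfolding covered_def by (elim ballE bexE) auto
  from assms(2) h(1) obtain k where k: "k \<in> U" "coupled b h k" unfolding covered_def by (elim ballE bexE) auto
  from coupled_trans[OF h(2) k(2) assms(3)] have "coupled c g k" using g h k assms(4-) by blast
  then show "\<exists>h\<in>U. coupled c g h" using k(1) by (rule bexI)
qed

lemma convergent_of_bool:
  assumes "convergent (\<lambda>n. of_bool (Q n) :: real)"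
  shows "(\<forall>\<^sub>F n in sequentially. Q n) \<or> (\<forall>\<^sub>F n in sequentially. \<not> Q n)"
proof -
  from assms have "Cauchy (\<lambda>n. of_bool (Q n) :: real)" by (simp add: Cauchy_convergent_iff)
  from metric_CauchyD[OF this, of 1] obtain N where N: "\<forall>m\<ge>N. \<forall>n\<ge>N. dist (of_bool (Q m) :: real) (of_bool (Q n)) < 1" by auto
  have "Q n = Q N" if "N \<le> n" for n using N[rule_format, OF that, of N] by (cases "Q n"; cases "Q N") auto
  then show ?thesis unfolding eventually_sequentially by (cases "Q N") blast+
qed

text \<open>Blaschke selection. Whether \<open>S n\<close> comes close to a given point of a
  countable family of nets is one bit; a diagonal subsequence makes all these bits eventually
  constant, and the limit is the lower limit of that subsequence.\<close>

lemma subset_sequence_compact: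
  assumes S: "\<And>n. S n \<subseteq> bounded_obs"
  shows "\<exists>(r :: nat \<Rightarrow> nat). strict_mono r \<and>
    (\<forall>e>0. \<forall>\<^sub>F n in sequentially. covered e (S (r n)) {g \<in> bounded_obs. \<forall>e>0. \<forall>\<^sub>F n in sequentially. \<exists>h\<in>S (r n). coupled e g h} \<and>
       covered e {g \<in> bounded_obs. \<forall>e>0. \<forall>\<^sub>F n in sequentially. \<exists>h\<in>S (r n). coupled e g h} (S (r n)))"
proof -
  define a where "a k = 1 / real (Suc k)" for k
  have a: "0 < a k" "0 < a k / 3" for k by (simp_all add: a_def)
  have small: "\<exists>k. a k < e" if "0 < e" for e using nat_approx_posE[OF that] by (auto simp: a_def)
  have "\<forall>k. \<exists>N. finite N \<and> N \<subseteq> bounded_obs \<and> (\<forall>g\<in>bounded_obs. \<exists>h\<in>N. coupled (a k / 3) g h)"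
    by (intro allI bounded_obs_net a)
  from choice[OF this] obtain N where N: "\<And>k. finite (N k)" "\<And>k. N k \<subseteq> bounded_obs"
    and net: "\<And>k. \<forall>g\<in>bounded_obs. \<exists>h\<in>N k. coupled (a k / 3) g h" by (elim exE) blast
  define V where "V = from_nat_into (\<Union>k. N k)"
  have "countable (\<Union>k. N k)" by (rule countable_UN) (simp_all add: countable_finite N(1))
  then have V: "\<exists>j. V j = \<nu>" if "\<nu> \<in> N k" for \<nu> k unfolding V_def using that by (intro from_nat_into_surj) auto
  have "\<exists>r. strict_mono r \<and> (\<forall>i. convergent (\<lambda>n. of_bool (\<exists>h\<in>S (r n). coupled (a (fst (prod_decode i))) (V (snd (prod_decode i))) h) :: real))"
    by (rule diagonal_convergent[of "\<lambda>n i. of_bool (\<exists>h\<in>S n. coupled (a (fst (prod_decode i))) (V (snd (prod_decode i))) h)" "\<lambda>_. 1"])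
      (simp add: of_bool_def)
  then obtain r where r: "strict_mono r" and cv: "\<forall>i. convergent (\<lambda>n. of_bool (\<exists>h\<in>S (r n). coupled (a (fst (prod_decode i))) (V (snd (prod_decode i))) h) :: real)"
    by (elim exE conjE)
  define Q where "Q k \<nu> n \<longleftrightarrow> (\<exists>h\<in>S (r n). coupled (a k) \<nu> h)" for k \<nu> n
  have Q: "(\<forall>\<^sub>F n in sequentially. Q k \<nu> n) \<or> (\<forall>\<^sub>F n in sequentially. \<not> Q k \<nu> n)" if \<nu>: "\<nu> \<in> N k" for k \<nu>
  proof -
    obtain j where j: "V j = \<nu>" using V[OF \<nu>] by (elim exE)
    from spec[OF cv, of "prod_encode (k, j)"] have "convergent (\<lambda>n. of_bool (Q k \<nu> n) :: real)" by (simp only: Q_def prod_encode_inverse fst_conv snd_conv j)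
    then show ?thesis by (rule convergent_of_bool)
  qed
  define T where "T = {g \<in> bounded_obs. \<forall>e>0. \<forall>\<^sub>F n in sequentially. \<exists>h\<in>S (r n). coupled e g h}"
  have Sb: "g \<in> bounded_obs" if "g \<in> S n" for g n using that S by blast
  have Nb: "g \<in> bounded_obs" if "g \<in> N k" for g k using that N by blast
  \<comment> \<open>Because the bits stabilize, being approached infinitely often already means
    being approached eventually.\<close>
  have accum: "h \<in> T" if h: "h \<in> bounded_obs" and fr: "\<And>e. 0 < e \<Longrightarrow> \<exists>\<^sub>F n in sequentially. \<exists>g\<in>S (r n). coupled e h g" for h
    unfolding T_def
  proof (rule CollectI, intro conjI allI impI)
    show "h \<in> bounded_obs" by (rule h)
    fix e :: real assume e: "0 < e"
    then obtain k where k: "a k < e / 2" using small[of "e / 2"] by auto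
    from bspec[OF net[of k] h] obtain \<nu> where \<nu>: "\<nu> \<in> N k" "coupled (a k / 3) h \<nu>" by (elim bexE)
    have "\<exists>\<^sub>F n in sequentially. Q k \<nu> n"
    proof (rule frequently_mono[OF _ fr[OF a(2)[of k]]], intro allI impI)
      fix n assume "\<exists>g\<in>S (r n). coupled (a k / 3) h g"
      then obtain g where g: "g \<in> S (r n)" "coupled (a k / 3) h g" by (elim bexE)
      have "coupled (a k) \<nu> g" by (rule coupled_trans[OF coupled_sym[OF \<nu>(2)] g(2) _ Nb[OF \<nu>(1)] h Sb[OF g(1)]]) (use a(1)[of k] in simp)
      then show "Q k \<nu> n" unfolding Q_def using g(1) by (rule bexI)
    qed
    then have ev: "\<forall>\<^sub>F n in sequentially. Q k \<nu> n" using Q[OF \<nu>(1)] by (auto simp: frequently_def)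
    show "\<forall>\<^sub>F n in sequentially. \<exists>g\<in>S (r n). coupled e h g"
    proof (rule eventually_mono[OF ev])
      fix n assume "Q k \<nu> n"
      then obtain g where g: "g \<in> S (r n)" "coupled (a k) \<nu> g" unfolding Q_def by (elim bexE)
      have "coupled e h g" by (rule coupled_trans[OF \<nu>(2) g(2) _ h Nb[OF \<nu>(1)] Sb[OF g(1)]]) (use k a(1)[of k] in simp)
      then show "\<exists>g\<in>S (r n). coupled e h g" using g(1) by (rule bexI)
    qed
  qed
  \<comment> \<open>For late n, a net point near some element of \<open>S (r n)\<close> stays near
    elements of all late sets, and a limit of those elements lies in \<open>T\<close>. Uniformity
    over \<open>S (r n)\<close> comes from the finiteness of the net.\<close>
  have one: "\<forall>\<^sub>F n in sequentially. covered e (S (r n)) T" if e: "0 < e" for e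
  proof -
    obtain k where k: "a k < e / 3" using small[of "e / 3"] e by auto
    have "\<forall>\<^sub>F n in sequentially. \<forall>\<nu>\<in>N k. Q k \<nu> n \<longrightarrow> (\<forall>\<^sub>F m in sequentially. Q k \<nu> m)"
    proof (intro eventually_ball_finite N ballI)
      fix \<nu> assume "\<nu> \<in> N k"
      from Q[OF this] show "\<forall>\<^sub>F n in sequentially. Q k \<nu> n \<longrightarrow> (\<forall>\<^sub>F m in sequentially. Q k \<nu> m)"
        by (rule disjE) (simp, erule eventually_mono, simp)
    qed
    then show ?thesis
    proof (rule eventually_mono)
      fix n assume n: "\<forall>\<nu>\<in>N k. Q k \<nu> n \<longrightarrow> (\<forall>\<^sub>F m in sequentially. Q k \<nu> m)"
      show "covered e (S (r n)) T" unfolding covered_def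
      proof
        fix g assume g: "g \<in> S (r n)"
        from bspec[OF net[of k] Sb[OF g]] obtain \<nu> where \<nu>: "\<nu> \<in> N k" "coupled (a k / 3) g \<nu>" by (elim bexE)
        have "coupled (a k) \<nu> g" by (rule coupled_mono[OF coupled_sym[OF \<nu>(2)]]) (use a(1)[of k] bounded_obsD(1) Nb[OF \<nu>(1)] Sb[OF g] in auto)
        then have "Q k \<nu> n" unfolding Q_def using g by (rule bexI)
        then have "\<forall>\<^sub>F m in sequentially. Q k \<nu> m" using n \<nu>(1) by blast
        then obtain m0 where m0: "\<forall>m\<ge>m0. Q k \<nu> m" unfolding eventually_sequentially by (elim exE)
        have "\<forall>m. \<exists>h. h \<in> S (r (m0 + m)) \<and> coupled (a k) \<nu> h"
        proof
          fix m have "Q k \<nu> (m0 + m)" using m0 by simp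
          then show "\<exists>h. h \<in> S (r (m0 + m)) \<and> coupled (a k) \<nu> h" unfolding Q_def Bex_def .
        qed
        from choice[OF this] obtain h where h: "\<forall>m. h m \<in> S (r (m0 + m)) \<and> coupled (a k) \<nu> (h m)" by (elim exE)
        note hS = conjunct1[OF spec[OF h]] and hc = conjunct2[OF spec[OF h]]
        from bounded_obs_limit[of h, OF Sb[OF hS]] obtain s :: "nat \<Rightarrow> nat" and l where s: "strict_mono s" and l: "l \<in> bounded_obs"
          and c: "\<forall>e>0. \<forall>\<^sub>F k in sequentially. coupled e (h (s k)) l" by (elim exE conjE)
        have lT: "l \<in> T"
        proof (rule accum[OF l])
          fix e' :: real assume e': "0 < e'"
          from spec[OF c, of e'] e' obtain K where K: "\<forall>k\<ge>K. coupled e' (h (s k)) l" unfolding eventually_sequentially by auto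
          show "\<exists>\<^sub>F n in sequentially. \<exists>g\<in>S (r n). coupled e' l g"
            unfolding frequently_sequentially
          proof
            fix M
            have "M \<le> m0 + s (max K M)" using seq_suble[OF s, of "max K M"] by simp
            moreover have "\<exists>g\<in>S (r (m0 + s (max K M))). coupled e' l g"
              by (rule bexI[OF _ hS]) (rule coupled_sym[OF K[rule_format]], simp)
            ultimately show "\<exists>n\<ge>M. \<exists>g\<in>S (r n). coupled e' l g" by (intro exI[of _ "m0 + s (max K M)"] conjI)
          qed
        qed
        from spec[OF c, of "a k"] a obtain j where j: "coupled (a k) (h (s j)) l" unfolding eventually_sequentially by auto
        \<comment> \<open>The factor lies strictly between 2 and 8/3: it exceeds the two errors
          \<open>a k\<close>, and with the net error \<open>a k / 3\<close> it stays below 3 times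
          \<open>a k\<close>, which is less than e.\<close>
        have "coupled (5 / 2 * a k) \<nu> l" by (rule coupled_trans[OF hc j _ Nb[OF \<nu>(1)] Sb[OF hS] l]) (use a(1)[of k] in simp)
        from coupled_trans[OF \<nu>(2) this _ Sb[OF g] Nb[OF \<nu>(1)] l] have "coupled e g l" using k a(1)[of k] by simp
        then show "\<exists>h\<in>T. coupled e g h" using lT by (rule bexI)
      qed
    qed
  qed
  have two: "\<forall>\<^sub>F n in sequentially. covered e T (S (r n))" if e: "0 < e" for e
  proof -
    obtain k where k: "a k < e / 3" using small[of "e / 3"] e by auto
    have "\<forall>\<^sub>F n in sequentially. \<forall>\<nu>\<in>N k. (\<exists>s\<in>T. coupled (a k / 3) s \<nu>) \<longrightarrow> (\<exists>h\<in>S (r n). coupled (2 * a k) \<nu> h)"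
    proof (intro eventually_ball_finite N ballI)
      fix \<nu> assume \<nu>: "\<nu> \<in> N k"
      show "\<forall>\<^sub>F n in sequentially. (\<exists>s\<in>T. coupled (a k / 3) s \<nu>) \<longrightarrow> (\<exists>h\<in>S (r n). coupled (2 * a k) \<nu> h)"
      proof (cases "\<exists>s\<in>T. coupled (a k / 3) s \<nu>")
        case True
        then obtain s where s: "s \<in> T" "coupled (a k / 3) s \<nu>" by (elim bexE)
        have sb: "s \<in> bounded_obs" and "\<forall>e>0. \<forall>\<^sub>F n in sequentially. \<exists>h\<in>S (r n). coupled e s h" using s(1) unfolding T_def by blast+
        from mp[OF spec[OF this(2)] a(1)] have "\<forall>\<^sub>F n in sequentially. \<exists>h\<in>S (r n). coupled (a k) s h" .
        then show ?thesis
        proof (rule eventually_mono, intro impI)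
          fix n assume "\<exists>h\<in>S (r n). coupled (a k) s h"
          then obtain h where h: "h \<in> S (r n)" "coupled (a k) s h" by (elim bexE)
          have "coupled (2 * a k) \<nu> h" by (rule coupled_trans[OF coupled_sym[OF s(2)] h(2) _ Nb[OF \<nu>] sb Sb[OF h(1)]]) (use a(1)[of k] in simp)
          then show "\<exists>h\<in>S (r n). coupled (2 * a k) \<nu> h" using h(1) by (rule bexI)
        qed
      qed simp
    qed
    then show ?thesis
    proof (rule eventually_mono)
      fix n assume n: "\<forall>\<nu>\<in>N k. (\<exists>s\<in>T. coupled (a k / 3) s \<nu>) \<longrightarrow> (\<exists>h\<in>S (r n). coupled (2 * a k) \<nu> h)"
      show "covered e T (S (r n))" unfolding covered_def
      proof
        fix g assume g: "g \<in> T"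
        then have gb: "g \<in> bounded_obs" by (simp add: T_def)
        from bspec[OF net[of k] gb] obtain \<nu> where \<nu>: "\<nu> \<in> N k" "coupled (a k / 3) g \<nu>" by (elim bexE)
        have "\<exists>h\<in>S (r n). coupled (2 * a k) \<nu> h" by (rule mp[OF bspec[OF n \<nu>(1)]], rule bexI[OF _ g], rule \<nu>(2))
        then obtain h where h: "h \<in> S (r n)" "coupled (2 * a k) \<nu> h" by (elim bexE)
        have "coupled e g h" by (rule coupled_trans[OF \<nu>(2) h(2) _ gb Nb[OF \<nu>(1)] Sb[OF h(1)]]) (use k a(1)[of k] in simp)
        then show "\<exists>h\<in>S (r n). coupled e g h" using h(1) by (rule bexI)
      qed
    qed
  qed
  show ?thesis using r eventually_conj[OF one two] unfolding T_def by (intro exI[of _ r] conjI allI impI)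
qed

section \<open>Realizations with finitely many entries\<close>

text \<open>One parameter value is picked for each level and each code that occurs. Where codes
  control the supremum distance, this gives the countable set that realizations ask for.\<close>

lemma countable_code_dense:
  fixes code :: "nat \<Rightarrow> real \<Rightarrow> nat"
  shows "\<exists>C. countable C \<and> C \<subseteq> {0..1} \<and> (\<forall>t\<in>{0..1}. \<forall>k. \<exists>s\<in>C. code k s = code k t)"
proof -
  define pick where "pick k j = (SOME t. t \<in> {0..1} \<and> code k t = j)" for k j
  have pick: "pick k (code k t) \<in> {0..1} \<and> code k (pick k (code k t)) = code k t" if "t \<in> {0..1}" for k t
    unfolding pick_def by (rule someI[of _ t]) (use that in simp)
  let ?C = "range (\<lambda>(k, j). pick k j) \<inter> {0..1}"
  have "\<exists>s\<in>?C. code k s = code k t" if t: "t \<in> {0..1}" for t k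
    using pick[OF t, of k] by (intro bexI[of _ "pick k (code k t)"]) auto
  then show ?thesis by (intro exI[of _ ?C]) auto
qed

text \<open>With finitely many nonzero entries the grid cells control the supremum distance, so the
  range is separable.\<close>

lemma (in clipped) finite_realization:
  assumes c: "c \<in> measurable leb01 RN" and z: "\<And>t n. m \<le> n \<Longrightarrow> c t n = 0"
  shows "\<exists>A\<in>l_classes L. \<exists>\<zeta> z. realizes L (rep A) \<zeta> c z"
proof -
  obtain C where C: "countable C" "C \<subseteq> {0..1}"
    and code: "\<forall>t\<in>{0..1}. \<forall>k. \<exists>s\<in>C. grid_cell m (1 / real (Suc k)) (c s) = grid_cell m (1 / real (Suc k)) (c t)"
    using countable_code_dense[of "\<lambda>k t. grid_cell m (1 / real (Suc k)) (c t)"] by (elim exE conjE)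
  show ?thesis
  proof (rule class_realization[OF c C])
    fix t e :: real assume t: "t \<in> {0..1}" and e: "0 < e"
    obtain k where k: "1 / real (Suc k) < e" using nat_approx_posE[OF e] by blast
    obtain s where s: "s \<in> C" "grid_cell m (1 / real (Suc k)) (c s) = grid_cell m (1 / real (Suc k)) (c t)" using code t by blast
    have "\<bar>c t n - c s n\<bar> \<le> e" for n
      using grid_cell_eq_imp_close[OF s(2)[symmetric], of n] k z[of n] e by (cases "n < m") auto
    then show "\<exists>s\<in>C. \<forall>n. \<bar>c t n - c s n\<bar> \<le> e" using s(1) by blast
  next
    fix s t :: real
    have "\<bar>c s n - c t n\<bar> \<le> (\<Sum>i<m. \<bar>c s i - c t i\<bar>)" for n
      using z[of n] by (cases "n < m") (auto intro: member_le_sum sum_nonneg)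
    then show "\<exists>B. \<forall>n. \<bar>c s n - c t n\<bar> \<le> B" by blast
  qed
qed

lemma realizesD:
  assumes "realizes L Z \<zeta> c z"
  shows "\<zeta> \<in> parameters Z" "z n \<in> feat_closure Z" "AE t in leb01. \<forall>n. z n (\<zeta> t) = c t n"
    "f \<in> feat_closure Z \<Longrightarrow> finite T \<Longrightarrow> T \<subseteq> pts Z \<Longrightarrow> 0 < e \<Longrightarrow> \<exists>p\<in>L. \<exists>n. \<forall>x\<in>T. \<bar>f x - p (z n x)\<bar> < e"
  using assms unfolding realizes_def by blast+

lemma (in cgds) realizes_approx:
  assumes r: "realizes L X \<zeta> c z" and c: "c \<in> measurable leb01 RN" and f: "f \<in> feat_closure X" and e: "0 < e"
  shows "\<exists>p\<in>L. \<exists>n. close leb01 e (\<lambda>t. f (\<zeta> t)) (\<lambda>t. p (c t n))"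
proof -
  note \<zeta> = realizesD(1)[OF r] and zF = realizesD(2)[OF r]
  have e3: "0 < e / 3" using e by simp
  obtain T where T: "finite T" "T \<subseteq> pts X" "1 - e / 3 < measure (meas X) (\<Union>x\<in>T. M.mball x (e / 3))"
    by (rule finite_net[OF e3])
  from realizesD(4)[OF r f T(1,2) e3] obtain p n where p: "p \<in> L" and a: "\<forall>x\<in>T. \<bar>f x - p (z n x)\<bar> < e / 3" by (elim bexE exE)
  have pz: "compose (pts X) p (z n) \<in> feat_closure X" by (rule post[OF p zF])
  have "close (meas X) (3 * (e / 3)) f (compose (pts X) p (z n))"
    by (rule close_of_agree[OF closure_lip[OF f] closure_lip[OF pz] T(2,1,3) _ e3]) (use a T(2) in \<open>auto simp: compose_def less_imp_le subset_iff\<close>)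
  then have "close leb01 e (\<lambda>t. f (\<zeta> t)) (\<lambda>t. compose (pts X) p (z n) (\<zeta> t))"
    using param_close[OF \<zeta> closure_measurable[OF f] closure_measurable[OF pz]] by simp
  then have c1: "close leb01 e (\<lambda>t. compose (pts X) p (z n) (\<zeta> t)) (\<lambda>t. f (\<zeta> t))" by (rule close_sym)
  have ae: "AE t in leb01. compose (pts X) p (z n) (\<zeta> t) = p (c t n)"
    using realizesD(3)[OF r]
  proof (rule AE_mp, intro AE_I2 impI)
    fix t assume t: "t \<in> space leb01" and eq: "\<forall>n. z n (\<zeta> t) = c t n"
    then show "compose (pts X) p (z n) (\<zeta> t) = p (c t n)" using param_pts[OF \<zeta>, of t] by (simp add: compose_def)
  qed
  have m: "(\<lambda>t. p (c t n)) \<in> borel_measurable leb01"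
    by (rule measurable_compose[OF RN_componentD[OF c] measurable_Lip1[OF L_Lip1[OF p]]])
  from close_sym[OF leb01.close_AE[OF ae c1 param_closure_measurable[OF \<zeta> pz] m param_closure_measurable[OF \<zeta> f]]] p
  show ?thesis by (intro bexI exI)
qed

section \<open>Pyramids are determined by their observables\<close>

definition obs_all :: "real gds set set \<Rightarrow> (real \<Rightarrow> nat \<Rightarrow> real) set" where
  "obs_all P = (\<Union>A\<in>P. obs (rep A))"

text \<open>The functions are a finite net of features up to translation, normalized to vanish at a
  base point of \<open>T\<close> and clipped at \<open>R\<close>. Since \<open>R\<close> bounds the
  distances to the base point within \<open>T\<close>, clipping changes nothing on
  \<open>T\<close>.\<close>

lemma (in cgds) finite_determining_family:
  assumes e: "0 < e"
  shows "\<exists>T (f :: nat \<Rightarrow> _) (m :: nat) R. finite T \<and> T \<subseteq> pts X \<and> T \<noteq> {} \<and> 1 - e < measure (meas X) (\<Union>x\<in>T. M.mball x e) \<and>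
    (\<forall>i. f i \<in> feat_closure X) \<and> (\<forall>i. \<forall>x\<in>pts X. \<bar>f i x\<bar> \<le> real R) \<and>
    (\<forall>i\<ge>m. \<forall>x\<in>pts X. f i x = 0) \<and>
    (\<forall>g\<in>feat_closure X. \<exists>i<m. \<exists>c. \<forall>x\<in>T. \<bar>g x - (f i x + c)\<bar> \<le> e)"
proof -
  obtain T where T: "finite T" "T \<subseteq> pts X" "T \<noteq> {}" "1 - e < measure (meas X) (\<Union>x\<in>T. M.mball x e)" by (rule finite_net[OF e])
  from finite_feature_net[OF T(1-3) e] obtain N where N: "finite N" "N \<subseteq> feat_closure X"
    and net: "\<forall>f\<in>feat_closure X. \<exists>n\<in>N. \<exists>c. \<forall>x\<in>T. \<bar>f x - (n x + c)\<bar> \<le> e" by (elim exE conjE)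
  obtain x1 where x1: "x1 \<in> T" using T by blast
  from ex_bij_betw_nat_finite[OF N(1)] obtain n where n: "bij_betw n {0..<card N} N" by (elim exE)
  have nF: "n i \<in> feat_closure X" if "i < card N" for i using bij_betwE[OF n] N(2) that by auto
  define R where "R = nat \<lceil>\<Sum>x\<in>T. gds_dist X x x1\<rceil>"
  have R: "gds_dist X x x1 \<le> real R" if x: "x \<in> T" for x
  proof -
    have "gds_dist X x x1 \<le> (\<Sum>x\<in>T. gds_dist X x x1)" by (rule member_le_sum[OF x _ T(1)]) simp
    then show ?thesis unfolding R_def by linarith
  qed
  define f where "f i = (if i < card N then restrict (\<lambda>x. clip (real R) (restrict (\<lambda>x. n i x + (- n i x1)) (pts X) x)) (pts X)
    else restrict (\<lambda>_. 0) (pts X))" for i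
  have fF: "f i \<in> feat_closure X" for i
  proof (cases "i < card N")
    case True
    from closure_clip[OF closure_shift[OF nF[OF this], of "- n i x1"], of "real R"] show ?thesis by (simp only: f_def True if_True of_nat_0_le_iff)
  qed (simp add: f_def closure_const)
  have fb: "\<bar>f i x\<bar> \<le> real R" if "x \<in> pts X" for i x using that by (simp add: f_def abs_clip)
  have f0: "f i x = 0" if "card N \<le> i" "x \<in> pts X" for i x using that by (simp add: f_def)
  have fT: "f i x = n i x - n i x1" if i: "i < card N" and x: "x \<in> T" for i x
  proof -
    have "\<bar>n i x - n i x1\<bar> \<le> real R" using lipD[OF closure_lip[OF nF[OF i]], of x x1] x x1 T(2) R[OF x] by (auto simp: subset_iff)
    then show ?thesis using i x T(2) by (simp add: f_def clip_id subset_iff)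
  qed
  have det: "\<exists>i<card N. \<exists>c. \<forall>x\<in>T. \<bar>g x - (f i x + c)\<bar> \<le> e" if g: "g \<in> feat_closure X" for g
  proof -
    from bspec[OF net g] obtain \<nu> c where \<nu>: "\<nu> \<in> N" and c: "\<forall>x\<in>T. \<bar>g x - (\<nu> x + c)\<bar> \<le> e" by (elim bexE exE)
    have "\<nu> \<in> n ` {0..<card N}" using \<nu> by (simp only: bij_betw_imp_surj_on[OF n])
    then obtain i where i: "i < card N" "n i = \<nu>" by auto
    have "\<forall>x\<in>T. \<bar>g x - (f i x + (n i x1 + c))\<bar> \<le> e" using c i by (simp add: fT algebra_simps)
    then show ?thesis using i(1) by blast
  qed
  show ?thesis
    by (rule exI[of _ T], rule exI[of _ f], rule exI[of _ "card N"], rule exI[of _ R], intro conjI allI ballI impI)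
      ((rule T fF fb f0 det; assumption?)+)
qed

lemma (in gds) param_escape:
  assumes \<phi>: "\<phi> \<in> parameters X" and U: "U \<in> sets (meas X)" "1 - e \<le> measure (meas X) U"
  shows "{t \<in> {0..1}. \<phi> t \<notin> U} \<in> sets leb01" "measure leb01 {t \<in> {0..1}. \<phi> t \<notin> U} \<le> e"
proof -
  have 0: "pts X - U \<in> sets (meas X)" using sets.compl_sets[OF U(1)] by (simp add: space_meas)
  have 1: "{t \<in> {0..1}. \<phi> t \<notin> U} = \<phi> -` (pts X - U) \<inter> space leb01" using param_pts[OF \<phi>] by auto
  show "{t \<in> {0..1}. \<phi> t \<notin> U} \<in> sets leb01" unfolding 1 by (rule measurable_sets[OF param_measurable[OF \<phi>] 0])
  have "measure leb01 {t \<in> {0..1}. \<phi> t \<notin> U} = measure (distr leb01 (meas X) \<phi>) (pts X - U)"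
    unfolding 1 by (rule measure_distr[OF param_measurable[OF \<phi>] 0, symmetric])
  then show "measure leb01 {t \<in> {0..1}. \<phi> t \<notin> U} \<le> e" using U(2) P.prob_compl[OF U(1)] param_distr[OF \<phi>] by (simp add: space_meas)
qed

text \<open>Closed balls replace open ones because the box distance asks for closed sets.\<close>

lemma (in gds) net_neighbourhood:
  assumes T: "finite T" "1 - e < measure (meas X) (\<Union>x\<in>T. M.mball x e)"
  shows "closedin M.mtopology (\<Union>x\<in>T. M.mcball x e)" "1 - e \<le> measure (meas X) (\<Union>x\<in>T. M.mcball x e)"
proof -
  show c: "closedin M.mtopology (\<Union>x\<in>T. M.mcball x e)" using T(1) by (intro closedin_Union) auto
  have "(\<Union>x\<in>T. M.mball x e) \<subseteq> (\<Union>x\<in>T. M.mcball x e)" by auto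
  then show "1 - e \<le> measure (meas X) (\<Union>x\<in>T. M.mcball x e)"
    using T(2) P.finite_measure_mono[OF _ sets_closed[OF c], of "\<Union>x\<in>T. M.mball x e"] by linarith
qed

text \<open>\<open>S\<close> collects the pairs of points near the two nets at which all
  \<open>f i\<close> and \<open>z i\<close> agree up to e. Near the nets a feature of X is a
  translate of some \<open>f i\<close>, and a feature of Z some \<open>p \<circ> z n\<close>, up to
  3e; with the error e on \<open>S\<close> this makes 4e, and \<open>box_dist_le\<close> turns it
  into 16e.\<close>

lemma (in clipped) determined_box_close:
  assumes X: "cgds X L" and Z: "cgds Z L" and r: "realizes L Z \<zeta> c z" and cm: "c \<in> measurable leb01 RN"
    and \<phi>: "\<phi> \<in> parameters X" and e: "0 < e" "e \<le> 1 / 4"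
    and T: "finite T" "T \<subseteq> pts X" "1 - e < measure (meas X) (\<Union>x\<in>T. Metric_space.mball (pts X) (gds_dist X) x e)"
    and fF: "\<And>i. f i \<in> feat_closure X"
    and det: "\<And>g. g \<in> feat_closure X \<Longrightarrow> \<exists>i<m. \<exists>c. \<forall>x\<in>T. \<bar>g x - (f i x + c)\<bar> \<le> e"
    and cl: "\<And>i. i < m \<Longrightarrow> close leb01 \<delta> (\<lambda>t. f i (\<phi> t)) (\<lambda>t. c t i)"
    and \<delta>: "0 \<le> \<delta>" "real m * \<delta> \<le> e"
    and f0: "\<And>i x. m \<le> i \<Longrightarrow> x \<in> pts X \<Longrightarrow> f i x = 0" and c0: "\<And>t i. m \<le> i \<Longrightarrow> c t i = 0"
  shows "box_dist X Z \<le> ennreal (16 * e)"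
proof -
  interpret X: cgds X L by fact
  interpret Z: cgds Z L by fact
  note \<zeta> = realizesD(1)[OF r] and zF = realizesD(2)[OF r]
  obtain T' where T': "finite T'" "T' \<subseteq> pts Z" "1 - e < measure (meas Z) (\<Union>y\<in>T'. Z.M.mball y e)" by (rule Z.finite_net[OF e(1)])
  define U where "U = (\<Union>x\<in>T. X.M.mcball x e)"
  define U' where "U' = (\<Union>y\<in>T'. Z.M.mcball y e)"
  have UX: "U \<subseteq> pts X" and UZ: "U' \<subseteq> pts Z" by (auto simp: U_def U'_def)
  note clU = X.net_neighbourhood(1)[OF T(1,3), folded U_def] and clU' = Z.net_neighbourhood(1)[OF T'(1,3), folded U'_def]
  note mU = X.net_neighbourhood(2)[OF T(1,3), folded U_def] and mU' = Z.net_neighbourhood(2)[OF T'(1,3), folded U'_def]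
  define K where "K i = {p \<in> pts X \<times> pts Z. \<bar>f i (fst p) - z i (snd p)\<bar> \<le> e}" for i
  define S where "S = (U \<times> U') \<inter> (\<Inter>i. K i)"
  have contX: "continuous_map X.M.mtopology euclideanreal (f i)" for i
    using X.lip_ball_open[OF X.closure_lip[OF fF[of i]]] by (simp add: continuous_map_def)
  have contZ: "continuous_map Z.M.mtopology euclideanreal (z i)" for i
    using Z.lip_ball_open[OF Z.closure_lip[OF zF[of i]]] by (simp add: continuous_map_def)
  let ?PT = "prod_topology X.M.mtopology Z.M.mtopology"
  have "continuous_map ?PT euclideanreal (\<lambda>p. \<bar>f i (fst p) - z i (snd p)\<bar>)" for i
    by (intro continuous_map_real_abs continuous_map_diff continuous_map_compose[OF continuous_map_fst contX, unfolded comp_def]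
        continuous_map_compose[OF continuous_map_snd contZ, unfolded comp_def])
  from closedin_continuous_map_preimage[OF this, of "{..e}"] have clK: "closedin ?PT (K i)" for i by (simp add: K_def)
  have clS: "closedin ?PT S" unfolding S_def by (intro closedin_Int closedin_INT clK) (simp_all add: closedin_prod_Times_iff clU clU')
  have mK: "K i \<in> sets (meas X \<Otimes>\<^sub>M meas Z)" for i
  proof -
    have [measurable]: "f i \<in> borel_measurable (meas X)" "z i \<in> borel_measurable (meas Z)"
      using X.closure_measurable[OF fF] Z.closure_measurable[OF zF] by auto
    have "{p \<in> space (meas X \<Otimes>\<^sub>M meas Z). \<bar>f i (fst p) - z i (snd p)\<bar> \<le> e} \<in> sets (meas X \<Otimes>\<^sub>M meas Z)" by measurable
    then show ?thesis by (simp add: K_def space_pair_measure X.space_meas Z.space_meas)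
  qed
  have mS: "S \<in> sets (meas X \<Otimes>\<^sub>M meas Z)" unfolding S_def
    by (intro sets.Int sets.countable_INT' pair_measureI X.sets_closed[OF clU] Z.sets_closed[OF clU']) (use mK in auto)
  define V where "V = {t \<in> {0..1}. (\<phi> t, \<zeta> t) \<in> S}"
  have "(\<lambda>t. (\<phi> t, \<zeta> t)) \<in> measurable leb01 (meas X \<Otimes>\<^sub>M meas Z)"
    by (intro measurable_Pair X.param_measurable \<phi> Z.param_measurable \<zeta>)
  from measurable_sets[OF this mS] have mV: "V \<in> sets leb01" by (simp add: V_def vimage_def Int_def conj_commute)
  define B where "B i = {t \<in> {0..1}. \<delta> < \<bar>f i (\<phi> t) - c t i\<bar>}" for i
  have mB: "B i \<in> sets leb01" for i
  proof -
    have [measurable]: "(\<lambda>t. f i (\<phi> t)) \<in> borel_measurable leb01" "(\<lambda>t. c t i) \<in> borel_measurable leb01"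
      by (rule X.param_closure_measurable[OF \<phi> fF]) (rule RN_componentD[OF cm])
    have "{t \<in> space leb01. \<delta> < \<bar>f i (\<phi> t) - c t i\<bar>} \<in> sets leb01" by measurable
    then show ?thesis by (simp add: B_def)
  qed
  have Bm: "measure leb01 (B i) \<le> \<delta>" if "i < m" for i using cl[OF that] by (simp add: close_def B_def)
  define E where "E = {t \<in> {0..1}. \<phi> t \<notin> U}"
  define E' where "E' = {t \<in> {0..1}. \<zeta> t \<notin> U'}"
  note EE = X.param_escape[OF \<phi> X.sets_closed[OF clU] mU, folded E_def] and EE' = Z.param_escape[OF \<zeta> Z.sets_closed[OF clU'] mU', folded E'_def]
  have \<delta>e: "\<delta> \<le> e" if "i < m" for i
  proof -
    have "1 * \<delta> \<le> real m * \<delta>" by (intro mult_right_mono \<delta>(1)) (use that in simp)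
    then show ?thesis using \<delta>(2) by simp
  qed
  have inS: "(\<phi> t, \<zeta> t) \<in> S" if t: "t \<in> {0..1}" "t \<notin> E" "t \<notin> E'" "\<And>i. i < m \<Longrightarrow> t \<notin> B i" and eq: "\<forall>n. z n (\<zeta> t) = c t n" for t
  proof -
    have "\<bar>f i (\<phi> t) - z i (\<zeta> t)\<bar> \<le> e" for i
    proof (cases "i < m")
      case True
      then have "\<bar>f i (\<phi> t) - c t i\<bar> \<le> \<delta>" using t(1) t(4)[OF True] by (simp add: B_def)
      then show ?thesis using eq \<delta>e[OF True] by simp
    next
      case False
      then show ?thesis using f0[of i] c0[of i t] X.param_pts[OF \<phi> t(1)] eq e by simp
    qed
    then show ?thesis using t(1-3) X.param_pts[OF \<phi> t(1)] Z.param_pts[OF \<zeta> t(1)] by (simp add: S_def K_def E_def E'_def)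
  qed
  have "1 = measure leb01 (space leb01)" by (rule leb01.prob_space[symmetric])
  also have "\<dots> \<le> measure leb01 (V \<union> (E \<union> (E' \<union> (\<Union>i<m. B i))))"
  proof (rule leb01.finite_measure_mono_AE)
    show "AE t in leb01. t \<in> space leb01 \<longrightarrow> t \<in> V \<union> (E \<union> (E' \<union> (\<Union>i<m. B i)))"
      using realizesD(3)[OF r]
    proof (rule AE_mp, intro AE_I2 impI)
      fix t assume t: "t \<in> space leb01" and eq: "\<forall>n. z n (\<zeta> t) = c t n"
      show "t \<in> V \<union> (E \<union> (E' \<union> (\<Union>i<m. B i)))"
      proof (rule ccontr)
        assume no: "t \<notin> V \<union> (E \<union> (E' \<union> (\<Union>i<m. B i)))"
        have "(\<phi> t, \<zeta> t) \<in> S" by (rule inS[OF _ _ _ _ eq]) (use no t in auto)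
        then show False using no t by (simp add: V_def)
      qed
    qed
    show "V \<union> (E \<union> (E' \<union> (\<Union>i<m. B i))) \<in> sets leb01" using mV EE(1) EE'(1) mB by (intro sets.Un sets.finite_UN) auto
  qed
  also have "\<dots> \<le> measure leb01 V + measure leb01 (E \<union> (E' \<union> (\<Union>i<m. B i)))"
    by (rule measure_Un_le) (intro sets.Un sets.finite_UN mV EE(1) EE'(1) mB finite_lessThan)+
  also have "measure leb01 (E \<union> (E' \<union> (\<Union>i<m. B i))) \<le> measure leb01 E + measure leb01 (E' \<union> (\<Union>i<m. B i))"
    by (rule measure_Un_le) (intro sets.Un sets.finite_UN EE(1) EE'(1) mB finite_lessThan)+
  also have "measure leb01 (E' \<union> (\<Union>i<m. B i)) \<le> measure leb01 E' + measure leb01 (\<Union>i<m. B i)"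
    by (rule measure_Un_le) (intro sets.Un sets.finite_UN EE'(1) mB finite_lessThan)+
  also have "measure leb01 (\<Union>i<m. B i) \<le> (\<Sum>i<m. measure leb01 (B i))"
    by (rule leb01.finite_measure_subadditive_finite) (simp_all add: mB image_subset_iff)
  also have "\<dots> \<le> (\<Sum>i<m. \<delta>)" by (rule sum_mono) (simp add: Bm)
  also have "\<dots> \<le> e" using \<delta>(2) by simp
  \<comment> \<open>Three exceptional sets have mass at most e each: off the first net, off the
    second net, and where some entry is badly matched. As e \<le> 1/4, what remains has positive
    mass, so \<open>S\<close> is nonempty.\<close>
  finally have V: "1 - 3 * e \<le> measure leb01 V" using EE(2) EE'(2) by linarith
  have Sx: "x \<in> pts X" "y \<in> pts Z" "x \<in> U" "y \<in> U'" "\<bar>f i x - z i y\<bar> \<le> e" if "(x, y) \<in> S" for x y i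
    using that UX UZ by (auto simp: S_def K_def)
  let ?e = "4 * e"
  have ne: "S \<noteq> {}" using V e by (auto simp: V_def)
  have "box_dist X Z \<le> ennreal (4 * ?e)"
  proof (rule box_dist_le[OF X.gds_axioms Z.gds_axioms \<phi> \<zeta> _ _ ne mS])
    show "0 < ?e" using e by simp
    show "closedin (prod_topology (gds_topology X) (gds_topology Z)) S" using clS by (simp add: X.topology Z.topology)
    show "1 - ?e \<le> measure leb01 {t \<in> {0..1}. (\<phi> t, \<zeta> t) \<in> S}" using V e unfolding V_def by simp
  next
    fix g assume g: "g \<in> feat_closure X"
    from det[OF g] obtain i b where i: "i < m" and b: "\<forall>x\<in>T. \<bar>g x - (f i x + b)\<bar> \<le> e" by (elim exE conjE)
    let ?g = "restrict (\<lambda>y. z i y + b) (pts Z)" and ?f = "restrict (\<lambda>x. f i x + b) (pts X)"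
    have "\<forall>(x, y)\<in>S. \<bar>g x - ?g y\<bar> \<le> ?e"
    proof (intro ballI case_prodI2, hypsubst)
      fix x y assume xy: "(x, y) \<in> S"
      have "\<bar>g x - ?f x\<bar> \<le> 2 * e + e"
        by (rule X.agree_on_balls[OF X.closure_lip[OF g] X.closure_lip[OF X.closure_shift[OF fF]] T(2)]) (use b T(2) Sx(3)[OF xy] in \<open>auto simp: U_def subset_iff\<close>)
      then show "\<bar>g x - ?g y\<bar> \<le> ?e" using Sx(5)[OF xy, of i] Sx(1,2)[OF xy] by simp
    qed
    then show "\<exists>h\<in>feat_closure Z. \<forall>(x, y)\<in>S. \<bar>g x - h y\<bar> \<le> ?e" by (rule bexI[OF _ Z.closure_shift[OF zF]])
  next
    fix g assume g: "g \<in> feat_closure Z"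
    from realizesD(4)[OF r g T'(1,2) e(1)] obtain p n where p: "p \<in> L" and b: "\<forall>y\<in>T'. \<bar>g y - p (z n y)\<bar> < e" by (elim bexE exE)
    let ?f = "compose (pts X) p (f n)" and ?g = "compose (pts Z) p (z n)"
    have "\<forall>(x, y)\<in>S. \<bar>?f x - g y\<bar> \<le> ?e"
    proof (intro ballI case_prodI2, hypsubst)
      fix x y assume xy: "(x, y) \<in> S"
      have "\<bar>g y - ?g y\<bar> \<le> 2 * e + e"
        by (rule Z.agree_on_balls[OF Z.closure_lip[OF g] Z.closure_lip[OF Z.post[OF p zF]] T'(2)]) (use b T'(2) Sx(4)[OF xy] in \<open>auto simp: U'_def compose_def less_imp_le subset_iff\<close>)
      moreover have "\<bar>p (f n x) - p (z n y)\<bar> \<le> e" using Lip1D[OF L_Lip1[OF p], of "f n x" "z n y"] Sx(5)[OF xy, of n] by linarith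
      ultimately show "\<bar>?f x - g y\<bar> \<le> ?e" using Sx(1,2)[OF xy] by (simp add: compose_def)
    qed
    then show "\<exists>h\<in>feat_closure X. \<forall>(x, y)\<in>S. \<bar>h x - g y\<bar> \<le> ?e" by (rule bexI[OF _ X.post[OF p fF]])
  qed
  then show ?thesis by simp
qed

text \<open>Features bounded by \<open>R\<close> are placed at the indices \<open>R + i\<close>,
  where observables may be that large; up to i = m they are seen with tolerance at most 2^(R + m)
  \<delta>. The target is some member of a family, so the lemma serves single data sets and pyramids
  alike.\<close>

lemma (in clipped) transfer_features:
  assumes X: "cgds X L" and cg: "\<And>Y. Y \<in> \<Y> \<Longrightarrow> cgds Y L"
    and cov: "\<And>g. g \<in> obs X \<Longrightarrow> \<exists>Y\<in>\<Y>. \<exists>h\<in>obs Y. coupled \<delta> g h"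
    and uF: "\<And>i. u i \<in> feat_closure X" and ub: "\<And>i x. x \<in> pts X \<Longrightarrow> \<bar>u i x\<bar> \<le> real R"
    and \<delta>: "0 < \<delta>" "2 ^ (R + m) * \<delta> \<le> a"
  shows "\<exists>Y\<in>\<Y>. \<exists>\<phi>\<in>parameters X. \<exists>\<psi>\<in>parameters Y. \<exists>v. (\<forall>i. v i \<in> feat_closure Y) \<and> (\<forall>i. \<forall>y\<in>pts Y. \<bar>v i y\<bar> \<le> real R) \<and>
    (\<forall>i\<le>m. close leb01 a (\<lambda>t. u i (\<phi> t)) (\<lambda>t. v i (\<psi> t)))"
proof -
  interpret X: cgds X L by fact
  obtain \<phi> where \<phi>: "\<phi> \<in> parameters X" using X.params_nonempty by (elim exE)
  define F where "F i = (if i < R then restrict (\<lambda>_. 0) (pts X) else u (i - R))" for i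
  have FF: "F i \<in> feat_closure X" for i using uF X.closure_const by (simp add: F_def)
  have Fb: "\<bar>F i x\<bar> \<le> real i" if x: "x \<in> pts X" for i x
  proof (cases "i < R")
    case False
    then show ?thesis using order.trans[OF ub[OF x], of "real i"] by (simp add: F_def)
  qed (use x in \<open>simp add: F_def\<close>)
  have "(\<lambda>t i. F i (\<phi> t)) \<in> obs X" by (rule X.obsI[OF \<phi> FF Fb])
  from cov[OF this] obtain Y h where Y: "Y \<in> \<Y>" and h: "h \<in> obs Y"
    and c: "coupled \<delta> (\<lambda>t i. F i (\<phi> t)) h" by (elim bexE)
  interpret Y: cgds Y L by (rule cg[OF Y])
  obtain \<psi> k where \<psi>: "\<psi> \<in> parameters Y" and k: "\<And>i. k i \<in> feat_closure Y"
    and eq: "\<And>t i. t \<in> {0..1} \<Longrightarrow> h t i = k i (\<psi> t)" by (rule obsE[OF h]) (rule that)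
  from c obtain \<tau> \<sigma> where \<tau>: "\<tau> \<in> mp" and \<sigma>: "\<sigma> \<in> mp" and nr: "near \<delta> (\<lambda>t i. F i (\<phi> (\<tau> t))) (\<lambda>t. h (\<sigma> t))" by (rule coupledE)
  note \<phi>' = X.param_mp[OF \<phi> \<tau>] and \<psi>' = Y.param_mp[OF \<psi> \<sigma>]
  define v where "v i = restrict (\<lambda>y. clip (real R) (k (R + i) y)) (pts Y)" for i
  have vF: "v i \<in> feat_closure Y" for i unfolding v_def by (rule Y.closure_clip[OF k]) simp
  have vb: "\<bar>v i y\<bar> \<le> real R" if "y \<in> pts Y" for i y using that by (simp add: v_def abs_clip)
  have cl: "close leb01 a (\<lambda>t. u i (\<phi> (\<tau> t))) (\<lambda>t. v i (\<psi> (\<sigma> t)))" if i: "i \<le> m" for i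
  proof -
    from nr have "close leb01 (2 ^ (R + i) * \<delta>) (\<lambda>t. F (R + i) (\<phi> (\<tau> t))) (\<lambda>t. h (\<sigma> t) (R + i))" unfolding near_def by (rule spec)
    moreover have "h (\<sigma> t) (R + i) = k (R + i) (\<psi> (\<sigma> t))" if "t \<in> space leb01" for t
      by (rule eq) (use measurable_space[OF mp_measurable[OF \<sigma>] that] in simp)
    ultimately have "close leb01 (2 ^ (R + i) * \<delta>) (\<lambda>t. u i (\<phi> (\<tau> t))) (\<lambda>t. k (R + i) (\<psi> (\<sigma> t)))"
      by (subst close_cong[of leb01 _ "\<lambda>t. F (R + i) (\<phi> (\<tau> t))" _ "\<lambda>t. h (\<sigma> t) (R + i)"]) (simp_all add: F_def)
    from leb01.close_Lip1[OF L_Lip1[OF L_clip[of "real R"]] this X.param_closure_measurable[OF \<phi>' uF] Y.param_closure_measurable[OF \<psi>' k]]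
    have "close leb01 (2 ^ (R + i) * \<delta>) (\<lambda>t. clip (real R) (u i (\<phi> (\<tau> t)))) (\<lambda>t. clip (real R) (k (R + i) (\<psi> (\<sigma> t))))" by simp
    moreover have "clip (real R) (u i (\<phi> (\<tau> t))) = u i (\<phi> (\<tau> t))" "clip (real R) (k (R + i) (\<psi> (\<sigma> t))) = v i (\<psi> (\<sigma> t))" if t: "t \<in> space leb01" for t
      using clip_id[OF ub[OF X.param_pts[OF \<phi>', of t]]] Y.param_pts[OF \<psi>', of t] t by (simp_all add: v_def)
    ultimately have c: "close leb01 (2 ^ (R + i) * \<delta>) (\<lambda>t. u i (\<phi> (\<tau> t))) (\<lambda>t. v i (\<psi> (\<sigma> t)))"
      by (subst (asm) close_cong[of leb01 _ "\<lambda>t. u i (\<phi> (\<tau> t))" _ "\<lambda>t. v i (\<psi> (\<sigma> t))"])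
    have "2 ^ (R + i) * \<delta> \<le> 2 ^ (R + m) * \<delta>" using i \<delta>(1) by (intro mult_right_mono power_increasing) auto
    then have "2 ^ (R + i) * \<delta> \<le> a" using \<delta>(2) by simp
    from leb01.close_mono[OF c this X.param_closure_measurable[OF \<phi>' uF] Y.param_closure_measurable[OF \<psi>' vF]] show ?thesis .
  qed
  show ?thesis
    by (rule bexI[OF _ Y], rule bexI[OF _ \<phi>'], rule bexI[OF _ \<psi>'], rule exI[of _ v]) (intro conjI allI ballI impI vF vb cl)
qed

text \<open>A determining family of \<open>A\<close> is transferred to a member \<open>B\<close> of
  \<open>P\<close>. The transferred features generate a data set that is dominated by
  \<open>B\<close>, hence lies in \<open>P\<close>, and is box close to \<open>A\<close>; box
  closedness concludes.\<close>

lemma (in clipped) pyramid_determined: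
  assumes P: "l_pyramid L P" and A: "A \<in> l_classes L"
    and approx: "\<And>g e. g \<in> obs (rep A) \<Longrightarrow> 0 < e \<Longrightarrow> \<exists>h\<in>obs_all P. coupled e g h"
  shows "A \<in> P"
proof -
  have PL: "B \<in> l_classes L" if "B \<in> P" for B using P that by (auto simp: l_pyramid_def)
  interpret X: cgds "rep A" L by (rule l_class_rep[OF A])
  have "\<exists>B\<in>P. box_class A B < ennreal e0" if e0: "0 < e0" for e0
  proof -
    \<comment> \<open>The bound 1/4 is required by \<open>determined_box_close\<close>, and e0/32
      keeps 16 e below e0.\<close>
    define e where "e = min (1 / 4) (e0 / 32)"
    have e: "0 < e" "e \<le> 1 / 4" "16 * e < e0" using e0 by (auto simp: e_def min_def)
    from X.finite_determining_family[OF e(1)] obtain T and f :: "nat \<Rightarrow> real \<Rightarrow> real" and m :: nat and R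
      where T: "finite T" "T \<subseteq> pts (rep A)" "1 - e < measure (meas (rep A)) (\<Union>x\<in>T. X.M.mball x e)"
        and fF: "\<forall>i. f i \<in> feat_closure (rep A)" and fb: "\<forall>i. \<forall>x\<in>pts (rep A). \<bar>f i x\<bar> \<le> real R"
        and f0: "\<forall>i\<ge>m. \<forall>x\<in>pts (rep A). f i x = 0"
        and det: "\<forall>g\<in>feat_closure (rep A). \<exists>i<m. \<exists>c. \<forall>x\<in>T. \<bar>g x - (f i x + c)\<bar> \<le> e" by (elim exE conjE)
    \<comment> \<open>Chosen so that m matching errors of size 2^(R + m) \<delta> sum to at most
      e.\<close>
    define \<delta> where "\<delta> = e / (2 ^ (R + m) * real (Suc m))"
    have \<delta>: "0 < \<delta>" using e by (simp add: \<delta>_def)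
    have cg: "cgds Y L" if "Y \<in> rep ` P" for Y using that l_class_rep(2)[OF PL] by blast
    have cov: "\<exists>Y\<in>rep ` P. \<exists>h\<in>obs Y. coupled \<delta> g h" if "g \<in> obs (rep A)" for g
      using approx[OF that \<delta>] unfolding obs_all_def by simp
    have "\<exists>Y\<in>rep ` P. \<exists>\<phi>\<in>parameters (rep A). \<exists>\<psi>\<in>parameters Y. \<exists>v. (\<forall>i. v i \<in> feat_closure Y) \<and> (\<forall>i. \<forall>y\<in>pts Y. \<bar>v i y\<bar> \<le> real R) \<and>
      (\<forall>i\<le>m. close leb01 (2 ^ (R + m) * \<delta>) (\<lambda>t. f i (\<phi> t)) (\<lambda>t. v i (\<psi> t)))"
      by (rule transfer_features[OF X.cgds_axioms cg cov spec[OF fF] bspec[OF spec[OF fb]] \<delta> order_refl])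
    then obtain B \<phi>' \<psi> k where B: "B \<in> P" and \<phi>': "\<phi>' \<in> parameters (rep A)" and \<psi>: "\<psi> \<in> parameters (rep B)"
      and k0: "\<forall>i. k i \<in> feat_closure (rep B)" and nr: "\<forall>i\<le>m. close leb01 (2 ^ (R + m) * \<delta>) (\<lambda>t. f i (\<phi>' t)) (\<lambda>t. k i (\<psi> t))"
      by (elim bexE exE conjE imageE) (hypsubst, rule that)
    note k = spec[OF k0]
    interpret Y: cgds "rep B" L by (rule l_class_rep[OF PL[OF B]])
    \<comment> \<open>Only the m transferred features are kept; the zero tail makes the sequence
      realizable.\<close>
    define c where "c = (\<lambda>t i. if i < m then k i (\<psi> t) else 0)"
    have cm: "c \<in> measurable leb01 RN"
      unfolding measurable_RN_iff
    proof
      fix i show "(\<lambda>t. c t i) \<in> borel_measurable leb01"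
        using Y.param_closure_measurable[OF \<psi> k] by (cases "i < m") (simp_all add: c_def)
    qed
    have cl: "close leb01 (2 ^ (R + m) * \<delta>) (\<lambda>t. f i (\<phi>' t)) (\<lambda>t. c t i)" if i: "i < m" for i
      using mp[OF spec[OF nr], of i] i by (simp add: c_def)
    from finite_realization[OF cm, of m] obtain A' \<zeta> z where A': "A' \<in> l_classes L" and r: "realizes L (rep A') \<zeta> c z" by (auto simp: c_def)
    interpret Z: cgds "rep A'" L by (rule l_class_rep[OF A'])
    have "dominated (rep A') (rep B)"
    proof (rule dominated_criterion[OF Z.cgds_axioms Y.gds_axioms realizesD(1)[OF r] \<psi>])
      fix f e' assume f: "f \<in> feat_closure (rep A')" and e': "0 < (e' :: real)"
      from Z.realizes_approx[OF r cm f e'] obtain p n where p: "p \<in> L" and pc: "close leb01 e' (\<lambda>t. f (\<zeta> t)) (\<lambda>t. p (c t n))" by (elim bexE exE)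
      define f' where "f' = (if n < m then compose (pts (rep B)) p (k n) else restrict (\<lambda>_. p 0) (pts (rep B)))"
      have f'F: "f' \<in> feat_closure (rep B)" using Y.post[OF p k] Y.closure_const by (simp add: f'_def)
      have "f' (\<psi> t) = p (c t n)" if "t \<in> space leb01" for t using Y.param_pts[OF \<psi>, of t] that by (simp add: f'_def c_def compose_def)
      from close_cong[where u = "\<lambda>t. f (\<zeta> t)" and u' = "\<lambda>t. f (\<zeta> t)" and e = e', OF refl this] pc
      have "close leb01 e' (\<lambda>t. f (\<zeta> t)) (\<lambda>t. f' (\<psi> t))" by (simp only: simp_thms)
      then show "\<exists>f'\<in>feat_closure (rep B). close leb01 e' (\<lambda>t. f (\<zeta> t)) (\<lambda>t. f' (\<psi> t))" using f'F by (rule bexI)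
    qed
    then have A'P: "A' \<in> P" using P A' B dominated_class_iff[OF A' PL[OF B]] by (auto simp: l_pyramid_def)
    have "box_dist (rep A) (rep A') \<le> ennreal (16 * e)"
    proof (rule determined_box_close[OF X.cgds_axioms Z.cgds_axioms r cm \<phi>' e(1,2) T spec[OF fF] bspec[OF det] cl])
      have "2 ^ (R + m) * \<delta> = e / real (Suc m)" by (simp add: \<delta>_def del: of_nat_Suc)
      then have "real m * (2 ^ (R + m) * \<delta>) = e * (real m / real (Suc m))" by (simp del: of_nat_Suc)
      also have "\<dots> \<le> e * 1" by (rule mult_left_mono) (use e in auto)
      finally show "real m * (2 ^ (R + m) * \<delta>) \<le> e" by simp
    qed (use f0 \<delta> in \<open>auto simp: c_def\<close>)
    also have "\<dots> < ennreal e0" using e by (simp add: ennreal_lessI)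
    finally show ?thesis using A'P unfolding box_class_def by (rule bexI)
  qed
  then show ?thesis using P A unfolding l_pyramid_def box_closed_def by (elim conjE ballE) auto
qed

text \<open>The closures of the sets of observables of pyramids are stable sets; the last condition is what makes
  a pyramid directed.\<close>

definition stable :: "(real \<Rightarrow> real) set \<Rightarrow> (real \<Rightarrow> nat \<Rightarrow> real) set \<Rightarrow> bool" where
  "stable L S \<longleftrightarrow> S \<subseteq> bounded_obs \<and> S \<noteq> {} \<and> (\<forall>g\<in>bounded_obs. (\<forall>e>0. \<exists>h\<in>S. coupled e g h) \<longrightarrow> g \<in> S) \<and>
     (\<forall>g\<in>S. \<forall>s q. (\<forall>j. q j \<in> L) \<longrightarrow> (\<forall>j r. \<bar>q j r\<bar> \<le> real j) \<longrightarrow> (\<lambda>t. reindex s q (g t)) \<in> S) \<and>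
     (\<forall>u\<in>S. \<forall>v\<in>S. \<exists>w\<in>S. distr leb01 RN (\<lambda>t i. w t (2 * i)) = distr leb01 RN u \<and>
        distr leb01 RN (\<lambda>t i. w t (2 * i + 1)) = distr leb01 RN v)"

lemma stableD:
  assumes "stable L S"
  shows "g \<in> S \<Longrightarrow> g \<in> bounded_obs" "S \<noteq> {}" "g \<in> bounded_obs \<Longrightarrow> (\<And>e. 0 < e \<Longrightarrow> \<exists>h\<in>S. coupled e g h) \<Longrightarrow> g \<in> S"
    "g \<in> S \<Longrightarrow> (\<And>j. q j \<in> L) \<Longrightarrow> (\<And>j r. \<bar>q j r\<bar> \<le> real j) \<Longrightarrow> (\<lambda>t. reindex s q (g t)) \<in> S"
    "u \<in> S \<Longrightarrow> v \<in> S \<Longrightarrow> \<exists>w\<in>S. distr leb01 RN (\<lambda>t i. w t (2 * i)) = distr leb01 RN u \<and>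
        distr leb01 RN (\<lambda>t i. w t (2 * i + 1)) = distr leb01 RN v"
  using assms unfolding stable_def by blast+

lemma stable_law:
  assumes S: "stable L S" and g: "g \<in> S" and h: "h \<in> bounded_obs" and eq: "distr leb01 RN h = distr leb01 RN g"
  shows "h \<in> S"
proof (rule stableD(3)[OF S h])
  fix e :: real assume "0 < e"
  from coupled_law[OF bounded_obsD(1)[OF h] bounded_obsD(1)[OF stableD(1)[OF S g]] eq this] g
  show "\<exists>k\<in>S. coupled e h k" by (rule bexI)
qed

section \<open>Pyramids spanned by stable sets\<close>

context clipped
begin

text \<open>Each entry of an observable is close to a clipped function of L of one entry of
  \<open>c\<close>. Hence the observable is, up to law, a limit of reindexings of \<open>c\<close>,
  and \<open>S\<close> is closed under both operations.\<close>

lemma realized_obs_stable: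
  assumes S: "stable L S" and A: "A \<in> l_classes L" and r: "realizes L (rep A) \<zeta> c z" and c: "c \<in> S"
  shows "obs (rep A) \<subseteq> S"
proof
  interpret X: cgds "rep A" L by (rule l_class_rep[OF A])
  note \<zeta> = realizesD(1)[OF r] and cm = bounded_obsD(1)[OF stableD(1)[OF S c]]
  fix g assume g: "g \<in> obs (rep A)"
  from X.obs_change_param[OF g \<zeta>] obtain f where f: "\<forall>i. f i \<in> feat_closure (rep A)" "\<forall>i. \<forall>x\<in>pts (rep A). \<bar>f i x\<bar> \<le> real i"
    and law: "distr leb01 RN g = distr leb01 RN (\<lambda>t i. f i (\<zeta> t))" by (elim exE conjE)
  have fm: "(\<lambda>t. f i (\<zeta> t)) \<in> borel_measurable leb01" for i by (rule X.param_closure_measurable[OF \<zeta> spec[OF f(1)]])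
  have "(\<lambda>t i. f i (\<zeta> t)) \<in> obs (rep A)" by (rule X.obsI[OF \<zeta> spec[OF f(1)] bspec[OF spec[OF f(2)]]])
  note fb = X.obs_bounded[OF this]
  have "(\<lambda>t i. f i (\<zeta> t)) \<in> S"
  proof (rule stableD(3)[OF S fb])
    fix e :: real assume e: "0 < e"
    have "\<forall>i. \<exists>q n. (q \<in> L \<and> (\<forall>r. \<bar>q r\<bar> \<le> real i)) \<and> close leb01 e (\<lambda>t. f i (\<zeta> t)) (\<lambda>t. q (c t n))"
    proof
      fix i
      from X.realizes_approx[OF r cm spec[OF f(1)] e, of i] obtain p n where p: "p \<in> L"
        and pc: "close leb01 e (\<lambda>t. f i (\<zeta> t)) (\<lambda>t. p (c t n))" by (elim bexE exE)
      define q where "q x = clip (real i) (p x)" for x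
      have q: "q \<in> L" unfolding q_def by (rule L_comp[OF L_clip p]) simp
      have m: "(\<lambda>t. p (c t n)) \<in> borel_measurable leb01"
        by (rule measurable_compose[OF RN_componentD[OF cm] measurable_Lip1[OF L_Lip1[OF p]]])
      have "close leb01 e (\<lambda>t. clip (real i) (f i (\<zeta> t))) (\<lambda>t. clip (real i) (p (c t n)))"
        by (rule leb01.close_Lip1[OF L_Lip1[OF L_clip] pc fm m]) simp
      moreover have "clip (real i) (f i (\<zeta> t)) = f i (\<zeta> t)" if "t \<in> space leb01" for t
        by (rule clip_id[OF bspec[OF spec[OF f(2)] X.param_pts[OF \<zeta>]]]) (use that in simp)
      ultimately have "close leb01 e (\<lambda>t. f i (\<zeta> t)) (\<lambda>t. q (c t n))"
        by (subst (asm) close_cong[of leb01 _ "\<lambda>t. f i (\<zeta> t)" _ "\<lambda>t. q (c t n)"]) (simp_all add: q_def)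
      moreover have "\<forall>r. \<bar>q r\<bar> \<le> real i" by (simp add: q_def abs_clip)
      ultimately show "\<exists>q n. (q \<in> L \<and> (\<forall>r. \<bar>q r\<bar> \<le> real i)) \<and> close leb01 e (\<lambda>t. f i (\<zeta> t)) (\<lambda>t. q (c t n))"
        using q by (intro exI conjI)
    qed
    from choice[OF this] obtain q where "\<forall>i. \<exists>n. (q i \<in> L \<and> (\<forall>r. \<bar>q i r\<bar> \<le> real i)) \<and> close leb01 e (\<lambda>t. f i (\<zeta> t)) (\<lambda>t. q i (c t n))" by (elim exE)
    from choice[OF this] obtain s where "\<forall>i. (q i \<in> L \<and> (\<forall>r. \<bar>q i r\<bar> \<le> real i)) \<and> close leb01 e (\<lambda>t. f i (\<zeta> t)) (\<lambda>t. q i (c t (s i)))" by (elim exE)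
    note 1 = spec[OF this]
    note q = conjunct1[OF conjunct1[OF 1]] and qb = spec[OF conjunct2[OF conjunct1[OF 1]]] and qc = conjunct2[OF 1]
    have h: "(\<lambda>t. reindex s q (c t)) \<in> S" by (rule stableD(4)[OF S c q qb])
    have "near e (\<lambda>t i. f i (\<zeta> t)) (\<lambda>t. reindex s q (c t))"
      by (rule near_if_close[OF _ less_imp_le[OF e] bounded_obsD(1)[OF fb] bounded_obsD(1)[OF stableD(1)[OF S h]]])
        (unfold reindex_def, rule qc)
    from coupled_near[OF this] h show "\<exists>h\<in>S. coupled e (\<lambda>t i. f i (\<zeta> t)) h" by (rule bexI)
  qed
  from stable_law[OF S this X.obs_bounded[OF g] law] show "g \<in> S" .
qed

text \<open>The entries of \<open>c\<close> obey the bounds, so clipping the generators makes them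
  admissible without changing them along the parameter, almost surely.\<close>

lemma obs_realization:
  assumes A: "A \<in> l_classes L" and r: "realizes L (rep A) \<zeta> c z" and c: "c \<in> bounded_obs" and e: "0 < e"
  shows "\<exists>h\<in>obs (rep A). coupled e c h"
proof -
  interpret X: cgds "rep A" L by (rule l_class_rep[OF A])
  note \<zeta> = realizesD(1)[OF r] and cm = bounded_obsD(1)[OF c]
  define k where "k i = restrict (\<lambda>x. clip (real i) (z i x)) (pts (rep A))" for i
  have kF: "k i \<in> feat_closure (rep A)" for i unfolding k_def by (rule X.closure_clip[OF realizesD(2)[OF r]]) simp
  have kb: "\<bar>k i x\<bar> \<le> real i" if "x \<in> pts (rep A)" for i x using that by (simp add: k_def abs_clip)
  have h: "(\<lambda>t i. k i (\<zeta> t)) \<in> obs (rep A)" by (rule X.obsI[OF \<zeta> kF kb])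
  have "AE t in leb01. c t = (\<lambda>i. k i (\<zeta> t))"
    using realizesD(3)[OF r]
  proof (rule AE_mp, intro AE_I2 impI ext)
    fix t i assume t: "t \<in> space leb01" and eq: "\<forall>n. z n (\<zeta> t) = c t n"
    then show "c t i = k i (\<zeta> t)" using X.param_pts[OF \<zeta>, of t] bounded_obsD(2)[OF c, of t i] by (simp add: k_def clip_id)
  qed
  then have "distr leb01 RN c = distr leb01 RN (\<lambda>t i. k i (\<zeta> t))"
    by (rule distr_cong_AE[OF refl refl _ cm obs_measurable[OF h]])
  from coupled_law[OF cm obs_measurable[OF h] this e] h show ?thesis by (rule bexI)
qed

definition spanned :: "(real \<Rightarrow> nat \<Rightarrow> real) set \<Rightarrow> real gds set set" where
  "spanned S = {A \<in> l_classes L. obs (rep A) \<subseteq> S}"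

text \<open>An element of \<open>S\<close> need not be realizable, as its range may fail to be
  separable. Setting the entries from m on to zero stays in \<open>S\<close>, costs at most e/3 and
  makes it realizable.\<close>

lemma spanned_dense:
  assumes S: "stable L S" and g: "g \<in> S" and e: "0 < e"
  shows "\<exists>h\<in>obs_all (spanned S). coupled e g h"
proof -
  note gb = stableD(1)[OF S g]
  obtain m where m: "1 < 2 ^ m * (e / 3)" using ex_pow2_mult_gt_1[of "e / 3"] e by auto
  define q where "q j = (if j < m then clip (real j) else (\<lambda>_. 0))" for j
  have qL: "q j \<in> L" and qb: "\<bar>q j r\<bar> \<le> real j" for j r by (simp_all add: q_def L_clip L_const abs_clip)
  define c where "c = (\<lambda>t. reindex (\<lambda>i. i) q (g t))"
  have cS: "c \<in> S" unfolding c_def by (rule stableD(4)[OF S g qL qb])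
  note cb = stableD(1)[OF S cS]
  have "near (e / 3) g c"
  proof (rule near_if_close_initial[OF _ _ less_imp_le[OF m] bounded_obsD(1)[OF gb] bounded_obsD(1)[OF cb]])
    fix i assume "i < m"
    then show "close leb01 (e / 3) (\<lambda>t. g t i) (\<lambda>t. c t i)"
      by (intro leb01.close_pointwise) (use e bounded_obsD(2)[OF gb, of _ i] in \<open>auto simp: c_def reindex_def q_def clip_id\<close>)
  qed (use e in simp)
  then have 1: "coupled (e / 3) g c" by (rule coupled_near)
  from finite_realization[OF bounded_obsD(1)[OF cb], of m] obtain A \<zeta> z where A: "A \<in> l_classes L" and r: "realizes L (rep A) \<zeta> c z"
    by (auto simp: c_def reindex_def q_def)
  interpret X: cgds "rep A" L by (rule l_class_rep[OF A])
  have AS: "A \<in> spanned S" using A realized_obs_stable[OF S A r cS] by (simp add: spanned_def)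
  from obs_realization[OF A r cb, of "e / 3"] e obtain h where h: "h \<in> obs (rep A)" "coupled (e / 3) c h" by auto
  have "coupled e g h" by (rule coupled_trans[OF 1 h(2) _ gb cb X.obs_bounded[OF h(1)]]) (use e in simp)
  then show ?thesis using h(1) AS unfolding obs_all_def by (intro bexI) auto
qed

text \<open>Directedness is the delicate part: the joined sequence \<open>w\<close> provided by
  stability has to be made realizable without truncation, since truncation would lose domination of
  the two data sets.\<close>

lemma spanned_pyramid:
  assumes S: "stable L S"
  shows "l_pyramid L (spanned S)"
  unfolding l_pyramid_def
proof (intro conjI ballI impI)
  show "spanned S \<subseteq> l_classes L" by (auto simp: spanned_def)
next
  fix A B assume A: "A \<in> l_classes L" and B: "B \<in> spanned S" and AB: "dominated_class A B"
  have BL: "B \<in> l_classes L" and BS: "obs (rep B) \<subseteq> S" using B by (simp_all add: spanned_def)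
  interpret X: cgds "rep A" L by (rule l_class_rep[OF A])
  interpret Y: cgds "rep B" L by (rule l_class_rep[OF BL])
  have "g \<in> S" if g: "g \<in> obs (rep A)" for g
  proof -
    from obs_dominated[OF Y.cgds_axioms X.gds_axioms _ g] AB dominated_class_iff[OF A BL]
    obtain h where h: "h \<in> obs (rep B)" "distr leb01 RN g = distr leb01 RN h" by auto
    show ?thesis by (rule stable_law[OF S _ X.obs_bounded[OF g] h(2)]) (use h(1) BS in blast)
  qed
  then show "A \<in> spanned S" using A by (auto simp: spanned_def)
next
  obtain g where "g \<in> S" using stableD(2)[OF S] by blast
  from spanned_dense[OF S this, of 1] show "spanned S \<noteq> {}" by (auto simp: obs_all_def)
next
  show "box_closed L (spanned S)"
    unfolding box_closed_def
  proof (intro ballI impI)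
    fix A assume A: "A \<in> l_classes L" and app: "\<forall>e>0. \<exists>B\<in>spanned S. box_class A B < ennreal e"
    interpret X: cgds "rep A" L by (rule l_class_rep[OF A])
    have "g \<in> S" if g: "g \<in> obs (rep A)" for g
    proof (rule stableD(3)[OF S X.obs_bounded[OF g]])
      fix e :: real assume e: "0 < e"
      from app e obtain B where B: "B \<in> spanned S" "box_class A B < ennreal (e / 2)" by (metis half_gt_zero)
      have BL: "B \<in> l_classes L" and BS: "obs (rep B) \<subseteq> S" using B(1) by (simp_all add: spanned_def)
      note Y = l_class_rep(2)[OF BL]
      have c: "conc (e / 2) (rep A) (rep B)" by (rule box_dist_less_imp_conc[OF X.cgds_axioms Y]) (use B(2) in \<open>simp add: box_class_def\<close>)
      from conc_coupled[OF X.cgds_axioms Y c _ g] e obtain h where h: "h \<in> obs (rep B)" and hc: "\<forall>\<eta>>0. coupled (e / 2 + \<eta>) g h" by auto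
      from spec[OF hc, of "e / 2"] e have "coupled e g h" by simp
      then show "\<exists>h\<in>S. coupled e g h" using h BS by blast
    qed
    then show "A \<in> spanned S" using A by (auto simp: spanned_def)
  qed
next
  fix A B assume A: "A \<in> spanned S" and B: "B \<in> spanned S"
  have AL: "A \<in> l_classes L" and AS: "obs (rep A) \<subseteq> S" and BL: "B \<in> l_classes L" and BS: "obs (rep B) \<subseteq> S"
    using A B by (simp_all add: spanned_def)
  interpret X: cgds "rep A" L by (rule l_class_rep[OF AL])
  interpret Y: cgds "rep B" L by (rule l_class_rep[OF BL])
  obtain \<phi> where \<phi>: "\<phi> \<in> parameters (rep A)" using X.params_nonempty by (elim exE)
  obtain \<psi> where \<psi>: "\<psi> \<in> parameters (rep B)" using Y.params_nonempty by (elim exE)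
  have "(\<lambda>t i. X.bseq i (\<phi> t)) \<in> S" "(\<lambda>t i. Y.bseq i (\<psi> t)) \<in> S"
    using X.obsI[OF \<phi> X.bseq_closure X.bseq_bound] Y.obsI[OF \<psi> Y.bseq_closure Y.bseq_bound] AS BS by blast+
  from stableD(5)[OF S this] obtain w where w: "w \<in> S"
    and w1: "distr leb01 RN (\<lambda>t i. w t (2 * i)) = distr leb01 RN (\<lambda>t i. X.bseq i (\<phi> t))"
    and w2: "distr leb01 RN (\<lambda>t i. w t (2 * i + 1)) = distr leb01 RN (\<lambda>t i. Y.bseq i (\<psi> t))" by (elim bexE conjE)
  note wb = stableD(1)[OF S w]
  have wm: "(\<lambda>t i. w t (s i)) \<in> measurable leb01 RN" for s
    unfolding measurable_RN_iff by (intro allI RN_componentD[OF bounded_obsD(1)[OF wb]])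
  from X.param_of_law[OF \<phi> wm w1] obtain \<phi>' where \<phi>': "\<phi>' \<in> parameters (rep A)" and ae1: "AE t in leb01. \<forall>i. X.bseq i (\<phi>' t) = w t (2 * i)" by (elim bexE)
  from Y.param_of_law[OF \<psi> wm w2] obtain \<psi>' where \<psi>': "\<psi>' \<in> parameters (rep B)" and ae2: "AE t in leb01. \<forall>i. Y.bseq i (\<psi>' t) = w t (2 * i + 1)" by (elim bexE)
  \<comment> \<open>Almost everywhere equal to \<open>w\<close>, but at every parameter value an
    interleaving of feature values at points of two separable data sets, which makes the range
    separable.\<close>
  define c where "c = (\<lambda>t j. if even j then X.bseq (j div 2) (\<phi>' t) else Y.bseq (j div 2) (\<psi>' t))"
  have c1: "c t (2 * i) = X.bseq i (\<phi>' t)" and c2: "c t (2 * i + 1) = Y.bseq i (\<psi>' t)" for t i by (simp_all add: c_def)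
  have cm: "c \<in> measurable leb01 RN"
    unfolding measurable_RN_iff
  proof
    fix j show "(\<lambda>t. c t j) \<in> borel_measurable leb01"
      using X.param_closure_measurable[OF \<phi>' X.bseq_closure] Y.param_closure_measurable[OF \<psi>' Y.bseq_closure] by (cases "even j") (simp_all add: c_def)
  qed
  have cb: "c \<in> bounded_obs"
    unfolding bounded_obs_def
  proof (intro CollectI conjI cm ballI allI)
    fix t :: real and j assume t: "t \<in> {0..1}"
    have "\<bar>c t j\<bar> \<le> real (j div 2)" using X.bseq_bound[OF X.param_pts[OF \<phi>' t], of "j div 2"] Y.bseq_bound[OF Y.param_pts[OF \<psi>' t], of "j div 2"] by (simp add: c_def)
    also have "\<dots> \<le> real j" by simp
    finally show "\<bar>c t j\<bar> \<le> real j" .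
  qed
  have "AE t in leb01. c t = w t"
    using ae1 ae2
  proof eventually_elim
    fix t assume 1: "\<forall>i. X.bseq i (\<phi>' t) = w t (2 * i)" and 2: "\<forall>i. Y.bseq i (\<psi>' t) = w t (2 * i + 1)"
    show "c t = w t"
    proof
      fix j show "c t j = w t j"
      proof (cases "even j")
        case True
        then obtain i where i: "j = 2 * i" by (elim evenE)
        show ?thesis unfolding i c1 by (rule spec[OF 1])
      next
        case False
        then obtain i where i: "j = 2 * i + 1" by (elim oddE)
        show ?thesis unfolding i c2 by (rule spec[OF 2])
      qed
    qed
  qed
  from distr_cong_AE[OF refl refl this cm bounded_obsD(1)[OF wb]] have cS: "c \<in> S" by (rule stable_law[OF S w cb])
  have "\<exists>C\<in>l_classes L. \<exists>\<zeta> z. realizes L (rep C) \<zeta> c z"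
  proof -
    obtain cX where cX: "\<And>i :: nat. cX i \<in> pts (rep A)" "\<And>x r. x \<in> pts (rep A) \<Longrightarrow> 0 < r \<Longrightarrow> \<exists>i. gds_dist (rep A) x (cX i) < r"
      by (rule X.dense_seq) blast
    obtain cY where cY: "\<And>i :: nat. cY i \<in> pts (rep B)" "\<And>x r. x \<in> pts (rep B) \<Longrightarrow> 0 < r \<Longrightarrow> \<exists>i. gds_dist (rep B) x (cY i) < r"
      by (rule Y.dense_seq) blast
    \<comment> \<open>The index of a dense point within 1/(k+1). Equal indices in both data sets
      bound the distances there, and hence, by \<open>cd\<close>, the supremum distance of the
      interleaved values.\<close>
    define iX where "iX k t = (LEAST j. gds_dist (rep A) (\<phi>' t) (cX j) < 1 / real (Suc k))" for k t
    define iY where "iY k t = (LEAST j. gds_dist (rep B) (\<psi>' t) (cY j) < 1 / real (Suc k))" for k t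
    have iX: "gds_dist (rep A) (\<phi>' t) (cX (iX k t)) < 1 / real (Suc k)" if t: "t \<in> {0..1}" for k t
      unfolding iX_def by (rule LeastI_ex, rule cX(2)[OF X.param_pts[OF \<phi>' t]]) simp
    have iY: "gds_dist (rep B) (\<psi>' t) (cY (iY k t)) < 1 / real (Suc k)" if t: "t \<in> {0..1}" for k t
      unfolding iY_def by (rule LeastI_ex, rule cY(2)[OF Y.param_pts[OF \<psi>' t]]) simp
    have cd: "\<bar>c t j - c s j\<bar> \<le> gds_dist (rep A) (\<phi>' t) (\<phi>' s) + gds_dist (rep B) (\<psi>' t) (\<psi>' s)" if t: "t \<in> {0..1}" "s \<in> {0..1}" for t s j
      using X.lipD[OF X.closure_lip[OF X.bseq_closure[of "j div 2"]] X.param_pts[OF \<phi>' t(1)] X.param_pts[OF \<phi>' t(2)]]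
        Y.lipD[OF Y.closure_lip[OF Y.bseq_closure[of "j div 2"]] Y.param_pts[OF \<psi>' t(1)] Y.param_pts[OF \<psi>' t(2)]]
        X.M.nonneg[of "\<phi>' t" "\<phi>' s"] Y.M.nonneg[of "\<psi>' t" "\<psi>' s"]
      unfolding c_def by (cases "even j") (auto simp del: abs_of_nonneg intro: order.trans)
    define code where "code k t = prod_encode (iX k t, iY k t)" for k t
    obtain C where C: "countable C" "C \<subseteq> {0..1}" and code: "\<forall>t\<in>{0..1}. \<forall>k. \<exists>s\<in>C. code k s = code k t"
      using countable_code_dense[of code] by (elim exE conjE)
    show ?thesis
    proof (rule class_realization[OF cm C])
      fix t e :: real assume t: "t \<in> {0..1}" and e: "0 < e"
      obtain k where k: "1 / real (Suc k) < e / 4" using nat_approx_posE[of "e / 4"] e by auto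
      from spec[OF bspec[OF code t], of k] obtain s where s: "s \<in> C" "code k s = code k t" by (elim bexE)
      have s01: "s \<in> {0..1}" using s(1) C(2) by blast
      have i: "iX k s = iX k t" "iY k s = iY k t" using s(2) by (simp_all add: code_def)
      have "gds_dist (rep A) (\<phi>' t) (\<phi>' s) \<le> 2 * (1 / real (Suc k))"
        using X.M.triangle'[OF X.param_pts[OF \<phi>' t] cX(1) X.param_pts[OF \<phi>' s01], of "iX k t"] iX[OF t, of k] iX[OF s01, of k]
        unfolding i by linarith
      moreover have "gds_dist (rep B) (\<psi>' t) (\<psi>' s) \<le> 2 * (1 / real (Suc k))"
        using Y.M.triangle'[OF Y.param_pts[OF \<psi>' t] cY(1) Y.param_pts[OF \<psi>' s01], of "iY k t"] iY[OF t, of k] iY[OF s01, of k]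
        unfolding i by linarith
      ultimately have "\<bar>c t n - c s n\<bar> \<le> e" for n using cd[OF t s01, of n] k by linarith
      then show "\<exists>s\<in>C. \<forall>n. \<bar>c t n - c s n\<bar> \<le> e" using s(1) by blast
    next
      fix s t :: real assume "s \<in> {0..1}" "t \<in> {0..1}"
      from cd[OF this] show "\<exists>B. \<forall>n. \<bar>c s n - c t n\<bar> \<le> B" by blast
    qed
  qed
  then obtain C \<zeta> z where C: "C \<in> l_classes L" and r: "realizes L (rep C) \<zeta> c z" by (elim bexE exE)
  interpret Z: cgds "rep C" L by (rule l_class_rep[OF C])
  have "C \<in> spanned S" using C realized_obs_stable[OF S C r cS] by (simp add: spanned_def)
  moreover have "dominated (rep A) (rep C)"
  proof (rule X.dominated_if_bseq[OF Z.gds_axioms \<phi>' realizesD(1,2)[OF r]])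
    show "AE t in leb01. \<forall>i. X.bseq i (\<phi>' t) = z (2 * i) (\<zeta> t)" using realizesD(3)[OF r] by (rule AE_mp) (simp add: c1)
  qed
  moreover have "dominated (rep B) (rep C)"
  proof (rule Y.dominated_if_bseq[OF Z.gds_axioms \<psi>' realizesD(1,2)[OF r]])
    show "AE t in leb01. \<forall>i. Y.bseq i (\<psi>' t) = z (2 * i + 1) (\<zeta> t)" using realizesD(3)[OF r] by (rule AE_mp, intro AE_I2 impI allI) (simp only: c2)
  qed
  ultimately show "\<exists>C\<in>spanned S. dominated_class A C \<and> dominated_class B C"
    using dominated_class_iff[OF AL C] dominated_class_iff[OF BL C] by blast
qed

end

section \<open>Limits of pyramids\<close>

lemma covered_refl: "S \<subseteq> T \<Longrightarrow> T \<subseteq> bounded_obs \<Longrightarrow> 0 < e \<Longrightarrow> covered e S T"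
  unfolding covered_def
proof
  fix g assume S: "S \<subseteq> T" and T: "T \<subseteq> bounded_obs" and e: "0 < e" and g: "g \<in> S"
  have "g \<in> bounded_obs" using S T g by blast
  from coupled_law[OF bounded_obsD(1)[OF this] bounded_obsD(1)[OF this] refl e] show "\<exists>h\<in>T. coupled e g h"
    using S g by (intro bexI[of _ g]) blast+
qed

lemma covered_mono:
  assumes c: "covered a S T" and ab: "a \<le> b" and S: "S \<subseteq> bounded_obs" and T: "T \<subseteq> bounded_obs"
  shows "covered b S T"
  unfolding covered_def
proof
  fix g assume g: "g \<in> S"
  then obtain h where h: "h \<in> T" "coupled a g h" using c unfolding covered_def by blast
  from coupled_mono[OF h(2) ab] show "\<exists>h\<in>T. coupled b g h" using bounded_obsD(1) S T g h(1) by blast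
qed

lemma coupled_subsequence:
  assumes "0 < e"
  shows "\<exists>\<delta>>0. \<forall>u v. u \<in> measurable leb01 RN \<longrightarrow> v \<in> measurable leb01 RN \<longrightarrow>
    coupled \<delta> u v \<longrightarrow> coupled e (\<lambda>t i. u t (s i)) (\<lambda>t i. v t (s i))"
proof -
  from coupled_reindex[OF assms, of s] obtain \<delta> where \<delta>: "0 < \<delta>"
    and c: "\<forall>q u v. (\<forall>j. q j \<in> Lip1) \<longrightarrow> u \<in> measurable leb01 RN \<longrightarrow> v \<in> measurable leb01 RN \<longrightarrow>
      coupled \<delta> u v \<longrightarrow> coupled e (\<lambda>t. reindex s q (u t)) (\<lambda>t. reindex s q (v t))" by (elim exE conjE)
  have r: "reindex s (\<lambda>_ x. x) y = (\<lambda>i. y (s i))" for y by (simp add: fun_eq_iff reindex_def)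
  have "(\<lambda>x. x) \<in> Lip1" by (rule Lip1I) simp
  then show ?thesis using \<delta> spec[OF c, of "\<lambda>_ x. x"] unfolding r by (intro exI[of _ \<delta>] conjI) blast+
qed

context clipped
begin

lemma obs_all_bounded: "P \<subseteq> l_classes L \<Longrightarrow> obs_all P \<subseteq> bounded_obs"
  using l_class_rep(2) cgds.axioms(1) gds.obs_bounded unfolding obs_all_def by blast

lemma pyramid_classes: "l_pyramid L P \<Longrightarrow> P \<subseteq> l_classes L"
  by (simp add: l_pyramid_def)

lemma pyramid_obs_bounded: "l_pyramid L P \<Longrightarrow> obs_all P \<subseteq> bounded_obs"
  by (rule obs_all_bounded[OF pyramid_classes])

lemma pyramid_obs_nonempty:
  assumes "l_pyramid L P"
  shows "obs_all P \<noteq> {}"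
proof -
  from assms obtain A where A: "A \<in> P" by (auto simp: l_pyramid_def)
  then show ?thesis using cgds.obs_nonempty[OF l_class_rep(2)] pyramid_classes[OF assms] unfolding obs_all_def by blast
qed

lemma obs_all_reindex:
  assumes P: "P \<subseteq> l_classes L" and g: "g \<in> obs_all P" and q: "\<And>j. q j \<in> L" "\<And>j r. \<bar>q j r\<bar> \<le> real j"
  shows "(\<lambda>t. reindex s q (g t)) \<in> obs_all P"
proof -
  from g obtain A where A: "A \<in> P" "g \<in> obs (rep A)" unfolding obs_all_def by blast
  then have "A \<in> l_classes L" using P by blast
  from cgds.obs_reindex[OF l_class_rep(2)[OF this] A(2) q] show ?thesis unfolding obs_all_def using A(1) by blast
qed

text \<open>Up to law, both observables are sequences of features of one common upper bound along
  one parameter, and these are interleaved. A bound by \<open>j div 2\<close> is a bound by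
  \<open>j\<close>, so the result is again an observable.\<close>

lemma pyramid_join:
  assumes P: "l_pyramid L P" and u: "u \<in> obs_all P" and v: "v \<in> obs_all P"
  shows "\<exists>w\<in>obs_all P. distr leb01 RN u = distr leb01 RN (\<lambda>t i. w t (2 * i)) \<and>
    distr leb01 RN v = distr leb01 RN (\<lambda>t i. w t (2 * i + 1))"
proof -
  from u v obtain A B where A: "A \<in> P" "u \<in> obs (rep A)" and B: "B \<in> P" "v \<in> obs (rep B)" unfolding obs_all_def by blast
  from P A(1) B(1) obtain C where C: "C \<in> P" and dom: "dominated_class A C" "dominated_class B C" unfolding l_pyramid_def by blast
  have cl: "A \<in> l_classes L" "B \<in> l_classes L" "C \<in> l_classes L" using A(1) B(1) C pyramid_classes[OF P] by blast+
  interpret X: cgds "rep A" L by (rule l_class_rep[OF cl(1)])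
  interpret Y: cgds "rep B" L by (rule l_class_rep[OF cl(2)])
  interpret Z: cgds "rep C" L by (rule l_class_rep[OF cl(3)])
  have d: "dominated (rep A) (rep C)" "dominated (rep B) (rep C)" using dom dominated_class_iff cl by blast+
  obtain \<psi> where \<psi>: "\<psi> \<in> parameters (rep C)" using Z.params_nonempty by (elim exE)
  from obs_dominated[OF Z.cgds_axioms X.gds_axioms d(1) A(2)] obtain u' where u': "u' \<in> obs (rep C)" "distr leb01 RN u = distr leb01 RN u'" by (elim bexE)
  from obs_dominated[OF Z.cgds_axioms Y.gds_axioms d(2) B(2)] obtain v' where v': "v' \<in> obs (rep C)" "distr leb01 RN v = distr leb01 RN v'" by (elim bexE)
  from Z.obs_change_param[OF u'(1) \<psi>] obtain f where f: "\<forall>i. f i \<in> feat_closure (rep C)" "\<forall>i. \<forall>x\<in>pts (rep C). \<bar>f i x\<bar> \<le> real i"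
    and fl: "distr leb01 RN u' = distr leb01 RN (\<lambda>t i. f i (\<psi> t))" by (elim exE conjE)
  from Z.obs_change_param[OF v'(1) \<psi>] obtain k where k: "\<forall>i. k i \<in> feat_closure (rep C)" "\<forall>i. \<forall>x\<in>pts (rep C). \<bar>k i x\<bar> \<le> real i"
    and kl: "distr leb01 RN v' = distr leb01 RN (\<lambda>t i. k i (\<psi> t))" by (elim exE conjE)
  define F where "F j = (if even j then f (j div 2) else k (j div 2))" for j
  have FF: "F j \<in> feat_closure (rep C)" for j using f(1) k(1) by (simp add: F_def)
  have Fb: "\<bar>F j x\<bar> \<le> real j" if x: "x \<in> pts (rep C)" for j x
  proof -
    have "\<bar>F j x\<bar> \<le> real (j div 2)" using f(2) k(2) x by (simp add: F_def)
    also have "\<dots> \<le> real j" by simp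
    finally show ?thesis .
  qed
  have "(\<lambda>t i. F i (\<psi> t)) \<in> obs_all P" unfolding obs_all_def using C Z.obsI[OF \<psi> FF Fb] by blast
  moreover have "F (2 * i) = f i" "F (2 * i + 1) = k i" for i by (simp_all add: F_def)
  ultimately show ?thesis using u'(2) v'(2) fl kl by (intro bexI[of _ "\<lambda>t i. F i (\<psi> t)"]) simp_all
qed

text \<open>Closedness and reindexing pass to lower limits directly. For joins, sequences joined
  inside the approximating pyramids are collected and a limit in law of them is taken; the covering
  by \<open>S\<close> keeps that limit in \<open>S\<close>.\<close>

lemma stable_limit:
  assumes P: "\<And>n. l_pyramid L (P n)"
    and S: "S = {g \<in> bounded_obs. \<forall>e>0. \<forall>\<^sub>F n in sequentially. \<exists>h\<in>obs_all (P n). coupled e g h}"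
    and cov: "\<And>e. 0 < e \<Longrightarrow> \<forall>\<^sub>F n in sequentially. covered e (obs_all (P n)) S"
  shows "stable L S"
proof -
  have Sb: "g \<in> bounded_obs" if "g \<in> S" for g using that S by blast
  have Pb: "g \<in> bounded_obs" if "g \<in> obs_all (P n)" for g n using that pyramid_obs_bounded[OF P] by blast
  have Sev: "\<forall>\<^sub>F n in sequentially. \<exists>h\<in>obs_all (P n). coupled e g h" if "g \<in> S" "0 < e" for g e using that unfolding S by blast
  have closed: "g \<in> S" if g: "g \<in> bounded_obs" and app: "\<forall>e>0. \<exists>h\<in>S. coupled e g h" for g
    unfolding S
  proof (intro CollectI conjI g allI impI)
    fix e :: real assume e: "0 < e"
    then have e3: "0 < e / 3" by simp
    from mp[OF spec[OF app] e3] obtain h where h: "h \<in> S" "coupled (e / 3) g h" by (elim bexE)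
    from Sev[OF h(1) e3] show "\<forall>\<^sub>F n in sequentially. \<exists>k\<in>obs_all (P n). coupled e g k"
    proof (rule eventually_mono)
      fix n assume "\<exists>k\<in>obs_all (P n). coupled (e / 3) h k"
      then obtain k where k: "k \<in> obs_all (P n)" "coupled (e / 3) h k" by (elim bexE)
      have "coupled e g k" by (rule coupled_trans[OF h(2) k(2) _ g Sb[OF h(1)] Pb[OF k(1)]]) (use e in simp)
      then show "\<exists>k\<in>obs_all (P n). coupled e g k" using k(1) by (rule bexI)
    qed
  qed
  have ne: "S \<noteq> {}"
  proof -
    from eventually_happens'[OF sequentially_bot cov[of 1]] obtain n where "covered 1 (obs_all (P n)) S" by auto
    then show ?thesis using pyramid_obs_nonempty[OF P, of n] unfolding covered_def by blast
  qed
  have reindex: "(\<lambda>t. reindex s q (g t)) \<in> S" if g: "g \<in> S" and q: "\<forall>j. q j \<in> L" and qb: "\<forall>j r. \<bar>q j r\<bar> \<le> real j" for g s q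
    unfolding S
  proof (intro CollectI conjI allI impI)
    show "(\<lambda>t. reindex s q (g t)) \<in> bounded_obs"
      unfolding bounded_obs_def using qb measurable_compose[OF bounded_obsD(1)[OF Sb[OF g]] measurable_reindex[OF L_Lip1[OF spec[OF q]]]]
      by (simp add: reindex_def)
    fix e :: real assume e: "0 < e"
    from coupled_reindex[OF e, of s] obtain \<delta> where \<delta>: "0 < \<delta>"
      and c: "\<forall>q u v. (\<forall>j. q j \<in> Lip1) \<longrightarrow> u \<in> measurable leb01 RN \<longrightarrow> v \<in> measurable leb01 RN \<longrightarrow>
        coupled \<delta> u v \<longrightarrow> coupled e (\<lambda>t. reindex s q (u t)) (\<lambda>t. reindex s q (v t))" by (elim exE conjE)
    from Sev[OF g \<delta>] show "\<forall>\<^sub>F n in sequentially. \<exists>h\<in>obs_all (P n). coupled e (\<lambda>t. reindex s q (g t)) h"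
    proof (rule eventually_mono)
      fix n assume "\<exists>h\<in>obs_all (P n). coupled \<delta> g h"
      then obtain h where h: "h \<in> obs_all (P n)" "coupled \<delta> g h" by (elim bexE)
      have "coupled e (\<lambda>t. reindex s q (g t)) (\<lambda>t. reindex s q (h t))"
        by (rule c[rule_format, OF L_Lip1[OF spec[OF q]] bounded_obsD(1)[OF Sb[OF g]] bounded_obsD(1)[OF Pb[OF h(1)]] h(2)])
      moreover have "(\<lambda>t. reindex s q (h t)) \<in> obs_all (P n)"
        by (rule obs_all_reindex[OF pyramid_classes[OF P] h(1) spec[OF q] spec[OF spec[OF qb]]])
      ultimately show "\<exists>h\<in>obs_all (P n). coupled e (\<lambda>t. reindex s q (g t)) h" by (rule bexI)
    qed
  qed
  have join: "\<exists>w\<in>S. distr leb01 RN (\<lambda>t i. w t (2 * i)) = distr leb01 RN u \<and> distr leb01 RN (\<lambda>t i. w t (2 * i + 1)) = distr leb01 RN v"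
    if u: "u \<in> S" and v: "v \<in> S" for u v
  proof -
    define a where "a k = 1 / real (Suc k)" for k
    have a: "0 < a k" for k by (simp add: a_def)
    \<comment> \<open>The factor 3 counts the approximation inside the pyramid, the equality in law
      with the even or odd entries, and the slack of the triangle inequality.\<close>
    have "\<forall>k. \<exists>w. (w \<in> bounded_obs \<and> (\<exists>s\<in>S. coupled (a k) w s)) \<and>
      coupled (3 * a k) (\<lambda>t i. w t (2 * i)) u \<and> coupled (3 * a k) (\<lambda>t i. w t (2 * i + 1)) v"
    proof
      fix k
      from eventually_happens'[OF sequentially_bot eventually_conj[OF cov[OF a[of k]] eventually_conj[OF Sev[OF u a[of k]] Sev[OF v a[of k]]]]]
      obtain n where n: "covered (a k) (obs_all (P n)) S" and "\<exists>h\<in>obs_all (P n). coupled (a k) u h" "\<exists>h\<in>obs_all (P n). coupled (a k) v h"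
        by (elim exE conjE)
      then obtain u' v' where u': "u' \<in> obs_all (P n)" "coupled (a k) u u'" and v': "v' \<in> obs_all (P n)" "coupled (a k) v v'" by (elim bexE)
      from pyramid_join[OF P u'(1) v'(1)] obtain w where w: "w \<in> obs_all (P n)"
        and wu: "distr leb01 RN u' = distr leb01 RN (\<lambda>t i. w t (2 * i))" and wv: "distr leb01 RN v' = distr leb01 RN (\<lambda>t i. w t (2 * i + 1))"
        by (elim bexE conjE)
      note m = bounded_obsD(1)[OF Sb[OF u]] bounded_obsD(1)[OF Sb[OF v]] bounded_obsD(1)[OF Pb[OF u'(1)]] bounded_obsD(1)[OF Pb[OF v'(1)]]
      have wm: "(\<lambda>t i. w t (s i)) \<in> measurable leb01 RN" for s
        unfolding measurable_RN_iff by (intro allI RN_componentD[OF bounded_obsD(1)[OF Pb[OF w]]])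
      have "coupled (a k + a k + a k) u (\<lambda>t i. w t (2 * i))" by (rule coupled_triangle[OF u'(2) coupled_law[OF m(3) wm wu a] a m(1,3) wm])
      moreover have "coupled (a k + a k + a k) v (\<lambda>t i. w t (2 * i + 1))" by (rule coupled_triangle[OF v'(2) coupled_law[OF m(4) wm wv a] a m(2,4) wm])
      moreover have "\<exists>s\<in>S. coupled (a k) w s" using n w unfolding covered_def by blast
      ultimately show "\<exists>w. (w \<in> bounded_obs \<and> (\<exists>s\<in>S. coupled (a k) w s)) \<and>
          coupled (3 * a k) (\<lambda>t i. w t (2 * i)) u \<and> coupled (3 * a k) (\<lambda>t i. w t (2 * i + 1)) v"
        using Pb[OF w] coupled_sym by (intro exI[of _ w]) simp
    qed
    from choice[OF this] obtain w where w0: "\<forall>k. (w k \<in> bounded_obs \<and> (\<exists>s\<in>S. coupled (a k) (w k) s)) \<and>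
      coupled (3 * a k) (\<lambda>t i. w k t (2 * i)) u \<and> coupled (3 * a k) (\<lambda>t i. w k t (2 * i + 1)) v" by (elim exE)
    note wb = conjunct1[OF conjunct1[OF spec[OF w0]]] and wS = conjunct2[OF conjunct1[OF spec[OF w0]]]
      and wu = conjunct1[OF conjunct2[OF spec[OF w0]]] and wv = conjunct2[OF conjunct2[OF spec[OF w0]]]
    from bounded_obs_limit[of w, OF wb] obtain r l where r: "strict_mono (r :: nat \<Rightarrow> nat)" and l: "l \<in> bounded_obs"
      and lim: "\<forall>e>0. \<forall>\<^sub>F k in sequentially. coupled e (w (r k)) l" by (elim exE conjE)
    have small: "\<forall>\<^sub>F k in sequentially. a (r k) < e" if "0 < e" for e
    proof -
      from order_tendstoD(2)[OF LIMSEQ_inverse_real_of_nat that] have "\<forall>\<^sub>F k in sequentially. a k < e" by (simp add: a_def inverse_eq_divide)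
      then show ?thesis by (rule eventually_subseq[OF r])
    qed
    have lS: "l \<in> S"
    proof (rule closed[OF l], intro allI impI)
      fix e :: real assume e: "0 < e"
      then have e3: "0 < e / 3" by simp
      from eventually_happens'[OF sequentially_bot eventually_conj[OF small[OF e3] mp[OF spec[OF lim] e3]]]
      obtain k where k: "a (r k) < e / 3" "coupled (e / 3) (w (r k)) l" by (elim exE conjE)
      from wS[of "r k"] obtain s where s: "s \<in> S" "coupled (a (r k)) (w (r k)) s" by (elim bexE)
      have "coupled e l s" by (rule coupled_trans[OF coupled_sym[OF k(2)] s(2) _ l wb Sb[OF s(1)]]) (use k e in simp)
      then show "\<exists>h\<in>S. coupled e l h" using s(1) by (rule bexI)
    qed
    have law: "distr leb01 RN (\<lambda>t i. l t (s i)) = distr leb01 RN x" if x: "x \<in> S" and c: "\<And>k. coupled (3 * a k) (\<lambda>t i. w k t (s i)) x" for s x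
    proof (rule coupled_imp_law)
      have m: "(\<lambda>t i. g t (s i)) \<in> measurable leb01 RN" if "g \<in> bounded_obs" for g
        unfolding measurable_RN_iff by (intro allI RN_componentD[OF bounded_obsD(1)[OF that]])
      show "(\<lambda>t i. l t (s i)) \<in> measurable leb01 RN" by (rule m[OF l])
      show "x \<in> measurable leb01 RN" by (rule bounded_obsD(1)[OF Sb[OF x]])
      fix e :: real assume e: "0 < e"
      then have e3: "0 < e / 3" and e9: "0 < e / 9" by simp_all
      from coupled_subsequence[OF e3, of s] obtain \<delta> where \<delta>: "0 < \<delta>" and d: "\<forall>u v. u \<in> measurable leb01 RN \<longrightarrow> v \<in> measurable leb01 RN \<longrightarrow>
        coupled \<delta> u v \<longrightarrow> coupled (e / 3) (\<lambda>t i. u t (s i)) (\<lambda>t i. v t (s i))" by (elim exE conjE)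
      from eventually_happens'[OF sequentially_bot eventually_conj[OF small[OF e9] mp[OF spec[OF lim] \<delta>]]]
      obtain k where k: "a (r k) < e / 9" "coupled \<delta> (w (r k)) l" by (elim exE conjE)
      have "coupled (e / 3) (\<lambda>t i. w (r k) t (s i)) (\<lambda>t i. l t (s i))"
        by (rule d[rule_format, OF bounded_obsD(1)[OF wb] bounded_obsD(1)[OF l] k(2)])
      moreover have "coupled (e / 3) (\<lambda>t i. w (r k) t (s i)) x"
        by (rule coupled_mono[OF c _ m[OF wb] bounded_obsD(1)[OF Sb[OF x]]]) (use k in simp)
      ultimately have "coupled (e / 3 + e / 3 + e / 3) (\<lambda>t i. l t (s i)) x"
        by (rule coupled_triangle[OF coupled_sym _ e3 m[OF l] m[OF wb] bounded_obsD(1)[OF Sb[OF x]]])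
      then show "coupled e (\<lambda>t i. l t (s i)) x" by simp
    qed
    show ?thesis using law[OF u wu] law[OF v wv] by (intro bexI[OF _ lS] conjI)
  qed
  show ?thesis unfolding stable_def
  proof (intro conjI)
    show "S \<subseteq> bounded_obs" by (rule subsetI) (rule Sb)
    show "S \<noteq> {}" by (rule ne)
    show "\<forall>g\<in>bounded_obs. (\<forall>e>0. \<exists>h\<in>S. coupled e g h) \<longrightarrow> g \<in> S" by (rule ballI, rule impI, rule closed)
    show "\<forall>g\<in>S. \<forall>s q. (\<forall>j. q j \<in> L) \<longrightarrow> (\<forall>j r. \<bar>q j r\<bar> \<le> real j) \<longrightarrow> (\<lambda>t. reindex s q (g t)) \<in> S"
      by (rule ballI, rule allI, rule allI, rule impI, rule impI, rule reindex)
    show "\<forall>u\<in>S. \<forall>v\<in>S. \<exists>w\<in>S. distr leb01 RN (\<lambda>t i. w t (2 * i)) = distr leb01 RN u \<and>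
        distr leb01 RN (\<lambda>t i. w t (2 * i + 1)) = distr leb01 RN v" by (rule ballI, rule ballI, rule join)
  qed
qed

text \<open>The limit set may contain sequences that are observables of no data set, but the
  observables of the spanned pyramid are dense in it, and the Hausdorff distance sees no more than
  that.\<close>

lemma pyramid_sequence_compact:
  assumes P: "\<And>n. l_pyramid L (P n)"
  shows "\<exists>r Q. strict_mono (r :: nat \<Rightarrow> nat) \<and> l_pyramid L Q \<and>
    (\<forall>e>0. \<forall>\<^sub>F n in sequentially. covered e (obs_all (P (r n))) (obs_all Q) \<and> covered e (obs_all Q) (obs_all (P (r n))))"
proof -
  from subset_sequence_compact[of "\<lambda>n. obs_all (P n)", OF pyramid_obs_bounded[OF P]] obtain r where r: "strict_mono (r :: nat \<Rightarrow> nat)"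
    and cov0: "\<forall>e>0. \<forall>\<^sub>F n in sequentially. covered e (obs_all (P (r n))) {g \<in> bounded_obs. \<forall>e>0. \<forall>\<^sub>F n in sequentially. \<exists>h\<in>obs_all (P (r n)). coupled e g h} \<and>
      covered e {g \<in> bounded_obs. \<forall>e>0. \<forall>\<^sub>F n in sequentially. \<exists>h\<in>obs_all (P (r n)). coupled e g h} (obs_all (P (r n)))" by (elim exE conjE)
  define S where "S = {g \<in> bounded_obs. \<forall>e>0. \<forall>\<^sub>F n in sequentially. \<exists>h\<in>obs_all (P (r n)). coupled e g h}"
  note cov = cov0[folded S_def]
  have st: "stable L S"
  proof (rule stable_limit[OF P S_def])
    fix e :: real assume "0 < e"
    from mp[OF spec[OF cov] this] show "\<forall>\<^sub>F n in sequentially. covered e (obs_all (P (r n))) S" by (rule eventually_mono) (rule conjunct1)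
  qed
  let ?Q = "spanned S"
  have Sb: "S \<subseteq> bounded_obs" by (auto simp: S_def)
  have Q: "l_pyramid L ?Q" by (rule spanned_pyramid[OF st])
  have QS: "obs_all ?Q \<subseteq> S" by (auto simp: obs_all_def spanned_def)
  have "\<forall>\<^sub>F n in sequentially. covered e (obs_all (P (r n))) (obs_all ?Q) \<and> covered e (obs_all ?Q) (obs_all (P (r n)))" if e: "0 < e" for e
  proof -
    from e have "0 < e / 3" by simp
    from mp[OF spec[OF cov] this] show ?thesis
    proof (rule eventually_mono)
      fix n assume n: "covered (e / 3) (obs_all (P (r n))) S \<and> covered (e / 3) S (obs_all (P (r n)))"
      have "covered (e / 3) S (obs_all ?Q)" unfolding covered_def by (intro ballI spanned_dense[OF st]) (use e in auto)
      from covered_trans[OF conjunct1[OF n] this _ pyramid_obs_bounded[OF P] Sb pyramid_obs_bounded[OF Q], of e] e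
      have "covered e (obs_all (P (r n))) (obs_all ?Q)" by simp
      moreover have "covered (e / 3) (obs_all ?Q) (obs_all (P (r n)))" using conjunct2[OF n] QS unfolding covered_def by blast
      then have "covered e (obs_all ?Q) (obs_all (P (r n)))"
        by (rule covered_mono[OF _ _ pyramid_obs_bounded[OF Q] pyramid_obs_bounded[OF P]]) (use e in simp)
      ultimately show "covered e (obs_all (P (r n))) (obs_all ?Q) \<and> covered e (obs_all ?Q) (obs_all (P (r n)))" by (rule conjI)
    qed
  qed
  then show ?thesis using r Q by (intro exI[of _ r] exI[of _ ?Q] conjI allI impI)
qed

end

section \<open>The metric on pyramids\<close>

text \<open>The inserted 1 keeps the infimum over a nonempty set; it is the scale from which on
  everything is coupled, see \<open>coupled_ge_1\<close>.\<close>

definition pyr_dist :: "real gds set set \<Rightarrow> real gds set set \<Rightarrow> real" where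
  "pyr_dist P Q = Inf (insert 1 {e. 0 < e \<and> covered e (obs_all P) (obs_all Q) \<and> covered e (obs_all Q) (obs_all P)})"

lemma pyr_dist_le:
  assumes "0 < e" "covered e (obs_all P) (obs_all Q)" "covered e (obs_all Q) (obs_all P)"
  shows "pyr_dist P Q \<le> e"
  unfolding pyr_dist_def by (rule cInf_lower) (use assms in \<open>auto intro!: bdd_belowI[of _ 0]\<close>)

lemma pyr_dist_sym: "pyr_dist P Q = pyr_dist Q P"
  unfolding pyr_dist_def by (rule arg_cong[of _ _ Inf]) blast

lemma pyr_dist_nonneg: "0 \<le> pyr_dist P Q"
  unfolding pyr_dist_def by (rule cInf_greatest) auto

lemma coupled_ge_1:
  assumes "1 \<le> e"
  shows "coupled e u v"
proof -
  have "1 \<le> 2 ^ i * e" for i using mult_mono[of 1 "2 ^ i" 1 e] assms by simp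
  then have "near e u v" unfolding near_def by (intro allI leb01.close_ge_1)
  then show ?thesis by (rule coupled_near)
qed

context clipped
begin

lemma pyr_dist_less:
  assumes P: "l_pyramid L P" and Q: "l_pyramid L Q" and less: "pyr_dist P Q < e"
  shows "0 < e" "covered e (obs_all P) (obs_all Q)" "covered e (obs_all Q) (obs_all P)"
proof -
  have one: "covered 1 (obs_all P') (obs_all Q')" if "l_pyramid L Q'" for P' Q'
    using pyramid_obs_nonempty[OF that] coupled_ge_1 unfolding covered_def by blast
  from cInf_lessD[OF _ less[unfolded pyr_dist_def]]
  obtain e' where e': "0 < e'" "covered e' (obs_all P) (obs_all Q)" "covered e' (obs_all Q) (obs_all P)" "e' < e"
    using one[OF P, of Q] one[OF Q, of P] by (auto intro: that[of 1])
  then show "0 < e" by simp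
  show "covered e (obs_all P) (obs_all Q)" "covered e (obs_all Q) (obs_all P)"
    by (rule covered_mono[OF e'(2) _ pyramid_obs_bounded[OF P] pyramid_obs_bounded[OF Q]], use e'(4) in simp)
      (rule covered_mono[OF e'(3) _ pyramid_obs_bounded[OF Q] pyramid_obs_bounded[OF P]], use e'(4) in simp)
qed

text \<open>At distance 0 every observable of one pyramid is a limit of observables of the other, so
  \<open>pyramid_determined\<close> applies to each member.\<close>

lemma pyr_dist_le_iff:
  assumes P: "l_pyramid L P" and Q: "l_pyramid L Q"
  shows "pyr_dist P Q \<le> 0 \<longleftrightarrow> P = Q"
proof
  assume le: "pyr_dist P Q \<le> 0"
  have sub: "P' \<subseteq> Q'" if P': "l_pyramid L P'" and Q': "l_pyramid L Q'" and le: "pyr_dist P' Q' \<le> 0" for P' Q'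
  proof
    fix A assume A: "A \<in> P'"
    show "A \<in> Q'"
    proof (rule pyramid_determined[OF Q'])
      show "A \<in> l_classes L" using A pyramid_classes[OF P'] by blast
      fix g and e :: real assume g: "g \<in> obs (rep A)" and e: "0 < e"
      have "covered e (obs_all P') (obs_all Q')" by (rule pyr_dist_less(2)[OF P' Q']) (use le e in simp)
      then show "\<exists>h\<in>obs_all Q'. coupled e g h" using g A unfolding covered_def obs_all_def by blast
    qed
  qed
  show "P = Q" using sub[OF P Q le] sub[OF Q P] le by (simp add: pyr_dist_sym[of Q P])
next
  assume "P = Q"
  have "pyr_dist P P \<le> 0 + e" if "0 < e" for e
    using pyr_dist_le[OF that covered_refl[OF order_refl pyramid_obs_bounded[OF P] that] covered_refl[OF order_refl pyramid_obs_bounded[OF P] that]] by simp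
  then have "pyr_dist P P \<le> 0" by (rule field_le_epsilon)
  then show "pyr_dist P Q \<le> 0" by (simp only: \<open>P = Q\<close>)
qed

lemma pyr_dist_triangle:
  assumes P: "l_pyramid L P" and Q: "l_pyramid L Q" and R: "l_pyramid L R"
  shows "pyr_dist P R \<le> pyr_dist P Q + pyr_dist Q R"
proof (rule field_le_epsilon)
  fix e :: real assume e: "0 < e"
  define a b where "a = pyr_dist P Q + e / 3" and "b = pyr_dist Q R + e / 3"
  have ab: "pyr_dist P Q < a" "pyr_dist Q R < b" "a + b < pyr_dist P Q + pyr_dist Q R + e" using e by (simp_all add: a_def b_def)
  note c1 = pyr_dist_less[OF P Q ab(1)] and c2 = pyr_dist_less[OF Q R ab(2)]
  note B = pyramid_obs_bounded[OF P] pyramid_obs_bounded[OF Q] pyramid_obs_bounded[OF R]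
  show "pyr_dist P R \<le> pyr_dist P Q + pyr_dist Q R + e"
    by (rule pyr_dist_le[OF _ covered_trans[OF c1(2) c2(2) ab(3) B] covered_trans[OF c2(3) c1(3) _ B(3,2,1)]]) (use c1(1) c2(1) ab(3) in linarith)+
qed

lemma pyr_metric: "Metric_space (l_pyramids L) pyr_dist"
proof
  show "pyr_dist P Q = 0 \<longleftrightarrow> P = Q" if "P \<in> l_pyramids L" "Q \<in> l_pyramids L" for P Q
    using that pyr_dist_le_iff[of P Q] pyr_dist_nonneg[of P Q] by (auto simp: l_pyramids_def)
  show "pyr_dist P R \<le> pyr_dist P Q + pyr_dist Q R" if "P \<in> l_pyramids L" "Q \<in> l_pyramids L" "R \<in> l_pyramids L" for P Q R
    by (rule pyr_dist_triangle) (use that in \<open>simp_all add: l_pyramids_def\<close>)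
qed (rule pyr_dist_nonneg pyr_dist_sym)+

lemma pyr_compact: "compact_space (Metric_space.mtopology (l_pyramids L) pyr_dist)"
proof -
  interpret Metric_space "l_pyramids L" pyr_dist by (rule pyr_metric)
  show ?thesis
    unfolding compact_space_sequentially
  proof (intro allI impI)
    fix P :: "nat \<Rightarrow> _" assume "range P \<subseteq> l_pyramids L"
    then have P: "l_pyramid L (P n)" for n by (auto simp: l_pyramids_def)
    from pyramid_sequence_compact[of P, OF P] obtain r Q where r: "strict_mono (r :: nat \<Rightarrow> nat)" and Q: "l_pyramid L Q"
      and cov: "\<forall>e>0. \<forall>\<^sub>F n in sequentially. covered e (obs_all (P (r n))) (obs_all Q) \<and> covered e (obs_all Q) (obs_all (P (r n)))"
      by (elim exE conjE)
    have "\<forall>\<^sub>F n in sequentially. (P \<circ> r) n \<in> l_pyramids L \<and> pyr_dist ((P \<circ> r) n) Q < e" if e: "0 < e" for e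
    proof -
      have e2: "0 < e / 2" using e by simp
      from mp[OF spec[OF cov] e2] show ?thesis
      proof (rule eventually_mono)
        fix n assume "covered (e / 2) (obs_all (P (r n))) (obs_all Q) \<and> covered (e / 2) (obs_all Q) (obs_all (P (r n)))"
        then have "pyr_dist (P (r n)) Q \<le> e / 2" by (elim conjE) (rule pyr_dist_le[OF e2])
        then show "(P \<circ> r) n \<in> l_pyramids L \<and> pyr_dist ((P \<circ> r) n) Q < e" using e P by (simp add: l_pyramids_def)
      qed
    qed
    moreover have Q': "Q \<in> l_pyramids L" using Q by (simp add: l_pyramids_def)
    ultimately have "limitin mtopology (P \<circ> r) Q sequentially" unfolding limitin_metric by blast
    then show "\<exists>l r. l \<in> l_pyramids L \<and> strict_mono r \<and> limitin mtopology (P \<circ> r) l sequentially"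
      using r Q' by blast
  qed
qed

section \<open>Principal pyramids and their density\<close>

lemma iota_self: "A \<in> l_classes L \<Longrightarrow> A \<in> iota L A"
  by (simp add: iota_def dominated_class_iff dominated_refl cgds.axioms(1)[OF l_class_rep(2)])

text \<open>The class itself is a largest element, which settles directedness. Box closeness implies
  closeness of observables, so box closedness is an instance of
  \<open>limit_dominated\<close>.\<close>

lemma iota_pyramid:
  assumes A: "A \<in> l_classes L"
  shows "l_pyramid L (iota L A)"
  unfolding l_pyramid_def
proof (intro conjI ballI impI)
  note X = l_class_rep(2)[OF A]
  interpret X: cgds "rep A" L by (rule X)
  note AA = iota_self[OF A]
  then show "iota L A \<noteq> {}" by blast
  show "iota L A \<subseteq> l_classes L" by (auto simp: iota_def)
  show "B \<in> iota L A" if B: "B \<in> l_classes L" and C: "C \<in> iota L A" and BC: "dominated_class B C" for B C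
  proof -
    have C': "C \<in> l_classes L" "dominated (rep C) (rep A)" using C dominated_class_iff[OF _ A] by (auto simp: iota_def)
    have "dominated (rep B) (rep A)"
      by (rule dominated_trans[OF X cgds.axioms(1)[OF l_class_rep(2)[OF C'(1)]] l_class_rep(2)[OF B] _ C'(2)])
        (use BC dominated_class_iff[OF B C'(1)] in simp)
    then show ?thesis using B dominated_class_iff[OF B A] by (simp add: iota_def)
  qed
  show "\<exists>D\<in>iota L A. dominated_class B D \<and> dominated_class C D" if "B \<in> iota L A" "C \<in> iota L A" for B C
    using that AA by (intro bexI[of _ A]) (auto simp: iota_def)
  show "box_closed L (iota L A)"
    unfolding box_closed_def
  proof (intro ballI impI)
    fix B assume B: "B \<in> l_classes L" and app: "\<forall>e>0. \<exists>C\<in>iota L A. box_class B C < ennreal e"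
    note Y = l_class_rep(2)[OF B]
    interpret Y: cgds "rep B" L by (rule Y)
    have "dominated (rep B) (rep A)"
    proof (rule limit_dominated[OF X Y])
      fix g and e :: real assume g: "g \<in> obs (rep B)" and e: "0 < e"
      from e have e4: "0 < e / 4" by simp
      from mp[OF spec[OF app] e4] obtain C where C: "C \<in> iota L A" "box_class B C < ennreal (e / 4)" by (elim bexE)
      have C': "C \<in> l_classes L" "dominated (rep C) (rep A)" using C(1) dominated_class_iff[OF _ A] by (auto simp: iota_def)
      note Z = l_class_rep(2)[OF C'(1)]
      interpret Z: cgds "rep C" L by (rule Z)
      have c: "conc (e / 4) (rep B) (rep C)" by (rule box_dist_less_imp_conc[OF Y Z]) (use C(2) in \<open>simp add: box_class_def\<close>)
      from conc_coupled[OF Y Z c less_imp_le[OF e4] g] obtain h where h: "h \<in> obs (rep C)" and hc: "\<forall>\<eta>>0. coupled (e / 4 + \<eta>) g h" by (elim bexE)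
      from obs_dominated[OF X Z.gds_axioms C'(2) h] obtain k where k: "k \<in> obs (rep A)" and law: "distr leb01 RN h = distr leb01 RN k" by (elim bexE)
      have "coupled e g k"
        by (rule coupled_trans[OF mp[OF spec[OF hc] e4] coupled_law[OF obs_measurable[OF h] obs_measurable[OF k] law e4] _
            Y.obs_bounded[OF g] Z.obs_bounded[OF h] X.obs_bounded[OF k]]) (use e in simp)
      then show "\<exists>k\<in>obs (rep A). coupled e g k" using k by (rule bexI)
    qed
    then show "B \<in> iota L A" using B dominated_class_iff[OF B A] by (simp add: iota_def)
  qed
qed

lemma obs_iota_covered:
  assumes A: "A \<in> l_classes L" and e: "0 < e"
  shows "covered e (obs_all (iota L A)) (obs (rep A))"
  unfolding covered_def
proof
  interpret X: cgds "rep A" L by (rule l_class_rep[OF A])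
  fix g assume "g \<in> obs_all (iota L A)"
  then obtain B where B: "B \<in> iota L A" and g: "g \<in> obs (rep B)" unfolding obs_all_def by blast
  have B': "B \<in> l_classes L" "dominated (rep B) (rep A)" using B dominated_class_iff[OF _ A] by (auto simp: iota_def)
  from obs_dominated[OF X.cgds_axioms cgds.axioms(1)[OF l_class_rep(2)[OF B'(1)]] B'(2) g]
  obtain h where h: "h \<in> obs (rep A)" "distr leb01 RN g = distr leb01 RN h" by (elim bexE)
  from coupled_law[OF obs_measurable[OF g] obs_measurable[OF h(1)] h(2) e] h(1) show "\<exists>h\<in>obs (rep A). coupled e g h" by (rule bexI)
qed

lemma obs_subset_iota: "A \<in> l_classes L \<Longrightarrow> obs (rep A) \<subseteq> obs_all (iota L A)"
  using iota_self unfolding obs_all_def by blast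

text \<open>A matching of features couples every observable of one data set with an observable of
  the other at scale e; the principal pyramids only add sequences equal in law to these.\<close>

lemma conc_imp_pyr_dist_le:
  assumes A: "A \<in> l_classes L" and B: "B \<in> l_classes L" and c: "conc e (rep A) (rep B)" and e: "0 \<le> e"
  shows "pyr_dist (iota L A) (iota L B) \<le> e"
proof (rule field_le_epsilon)
  fix \<eta> :: real assume \<eta>: "0 < \<eta>"
  have cov: "covered (e + \<eta>) (obs_all (iota L A)) (obs_all (iota L B))"
    if A: "A \<in> l_classes L" and B: "B \<in> l_classes L" and c: "conc e (rep A) (rep B)" for A B
  proof -
    note X = l_class_rep(2)[OF A] and Y = l_class_rep(2)[OF B]
    have "covered (e + \<eta> / 3) (obs (rep A)) (obs_all (iota L B))"
      unfolding covered_def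
    proof
      fix g assume "g \<in> obs (rep A)"
      from conc_coupled[OF X Y c e this] obtain h where h: "h \<in> obs (rep B)" and hc: "\<forall>\<eta>>0. coupled (e + \<eta>) g h" by (elim bexE)
      have "coupled (e + \<eta> / 3) g h" using hc \<eta> by simp
      then show "\<exists>h\<in>obs_all (iota L B). coupled (e + \<eta> / 3) g h" using obs_subset_iota[OF B] h by (intro bexI[of _ h]) auto
    qed
    from covered_trans[OF obs_iota_covered[OF A, of "\<eta> / 3"] this]
    show ?thesis using \<eta> pyramid_obs_bounded[OF iota_pyramid[OF A]] pyramid_obs_bounded[OF iota_pyramid[OF B]] obs_subset_iota[OF A] by auto
  qed
  show "pyr_dist (iota L A) (iota L B) \<le> e + \<eta>"
    by (rule pyr_dist_le[OF _ cov[OF A B c] cov[OF B A conc_sym[OF c]]]) (use e \<eta> in simp)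
qed

lemma pyramid_finite_upper_bound:
  assumes P: "l_pyramid L P" and F: "finite F" "F \<subseteq> P"
  shows "\<exists>C\<in>P. \<forall>A\<in>F. dominated (rep A) (rep C)"
  using F
proof (induction F)
  case empty
  then show ?case using P by (auto simp: l_pyramid_def)
next
  case (insert A F)
  then obtain C where C: "C \<in> P" "\<forall>B\<in>F. dominated (rep B) (rep C)" by auto
  from P C(1) insert.prems obtain D where D: "D \<in> P" "dominated_class A D" "dominated_class C D" unfolding l_pyramid_def by blast
  have cl: "B \<in> l_classes L" if "B \<in> P" for B using that pyramid_classes[OF P] by blast
  have CD: "dominated (rep C) (rep D)" using D(3) dominated_class_iff[OF cl[OF C(1)] cl[OF D(1)]] by simp
  have "dominated (rep B) (rep D)" if B: "B \<in> insert A F" for B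
  proof (cases "B = A")
    case True
    then show ?thesis using D(2) dominated_class_iff[OF cl cl[OF D(1)]] insert.prems by simp
  next
    case False
    then have BF: "B \<in> F" "B \<in> P" using B insert.prems by auto
    show ?thesis
      by (rule dominated_trans[OF l_class_rep(2)[OF cl[OF D(1)]] cgds.axioms(1)[OF l_class_rep(2)[OF cl[OF C(1)]]] l_class_rep(2)[OF cl[OF BF(2)]] _ CD])
        (use C(2) BF(1) in simp)
  qed
  then show ?case using D(1) by blast
qed

text \<open>For each point of a finite net of bounded sequences choose, where possible, a member of
  \<open>P\<close> with an observable near it. The observables of an upper bound of these finitely
  many members come close to all observables of \<open>P\<close>.\<close>

lemma iota_dense:
  assumes P: "l_pyramid L P" and e: "0 < e"
  shows "\<exists>A\<in>l_classes L. pyr_dist P (iota L A) \<le> e"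
proof -
  from e have e4: "0 < e / 4" by simp
  from bounded_obs_net[OF e4] obtain N where N: "finite N" "N \<subseteq> bounded_obs" and net: "\<forall>g\<in>bounded_obs. \<exists>h\<in>N. coupled (e / 4) g h" by (elim exE conjE)
  define near_class where "near_class \<nu> A \<longleftrightarrow> A \<in> P \<and> (\<exists>h\<in>obs (rep A). coupled (e / 4) h \<nu>)" for \<nu> A
  define pick where "pick \<nu> = (SOME A. near_class \<nu> A)" for \<nu>
  define F where "F = pick ` {\<nu> \<in> N. \<exists>A. near_class \<nu> A}"
  have pick: "near_class \<nu> (pick \<nu>)" if "\<exists>A. near_class \<nu> A" for \<nu> unfolding pick_def by (rule someI_ex[OF that])
  have "finite F" "F \<subseteq> P" using N(1) pick by (auto simp: F_def near_class_def)
  from pyramid_finite_upper_bound[OF P this] obtain C where C: "C \<in> P" and up: "\<forall>A\<in>F. dominated (rep A) (rep C)" by (elim bexE)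
  have cl: "A \<in> l_classes L" if "A \<in> P" for A using that pyramid_classes[OF P] by blast
  note Pb = pyramid_obs_bounded[OF P]
  note Z = l_class_rep(2)[OF cl[OF C]]
  interpret Z: cgds "rep C" L by (rule Z)
  have sub: "iota L C \<subseteq> P" using P C by (auto simp: l_pyramid_def iota_def)
  then have "obs_all (iota L C) \<subseteq> obs_all P" unfolding obs_all_def by blast
  then have 1: "covered e (obs_all (iota L C)) (obs_all P)" by (rule covered_refl[OF _ Pb e])
  have 2: "covered e (obs_all P) (obs_all (iota L C))"
    unfolding covered_def
  proof
    fix g assume g: "g \<in> obs_all P"
    then have gb: "g \<in> bounded_obs" using Pb by blast
    from bspec[OF net gb] obtain \<nu> where \<nu>: "\<nu> \<in> N" "coupled (e / 4) g \<nu>" by (elim bexE)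
    have "\<exists>A. near_class \<nu> A" using g \<nu>(2) unfolding near_class_def obs_all_def by blast
    from pick[OF this] \<nu>(1) this have A: "pick \<nu> \<in> F" "pick \<nu> \<in> P" and "\<exists>h\<in>obs (rep (pick \<nu>)). coupled (e / 4) h \<nu>"
      by (auto simp: F_def near_class_def)
    then obtain h where h: "h \<in> obs (rep (pick \<nu>))" "coupled (e / 4) h \<nu>" by (elim bexE)
    interpret X: cgds "rep (pick \<nu>)" L by (rule l_class_rep[OF cl[OF A(2)]])
    from obs_dominated[OF Z X.gds_axioms bspec[OF up A(1)] h(1)] obtain k where k: "k \<in> obs (rep C)" "distr leb01 RN h = distr leb01 RN k" by (elim bexE)
    have \<nu>b: "\<nu> \<in> bounded_obs" using N(2) \<nu>(1) by blast
    \<comment> \<open>The scale is 5/8 e: more than the two net errors e/4, and small enough to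
      leave room for a third e/4 below e.\<close>
    have "coupled (3 / 4 * e - e / 8) g h" by (rule coupled_trans[OF \<nu>(2) coupled_sym[OF h(2)] _ gb \<nu>b X.obs_bounded[OF h(1)]]) (use e in simp)
    from coupled_trans[OF this coupled_law[OF obs_measurable[OF h(1)] obs_measurable[OF k(1)] k(2) e4] _ gb X.obs_bounded[OF h(1)] Z.obs_bounded[OF k(1)]]
    have "coupled e g k" using e by simp
    then show "\<exists>k\<in>obs_all (iota L C). coupled e g k" using k(1) obs_subset_iota[OF cl[OF C]] by (intro bexI[of _ k]) auto
  qed
  from pyr_dist_le[OF e 2 1] cl[OF C] show ?thesis by (intro bexI)
qed

end

section \<open>Continuity of the inverse of the embedding\<close>

text \<open>Take the least grid point of step 1 up to which at least half of the mass lies; up to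
  the previous grid point there is less than half. The grid starts at -n, where n is so large that
  more than half of the mass lies in [-n, n].\<close>

lemma (in prob_space) approximate_median:
  assumes [measurable]: "(u :: _ \<Rightarrow> real) \<in> borel_measurable M"
  shows "\<exists>c. 1 / 2 \<le> prob {x \<in> space M. u x \<le> c} \<and> 1 / 2 \<le> prob {x \<in> space M. c - 1 \<le> u x}"
proof -
  have "(\<lambda>n. prob {x \<in> space M. \<bar>u x\<bar> \<le> real n}) \<longlonglongrightarrow> prob (\<Union>n. {x \<in> space M. \<bar>u x\<bar> \<le> real n})"
    by (rule finite_Lim_measure_incseq) (auto simp: incseq_def)
  moreover have "(\<Union>n. {x \<in> space M. \<bar>u x\<bar> \<le> real n}) = space M" using real_arch_simple by auto
  ultimately have "(\<lambda>n. prob {x \<in> space M. \<bar>u x\<bar> \<le> real n}) \<longlonglongrightarrow> 1" by (simp add: prob_space)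
  from order_tendstoD(1)[OF this, of "1 / 2"] obtain n where n: "1 / 2 < prob {x \<in> space M. \<bar>u x\<bar> \<le> real n}"
    by (auto dest: eventually_happens'[OF sequentially_bot])
  define Q where "Q j \<longleftrightarrow> 1 / 2 \<le> prob {x \<in> space M. u x \<le> real j - real n}" for j
  have "prob {x \<in> space M. \<bar>u x\<bar> \<le> real n} \<le> prob {x \<in> space M. u x \<le> real (2 * n) - real n}"
    by (rule finite_measure_mono) auto
  then have "Q (2 * n)" using n by (simp add: Q_def)
  define j where "j = (LEAST j. Q j)"
  have j: "Q j" unfolding j_def by (rule LeastI[where P = Q, OF \<open>Q (2 * n)\<close>])
  have "1 / 2 \<le> prob {x \<in> space M. real j - real n - 1 \<le> u x}"
  proof (cases j)
    case 0
    have "prob {x \<in> space M. \<bar>u x\<bar> \<le> real n} \<le> prob {x \<in> space M. real j - real n - 1 \<le> u x}"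
      by (rule finite_measure_mono) (auto simp: 0)
    then show ?thesis using n by simp
  next
    case (Suc i)
    have "\<not> Q i" unfolding j_def using Suc not_less_Least[of i Q] by (simp add: j_def)
    then have "prob {x \<in> space M. u x \<le> real i - real n} < 1 / 2" by (simp add: Q_def)
    then have "1 / 2 \<le> prob (space M - {x \<in> space M. u x \<le> real i - real n})" by (subst prob_compl) auto
    also have "\<dots> \<le> prob {x \<in> space M. real j - real n - 1 \<le> u x}" by (rule finite_measure_mono) (auto simp: Suc)
    finally show ?thesis .
  qed
  then show ?thesis using j by (intro exI[of _ "real j - real n"]) (simp add: Q_def)
qed

lemma (in prob_space) prob_sum_gt_1_meets:
  assumes "A \<in> events" "B \<in> events" "1 < prob A + prob B"
  shows "\<exists>x. x \<in> A \<and> x \<in> B"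
proof (rule ccontr)
  assume "\<nexists>x. x \<in> A \<and> x \<in> B"
  then have "prob (A \<union> B) = prob A + prob B" using assms(1,2) by (intro finite_measure_Union) auto
  then show False using assms(3) prob_le_1[of "A \<union> B"] by simp
qed

text \<open>The set is a finite union of balls, and the bound depends on their centres and radius
  only; hence it serves all Lipschitz functions at once.\<close>

lemma (in gds) tight:
  assumes e: "0 < e"
  shows "\<exists>x\<in>pts X. \<exists>r. \<exists>B\<in>sets (meas X). 1 - e \<le> measure (meas X) B \<and> (\<forall>f y. lip f \<longrightarrow> y \<in> B \<longrightarrow> \<bar>f y - f x\<bar> \<le> r)"
proof -
  obtain T where T: "finite T" "T \<subseteq> pts X" "T \<noteq> {}" "1 - e < measure (meas X) (\<Union>x\<in>T. M.mball x e)" by (rule finite_net[OF e])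
  obtain x where x: "x \<in> T" using T by blast
  define r where "r = (\<Sum>y\<in>T. gds_dist X y x) + e"
  have "\<bar>f y - f x\<bar> \<le> r" if f: "lip f" and y: "y \<in> (\<Union>x\<in>T. M.mball x e)" for f y
  proof -
    from y obtain z where z: "z \<in> T" "z \<in> pts X" "y \<in> pts X" "gds_dist X z y < e" by auto
    have "gds_dist X z x \<le> (\<Sum>y\<in>T. gds_dist X y x)" by (rule member_le_sum[OF z(1) _ T(1)]) simp
    then show ?thesis unfolding r_def
      using lipD[OF f z(2,3)] lipD[OF f z(2), of x] x T(2) z(4) by (auto simp: subset_iff)
  qed
  moreover have "(\<Union>x\<in>T. M.mball x e) \<in> sets (meas X)" by (intro sets_open) auto
  moreover have "x \<in> pts X" using x T(2) by blast
  ultimately show ?thesis using T(4) by (intro bexI[of _ x] exI[of _ r] bexI[of _ "\<Union>x\<in>T. M.mball x e"]) auto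
qed

text \<open>Members of a separated family have distinct rounded values on a finite net, and features
  bounded by \<open>R\<close> have only finitely many of these.\<close>

lemma (in cgds) separated_family_bounded:
  assumes e: "0 < e"
  shows "\<exists>b. \<forall>m (f :: nat \<Rightarrow> 'a \<Rightarrow> real). (\<forall>i. f i \<in> feat_closure X) \<and> (\<forall>i. \<forall>x\<in>pts X. \<bar>f i x\<bar> \<le> R) \<and>
    (\<forall>i<m. \<forall>j<i. \<not> close (meas X) e (f i) (f j)) \<longrightarrow> m \<le> b"
proof -
  have e3: "0 < e / 3" using e by simp
  obtain T where T: "finite T" "T \<subseteq> pts X" "1 - e / 3 < measure (meas X) (\<Union>x\<in>T. M.mball x (e / 3))" by (rule finite_net[OF e3])
  let ?K = "{f \<in> feat_closure X. \<forall>x\<in>pts X. \<bar>f x\<bar> \<le> R}"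
  let ?code = "\<lambda>f. restrict (\<lambda>x. \<lfloor>f x / (e / 3)\<rfloor>) T"
  have fin: "finite (?code ` ?K)" by (rule floor_code_finite[OF T(1,2) e3]) (use T(2) in auto)
  have "m \<le> card (?code ` ?K)" if f: "\<forall>i. f i \<in> feat_closure X" "\<forall>i. \<forall>x\<in>pts X. \<bar>f i x\<bar> \<le> R"
    and sep: "\<forall>i<m. \<forall>j<i. \<not> close (meas X) e (f i) (f j)" for m :: nat and f :: "nat \<Rightarrow> 'a \<Rightarrow> real"
  proof -
    have eq: "close (meas X) e (f i) (f j)" if code: "?code (f i) = ?code (f j)" for i j
    proof -
      have "close (meas X) (3 * (e / 3)) (f i) (f j)"
        by (rule close_of_agree[OF closure_lip[OF spec[OF f(1)]] closure_lip[OF spec[OF f(1)]] T(2,1,3) _ e3])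
          (rule floor_code_eq_imp_close[OF code _ e3])
      then show ?thesis by simp
    qed
    have "inj_on (\<lambda>i. ?code (f i)) {..<m}"
    proof (rule inj_onI)
      fix i j assume ij: "i \<in> {..<m}" "j \<in> {..<m}" and code: "?code (f i) = ?code (f j)"
      show "i = j"
        using sep ij eq[OF code] eq[OF code[symmetric]] by (metis lessThan_iff linorder_neqE_nat)
    qed
    then have "card {..<m} \<le> card (?code ` ?K)"
      by (rule card_inj_on_le[OF _ _ fin]) (use f in auto)
    then show ?thesis by simp
  qed
  then show ?thesis by blast
qed

text \<open>Closeness is a closed condition by \<open>close_limit\<close>, so finitely many failures
  of it persist at a slightly larger tolerance.\<close>

lemma (in prob_space) not_close_slack:
  assumes fin: "finite I" and nc: "\<And>p. p \<in> I \<Longrightarrow> \<not> close M e (u p) (v p)"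
    and m: "\<And>p. u p \<in> borel_measurable M" "\<And>p. v p \<in> borel_measurable M"
  shows "\<exists>\<eta>>0. \<forall>p\<in>I. \<not> close M (e + \<eta>) (u p) (v p)"
  using fin nc
proof (induction I)
  case empty
  then show ?case by (intro exI[of _ 1]) simp
next
  case (insert p I)
  then obtain \<eta> where \<eta>: "0 < \<eta>" "\<forall>p\<in>I. \<not> close M (e + \<eta>) (u p) (v p)" by auto
  have "\<exists>\<theta>>0. \<not> close M (e + \<theta>) (u p) (v p)"
    using close_limit[OF _ m(1)[of p] m(2)[of p], of e] insert.prems[of p] by blast
  then obtain \<theta> where \<theta>: "0 < \<theta>" "\<not> close M (e + \<theta>) (u p) (v p)" by (elim exE conjE)
  have "\<not> close M (e + min \<eta> \<theta>) (u q) (v q)" if q: "q \<in> insert p I" for q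
  proof
    assume c: "close M (e + min \<eta> \<theta>) (u q) (v q)"
    from close_mono[OF c _ m] have "close M (e + \<eta>) (u q) (v q)" "close M (e + \<theta>) (u q) (v q)" by simp_all
    then show False using q \<eta>(2) \<theta>(2) by blast
  qed
  then show ?case using \<eta>(1) \<theta>(1) by (intro exI[of _ "min \<eta> \<theta>"]) simp
qed

lemma close_shift: "close M e (\<lambda>x. u x + c) (\<lambda>x. v x + (c :: real)) \<longleftrightarrow> close M e u v"
  by (simp add: close_def)

text \<open>A maximal separated family of bounded features of \<open>X\<close> is transported to a family of \<open>Y\<close> that is again
  almost maximal, since any bounded feature of \<open>Y\<close> can be transported back to \<open>X\<close> together with that family.\<close>

lemma (in clipped) near_obs_imp_conc:
  assumes X: "cgds X L" and e: "0 < e" "e \<le> 1 / 8"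
  shows "\<exists>\<delta>>0. \<forall>Y. cgds Y L \<longrightarrow> (\<forall>g\<in>obs X. \<exists>h\<in>obs Y. coupled \<delta> g h) \<longrightarrow> (\<forall>h\<in>obs Y. \<exists>g\<in>obs X. coupled \<delta> h g) \<longrightarrow>
    conc (6 * e) X Y"
proof -
  interpret X: cgds X L by fact
  obtain x0 r B where x0: "x0 \<in> pts X" and B: "B \<in> sets (meas X)" "1 - e \<le> measure (meas X) B"
    and tight: "\<forall>f y. X.lip f \<longrightarrow> y \<in> B \<longrightarrow> \<bar>f y - f x0\<bar> \<le> r" using X.tight[OF e(1)] by (elim bexE exE conjE)
  have BX: "B \<subseteq> pts X" using sets.sets_into_space[OF B(1)] by (simp add: X.space_meas)
  \<comment> \<open>Large enough that clipping acts neither on features of X recentred at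
    \<open>x0\<close>, on the set \<open>B\<close>, nor on features of Y recentred at an approximate
    median, on the set \<open>D\<close> below.\<close>
  obtain R :: nat where R: "2 * \<bar>r\<bar> + 3 \<le> real R" using real_arch_simple[of "2 * \<bar>r\<bar> + 3"] by (elim exE)
  define fam where "fam m f \<longleftrightarrow> (\<forall>i. f i \<in> feat_closure X) \<and> (\<forall>i. \<forall>x\<in>pts X. \<bar>f i x\<bar> \<le> real R) \<and>
    (\<forall>i<m. \<forall>j<i. \<not> close (meas X) e (f i) (f j))" for m :: nat and f
  from X.separated_family_bounded[OF e(1), of "real R"] obtain b where b: "\<And>m f. fam m f \<Longrightarrow> m \<le> b"
    unfolding fam_def by (elim exE) blast
  have "fam 0 (\<lambda>_. restrict (\<lambda>_. 0) (pts X))" by (simp add: fam_def X.closure_const)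
  \<comment> \<open>The sizes of separated families are bounded, so there is a largest size m. Every
    separated family of that size is then maximal, which is used for the family that returns from Y
    and not just for \<open>f\<close>.\<close>
  then have "\<exists>m. (\<exists>f. fam m f) \<and> (\<forall>m'. (\<exists>f. fam m' f) \<longrightarrow> m' \<le> m)"
    by (intro ex_has_greatest_nat[of _ 0 "\<lambda>m. m" "Suc b"]) (use b in \<open>auto simp: less_Suc_eq_le\<close>)
  then obtain m f where f: "fam m f" and maxi: "\<And>m' f. fam m' f \<Longrightarrow> m' \<le> m" by (elim exE conjE) blast
  have maximal: "\<exists>i<m. close (meas X) e k (f' i)" if f': "fam m f'" and k: "k \<in> feat_closure X" "\<forall>x\<in>pts X. \<bar>k x\<bar> \<le> real R" for f' k
  proof (rule ccontr)
    assume "\<not> (\<exists>i<m. close (meas X) e k (f' i))"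
    then have "fam (Suc m) (f'(m := k))" using f' k unfolding fam_def by (simp add: less_Suc_eq)
    from maxi[OF this] show False by simp
  qed
  have fF: "f i \<in> feat_closure X" and fb: "x \<in> pts X \<Longrightarrow> \<bar>f i x\<bar> \<le> real R" for i x using f by (simp_all add: fam_def)
  have "\<exists>\<eta>>0. \<forall>p\<in>(SIGMA i:{..<m}. {..<i}). \<not> close (meas X) (e + \<eta>) (f (fst p)) (f (snd p))"
  proof (rule X.P.not_close_slack)
    show "finite (SIGMA i:{..<m}. {..<i})" by simp
    show "\<not> close (meas X) e (f (fst p)) (f (snd p))" if "p \<in> (SIGMA i:{..<m}. {..<i})" for p using that f by (auto simp: fam_def)
  qed (rule X.closure_measurable[OF fF])+
  then obtain \<eta>0 where \<eta>0: "0 < \<eta>0" and slack: "\<forall>p\<in>(SIGMA i:{..<m}. {..<i}). \<not> close (meas X) (e + \<eta>0) (f (fst p)) (f (snd p))" by (elim exE conjE)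
  \<comment> \<open>Passing from X to Y and back costs \<eta> four times, which has to stay within
    the slack \<open>\<eta>0\<close>.\<close>
  define \<eta> where "\<eta> = min (\<eta>0 / 4) e"
  have \<eta>: "0 < \<eta>" "\<eta> \<le> e" "4 * \<eta> \<le> \<eta>0" using \<eta>0 e by (auto simp: \<eta>_def)
  define \<delta> where "\<delta> = \<eta> / 2 ^ (R + m)"
  have \<delta>: "0 < \<delta>" "2 ^ (R + m) * \<delta> \<le> \<eta>" using \<eta> by (simp_all add: \<delta>_def)
  have "conc (6 * e) X Y" if Y: "cgds Y L" and XY: "\<forall>g\<in>obs X. \<exists>h\<in>obs Y. coupled \<delta> g h"
    and YX: "\<forall>h\<in>obs Y. \<exists>g\<in>obs X. coupled \<delta> h g" for Y
  proof -
    interpret Y: cgds Y L by fact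
    have "\<exists>Y'\<in>{Y}. \<exists>\<phi>\<in>parameters X. \<exists>\<psi>\<in>parameters Y'. \<exists>v. (\<forall>i. v i \<in> feat_closure Y') \<and> (\<forall>i. \<forall>y\<in>pts Y'. \<bar>v i y\<bar> \<le> real R) \<and>
      (\<forall>i\<le>m. close leb01 \<eta> (\<lambda>t. f i (\<phi> t)) (\<lambda>t. v i (\<psi> t)))"
      by (rule transfer_features[OF X _ _ fF fb \<delta>]) (use Y XY in auto)
    then obtain \<phi> \<psi> v where \<phi>: "\<phi> \<in> parameters X" and \<psi>: "\<psi> \<in> parameters Y" and v: "\<forall>i. v i \<in> feat_closure Y" "\<forall>i. \<forall>y\<in>pts Y. \<bar>v i y\<bar> \<le> real R"
      and fv: "\<forall>i\<le>m. close leb01 \<eta> (\<lambda>t. f i (\<phi> t)) (\<lambda>t. v i (\<psi> t))" by (elim bexE exE conjE) (simp only: singleton_iff)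
    note vF = spec[OF v(1)]
    have fm: "(\<lambda>t. f i (\<phi> t)) \<in> borel_measurable leb01" and vm: "(\<lambda>t. v i (\<psi> t)) \<in> borel_measurable leb01" for i
      by (rule X.param_closure_measurable[OF \<phi> fF]) (rule Y.param_closure_measurable[OF \<psi> vF])
    have fvc: "close leb01 \<eta> (\<lambda>t. f i (\<phi> t) + c) (\<lambda>t. v i (\<psi> t) + c)" if "i < m" for i c using fv that by (simp add: close_shift)
    show "conc (6 * e) X Y"
    proof (rule concI[OF \<phi> \<psi>]; rule matchedI)
      fix g assume g: "g \<in> feat_closure X"
      let ?s = "restrict (\<lambda>x. g x + (- g x0)) (pts X)"
      define k where "k = restrict (\<lambda>x. clip (real R) (?s x)) (pts X)"
      have sF: "?s \<in> feat_closure X" by (rule X.closure_shift[OF g])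
      have kF: "k \<in> feat_closure X" unfolding k_def by (rule X.closure_clip[OF sF]) simp
      have "\<exists>i<m. close (meas X) e k (f i)" by (rule maximal[OF f kF]) (simp add: k_def abs_clip)
      then obtain i where i: "i < m" "close (meas X) e k (f i)" by (elim exE conjE)
      have "close (meas X) e g (\<lambda>x. k x + g x0)"
      proof (rule X.P.close_on_set[OF _ B])
        fix x assume x: "x \<in> B"
        then have "\<bar>g x - g x0\<bar> \<le> real R" using tight X.closure_lip[OF g] R by fastforce
        then show "\<bar>g x - (k x + g x0)\<bar> \<le> e" using x BX e by (auto simp: k_def clip_id)
      qed (use X.closure_measurable[OF g] X.closure_measurable[OF kF] in simp_all)
      moreover have "close (meas X) e (\<lambda>x. k x + g x0) (\<lambda>x. f i x + g x0)" using i(2) by (simp only: close_shift)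
      ultimately have "close (meas X) (e + e) g (\<lambda>x. f i x + g x0)"
        by (rule X.P.close_triangle) (use X.closure_measurable[OF g] X.closure_measurable[OF kF] X.closure_measurable[OF fF] in simp_all)
      then have "close leb01 (e + e) (\<lambda>t. g (\<phi> t)) (\<lambda>t. f i (\<phi> t) + g x0)"
        using X.param_close[OF \<phi> X.closure_measurable[OF g], of "\<lambda>x. f i x + g x0"] X.closure_measurable[OF fF] by simp
      from leb01.close_triangle[OF this fvc[OF i(1)]] have "close leb01 (e + e + \<eta>) (\<lambda>t. g (\<phi> t)) (\<lambda>t. v i (\<psi> t) + g x0)"
        using X.param_closure_measurable[OF \<phi> g] fm vm by simp
      from leb01.close_mono[OF this, of "6 * e"] have c: "close leb01 (6 * e) (\<lambda>t. g (\<phi> t)) (\<lambda>t. v i (\<psi> t) + g x0)"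
        using X.param_closure_measurable[OF \<phi> g] vm \<eta> e by simp
      have "close leb01 (6 * e) (\<lambda>t. g (\<phi> t)) (\<lambda>t. restrict (\<lambda>y. v i y + g x0) (pts Y) (\<psi> t))"
        using c by (subst close_cong[of leb01 _ "\<lambda>t. g (\<phi> t)" _ "\<lambda>t. v i (\<psi> t) + g x0"]) (simp_all add: Y.param_pts[OF \<psi>])
      then show "\<exists>h\<in>feat_closure Y. close leb01 (6 * e) (\<lambda>t. g (\<phi> t)) (\<lambda>t. h (\<psi> t))" by (rule bexI[OF _ Y.closure_shift[OF vF]])
    next
      fix k assume k: "k \<in> feat_closure Y"
      note km = Y.closure_measurable[OF k]
      \<comment> \<open>Tightness is available for X only, so the translation that recentres
        \<open>k\<close> is read off from the values of \<open>k\<close> itself.\<close>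
      from Y.P.approximate_median[OF km] obtain c where c: "1 / 2 \<le> measure (meas Y) {y \<in> space (meas Y). k y \<le> c}"
        "1 / 2 \<le> measure (meas Y) {y \<in> space (meas Y). c - 1 \<le> k y}" by (elim exE conjE)
      let ?s = "restrict (\<lambda>y. k y + (- c)) (pts Y)"
      define h where "h = restrict (\<lambda>y. clip (real R) (?s y)) (pts Y)"
      have hF: "h \<in> feat_closure Y" unfolding h_def by (rule Y.closure_clip[OF Y.closure_shift[OF k]]) simp
      note hm = Y.closure_measurable[OF hF]
      have hb: "\<bar>h y\<bar> \<le> real R" if "y \<in> pts Y" for y using that by (simp add: h_def abs_clip)
      \<comment> \<open>The feature \<open>h\<close> travels back at index m together with the
        family, so that one pair of parameters compares \<open>h\<close> with all
        \<open>v i\<close>.\<close>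
      define u where "u i = (if i < m then v i else h)" for i
      have uF: "u i \<in> feat_closure Y" and ub: "y \<in> pts Y \<Longrightarrow> \<bar>u i y\<bar> \<le> real R" for i y
        using v hF hb by (simp_all add: u_def)
      have "\<exists>X'\<in>{X}. \<exists>\<psi>\<in>parameters Y. \<exists>\<phi>\<in>parameters X'. \<exists>w. (\<forall>i. w i \<in> feat_closure X') \<and> (\<forall>i. \<forall>x\<in>pts X'. \<bar>w i x\<bar> \<le> real R) \<and>
        (\<forall>i\<le>m. close leb01 \<eta> (\<lambda>t. u i (\<psi> t)) (\<lambda>t. w i (\<phi> t)))"
        by (rule transfer_features[OF Y _ _ uF ub \<delta>]) (use X YX in auto)
      then obtain \<phi>' \<psi>' w where \<phi>': "\<phi>' \<in> parameters X" and \<psi>': "\<psi>' \<in> parameters Y" and w: "\<forall>i. w i \<in> feat_closure X" "\<forall>i. \<forall>x\<in>pts X. \<bar>w i x\<bar> \<le> real R"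
        and uw: "\<forall>i\<le>m. close leb01 \<eta> (\<lambda>t. u i (\<psi>' t)) (\<lambda>t. w i (\<phi>' t))" by (elim bexE exE conjE) (simp only: singleton_iff)
      note wF = spec[OF w(1)]
      have um: "(\<lambda>t. u i (\<psi>' t)) \<in> borel_measurable leb01" and wm: "(\<lambda>t. w i (\<phi>' t)) \<in> borel_measurable leb01" for i
        by (rule Y.param_closure_measurable[OF \<psi>' uF]) (rule X.param_closure_measurable[OF \<phi>' wF])
      have w_to_u: "close (meas Y) (e + 2 * \<eta>) (u i) (u j)" if "close (meas X) e (w i) (w j)" and ij: "i \<le> m" "j \<le> m" for i j
      proof -
        have "close leb01 e (\<lambda>t. w i (\<phi>' t)) (\<lambda>t. w j (\<phi>' t))"
          using that X.param_close[OF \<phi>' X.closure_measurable[OF wF] X.closure_measurable[OF wF]] by simp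
        from leb01.close_triangle[OF mp[OF spec[OF uw] ij(1)] this um wm wm]
        have "close leb01 (\<eta> + e) (\<lambda>t. u i (\<psi>' t)) (\<lambda>t. w j (\<phi>' t))" .
        from leb01.close_triangle[OF this close_sym[OF mp[OF spec[OF uw] ij(2)]] um wm um]
        have "close leb01 (\<eta> + e + \<eta>) (\<lambda>t. u i (\<psi>' t)) (\<lambda>t. u j (\<psi>' t))" .
        then show ?thesis using Y.param_close[OF \<psi>' Y.closure_measurable[OF uF] Y.closure_measurable[OF uF]] by (simp add: algebra_simps)
      qed
      \<comment> \<open>Two close members of \<open>w\<close> would make the corresponding members
        of \<open>v\<close>, and then of \<open>f\<close>, close within e + 4 \<eta>, against the
        slack.\<close>
      have "fam m w"
        unfolding fam_def
      proof (intro conjI allI impI notI)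
        show "w i \<in> feat_closure X" for i by (rule wF)
        show "\<forall>x\<in>pts X. \<bar>w i x\<bar> \<le> real R" for i by (rule spec[OF w(2)])
        fix i j assume ij: "i < m" "j < i" and cl: "close (meas X) e (w i) (w j)"
        from w_to_u[OF cl] ij have "close (meas Y) (e + 2 * \<eta>) (v i) (v j)" by (simp add: u_def)
        then have "close leb01 (e + 2 * \<eta>) (\<lambda>t. v i (\<psi> t)) (\<lambda>t. v j (\<psi> t))"
          using Y.param_close[OF \<psi> Y.closure_measurable[OF vF] Y.closure_measurable[OF vF]] by simp
        from leb01.close_triangle[OF mp[OF spec[OF fv, of i]] this fm vm vm] ij
        have "close leb01 (\<eta> + (e + 2 * \<eta>)) (\<lambda>t. f i (\<phi> t)) (\<lambda>t. v j (\<psi> t))" by simp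
        from leb01.close_triangle[OF this close_sym[OF mp[OF spec[OF fv, of j]]] fm vm fm] ij
        have "close leb01 (\<eta> + (e + 2 * \<eta>) + \<eta>) (\<lambda>t. f i (\<phi> t)) (\<lambda>t. f j (\<phi> t))" by simp
        from leb01.close_mono[OF this _ fm fm, of "e + \<eta>0"] \<eta>
        have "close leb01 (e + \<eta>0) (\<lambda>t. f i (\<phi> t)) (\<lambda>t. f j (\<phi> t))" by simp
        then have "close (meas X) (e + \<eta>0) (f i) (f j)"
          using X.param_close[OF \<phi> X.closure_measurable[OF fF] X.closure_measurable[OF fF]] by simp
        then show False using bspec[OF slack, of "(i, j)"] ij by simp
      qed
      from maximal[OF this wF[of m] spec[OF w(2)]] obtain i where i: "i < m" "close (meas X) e (w m) (w i)" by (elim exE conjE)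
      from w_to_u[OF i(2)] i(1) have hv: "close (meas Y) (e + 2 * \<eta>) h (v i)" by (simp add: u_def)
      define a where "a = w m x0"
      define D where "D = {y \<in> space (meas Y). \<bar>h y - a\<bar> \<le> r + \<eta>}"
      have Dm: "D \<in> sets (meas Y)" unfolding D_def using hm by measurable
      \<comment> \<open>On \<open>B\<close> the returned feature \<open>w m\<close> stays within r
        of its value at \<open>x0\<close>, so \<open>h\<close> is concentrated near a. The loss is e
        for the complement of \<open>B\<close> and \<eta> \<le> e for the matching.\<close>
      have Dp: "1 - 2 * e \<le> measure (meas Y) D"
      proof -
        have hw: "close leb01 \<eta> (\<lambda>t. h (\<psi>' t)) (\<lambda>t. w m (\<phi>' t))" using uw by (auto simp: u_def)
        define E where "E = {t \<in> space leb01. \<eta> < \<bar>h (\<psi>' t) - w m (\<phi>' t)\<bar>}"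
        have hm': "(\<lambda>t. h (\<psi>' t)) \<in> borel_measurable leb01" by (rule Y.param_closure_measurable[OF \<psi>' hF])
        have E: "E \<in> sets leb01" "measure leb01 E \<le> \<eta>" unfolding E_def using hm' wm[of m] hw by (measurable, simp add: close_def)
        have "1 - e \<le> measure (distr leb01 (meas X) \<phi>') B" using B(2) by (simp only: X.param_distr[OF \<phi>'])
        also have "\<dots> = measure leb01 (\<phi>' -` B \<inter> space leb01)" by (rule measure_distr[OF X.param_measurable[OF \<phi>'] B(1)])
        also have "\<dots> \<le> measure leb01 ((\<psi>' -` D \<inter> space leb01) \<union> E)"
        proof (rule leb01.finite_measure_mono)
          show "(\<psi>' -` D \<inter> space leb01) \<union> E \<in> sets leb01" by (rule sets.Un[OF measurable_sets[OF Y.param_measurable[OF \<psi>'] Dm] E(1)])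
          show "\<phi>' -` B \<inter> space leb01 \<subseteq> (\<psi>' -` D \<inter> space leb01) \<union> E"
          proof
            fix t assume t: "t \<in> \<phi>' -` B \<inter> space leb01"
            then have "\<bar>w m (\<phi>' t) - a\<bar> \<le> r" using tight X.closure_lip[OF wF] by (simp add: a_def)
            then show "t \<in> (\<psi>' -` D \<inter> space leb01) \<union> E" using t Y.param_pts[OF \<psi>', of t] by (auto simp: D_def E_def Y.space_meas)
          qed
        qed
        also have "\<dots> \<le> measure leb01 (\<psi>' -` D \<inter> space leb01) + measure leb01 E"
          by (rule measure_Un_le[OF measurable_sets[OF Y.param_measurable[OF \<psi>'] Dm] E(1)])
        also have "measure leb01 (\<psi>' -` D \<inter> space leb01) = measure (distr leb01 (meas Y) \<psi>') D" by (rule measure_distr[OF Y.param_measurable[OF \<psi>'] Dm, symmetric])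
        finally show ?thesis using E(2) \<eta>(2) by (simp only: Y.param_distr[OF \<psi>'])
      qed
      have sm: "{y \<in> space (meas Y). k y \<le> c} \<in> sets (meas Y)" "{y \<in> space (meas Y). c - 1 \<le> k y} \<in> sets (meas Y)" using km by measurable
      \<comment> \<open>As e \<le> 1/8, the set \<open>D\<close> has mass at least 3/4 and meets
        both half-mass sets of the approximate median. This confines a to a bounded range, so that
        clipping does not act on \<open>D\<close>.\<close>
      obtain y1 where y1: "y1 \<in> D" "y1 \<in> pts Y" "k y1 \<le> c"
        using Y.P.prob_sum_gt_1_meets[OF Dm sm(1)] Dp c(1) e by (auto simp: Y.space_meas)
      obtain y2 where y2: "y2 \<in> D" "y2 \<in> pts Y" "c - 1 \<le> k y2"
        using Y.P.prob_sum_gt_1_meets[OF Dm sm(2)] Dp c(2) e by (auto simp: Y.space_meas)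
      have "h y1 \<le> 0" "- 1 \<le> h y2" using y1 y2 R by (auto simp: h_def clip_def)
      then have a: "a \<le> r + \<eta>" "- 1 - r - \<eta> \<le> a" using y1(1) y2(1) by (auto simp: D_def)
      have "close (meas Y) (2 * e) k (\<lambda>y. h y + c)"
      proof (rule Y.P.close_on_set[OF _ Dm Dp])
        fix y assume y: "y \<in> D"
        then have yY: "y \<in> pts Y" by (simp add: D_def Y.space_meas)
        have "\<bar>h y\<bar> < real R" using y a R \<eta> e unfolding D_def by auto
        then have "h y = k y - c" using yY by (auto simp: h_def clip_def)
        then show "\<bar>k y - (h y + c)\<bar> \<le> 2 * e" using e by simp
      qed (use km hm in simp_all)
      moreover have "close (meas Y) (e + 2 * \<eta>) (\<lambda>y. h y + c) (\<lambda>y. v i y + c)" using hv by (simp only: close_shift)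
      ultimately have "close (meas Y) (2 * e + (e + 2 * \<eta>)) k (\<lambda>y. v i y + c)"
        by (rule Y.P.close_triangle) (use km hm Y.closure_measurable[OF vF] in simp_all)
      then have "close leb01 (2 * e + (e + 2 * \<eta>)) (\<lambda>t. k (\<psi> t)) (\<lambda>t. v i (\<psi> t) + c)"
        using Y.param_close[OF \<psi> km, of "\<lambda>y. v i y + c"] Y.closure_measurable[OF vF] by simp
      from leb01.close_triangle[OF this close_sym[OF fvc[OF i(1)]]]
      have "close leb01 (2 * e + (e + 2 * \<eta>) + \<eta>) (\<lambda>t. k (\<psi> t)) (\<lambda>t. f i (\<phi> t) + c)"
        using Y.param_closure_measurable[OF \<psi> k] vm fm by simp
      \<comment> \<open>The total is 3 e + 3 \<eta> \<le> 6 e, the origin of the constant 6.\<close>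
      from leb01.close_mono[OF this, of "6 * e"] have cl: "close leb01 (6 * e) (\<lambda>t. k (\<psi> t)) (\<lambda>t. f i (\<phi> t) + c)"
        using Y.param_closure_measurable[OF \<psi> k] fm \<eta> e by simp
      have "close leb01 (6 * e) (\<lambda>t. k (\<psi> t)) (\<lambda>t. restrict (\<lambda>x. f i x + c) (pts X) (\<phi> t))"
        using cl by (subst close_cong[of leb01 _ "\<lambda>t. k (\<psi> t)" _ "\<lambda>t. f i (\<phi> t) + c"]) (simp_all add: X.param_pts[OF \<phi>])
      then show "\<exists>g\<in>feat_closure X. close leb01 (6 * e) (\<lambda>t. k (\<psi> t)) (\<lambda>t. g (\<phi> t))" by (rule bexI[OF _ X.closure_shift[OF fF]])
    qed
  qed
  then show ?thesis using \<delta>(1) by blast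
qed

section \<open>The compactification\<close>

lemma dconc_sym: "dconc X Y = dconc Y X"
proof -
  have h: "hausdorff d A B = hausdorff d B A" for d :: "(real \<Rightarrow> real) \<Rightarrow> (real \<Rightarrow> real) \<Rightarrow> ennreal" and A B
    unfolding hausdorff_def by (rule arg_cong[of _ _ Inf]) blast
  have le: "dconc X Y \<le> dconc Y X" for X :: "'c gds" and Y :: "'d gds"
    unfolding dconc_def
  proof (rule INF_mono)
    fix p assume p: "p \<in> parameters Y \<times> parameters X"
    then show "\<exists>q\<in>parameters X \<times> parameters Y.
        (case q of (h, k) \<Rightarrow> hausdorff (ky_fan leb01) (pull {0..1} h (feat X)) (pull {0..1} k (feat Y)))
        \<le> (case p of (h, k) \<Rightarrow> hausdorff (ky_fan leb01) (pull {0..1} h (feat Y)) (pull {0..1} k (feat X)))"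
      by (intro bexI[of _ "(snd p, fst p)"]) (auto simp: h[of _ "pull {0..1} (snd p) (feat X)"])
  qed
  show ?thesis by (rule antisym[OF le le])
qed

context clipped
begin

text \<open>The observable distance is at most 1, hence finite, so nothing is lost in passing to its
  real value.\<close>

lemma dconc_class_lessD:
  assumes A: "A \<in> l_classes L" and B: "B \<in> l_classes L" and "dconc_class A B < e"
  shows "conc e (rep A) (rep B)"
proof (rule dconc_less_imp_conc)
  note X = l_class_rep(2)[OF A] and Y = l_class_rep(2)[OF B]
  show "gds (rep A)" "gds (rep B)" by (rule cgds.axioms(1)[OF X], rule cgds.axioms(1)[OF Y])
  then have "dconc (rep A) (rep B) \<le> ennreal 1" by (rule conc_imp_dconc_le[OF _ _ conc_ge_1[OF X Y]]) simp_all
  then have "dconc (rep A) (rep B) < \<top>" by (rule order.strict_trans1) simp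
  then have "dconc (rep A) (rep B) = ennreal (dconc_class A B)" by (simp add: dconc_class_def)
  also have "\<dots> < ennreal e" using assms(3) by (simp add: ennreal_less_iff dconc_class_def)
  finally show "dconc (rep A) (rep B) < ennreal e" .
qed

lemma dconc_class_le:
  assumes A: "A \<in> l_classes L" and B: "B \<in> l_classes L" and c: "conc e (rep A) (rep B)" and e: "0 \<le> e"
  shows "dconc_class A B \<le> e"
  unfolding dconc_class_def
  by (rule enn2real_leI[OF e conc_imp_dconc_le[OF cgds.axioms(1) cgds.axioms(1) c e]]) (rule l_class_rep[OF A] l_class_rep[OF B])+

lemma iota_Lipschitz:
  assumes A: "A \<in> l_classes L" and B: "B \<in> l_classes L"
  shows "pyr_dist (iota L A) (iota L B) \<le> dconc_class A B"
proof (rule field_le_epsilon)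
  fix e :: real assume e: "0 < e"
  show "pyr_dist (iota L A) (iota L B) \<le> dconc_class A B + e"
    by (rule conc_imp_pyr_dist_le[OF A B dconc_class_lessD[OF A B]]) (use e in \<open>simp_all add: dconc_class_def\<close>)
qed

lemma iota_inj:
  assumes A: "A \<in> l_classes L" and B: "B \<in> l_classes L" and eq: "iota L A = iota L B"
  shows "A = B"
proof (rule l_class_eqI[OF A B])
  have "A \<in> iota L B" "B \<in> iota L A" using iota_self[OF A] iota_self[OF B] eq by auto
  then show "dominated (rep A) (rep B)" "dominated (rep B) (rep A)"
    using dominated_class_iff[OF A B] dominated_class_iff[OF B A] by (simp_all add: iota_def)
qed

text \<open>That distance 0 forces equality is inherited from the metric on pyramids, through the
  Lipschitz estimate and injectivity of \<open>iota\<close>.\<close>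

lemma dconc_metric: "Metric_space (l_classes L) dconc_class"
proof
  show "0 \<le> dconc_class A B" for A B by (simp add: dconc_class_def)
  show "dconc_class A B = dconc_class B A" for A B by (simp add: dconc_class_def dconc_sym[of "rep B"])
  fix A B C assume A: "A \<in> l_classes L" and B: "B \<in> l_classes L"
  show "dconc_class A B = 0 \<longleftrightarrow> A = B"
  proof
    assume "dconc_class A B = 0"
    then have "pyr_dist (iota L A) (iota L B) \<le> 0" using iota_Lipschitz[OF A B] by simp
    then have "iota L A = iota L B" using pyr_dist_le_iff[OF iota_pyramid[OF A] iota_pyramid[OF B]] by simp
    then show "A = B" by (rule iota_inj[OF A B])
  next
    assume "A = B"
    with dconc_class_le[OF A A conc_refl[OF l_class_rep(2)[OF A]]] have "dconc_class A B \<le> 0" by simp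
    then show "dconc_class A B = 0" by (rule antisym) (simp add: dconc_class_def)
  qed
  assume C: "C \<in> l_classes L"
  show "dconc_class A C \<le> dconc_class A B + dconc_class B C"
  proof (rule field_le_epsilon)
    fix e :: real assume e: "0 < e"
    have n: "0 \<le> dconc_class A B" "0 \<le> dconc_class B C" by (simp_all add: dconc_class_def)
    have "conc (dconc_class A B + e / 3 + e / 3 + (dconc_class B C + e / 3)) (rep A) (rep C)"
      by (rule conc_triangle[OF _ _ _ dconc_class_lessD[OF A B] dconc_class_lessD[OF B C]])
        (use e cgds.axioms(1) l_class_rep(2) A B C in auto)
    from dconc_class_le[OF A C this] show "dconc_class A C \<le> dconc_class A B + dconc_class B C + e" using e n by simp
  qed
qed

text \<open>Observables of a principal pyramid agree in law with observables of its largest element,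
  so closeness of the pyramids couples the observables of the two data sets, as
  \<open>near_obs_imp_conc\<close> requires.\<close>

lemma iota_inverse_continuous:
  assumes A: "A \<in> l_classes L" and e: "0 < e"
  shows "\<exists>\<delta>>0. \<forall>B\<in>l_classes L. pyr_dist (iota L A) (iota L B) < \<delta> \<longrightarrow> dconc_class A B < e"
proof -
  \<comment> \<open>The bound 1/8 and the factor 6 come from \<open>near_obs_imp_conc\<close>; e/7
    keeps 6 a below e.\<close>
  define a where "a = min (1 / 8) (e / 7)"
  have a: "0 < a" "a \<le> 1 / 8" "6 * a < e" using e by (auto simp: a_def min_def)
  note X = l_class_rep(2)[OF A]
  from near_obs_imp_conc[OF X a(1,2)] obtain \<delta> where \<delta>: "0 < \<delta>"
    and conc: "\<forall>Y :: real gds. cgds Y L \<longrightarrow> (\<forall>g\<in>obs (rep A). \<exists>h\<in>obs Y. coupled \<delta> g h) \<longrightarrow> (\<forall>h\<in>obs Y. \<exists>g\<in>obs (rep A). coupled \<delta> h g) \<longrightarrow>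
      conc (6 * a) (rep A) Y" by (elim exE conjE)
  have "dconc_class A B < e" if B: "B \<in> l_classes L" and less: "pyr_dist (iota L A) (iota L B) < \<delta> / 2" for B
  proof -
    have cov: "covered \<delta> (obs (rep A)) (obs (rep B))"
      if A: "A \<in> l_classes L" and B: "B \<in> l_classes L" and c: "covered (\<delta> / 2) (obs_all (iota L A)) (obs_all (iota L B))" for A B
    proof (rule covered_trans)
      show "covered (\<delta> / 2) (obs (rep A)) (obs_all (iota L B))" using c obs_subset_iota[OF A] unfolding covered_def by blast
      show "covered (\<delta> / 4) (obs_all (iota L B)) (obs (rep B))" by (rule obs_iota_covered[OF B]) (use \<delta> in simp)
      show "obs (rep A) \<subseteq> bounded_obs" "obs_all (iota L B) \<subseteq> bounded_obs" "obs (rep B) \<subseteq> bounded_obs"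
        using obs_subset_iota[OF A] obs_subset_iota[OF B] pyramid_obs_bounded[OF iota_pyramid[OF A]] pyramid_obs_bounded[OF iota_pyramid[OF B]] by auto
    qed (use \<delta> in simp)
    note c = pyr_dist_less[OF iota_pyramid[OF A] iota_pyramid[OF B] less]
    from cov[OF A B c(2)] cov[OF B A c(3)] have "conc (6 * a) (rep A) (rep B)"
      unfolding covered_def by (rule mp[OF mp[OF mp[OF spec[OF conc] l_class_rep(2)[OF B]]]])
    from dconc_class_le[OF A B this] a show ?thesis by simp
  qed
  then show ?thesis using \<delta> by (intro exI[of _ "\<delta> / 2"]) simp
qed

lemma iota_embedding:
  "embedding_map (Metric_space.mtopology (l_classes L) dconc_class) (Metric_space.mtopology (l_pyramids L) pyr_dist) (iota L)"
proof -
  interpret D: Metric_space "l_classes L" dconc_class by (rule dconc_metric)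
  interpret P: Metric_space "l_pyramids L" pyr_dist by (rule pyr_metric)
  let ?I = "iota L ` l_classes L"
  have sub: "?I \<subseteq> l_pyramids L" using iota_pyramid by (auto simp: l_pyramids_def)
  interpret S: Submetric "l_pyramids L" pyr_dist ?I by unfold_locales (rule sub)
  have inj: "inj_on (iota L) (l_classes L)" by (rule inj_onI) (rule iota_inj)
  define k where "k = inv_into (l_classes L) (iota L)"
  have k: "k (iota L A) = A" if "A \<in> l_classes L" for A unfolding k_def by (rule inv_into_f_f[OF inj that])
  have "continuous_map D.mtopology S.sub.mtopology (iota L)"
    unfolding D.metric_continuous_map[OF S.sub.Metric_space_axioms]
  proof (intro conjI ballI allI impI)
    fix A and e :: real assume "A \<in> l_classes L" and e: "0 < e"
    then show "\<exists>\<delta>>0. \<forall>B. B \<in> l_classes L \<and> dconc_class A B < \<delta> \<longrightarrow> pyr_dist (iota L A) (iota L B) < e"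
      using iota_Lipschitz by (intro exI[of _ e]) (auto intro: order.strict_trans1)
  qed simp
  moreover have "continuous_map S.sub.mtopology D.mtopology k"
    unfolding S.sub.metric_continuous_map[OF D.Metric_space_axioms]
  proof (intro conjI ballI allI impI)
    show "k ` ?I \<subseteq> l_classes L" using k by auto
    fix Q and e :: real assume "Q \<in> ?I" and e: "0 < e"
    then obtain A where A: "A \<in> l_classes L" "Q = iota L A" by auto
    from iota_inverse_continuous[OF A(1) e] obtain \<delta> where "0 < \<delta>"
      "\<forall>B\<in>l_classes L. pyr_dist (iota L A) (iota L B) < \<delta> \<longrightarrow> dconc_class A B < e" by (elim exE conjE)
    then show "\<exists>\<delta>>0. \<forall>R. R \<in> ?I \<and> pyr_dist Q R < \<delta> \<longrightarrow> dconc_class (k Q) (k R) < e"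
      using A k by (intro exI[of _ \<delta>]) auto
  qed
  ultimately have "homeomorphic_maps D.mtopology S.sub.mtopology (iota L) k"
    unfolding homeomorphic_maps_def using k by auto
  then have "homeomorphic_map D.mtopology (subtopology P.mtopology ?I) (iota L)"
    unfolding S.mtopology_submetric[symmetric] by (rule homeomorphic_maps_imp_map)
  then show ?thesis by (simp add: embedding_map_def)
qed

lemma iota_closure:
  "Metric_space.mtopology (l_pyramids L) pyr_dist closure_of (iota L ` l_classes L) = l_pyramids L"
proof -
  interpret P: Metric_space "l_pyramids L" pyr_dist by (rule pyr_metric)
  have "\<exists>Q\<in>iota L ` l_classes L. Q \<in> P.mball R e" if R: "R \<in> l_pyramids L" and e: "0 < e" for R e
  proof -
    have "l_pyramid L R" using R by (simp add: l_pyramids_def)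
    from iota_dense[OF this, of "e / 2"] e obtain A where A: "A \<in> l_classes L" "pyr_dist R (iota L A) \<le> e / 2" by auto
    have "iota L A \<in> l_pyramids L" using iota_pyramid[OF A(1)] by (simp add: l_pyramids_def)
    then show ?thesis using A R e by (intro bexI[of _ "iota L A"]) auto
  qed
  then show ?thesis unfolding P.metric_closure_of by blast
qed

end

theorem proposition1p2:
  fixes L :: "(real \<Rightarrow> real) set"
  assumes "monoidal L" and "clippings \<subseteq> L"
  shows "Metric_space (l_classes L) dconc_class \<and>
    (\<exists>\<rho>. Metric_space (l_pyramids L) \<rho> \<and>
      (\<forall>A\<in>l_classes L. \<forall>B\<in>l_classes L. \<rho> (iota L A) (iota L B) \<le> dconc_class A B) \<and>
      embedding_map (Metric_space.mtopology (l_classes L) dconc_class)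
        (Metric_space.mtopology (l_pyramids L) \<rho>) (iota L) \<and>
      compact_space (Metric_space.mtopology (l_pyramids L) \<rho>) \<and>
      Metric_space.mtopology (l_pyramids L) \<rho> closure_of (iota L ` l_classes L) = l_pyramids L)"
proof -
  interpret clipped L by unfold_locales (rule assms)+
  show ?thesis
    by (intro conjI exI[of _ pyr_dist] ballI dconc_metric pyr_metric iota_Lipschitz iota_embedding pyr_compact iota_closure)
qed

end
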